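(* Let $A(x,y)=ax^2+bxy+cy^2$ with $a,b,c\in\mathbb{Z}$ be a positive definite binary quadratic form of discriminant $D=b^2-4ac<0$, and let $\vartheta_A(\tau)=\sum_{m,n\in\mathbb{Z}}q^{A(m,n)}$, $q=e^{2\pi i\tau}$, $\tau\in\mathbb{H}$. For $n\in\mathbb{N}$ put \[ d_A(n)=\sum_{\substack{\alpha,\beta,\gamma\in\mathbb{Z}\\ \alpha a+\beta b+\gamma c=n}}(-1)^{(\alpha+1)(\gamma+1)}\,c_{1/\theta}(\alpha\gamma-\beta^2). \] Then $d_A(n)\in\mathbb{Z}$ for all $n$, and for $\Im(\tau)$ sufficiently large \[ \vartheta_A(\tau)=\prod_{n=1}^\infty\left(\frac{1+q^n}{1-q^n}\right)^{d_A(n)}. \]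
   Context: $\mathbb{H}$ is the complex upper half-plane. $\theta(\tau)=\sum_{n\in\mathbb{Z}}q^{n^2}$ is the Jacobi theta function, and $1/\theta(\tau)=\sum_{n\ge 0}c_{1/\theta}(n)q^n=1-2q+4q^2-8q^3+\dots$; we set $c_{1/\theta}(n)=0$ for $n<0$ (so the sum defining $d_A(n)$ is finite). *)

theory Defs
  imports "HOL-Analysis.Analysis"
begin

definition nome :: "complex \<Rightarrow> complex" where
  "nome \<tau> = exp (2 * of_real pi * \<i> * \<tau>)"

definition jacobi_theta :: "complex \<Rightarrow> complex" where
  "jacobi_theta \<tau> = (\<Sum>\<^sub>\<infinity>n\<in>(UNIV :: int set). nome \<tau> powi (n\<^sup>2))"

(* The q-expansion of the theta function: the coefficient of q^k is the number of
   integers n with n^2 = k.  See jacobi_theta_sums. *)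
definition theta_fps :: "real fps" where
  "theta_fps = Abs_fps (\<lambda>k. of_nat (card {n :: int. n\<^sup>2 = int k}))"

(* The Fourier coefficients of 1/theta, extended by 0 to negative indices.
   See inverse_jacobi_theta_sums. *)
definition c_inv_theta :: "int \<Rightarrow> real" where
  "c_inv_theta n = (if n < 0 then 0 else fps_nth (inverse theta_fps) (nat n))"

definition bin_form :: "int \<Rightarrow> int \<Rightarrow> int \<Rightarrow> 'a \<Rightarrow> 'a \<Rightarrow> 'a :: comm_ring_1" where
  "bin_form a b c x y = of_int a * x\<^sup>2 + of_int b * x * y + of_int c * y\<^sup>2"

definition pos_def_form :: "int \<Rightarrow> int \<Rightarrow> int \<Rightarrow> bool" where
  "pos_def_form a b c \<longleftrightarrow> (\<forall>x y :: real. (x, y) \<noteq> (0, 0) \<longrightarrow> bin_form a b c x y > 0)"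

definition theta_form :: "int \<Rightarrow> int \<Rightarrow> int \<Rightarrow> complex \<Rightarrow> complex" where
  "theta_form a b c \<tau> =
     (\<Sum>\<^sub>\<infinity>(m, n)\<in>(UNIV :: (int \<times> int) set). nome \<tau> powi (bin_form a b c m n))"

(* For a positive definite form only finitely many terms are nonzero
   (finite_d_form_support), so infsum is a finite sum here. *)
definition d_form :: "int \<Rightarrow> int \<Rightarrow> int \<Rightarrow> nat \<Rightarrow> real" where
  "d_form a b c n =
     (\<Sum>\<^sub>\<infinity>(\<alpha>, \<beta>, \<gamma>)\<in>{(\<alpha>, \<beta>, \<gamma>). \<alpha> * a + \<beta> * b + \<gamma> * c = int n}.
        (-1) powi ((\<alpha> + 1) * (\<gamma> + 1)) * c_inv_theta (\<alpha> * \<gamma> - \<beta>\<^sup>2))"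

lemma finite_square_eq: "finite {n :: int. n\<^sup>2 = k}"
proof (rule finite_subset)
  show "{n :: int. n\<^sup>2 = k} \<subseteq> {-\<bar>k\<bar>..\<bar>k\<bar>}"
  proof
    fix n :: int assume "n \<in> {n. n\<^sup>2 = k}"
    then have "n\<^sup>2 = k" by simp
    moreover have "\<bar>n\<bar> \<le> n\<^sup>2"
      by (cases "n = 0") (use self_le_power[of "\<bar>n\<bar>" 2] in auto)
    ultimately show "n \<in> {-\<bar>k\<bar>..\<bar>k\<bar>}" by auto
  qed
qed auto

lemma norm_nome_less_1: "Im \<tau> > 0 \<Longrightarrow> norm (nome \<tau>) < 1"
  by (simp add: nome_def)

lemma theta_summable:
  fixes q :: complex
  assumes "norm q < 1"
  shows "(\<lambda>n :: int. q powi (n\<^sup>2)) summable_on UNIV"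
proof -
  have sq: "summable (\<lambda>n :: nat. norm (q ^ (f n)))" if "\<And>n. f n \<ge> n" for f
  proof (rule summable_comparison_test')
    show "summable (\<lambda>n. norm q ^ n)" using assms by simp
    show "norm (norm (q ^ f n)) \<le> norm q ^ n" if "n \<ge> 0" for n
      using assms \<open>f n \<ge> n\<close> by (simp add: norm_power power_decreasing)
  qed
  have e1: "((\<lambda>n :: int. q powi (n\<^sup>2)) \<circ> int) = (\<lambda>n. q ^ (n\<^sup>2))"
    by (auto simp: fun_eq_iff simp flip: of_nat_power)
  have e2: "((\<lambda>n :: int. q powi (n\<^sup>2)) \<circ> (\<lambda>n. - int (Suc n))) = (\<lambda>n. q ^ ((Suc n)\<^sup>2))"
    unfolding fun_eq_iff o_def power2_minus of_nat_power [symmetric] power_int_of_nat by simp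
  have "(\<lambda>n :: int. q powi (n\<^sup>2)) summable_on range int"
    unfolding summable_on_reindex[OF inj_of_nat] e1
    by (rule norm_summable_imp_summable_on, rule sq) (simp add: power2_eq_square)
  moreover have "(\<lambda>n :: int. q powi (n\<^sup>2)) summable_on range (\<lambda>n. - int (Suc n))"
    by (subst summable_on_reindex, simp add: inj_def, unfold e2)
       (rule norm_summable_imp_summable_on, rule sq, simp add: power2_eq_square)
  ultimately have "(\<lambda>n :: int. q powi (n\<^sup>2)) summable_on
                     (range int \<union> range (\<lambda>n. - int (Suc n)))"
    by (rule summable_on_Un_disjoint) auto
  also have "range int \<union> range (\<lambda>n. - int (Suc n)) = UNIV"
  proof -
    have "x \<in> range int \<union> range (\<lambda>n. - int (Suc n))" for x
      by (cases x) auto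
    then show ?thesis by blast
  qed
  finally show ?thesis .
qed

lemma theta_fps_sums:
  fixes q :: complex
  assumes "norm q < 1"
  shows "(\<lambda>k. of_real (fps_nth theta_fps k) * q ^ k) sums
           (\<Sum>\<^sub>\<infinity>n\<in>(UNIV :: int set). q powi (n\<^sup>2))"
proof -
  define S where "S = (\<Sum>\<^sub>\<infinity>n\<in>(UNIV :: int set). q powi (n\<^sup>2))"
  define B where "B = (\<lambda>k. {n :: int. n\<^sup>2 = int k})"
  have "((\<lambda>n :: int. q powi (n\<^sup>2)) has_sum S) UNIV"
    unfolding S_def by (rule has_sum_infsum) (rule theta_summable[OF assms])
  also have "(UNIV :: int set) = snd ` Sigma UNIV B"
  proof -
    have "n \<in> snd ` Sigma UNIV B" for n
      by (rule image_eqI[of _ _ "(nat (n\<^sup>2), n)"]) (auto simp: B_def)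
    then show ?thesis by blast
  qed
  finally have "((\<lambda>p. q powi ((snd p)\<^sup>2)) has_sum S) (Sigma UNIV B)"
    by (subst (asm) has_sum_reindex) (auto simp: inj_on_def B_def o_def)
  then have "((\<lambda>k. \<Sum>n\<in>B k. q powi (n\<^sup>2)) has_sum S) UNIV"
    by (rule has_sum_SigmaD) (auto intro!: has_sum_finiteI simp: B_def finite_square_eq)
  moreover have "(\<Sum>n\<in>B k. q powi (n\<^sup>2)) = of_real (fps_nth theta_fps k) * q ^ k" for k
    by (simp add: B_def theta_fps_def)
  ultimately show ?thesis
    unfolding S_def by (simp add: has_sum_imp_sums)
qed

lemma jacobi_theta_sums:
  assumes "Im \<tau> > 0"
  shows "(\<lambda>k. of_real (fps_nth theta_fps k) * nome \<tau> ^ k) sums jacobi_theta \<tau>"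
  unfolding jacobi_theta_def by (rule theta_fps_sums[OF norm_nome_less_1[OF assms]])

lemma fps_nth_theta_fps_0: "fps_nth theta_fps 0 = 1"
  by (simp add: theta_fps_def)

lemma inverse_jacobi_theta_sums:
  "\<exists>Y>0. \<forall>\<tau>. Im \<tau> > Y \<longrightarrow>
     (\<lambda>n. of_real (c_inv_theta (int n)) * nome \<tau> ^ n) sums (1 / jacobi_theta \<tau>)"
proof -
  define F :: "complex fps" where "F = Abs_fps (\<lambda>k. of_real (fps_nth theta_fps k))"
  define G :: "complex fps" where "G = Abs_fps (\<lambda>k. of_real (c_inv_theta (int k)))"
  have "theta_fps * inverse theta_fps = 1"
    by (rule inverse_mult_eq_1') (simp add: fps_nth_theta_fps_0)
  then have "fps_nth (theta_fps * inverse theta_fps) n = fps_nth 1 n" for n by simp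
  then have "(of_real (fps_nth (theta_fps * inverse theta_fps) n) :: complex) = of_real (fps_nth 1 n)" for n
    by simp
  then have "fps_nth (F * G) n = fps_nth 1 n" for n
    by (simp add: fps_mult_nth F_def G_def c_inv_theta_def)
  then have FG: "F * G = 1" by (simp add: fps_eq_iff)
  have F0: "fps_nth F 0 = 1" by (simp add: F_def fps_nth_theta_fps_0)
  have G: "G = inverse F"
    using FG F0 by (metis fps_inverse_unique mult.commute zero_neq_one)
  have radF: "fps_conv_radius F \<ge> 1"
    unfolding fps_conv_radius_def
  proof (rule conv_radius_geI_ex)
    fix r :: real assume "r > 0" "ereal r < 1"
    then show "\<exists>z. norm z = r \<and> summable (\<lambda>n. fps_nth F n * z ^ n)"
      using theta_fps_sums[of "of_real r"]
      by (intro exI[of _ "of_real r"]) (auto simp: F_def sums_iff)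
  qed
  have "fps_conv_radius F > 0" using radF by (rule less_le_trans[rotated]) simp
  then have "fps_conv_radius G > 0"
    unfolding G using F0 by (intro fps_conv_radius_inverse_pos) auto
  then have "min (fps_conv_radius G) 1 > 0" by simp
  then obtain R where R0: "0 < ereal R" "ereal R < min (fps_conv_radius G) 1"
    using ereal_dense2 by blast
  then have R: "R > 0" "ereal R < fps_conv_radius G" "R < 1"
    by (auto simp flip: ereal_less(2) simp: one_ereal_def)
  define Y where "Y = - ln R / (2 * pi)"
  show ?thesis
  proof (intro exI conjI allI impI)
    show Y: "Y > 0" using R by (simp add: Y_def divide_neg_pos)
    fix \<tau> assume \<tau>: "Im \<tau> > Y"
    define q where "q = nome \<tau>"
    have "norm q = exp (- 2 * pi * Im \<tau>)" by (simp add: q_def nome_def)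
    also have "\<dots> < exp (ln R)"
      using \<tau> by (simp add: Y_def field_simps)
    finally have q: "norm q < R" using R by simp
    have ev: "eval_fps F q = jacobi_theta \<tau>"
      using jacobi_theta_sums[of \<tau>] Y \<tau> by (simp add: eval_fps_def F_def q_def sums_iff)
    have qG: "ereal (norm q) < fps_conv_radius G"
      using q R by (meson less_ereal.simps(1) less_trans)
    have qF: "ereal (norm q) < fps_conv_radius F"
      using q R radF by (metis ereal_less(3) less_le_trans less_trans)
    have "eval_fps F q * eval_fps G q = 1"
      using eval_fps_mult[OF qF qG] FG by simp
    then have "eval_fps G q = 1 / jacobi_theta \<tau>"
      unfolding ev by (metis eq_divide_imp mult.commute mult_zero_left zero_neq_one)
    with sums_eval_fps[OF qG]
    show "(\<lambda>n. of_real (c_inv_theta (int n)) * nome \<tau> ^ n) sums (1 / jacobi_theta \<tau>)"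
      by (simp add: G_def q_def)
  qed
qed

lemma finite_d_form_support:
  assumes "pos_def_form a b c"
  shows "finite {(\<alpha>, \<beta>, \<gamma>). \<alpha> * a + \<beta> * b + \<gamma> * c = int n \<and>
                              c_inv_theta (\<alpha> * \<gamma> - \<beta>\<^sup>2) \<noteq> 0}" (is "finite ?S")
proof (rule finite_subset)
  have pos: "bin_form a b c x y > 0" if "x \<noteq> 0 \<or> y \<noteq> 0" for x y :: int
  proof -
    have "bin_form a b c (of_int x) (of_int y) > (0 :: real)"
      using assms that unfolding pos_def_form_def by simp
    also have "bin_form a b c (of_int x) (of_int y) = (of_int (bin_form a b c x y) :: real)"
      by (simp add: bin_form_def)
    finally show ?thesis by linarith
  qed
  have a: "a > 0" using pos[of 1 0] by (simp add: bin_form_def)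
  have c: "c > 0" using pos[of 0 1] by (simp add: bin_form_def)
  have "a * (4 * a * c - b\<^sup>2) = bin_form a b c b (- 2 * a)"
    by (simp add: bin_form_def algebra_simps power2_eq_square)
  also have "\<dots> > 0" using pos[of b "- 2 * a"] a by simp
  finally have D: "4 * a * c - b\<^sup>2 \<ge> 1" using a by (simp add: zero_less_mult_iff)
  let ?M = "4 * a * int n" and ?N = "4 * c * int n"
  show "?S \<subseteq> {0..?N} \<times> {- (?N * ?M)..?N * ?M} \<times> {0..?M}"
  proof
    fix t assume "t \<in> ?S"
    then obtain \<alpha> \<beta> \<gamma> where t: "t = (\<alpha>, \<beta>, \<gamma>)" and eq: "\<alpha> * a + \<beta> * b + \<gamma> * c = int n" and nz: "c_inv_theta (\<alpha> * \<gamma> - \<beta>\<^sup>2) \<noteq> 0"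
      by auto
    have disc: "\<beta>\<^sup>2 \<le> \<alpha> * \<gamma>" using nz by (simp add: c_inv_theta_def split: if_splits)
    have bound: "0 \<le> x \<and> x \<le> 4 * v * int n"
      if "x * u + \<beta> * b + y * v = int n" "\<beta>\<^sup>2 \<le> x * y" "v > 0" "4 * u * v - b\<^sup>2 \<ge> 1"
      for x y u v :: int
    proof -
      have "x\<^sup>2 \<le> (4 * u * v - b\<^sup>2) * x\<^sup>2"
        using that(4) mult_right_mono[of 1 "4 * u * v - b\<^sup>2" "x\<^sup>2"] by simp
      also have "\<dots> \<le> (4 * u * v - b\<^sup>2) * x\<^sup>2 + (2 * v * \<beta> + b * x)\<^sup>2" by simp
      also have "\<dots> = 4 * v * (u * x\<^sup>2 + b * x * \<beta> + v * \<beta>\<^sup>2)"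
        by (simp add: algebra_simps power2_eq_square)
      also have "\<dots> \<le> 4 * v * (u * x\<^sup>2 + b * x * \<beta> + v * (x * y))"
        using that(2,3) by (intro mult_left_mono add_left_mono) auto
      also have "\<dots> = 4 * v * (x * (x * u + \<beta> * b + y * v))"
        by (simp add: algebra_simps power2_eq_square)
      also have "\<dots> = x * (4 * v * int n)"
        unfolding that(1) by simp
      finally have le: "x * x \<le> x * (4 * v * int n)" by (simp add: power2_eq_square)
      have nn: "4 * v * int n \<ge> 0" using that(3) by simp
      show ?thesis
      proof (cases x "0 :: int" rule: linorder_cases)
        case less
        then have "x * (4 * v * int n) \<le> 0" using nn by (simp add: mult_nonpos_nonneg)
        moreover have "x * x > 0" using less by (simp add: mult_neg_neg)
        ultimately show ?thesis using le by linarith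
      next
        case equal
        then show ?thesis using nn by simp
      next
        case greater
        then show ?thesis using le by simp
      qed
    qed
    have A: "0 \<le> \<alpha> \<and> \<alpha> \<le> ?N"
      using bound[of \<alpha> a \<gamma> c] eq disc c D by simp
    have C: "0 \<le> \<gamma> \<and> \<gamma> \<le> ?M"
      using bound[of \<gamma> c \<alpha> a] eq disc a D by (simp add: algebra_simps)
    have "\<bar>\<beta>\<bar> \<le> \<beta>\<^sup>2"
      by (cases "\<beta> = 0") (use self_le_power[of "\<bar>\<beta>\<bar>" 2] in auto)
    also have "\<dots> \<le> ?N * ?M"
      using disc A C mult_mono[of \<alpha> ?N \<gamma> ?M] by linarith
    finally have B: "\<bar>\<beta>\<bar> \<le> ?N * ?M" .
    show "t \<in> {0..?N} \<times> {- (?N * ?M)..?N * ?M} \<times> {0..?M}"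
      using A B C unfolding t abs_le_iff by simp
  qed
qed auto

end

theory Submission
  imports Defs "HOL-Complex_Analysis.Complex_Analysis"
begin

text \<open>All binary forms are treated at once. Put \<open>X = E \<tau>\<close>, \<open>Y = E s\<close>,
  \<open>th \<tau> z = (\<Sum>n. X ^ n\<^sup>2 * E (2 n z))\<close> and \<open>ph \<tau> z = th \<tau> z / th \<tau> 0\<close>; the theta series of a form is a
  specialization of \<open>(\<Sum>n. th \<tau> (n z) * Y ^ n\<^sup>2)\<close>. The product for it amounts to
  \<open>(\<Sum>n. ph \<tau> (n z) * Y ^ n\<^sup>2) = exp (\<Sum>N>0. ell N \<tau> z * Y ^ N)\<close>, in which \<open>ell N\<close> is, up to a factor, the image
  \<open>psi N\<close> of \<open>ph\<close> under a Hecke operator, together with the classical product for \<open>th \<tau> 0\<close>.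

  The coefficients of \<open>Y ^ N\<close> on both sides are Jacobi forms of weight 0 and index \<open>N / 2\<close> for the theta group,
  holomorphic on the upper half-plane. Their difference \<open>D\<close> vanishes by induction on \<open>N\<close>. After multiplication
  by \<open>th \<tau> 0\<close> both sides are symmetric in \<open>X\<close> and \<open>Y\<close> (for the exponential because two commuting derivations
  kill the same obstruction), so the induction hypothesis gives \<open>D = O(X ^ N)\<close>. This zero outweighs the growth at
  the other cusp: the product over the three cosets of the theta group of \<open>\<bar>D\<bar>\<close>, weighted by a Gaussian
  in \<open>z\<close>, is invariant under the full modular group and tends to 0 at the cusp, so that it attains its
  supremum, and the maximum modulus principle in \<open>\<tau>\<close> forces it to vanish.

  Convergence rests on the bound \<open>exp (4 sqrt n)\<close> for the coefficients of \<open>1 / \<theta>\<close>.\<close>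

section \<open>The triple product and the logarithmic derivative of theta\<close>

text \<open>The shape of \<open>ell\<close> comes from log ((1 + x) / (1 - x)), the sum of 2 x^k / k
  over odd k, evaluated at monomials with exponents c(i N - b^2). These c(i N - b^2) are exactly the
  coefficients that make up \<open>ph\<close>, so the part of degree N in Y is a sum over odd
  divisors of N, that is, a Hecke image. Dividing by \<open>th \<tau> 0\<close> gives weight 0, and
  the price is growth at the second cusp of the theta group, where \<open>th \<tau> 0\<close>
  decays. This growth is the main obstacle. With y = Im \<tau> and the Gaussian weight of index N /
  2, a zero of order N at infinity gives decay exp (- pi N y / 4), uniformly for z modulo the
  lattice, while degree N at the other cusp allows growth exp (pi N y / 4). The rates are equal, so
  comparing one cusp with the other decides nothing. What tips the balance is that infinity has
  width 2: two of the three cosets lie over it and only one over the other cusp, so the product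
  still decays like exp (- pi N y / 4).\<close>

definition even_qpoch :: "nat \<Rightarrow> real fps" where
  "even_qpoch m = (\<Prod>j=1..m. 1 - fps_X ^ (2 * j))"

definition odd_qpoch :: "nat \<Rightarrow> real fps" where
  "odd_qpoch m = (\<Prod>j=1..m. 1 + fps_X ^ (2 * j - 1))"

text \<open>With q = \<open>fps_X\<close> this is the q^2-binomial coefficient 2 n over n + k
  without its numerator \<open>even_qpoch (2 * n)\<close>. The value 0 outside the range allows
  shifted sums over \<open>k\<close> to be merged.\<close>

definition qbin_coeff :: "nat \<Rightarrow> int \<Rightarrow> real fps" where
  "qbin_coeff n k = (if \<bar>k\<bar> \<le> int n then
     inverse (even_qpoch (nat (int n - k))) * inverse (even_qpoch (nat (int n + k))) else 0)"

lemma even_qpoch_nth_0: "fps_nth (even_qpoch m) 0 = 1"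
  unfolding even_qpoch_def by (induction m) (auto simp: fps_mult_nth_0)

lemma even_qpoch_Suc: "even_qpoch (Suc m) = even_qpoch m * (1 - fps_X ^ (2 * Suc m))"
  unfolding even_qpoch_def by simp

lemma even_qpoch_inverse: "even_qpoch m * inverse (even_qpoch m) = 1"
  by (rule inverse_mult_eq_1') (simp add: even_qpoch_nth_0)

lemma inverse_even_qpoch_Suc:
  "inverse (even_qpoch m) = (1 - fps_X ^ (2 * Suc m)) * inverse (even_qpoch (Suc m))"
proof -
  have "even_qpoch m * ((1 - fps_X ^ (2 * Suc m)) * inverse (even_qpoch (Suc m))) = 1"
    using even_qpoch_inverse[of "Suc m"] by (simp only: even_qpoch_Suc mult.assoc)
  then show ?thesis
    by (metis even_qpoch_nth_0 fps_inverse_unique zero_neq_one)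
qed

text \<open>The identity is multiplied by \<open>fps_X\<^sup>2\<close> to avoid negative exponents.\<close>

lemma qbin_coeff_rec:
  assumes "\<bar>k\<bar> \<le> int n + 1"
  shows "(1 - fps_X ^ (4 * n + 2)) * (1 - fps_X ^ (4 * n + 4)) * qbin_coeff (Suc n) k =
    (1 + fps_X ^ (4 * n + 2)) * qbin_coeff n k
    + fps_X ^ (nat (2 * int n + 2 - 2 * k)) * qbin_coeff n (k - 1)
    + fps_X ^ (nat (2 * int n + 2 + 2 * k)) * qbin_coeff n (k + 1)"
proof -
  define P where "P = nat (int n + 1 - k)"
  define Q where "Q = nat (int n + 1 + k)"
  have PQ: "P + Q = 2 * n + 2" "int P = int n + 1 - k" "int Q = int n + 1 + k"
    using assms by (auto simp: P_def Q_def)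
  \<comment> \<open>\<open>V1\<close> and \<open>V2\<close> continue the inverses at
    \<open>m - 1\<close> and \<open>m - 2\<close> by 0. The two rules below then hold for every
    \<open>m\<close>, because \<open>1 - u ^ m\<close> vanishes at 0 and \<open>u - u ^ m\<close> at
    1. This covers the boundary values of \<open>k\<close>.\<close>
  define V1 where "V1 m = (if m \<ge> 1 then inverse (even_qpoch (m - 1)) else 0)" for m
  define V2 where "V2 m = (if m \<ge> 2 then inverse (even_qpoch (m - 2)) else 0)" for m
  define V where "V m = inverse (even_qpoch m)" for m
  define u :: "real fps" where "u = fps_X ^ 2"
  have u0: "u \<noteq> 0" by (simp add: u_def)
  have V1: "V1 m = (1 - u ^ m) * V m" for m
  proof (cases m)
    case (Suc j)
    show ?thesis
      unfolding Suc V1_def V_def u_def power_mult[symmetric] inverse_even_qpoch_Suc[of j, symmetric]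
      by simp
  qed (simp add: V1_def)
  have V2: "u * V2 m = (u - u ^ m) * V1 m" for m
  proof (cases "m \<ge> 2")
    case True
    then obtain j where j: "m = Suc (Suc j)" by (metis add_2_eq_Suc le_Suc_ex)
    have e: "u - u ^ m = u * (1 - fps_X ^ (2 * Suc j))"
      unfolding j u_def power_mult[symmetric] by (simp add: right_diff_distrib flip: power_add)
    have "V2 m = (1 - fps_X ^ (2 * Suc j)) * V1 m"
      using inverse_even_qpoch_Suc[of j] by (simp add: V2_def V1_def j)
    then show ?thesis unfolding e by (simp only: mult.assoc)
  qed (auto simp: V2_def V1_def not_le less_Suc_eq numeral_2_eq_2)
  have c0: "qbin_coeff (Suc n) k = V P * V Q"
    using assms by (auto simp: qbin_coeff_def V_def P_def Q_def algebra_simps)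
  have c1: "qbin_coeff n k = V1 P * V1 Q"
  proof -
    have "(\<bar>k\<bar> \<le> int n) = (P \<ge> 1 \<and> Q \<ge> 1)" using PQ by linarith
    moreover have "nat (int n - k) = P - 1" "nat (int n + k) = Q - 1" using PQ by linarith+
    ultimately show ?thesis by (auto simp: qbin_coeff_def V1_def)
  qed
  have c2: "qbin_coeff n (k - 1) = V P * V2 Q"
  proof -
    have "(\<bar>k - 1\<bar> \<le> int n) = (Q \<ge> 2)" using PQ by linarith
    moreover have "nat (int n - (k - 1)) = P" "nat (int n + (k - 1)) = Q - 2" using PQ by linarith+
    ultimately show ?thesis by (auto simp: qbin_coeff_def V2_def V_def)
  qed
  have c3: "qbin_coeff n (k + 1) = V2 P * V Q"
  proof -
    have "(\<bar>k + 1\<bar> \<le> int n) = (P \<ge> 2)" using PQ by linarith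
    moreover have "nat (int n - (k + 1)) = P - 2" "nat (int n + (k + 1)) = Q" using PQ by linarith+
    ultimately show ?thesis by (auto simp: qbin_coeff_def V2_def V_def)
  qed
  have e1: "(fps_X :: real fps) ^ (nat (2 * int n + 2 - 2 * k)) = u ^ P"
    unfolding u_def power_mult[symmetric] by (rule arg_cong[where f = "power fps_X"]) (use PQ in linarith)
  have e2: "(fps_X :: real fps) ^ (nat (2 * int n + 2 + 2 * k)) = u ^ Q"
    unfolding u_def power_mult[symmetric] by (rule arg_cong[where f = "power fps_X"]) (use PQ in linarith)
  define x where "x = u ^ P"
  define y where "y = u ^ Q"
  define p :: "real fps" where "p = fps_X ^ (4 * n + 2)"
  have xy: "u * p = x * y" 
    unfolding x_def y_def p_def u_def power_mult[symmetric] power_add[symmetric]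
    by (rule arg_cong[where f = "power fps_X"]) (use PQ in linarith)
  have xy2: "fps_X ^ (4 * n + 4) = x * y"
    unfolding x_def y_def u_def power_mult[symmetric] power_add[symmetric]
    by (rule arg_cong[where f = "power fps_X"]) (use PQ in linarith)
  have "u * ((1 - p) * (1 - x * y) * (V P * V Q)) = (u - u * p) * (1 - x * y) * (V P * V Q)"
    by (simp add: algebra_simps)
  also have "\<dots> = (u + u * p) * (V1 P * V1 Q) + x * V P * (u * V2 Q) + y * (u * V2 P) * V Q"
    unfolding xy V2 V1 x_def[symmetric] y_def[symmetric] by (simp add: algebra_simps)
  also have "\<dots> = u * ((1 + p) * (V1 P * V1 Q) + x * (V P * V2 Q) + y * (V2 P * V Q))"
    by (simp add: algebra_simps)
  finally show ?thesis
    using u0 unfolding c0 c1 c2 c3 e1 e2 xy2 x_def[symmetric] y_def[symmetric] p_def[symmetric]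
    by simp
qed

definition qbin_sum :: "nat \<Rightarrow> real fps" where
  "qbin_sum n = (\<Sum>k\<in>{-int n..int n}. fps_X ^ nat (k\<^sup>2) * qbin_coeff n k)"

lemma qbin_sum_superset:
  assumes "finite K" "{-int n..int n} \<subseteq> K"
  shows "(\<Sum>k\<in>K. fps_X ^ nat (k\<^sup>2) * qbin_coeff n k) = qbin_sum n"
  unfolding qbin_sum_def
  by (rule sum.mono_neutral_right) (use assms in \<open>auto simp: qbin_coeff_def\<close>)

text \<open>Completing the square, k^2 + 2n + 2 - 2k = (2n + 1) + (k - 1)^2, turns each of the three
  terms of \<open>qbin_coeff_rec\<close> into a multiple of \<open>qbin_sum n\<close>; the
  multipliers add up to a square.\<close>

lemma qbin_sum_Suc:
  "(1 - fps_X ^ (4 * n + 2)) * (1 - fps_X ^ (4 * n + 4)) * qbin_sum (Suc n) =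
     (1 + fps_X ^ (2 * n + 1))\<^sup>2 * qbin_sum n"
proof -
  let ?K = "{-int (Suc n)..int (Suc n)}"
  have sq: "nat (k\<^sup>2) + nat (2 * int n + 2 - 2 * k) = (2 * n + 1) + nat ((k - 1)\<^sup>2)"
           "nat (k\<^sup>2) + nat (2 * int n + 2 + 2 * k) = (2 * n + 1) + nat ((k + 1)\<^sup>2)"
    if "k \<in> ?K" for k :: int
  proof -
    have *: "2 * int n + 2 - 2 * k \<ge> 0" "2 * int n + 2 + 2 * k \<ge> 0" using that by auto
    have "int (nat (k\<^sup>2) + nat (2 * int n + 2 - 2 * k)) = int ((2 * n + 1) + nat ((k - 1)\<^sup>2))"
         "int (nat (k\<^sup>2) + nat (2 * int n + 2 + 2 * k)) = int ((2 * n + 1) + nat ((k + 1)\<^sup>2))"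
      using * by (simp_all only: of_nat_add int_nat_eq zero_le_power2 if_True)
        (simp_all add: power2_eq_square algebra_simps)
    then show "nat (k\<^sup>2) + nat (2 * int n + 2 - 2 * k) = (2 * n + 1) + nat ((k - 1)\<^sup>2)"
           "nat (k\<^sup>2) + nat (2 * int n + 2 + 2 * k) = (2 * n + 1) + nat ((k + 1)\<^sup>2)"
      by linarith+
  qed
  have "(1 - fps_X ^ (4 * n + 2)) * (1 - fps_X ^ (4 * n + 4)) * qbin_sum (Suc n) =
     (\<Sum>k\<in>?K. fps_X ^ nat (k\<^sup>2) * ((1 - fps_X ^ (4 * n + 2)) * (1 - fps_X ^ (4 * n + 4)) * qbin_coeff (Suc n) k))"
    unfolding qbin_sum_def by (simp add: sum_distrib_left mult_ac)
  also have "\<dots> = (\<Sum>k\<in>?K. (1 + fps_X ^ (4 * n + 2)) * (fps_X ^ nat (k\<^sup>2) * qbin_coeff n k)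
        + fps_X ^ (2 * n + 1) * (fps_X ^ nat ((k - 1)\<^sup>2) * qbin_coeff n (k - 1))
        + fps_X ^ (2 * n + 1) * (fps_X ^ nat ((k + 1)\<^sup>2) * qbin_coeff n (k + 1)))"
  proof (rule sum.cong)
    fix k assume k: "k \<in> ?K"
    then have kk: "\<bar>k\<bar> \<le> int n + 1" by auto
    show "fps_X ^ nat (k\<^sup>2) * ((1 - fps_X ^ (4 * n + 2)) * (1 - fps_X ^ (4 * n + 4)) * qbin_coeff (Suc n) k)
      = (1 + fps_X ^ (4 * n + 2)) * (fps_X ^ nat (k\<^sup>2) * qbin_coeff n k)
        + fps_X ^ (2 * n + 1) * (fps_X ^ nat ((k - 1)\<^sup>2) * qbin_coeff n (k - 1))
        + fps_X ^ (2 * n + 1) * (fps_X ^ nat ((k + 1)\<^sup>2) * qbin_coeff n (k + 1))"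
    proof -
      have "fps_X ^ nat (k\<^sup>2) * (fps_X ^ nat (2 * int n + 2 - 2 * k) * r) =
          fps_X ^ (2 * n + 1) * (fps_X ^ nat ((k - 1)\<^sup>2) * r)"
        "fps_X ^ nat (k\<^sup>2) * (fps_X ^ nat (2 * int n + 2 + 2 * k) * r) =
          fps_X ^ (2 * n + 1) * (fps_X ^ nat ((k + 1)\<^sup>2) * r)" for r :: "real fps"
        unfolding mult.assoc[symmetric] power_add[symmetric] sq[OF k] by (rule refl)+
      then show ?thesis
        unfolding qbin_coeff_rec[OF kk] distrib_left
        by (simp only: mult.left_commute)
    qed
  qed simp
  also have "\<dots> = (1 + fps_X ^ (4 * n + 2)) * (\<Sum>k\<in>?K. fps_X ^ nat (k\<^sup>2) * qbin_coeff n k)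
     + fps_X ^ (2 * n + 1) * (\<Sum>k\<in>?K. fps_X ^ nat ((k - 1)\<^sup>2) * qbin_coeff n (k - 1))
     + fps_X ^ (2 * n + 1) * (\<Sum>k\<in>?K. fps_X ^ nat ((k + 1)\<^sup>2) * qbin_coeff n (k + 1))"
    by (simp add: sum.distrib sum_distrib_left)
  also have "(\<Sum>k\<in>?K. fps_X ^ nat (k\<^sup>2) * qbin_coeff n k) = qbin_sum n"
    by (rule qbin_sum_superset) auto
  also have "(\<Sum>k\<in>?K. fps_X ^ nat ((k - 1)\<^sup>2) * qbin_coeff n (k - 1)) =
       (\<Sum>k\<in>(\<lambda>k. k - 1) ` ?K. fps_X ^ nat (k\<^sup>2) * qbin_coeff n k)"
    by (subst sum.reindex) (auto simp: inj_on_def)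
  also have "\<dots> = qbin_sum n"
    by (rule qbin_sum_superset) auto
  also have "(\<Sum>k\<in>?K. fps_X ^ nat ((k + 1)\<^sup>2) * qbin_coeff n (k + 1)) =
       (\<Sum>k\<in>(\<lambda>k. k + 1) ` ?K. fps_X ^ nat (k\<^sup>2) * qbin_coeff n k)"
    by (subst sum.reindex) (auto simp: inj_on_def)
  also have "\<dots> = qbin_sum n"
    by (rule qbin_sum_superset) auto
  finally show ?thesis
    by (simp add: power2_eq_square algebra_simps flip: power_add mult_2)
qed

text \<open>This is the finite Jacobi triple product at argument 1. From \<open>n\<close> to
  \<open>Suc n\<close>, \<open>even_qpoch (2 * n)\<close> gains precisely the two factors on the
  left of \<open>qbin_sum_Suc\<close>.\<close>

lemma finite_triple_product:
  "even_qpoch (2 * n) * qbin_sum n = (odd_qpoch n)\<^sup>2"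
proof (induction n)
  case 0
  then show ?case by (simp add: even_qpoch_def qbin_sum_def qbin_coeff_def odd_qpoch_def)
next
  case (Suc n)
  have "even_qpoch (2 * Suc n) = even_qpoch (2 * n) * ((1 - fps_X ^ (4 * n + 2)) * (1 - fps_X ^ (4 * n + 4)))"
  proof -
    have "2 * Suc n = Suc (Suc (2 * n))" "2 * Suc (2 * n) = 4 * n + 2"
      "2 * Suc (Suc (2 * n)) = 4 * n + 4" by simp_all
    then show ?thesis by (metis even_qpoch_Suc mult.assoc)
  qed
  then have "even_qpoch (2 * Suc n) * qbin_sum (Suc n) =
    even_qpoch (2 * n) * ((1 - fps_X ^ (4 * n + 2)) * (1 - fps_X ^ (4 * n + 4)) * qbin_sum (Suc n))"
    by (simp add: mult_ac)
  also have "\<dots> = (1 + fps_X ^ (2 * n + 1))\<^sup>2 * (even_qpoch (2 * n) * qbin_sum n)"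
    unfolding qbin_sum_Suc by (simp add: mult_ac)
  also have "\<dots> = (odd_qpoch (Suc n))\<^sup>2"
    unfolding Suc by (simp add: odd_qpoch_def power_mult_distrib)
  finally show ?case .
qed

lemma X_power_dvd_nth:
  assumes "fps_X ^ m dvd (F :: 'a :: comm_ring_1 fps)" "i < m"
  shows "fps_nth F i = 0"
  using assms by (auto simp: dvd_def fps_X_power_mult_nth)

text \<open>The quotient is the product of \<open>1 - fps_X ^ (2 * j)\<close> over m < j \<le> n, so
  it first deviates from 1 in degree 2 m + 2.\<close>

lemma even_qpoch_quotient:
  assumes "m \<le> n"
  shows "fps_X ^ (2 * m + 2) dvd (even_qpoch n * inverse (even_qpoch m) - 1)"
  using assms
proof (induction n rule: dec_induct)
  case base
  then show ?case by (simp add: even_qpoch_inverse)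
next
  case (step n)
  have "even_qpoch (Suc n) * inverse (even_qpoch m) - 1 =
     (even_qpoch n * inverse (even_qpoch m) - 1)
     - fps_X ^ (2 * Suc n) * (even_qpoch n * inverse (even_qpoch m))"
    by (simp only: even_qpoch_Suc) (simp add: algebra_simps)
  moreover have "fps_X ^ (2 * m + 2) dvd (fps_X :: real fps) ^ (2 * Suc n)"
    by (rule le_imp_power_dvd) (use step.hyps in simp)
  ultimately show ?case using step.IH by (metis dvd_diff dvd_mult2)
qed

text \<open>A passage to the limit with explicit error: in the summand \<open>k\<close> the
  quotients differ from 1 only from degree 2 (n - |k|) + 2 on, and together with the factor of
  degree k^2 the error starts at (|k| - 1)^2 + 2 n + 1, beyond 2 n for every
  \<open>k\<close>.\<close>

lemma theta_fps_finite_product: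
  assumes "i \<le> 2 * n"
  shows "fps_nth theta_fps i = fps_nth (even_qpoch n * (odd_qpoch n)\<^sup>2) i"
proof -
  define R where "R k = even_qpoch n * even_qpoch (2 * n) * qbin_coeff n k" for k
  have "fps_nth (even_qpoch n * (odd_qpoch n)\<^sup>2) i = (\<Sum>k\<in>{-int n..int n}. fps_nth (fps_X ^ nat (k\<^sup>2) * R k) i)"
    unfolding finite_triple_product[symmetric] qbin_sum_def R_def fps_sum_nth[symmetric]
    by (simp add: sum_distrib_left mult_ac)
  also have "\<dots> = (\<Sum>k\<in>{-int n..int n}. fps_nth (fps_X ^ nat (k\<^sup>2)) i)"
  proof (rule sum.cong)
    fix k assume k: "k \<in> {-int n..int n}"
    define a where "a = n - nat \<bar>k\<bar>"
    define b where "b = n + nat \<bar>k\<bar>"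
    have ab: "qbin_coeff n k = inverse (even_qpoch a) * inverse (even_qpoch b)"
    proof (cases "k \<ge> 0")
      case True
      then have "nat (int n - k) = a" "nat (int n + k) = b" using k by (auto simp: a_def b_def)
      then show ?thesis using k by (auto simp: qbin_coeff_def)
    next
      case False
      then have "nat (int n - k) = b" "nat (int n + k) = a" using k by (auto simp: a_def b_def)
      then show ?thesis using k by (auto simp: qbin_coeff_def)
    qed
    have le: "a \<le> n" "b \<le> 2 * n" "a \<le> b" using k by (auto simp: a_def b_def)
    define U where "U = even_qpoch n * inverse (even_qpoch a)"
    define U' where "U' = even_qpoch (2 * n) * inverse (even_qpoch b)"
    have "fps_X ^ (2 * a + 2) dvd U - 1" "fps_X ^ (2 * b + 2) dvd U' - 1"
      unfolding U_def U'_def using le by (intro even_qpoch_quotient; simp)+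
    moreover have "fps_X ^ (2 * a + 2) dvd (fps_X :: real fps) ^ (2 * b + 2)"
      using le by (intro le_imp_power_dvd) auto
    ultimately have "fps_X ^ (2 * a + 2) dvd (U - 1) * U' + (U' - 1)"
      by (meson dvd_add dvd_mult2 dvd_trans)
    also have "(U - 1) * U' + (U' - 1) = R k - 1"
      by (simp add: R_def ab U_def U'_def algebra_simps)
    finally have "fps_X ^ nat (k\<^sup>2) * fps_X ^ (2 * a + 2) dvd fps_X ^ nat (k\<^sup>2) * (R k - 1)"
      by (intro mult_dvd_mono) auto
    then have d: "fps_X ^ (nat (k\<^sup>2) + (2 * a + 2)) dvd fps_X ^ nat (k\<^sup>2) * (R k - 1)"
      by (simp add: power_add)
    have "int (nat (k\<^sup>2) + (2 * a + 2)) = (\<bar>k\<bar> - 1)\<^sup>2 + 2 * int n + 1"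
      using k by (auto simp: a_def power2_eq_square algebra_simps abs_mult_self_eq)
    then have "int (nat (k\<^sup>2) + (2 * a + 2)) \<ge> 2 * int n + 1" by simp
    then have "i < nat (k\<^sup>2) + (2 * a + 2)" using assms by linarith
    from X_power_dvd_nth[OF d this]
    show "fps_nth (fps_X ^ nat (k\<^sup>2) * R k) i = fps_nth (fps_X ^ nat (k\<^sup>2)) i"
      by (simp add: algebra_simps)
  qed simp
  also have "\<dots> = (\<Sum>k\<in>{k\<in>{-int n..int n}. k\<^sup>2 = int i}. 1)"
    unfolding sum.inter_filter[OF finite_atLeastAtMost_int]
    by (rule sum.cong) (simp_all add: fps_X_power_nth eq_nat_nat_iff nat_eq_iff2)
  also have "{k\<in>{-int n..int n}. k\<^sup>2 = int i} = {k. k\<^sup>2 = int i}"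
  proof -
    have "\<bar>k\<bar> \<le> int n" if "k\<^sup>2 = int i" for k
    proof (rule ccontr)
      assume "\<not> \<bar>k\<bar> \<le> int n"
      then have "\<bar>k\<bar>\<^sup>2 \<ge> (int n + 1)\<^sup>2" by (intro power_mono) auto
      moreover have "(int n + 1)\<^sup>2 \<ge> 2 * int n + 1" by (simp add: power2_sum)
      ultimately show False using that assms by simp
    qed
    then show ?thesis by force
  qed
  finally show ?thesis by (simp add: theta_fps_def)
qed

section \<open>The logarithmic derivative of theta\<close>

text \<open>For odd \<open>n\<close> all three sums agree. For n = 2 j the divisors with even
  quotient are the divisors of j, which reduces the claim to j. The identity merges the even factors
  of the triple product, taken once, and the odd factors, taken twice, into a single divisor
  sum.\<close>

lemma divisor_sums_parity:
  fixes n :: nat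
  assumes "n > 0"
  shows "\<Sum>{e. e dvd n} + \<Sum>{e. e dvd n \<and> odd e} = 2 * \<Sum>{e. e dvd n \<and> odd (n div e)}"
  using assms
proof (induction n rule: less_induct)
  case (less n)
  show ?case
  proof (cases "odd n")
    case True
    then have "odd e" if "e dvd n" for e using that dvd_trans by blast
    moreover have "odd (n div e)" if "e dvd n" for e using that True
      by (metis dvd_mult_div_cancel even_mult_iff)
    ultimately have "{e. e dvd n \<and> odd e} = {e. e dvd n}" "{e. e dvd n \<and> odd (n div e)} = {e. e dvd n}"
      by blast+
    then show ?thesis by simp
  next
    case False
    then obtain j where j: "n = 2 * j" by blast
    have j0: "j > 0" "j < n" using less.prems j by auto
    have fin: "finite {e. e dvd n}" "finite {e. e dvd j}" using less.prems j0 by auto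
    have "{e. e dvd n \<and> odd (n div e)} = (\<lambda>e. 2 * e) ` {e. e dvd j \<and> odd (j div e)}"
    proof (intro equalityI subsetI)
      fix e assume e: "e \<in> {e. e dvd n \<and> odd (n div e)}"
      then have "n = e * (n div e)" by simp
      then have "even e" using e j by (metis even_mult_iff dvd_triv_left mem_Collect_eq)
      then obtain f where f: "e = 2 * f" by blast
      then show "e \<in> (\<lambda>e. 2 * e) ` {e. e dvd j \<and> odd (j div e)}" using e j by auto
    qed (auto simp: j)
    then have o: "\<Sum>{e. e dvd n \<and> odd (n div e)} = 2 * \<Sum>{e. e dvd j \<and> odd (j div e)}"
      by (simp add: sum.reindex inj_on_def sum_distrib_left)
    have "{e. e dvd n \<and> even (n div e)} = {e. e dvd j}"
    proof (intro equalityI subsetI)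
      fix e assume e: "e \<in> {e. e dvd n \<and> even (n div e)}"
      then obtain f where f: "n div e = 2 * f" by auto
      have "n = e * (n div e)" using e by simp
      then have "j = e * f" using f j by simp
      then show "e \<in> {e. e dvd j}" by simp
    next
      fix e assume "e \<in> {e. e dvd j}"
      then obtain f where f: "j = e * f" by auto
      then have "e \<noteq> 0" using j0 by auto
      then show "e \<in> {e. e dvd n \<and> even (n div e)}" using f j
        by (simp add: mult.left_commute)
    qed
    moreover have "\<Sum>{e. e dvd n} = \<Sum>{e. e dvd n \<and> odd (n div e)} + \<Sum>{e. e dvd n \<and> even (n div e)}"
      by (subst sum.union_disjoint[symmetric]) (use fin in \<open>auto intro!: sum.cong finite_subset[OF _ fin(1)]\<close>)
    ultimately have s: "\<Sum>{e. e dvd n} = \<Sum>{e. e dvd n \<and> odd (n div e)} + \<Sum>{e. e dvd j}" by simp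
    have "{e. e dvd n \<and> odd e} = {e. e dvd j \<and> odd e}"
      unfolding j by (auto simp: coprime_commute coprime_dvd_mult_right_iff)
    then show ?thesis using less.IH[OF j0(2,1)] o s by simp
  qed
qed

text \<open>Coefficient of log theta as read off from the product of ((1 + q^m) / (1 -
  q^m))^((-1)^(m+1)) over m \<ge> 1; n / k has the parity of n because k is odd. This shape
  reappears as the row N = 0 of \<open>log_coeff\<close>.\<close>

definition log_theta_coeff :: "nat \<Rightarrow> real" where
  "log_theta_coeff n = (\<Sum>k | k dvd n \<and> odd k. 2 / real k * (-1) ^ (n + 1))"

lemma mult_log_theta_coeff:
  assumes "n > 0"
  shows "real n * log_theta_coeff n = 2 * (-1) ^ (n + 1) * real (\<Sum>{e. e dvd n \<and> odd (n div e)})"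
proof -
  have "real n * log_theta_coeff n = (\<Sum>k | k dvd n \<and> odd k. 2 * (-1) ^ (n + 1) * real (n div k))"
    unfolding log_theta_coeff_def sum_distrib_left
    by (rule sum.cong) (auto simp: real_of_nat_div)
  also have "\<dots> = (\<Sum>e | e dvd n \<and> odd (n div e). 2 * (-1) ^ (n + 1) * real e)"
    by (rule sum.reindex_bij_witness[of _ "\<lambda>e. n div e" "\<lambda>e. n div e"]) (use assms in auto)
  finally show ?thesis by (simp add: sum_distrib_left)
qed

text \<open>The Euler derivation X d/dX, which unlike \<open>fps_deriv\<close> preserves degrees. On
  \<open>complex fps fps\<close> it acts on the outer variable.\<close>

definition theta_op :: "'a :: comm_ring_1 fps \<Rightarrow> 'a fps" where
  "theta_op F = Abs_fps (\<lambda>n. of_nat n * fps_nth F n)"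

lemma theta_op_nth [simp]: "fps_nth (theta_op F) n = of_nat n * fps_nth F n"
  by (simp add: theta_op_def)

lemma theta_op_mult: "theta_op (F * G) = theta_op F * G + F * theta_op G"
proof (rule fps_ext)
  fix n
  have "of_nat n * (fps_nth F i * fps_nth G (n - i)) =
      of_nat i * fps_nth F i * fps_nth G (n - i) + fps_nth F i * (of_nat (n - i) * fps_nth G (n - i))"
    if "i \<in> {0..n}" for i
  proof -
    have "(of_nat n :: 'a) = of_nat i + of_nat (n - i)" using that by (simp flip: of_nat_add)
    then show ?thesis by (simp add: algebra_simps)
  qed
  then show "fps_nth (theta_op (F * G)) n = fps_nth (theta_op F * G + F * theta_op G) n"
    by (simp add: fps_mult_nth sum_distrib_left sum.distrib[symmetric])
qed

lemma theta_op_prod: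
  assumes "finite A" "\<And>j. j \<in> A \<Longrightarrow> theta_op (F j) = F j * G j"
  shows "theta_op (prod F A) = prod F A * sum G A"
  using assms
proof (induction A rule: finite_induct)
  case empty
  show ?case by (rule fps_ext) auto
next
  case (insert x A)
  then show ?case by (simp add: theta_op_mult algebra_simps)
qed

lemma theta_op_one_minus_X_power:
  assumes "m > 0"
  shows "theta_op (1 - fps_X ^ m :: real fps) =
     (1 - fps_X ^ m) * Abs_fps (\<lambda>i. if i > 0 \<and> m dvd i then - real m else 0)" (is "?L = (1 - _) * ?G")
proof (rule fps_ext)
  fix i
  show "fps_nth ?L i = fps_nth ((1 - fps_X ^ m) * ?G) i"
    using assms dvd_diff_nat[of m i m] dvd_diffD1[of m i m]
    by (auto simp: left_diff_distrib fps_X_power_mult_nth fps_X_power_nth dest: dvd_imp_le)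
      (metis dvd_diffD dvd_refl le_eq_less_or_eq not_less)+
qed

lemma theta_op_one_plus_X_power:
  assumes "m > 0"
  shows "theta_op (1 + fps_X ^ m :: real fps) =
     (1 + fps_X ^ m) * Abs_fps (\<lambda>i. if i > 0 \<and> m dvd i then (-1) ^ (i div m + 1) * real m else 0)"
     (is "?L = (1 + _) * ?G")
proof (rule fps_ext)
  fix i
  consider "i < m" | "i = m" | "i > m" by linarith
  then show "fps_nth ?L i = fps_nth ((1 + fps_X ^ m) * ?G) i"
  proof cases
    case 3
    have "(m dvd i) = (m dvd (i - m))" using 3 by (metis dvd_diffD dvd_diff_nat dvd_refl less_imp_le_nat)
    moreover have "i div m = Suc ((i - m) div m)" using 3 assms by (simp add: le_div_geq)
    ultimately show ?thesis using 3 assms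
      by (auto simp: distrib_right fps_X_power_mult_nth fps_X_power_nth)
  qed (use assms in \<open>auto simp: distrib_right fps_X_power_mult_nth fps_X_power_nth dest: dvd_imp_le\<close>)
qed

text \<open>Logarithmic derivatives are taken factor by factor in the product truncated at
  \<open>n\<close>. The truncation is exact up to degree 2 n, in particular for the coefficient
  \<open>n\<close> under comparison.\<close>

lemma theta_op_theta_fps:
  "theta_op theta_fps = theta_fps * Abs_fps (\<lambda>i. real i * log_theta_coeff i)"
proof (rule fps_ext)
  fix n
  define L where "L = Abs_fps (\<lambda>i. real i * log_theta_coeff i)"
  define G1 where "G1 j = Abs_fps (\<lambda>i. if i > 0 \<and> 2 * j dvd i then - real (2 * j) else 0)" for j
  define G2 where "G2 j = Abs_fps (\<lambda>i. if i > 0 \<and> (2 * j - 1) dvd i then (-1) ^ (i div (2 * j - 1) + 1) * real (2 * j - 1) else 0)" for j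
  define f where "f = even_qpoch n * (odd_qpoch n)\<^sup>2"
  have "theta_op (even_qpoch n) = even_qpoch n * sum G1 {1..n}"
    unfolding even_qpoch_def G1_def by (intro theta_op_prod theta_op_one_minus_X_power) auto
  moreover have "theta_op (odd_qpoch n) = odd_qpoch n * sum G2 {1..n}"
    unfolding odd_qpoch_def G2_def by (intro theta_op_prod theta_op_one_plus_X_power) auto
  ultimately have f: "theta_op f = f * (sum G1 {1..n} + 2 * sum G2 {1..n})"
    by (simp add: f_def power2_eq_square theta_op_mult algebra_simps)
  \<comment> \<open>A divisor 2 j or 2 j - 1 of i \<le> 2 n has j \<le> n, so the truncated sums see
    every divisor of \<open>i\<close>.\<close>
  have G: "fps_nth (sum G1 {1..n} + 2 * sum G2 {1..n}) i = fps_nth L i" if "i \<le> 2 * n" for i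
  proof (cases "i = 0")
    case True
    then show ?thesis by (simp add: fps_sum_nth G1_def G2_def L_def numeral_fps_const)
  next
    case False
    have "(\<Sum>j=1..n. fps_nth (G1 j) i) = (\<Sum>j\<in>{j\<in>{1..n}. 2 * j dvd i}. - real (2 * j))"
      unfolding sum.inter_filter[OF finite_atLeastAtMost] G1_def using False by (auto intro!: sum.cong)
    also have "\<dots> = (\<Sum>e | e dvd i \<and> even e. - real e)"
    proof (rule sum.reindex_bij_witness[of _ "\<lambda>e. e div 2" "\<lambda>e. 2 * e"])
      fix e assume e: "e \<in> {e. e dvd i \<and> even e}"
      then obtain k where k: "e = 2 * k" by blast
      have "e \<le> i" "k \<noteq> 0" using e False by (auto simp: k intro: dvd_imp_le)
      then show "e div 2 \<in> {j\<in>{1..n}. 2 * j dvd i}" "2 * (e div 2) = e"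
        using e that by (auto simp: k)
    qed auto
    finally have g1: "(\<Sum>j=1..n. fps_nth (G1 j) i) = - real (\<Sum>{e. e dvd i \<and> even e})"
      by (simp add: sum_negf)
    have "(\<Sum>j=1..n. fps_nth (G2 j) i) = (\<Sum>j\<in>{j\<in>{1..n}. 2 * j - 1 dvd i}. (-1) ^ (i div (2 * j - 1) + 1) * real (2 * j - 1))"
      unfolding sum.inter_filter[OF finite_atLeastAtMost] G2_def using False by (auto intro!: sum.cong)
    also have "\<dots> = (\<Sum>e | e dvd i \<and> odd e. (-1) ^ (i div e + 1) * real e)"
    proof (rule sum.reindex_bij_witness[of _ "\<lambda>e. (e + 1) div 2" "\<lambda>e. 2 * e - 1"])
      fix e assume e: "e \<in> {e. e dvd i \<and> odd e}"
      then obtain k where k: "e = 2 * k + 1" by (auto elim: oddE)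
      have "e \<le> i" using e False by (auto intro: dvd_imp_le)
      then show "(e + 1) div 2 \<in> {j\<in>{1..n}. 2 * j - 1 dvd i}" "2 * ((e + 1) div 2) - 1 = e"
        using e that by (auto simp: k)
    qed (auto simp: Suc_le_eq)
    also have "\<dots> = (\<Sum>e | e dvd i \<and> odd e. (-1) ^ (i + 1) * real e)"
    proof (rule sum.cong)
      fix e assume e: "e \<in> {e. e dvd i \<and> odd e}"
      then obtain f where "i = e * f" by auto
      then have "even (i div e) = even i" using e by (cases "e = 0") auto
      then show "(-1) ^ (i div e + 1) * real e = (-1) ^ (i + 1) * real e"
        by (simp add: uminus_power_if)
    qed simp
    finally have g2: "(\<Sum>j=1..n. fps_nth (G2 j) i) = (-1) ^ (i + 1) * real (\<Sum>{e. e dvd i \<and> odd e})"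
      by (simp add: sum_distrib_left)
    have fin: "finite {e. e dvd i}" using False by auto
    have s: "\<Sum>{e. e dvd i} = \<Sum>{e. e dvd i \<and> odd e} + \<Sum>{e. e dvd i \<and> even e}"
      by (subst sum.union_disjoint[symmetric]) (use fin in \<open>auto intro!: sum.cong finite_subset[OF _ fin]\<close>)
    have p: "\<Sum>{e. e dvd i} + \<Sum>{e. e dvd i \<and> odd e} = 2 * \<Sum>{e. e dvd i \<and> odd (i div e)}"
      using divisor_sums_parity False by simp
    have ev: "\<Sum>{e. e dvd i \<and> even e} = 0" if "odd i"
      by (rule sum.neutral) (use that dvd_trans in blast)
    have "fps_nth (sum G1 {1..n} + 2 * sum G2 {1..n}) i =
       - real (\<Sum>{e. e dvd i \<and> even e}) + 2 * ((-1) ^ (i + 1) * real (\<Sum>{e. e dvd i \<and> odd e}))"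
      using g1 g2 by (simp add: fps_sum_nth numeral_fps_const)
    also have "\<dots> = 2 * (-1) ^ (i + 1) * real (\<Sum>{e. e dvd i \<and> odd (i div e)})"
    proof (cases "odd i")
      case True
      then have "\<Sum>{e. e dvd i \<and> odd e} = \<Sum>{e. e dvd i \<and> odd (i div e)}" using s p ev by linarith
      then show ?thesis using True ev by (simp del: of_nat_sum)
    next
      case False
      have "real (\<Sum>{e. e dvd i \<and> even e}) + 2 * real (\<Sum>{e. e dvd i \<and> odd e}) = 2 * real (\<Sum>{e. e dvd i \<and> odd (i div e)})"
        using s p by linarith
      then show ?thesis using False by simp
    qed
    also have "\<dots> = fps_nth L i"
      using mult_log_theta_coeff[of i] False by (simp add: L_def)
    finally show ?thesis .
  qed
  have "fps_nth (theta_op theta_fps) n = fps_nth (theta_op f) n"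
    using theta_fps_finite_product[of n n] by (simp add: f_def)
  also have "\<dots> = fps_nth (theta_fps * L) n"
    unfolding f fps_mult_nth
  proof (rule sum.cong)
    fix i assume "i \<in> {0..n}"
    then show "fps_nth f i * fps_nth (sum G1 {1..n} + 2 * sum G2 {1..n}) (n - i) = fps_nth theta_fps i * fps_nth L (n - i)"
      using theta_fps_finite_product[of i n] G[of "n - i"] by (simp add: f_def)
  qed simp
  finally show "fps_nth (theta_op theta_fps) n = fps_nth (theta_fps * Abs_fps (\<lambda>i. real i * log_theta_coeff i)) n"
    by (simp add: L_def)
qed

lemma theta_op_inverse_theta_fps:
  "theta_op (inverse theta_fps) = - (inverse theta_fps * Abs_fps (\<lambda>i. real i * log_theta_coeff i))"
proof -
  define L where "L = Abs_fps (\<lambda>i. real i * log_theta_coeff i)"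
  define I where "I = inverse theta_fps"
  have inv: "theta_fps * I = 1"
    unfolding I_def by (rule inverse_mult_eq_1') (simp add: fps_nth_theta_fps_0)
  have "theta_op (1 :: real fps) = 0" by (rule fps_ext) auto
  then have "theta_fps * (I * L + theta_op I) = 0"
    using theta_op_mult[of theta_fps I] unfolding inv theta_op_theta_fps L_def[symmetric]
    by (simp add: algebra_simps)
  then have "I * (theta_fps * (I * L + theta_op I)) = 0" by simp
  then have "I * L + theta_op I = 0" by (metis inv mult.assoc mult.commute mult_1)
  then show ?thesis unfolding L_def I_def by (simp add: eq_neg_iff_add_eq_0 add.commute)
qed

section \<open>Subexponential growth of the coefficients of 1/theta\<close>

text \<open>The full series is y / (1 - y)^2. With y = exp (- 2 x) its comparison with 1 / (ln y)^2
  is x \<le> sinh x.\<close>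

lemma sum_mult_power_le:
  fixes y :: real
  assumes "0 < y" "y < 1"
  shows "(\<Sum>d=1..n. real d * y ^ d) \<le> 1 / (ln y)\<^sup>2"
proof -
  have s: "(\<lambda>n. real (Suc n) * y ^ n) sums (1 / (1 - y)\<^sup>2)"
    using geometric_deriv_sums[of y] assms by simp
  have "(\<Sum>d=1..n. real d * y ^ d) = y * (\<Sum>d<n. real (Suc d) * y ^ d)"
    by (simp add: sum_distrib_left sum.atLeast_Suc_lessThan_Suc_shift sum.atLeast1_atMost_eq mult_ac)
  also have "\<dots> \<le> y * (1 / (1 - y)\<^sup>2)"
    using assms s sum_le_suminf[of "\<lambda>n. real (Suc n) * y ^ n" "{..<n}"]
    by (intro mult_left_mono) (auto simp: sums_iff)
  also have "\<dots> \<le> 1 / (ln y)\<^sup>2"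
  proof -
    define x where "x = - ln y / 2"
    have x: "x > 0" "y = exp (- 2 * x)" using assms by (auto simp: x_def)
    have "x \<le> (exp x - inverse (exp x)) / 2" using x by (intro real_le_x_sinh) auto
    then have "2 * x * exp (- x) \<le> (exp x - exp (- x)) * exp (- x)"
      by (intro mult_right_mono) (auto simp: exp_minus)
    also have "\<dots> = 1 - y" by (simp add: x algebra_simps flip: exp_add)
    finally have "(2 * x * exp (- x))\<^sup>2 \<le> (1 - y)\<^sup>2"
      using x by (intro power_mono) auto
    then have "(ln y)\<^sup>2 * y \<le> (1 - y)\<^sup>2"
      by (simp add: x power_mult_distrib power2_eq_square algebra_simps flip: exp_add)
    then show ?thesis using assms by (simp add: field_simps)
  qed
  finally show ?thesis .
qed

lemma sum_inverse_squares_le: "n \<ge> 1 \<Longrightarrow> (\<Sum>k=1..n. 1 / (real k)\<^sup>2) \<le> 2 - 1 / real n"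
proof (induction n rule: dec_induct)
  case (step n)
  have "1 / (real (Suc n))\<^sup>2 \<le> 1 / real n - 1 / real (Suc n)"
  proof -
    have "1 / (real (Suc n))\<^sup>2 \<le> 1 / (real n * real (Suc n))"
      using step.hyps by (intro divide_left_mono) (auto simp: power2_eq_square intro!: mult_right_mono)
    also have "\<dots> = 1 / real n - 1 / real (Suc n)"
      using step.hyps by (simp add: field_simps)
    finally show ?thesis .
  qed
  then show ?case using step.IH by simp
qed simp

text \<open>Erdos' elementary method for the partition function, applied to the recursion
  given by the logarithmic derivative.\<close>

lemma norm_inverse_theta_fps_le:
  "\<bar>fps_nth (inverse theta_fps) n\<bar> \<le> exp (4 * sqrt (real n))"
proof (induction n rule: less_induct)
  case (less n)
  define c where "c = fps_nth (inverse theta_fps)"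
  define L where "L i = real i * log_theta_coeff i" for i
  show ?case
  proof (cases "n = 0")
    case True
    then show ?thesis by (simp add: fps_nth_theta_fps_0)
  next
    case False
    \<comment> \<open>By concavity 4 sqrt (n - i) \<le> 4 sqrt n - 2 i / sqrt n, so the inductive
      bound at \<open>n - i\<close> is at most the bound at \<open>n\<close> times
      \<open>x ^ i\<close>.\<close>
    define x where "x = exp (- 2 / sqrt (real n))"
    have x: "0 < x" "x < 1" using False by (auto simp: x_def)
    have "real n * c n = - (\<Sum>i=0..n. c i * L (n - i))"
      using arg_cong[OF theta_op_inverse_theta_fps, of "\<lambda>F. fps_nth F n"]
      by (simp add: fps_mult_nth c_def L_def)
    also have "(\<Sum>i=0..n. c i * L (n - i)) = (\<Sum>i\<le>n. L i * c (n - i))"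
      by (rule sum.reindex_bij_witness[of _ "\<lambda>i. n - i" "\<lambda>i. n - i"]) auto
    also have "\<dots> = (\<Sum>i=1..n. L i * c (n - i))"
      by (rule sum.mono_neutral_right) (auto simp: L_def)
    finally have "real n * \<bar>c n\<bar> = \<bar>\<Sum>i=1..n. L i * c (n - i)\<bar>"
      by (metis abs_minus_cancel abs_mult abs_of_nat)
    also have "\<dots> \<le> (\<Sum>i=1..n. \<bar>L i\<bar> * \<bar>c (n - i)\<bar>)"
      by (intro order.trans[OF sum_abs]) (simp add: abs_mult)
    also have "\<dots> \<le> (\<Sum>i=1..n. (2 * (\<Sum>d | d dvd i. real d)) * (exp (4 * sqrt (real n)) * x ^ i))"
    proof (intro sum_mono mult_mono)
      fix i assume i: "i \<in> {1..n}"
      have "\<bar>L i\<bar> = 2 * (\<Sum>e | e dvd i \<and> odd (i div e). real e)"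
        using i mult_log_theta_coeff[of i] by (simp add: L_def abs_mult power_abs sum_nonneg)
      also have "\<dots> \<le> 2 * (\<Sum>d | d dvd i. real d)"
        using i by (intro mult_left_mono sum_mono2) auto
      finally show "\<bar>L i\<bar> \<le> 2 * (\<Sum>d | d dvd i. real d)" .
      have "\<bar>c (n - i)\<bar> \<le> exp (4 * sqrt (real (n - i)))"
        unfolding c_def using i False by (intro less) auto
      also have "sqrt (real (n - i)) \<le> sqrt (real n) - real i / (2 * sqrt (real n))"
      proof (rule real_le_lsqrt)
        have "real i \<le> sqrt (real n) * (sqrt (real n) * 2)"
          using i by (simp flip: mult.assoc)
        then show "0 \<le> sqrt (real n) - real i / (2 * sqrt (real n))"
          using False by (simp add: divide_le_eq mult_ac)
        have "(sqrt (real n) - real i / (2 * sqrt (real n)))\<^sup>2 =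
            real n - real i + (real i / (2 * sqrt (real n)))\<^sup>2"
          using False by (simp add: power2_diff)
        then show "real (n - i) \<le> (sqrt (real n) - real i / (2 * sqrt (real n)))\<^sup>2"
          using i by simp
      qed
      then have "exp (4 * sqrt (real (n - i))) \<le> exp (4 * (sqrt (real n) - real i / (2 * sqrt (real n))))"
        by simp
      also have "\<dots> = exp (4 * sqrt (real n)) * x ^ i"
        unfolding x_def exp_of_nat_mult[symmetric] exp_add[symmetric] using False by (simp add: field_simps)
      finally show "\<bar>c (n - i)\<bar> \<le> exp (4 * sqrt (real n)) * x ^ i" .
    qed (auto intro!: mult_nonneg_nonneg sum_nonneg)
    also have "\<dots> = 2 * exp (4 * sqrt (real n)) * (\<Sum>i=1..n. \<Sum>d | d dvd i. real d * x ^ i)"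
      by (simp add: sum_distrib_left sum_distrib_right mult_ac)
    also have "(\<Sum>i=1..n. \<Sum>d | d dvd i. real d * x ^ i) = (\<Sum>(i, d)\<in>Sigma {1..n} (\<lambda>i. {d. d dvd i}). real d * x ^ i)"
      by (subst sum.Sigma) auto
    also have "\<dots> = (\<Sum>(k, d)\<in>(\<lambda>(i, d). (i div d, d)) ` Sigma {1..n} (\<lambda>i. {d. d dvd i}). real d * x ^ (k * d))"
      by (subst sum.reindex) (auto simp: inj_on_def intro!: sum.cong)
    also have "\<dots> \<le> (\<Sum>(k, d)\<in>{1..n} \<times> {1..n}. real d * x ^ (k * d))"
    proof (intro sum_mono2 subsetI)
      fix p assume "p \<in> (\<lambda>(i, d). (i div d, d)) ` Sigma {1..n} (\<lambda>i. {d. d dvd i})"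
      then obtain i d where p: "p = (i div d, d)" "1 \<le> i" "i \<le> n" "d dvd i" by auto
      then have "d > 0" "d \<le> i" by (auto intro: dvd_pos_nat dvd_imp_le)
      moreover from this have "i div d > 0" "i div d \<le> n"
        using p order.trans[OF div_le_dividend[of i d]] by (auto simp: div_greater_zero_iff)
      ultimately show "p \<in> {1..n} \<times> {1..n}" using p by auto
    qed (use x in auto)
    also have "\<dots> = (\<Sum>k=1..n. \<Sum>d=1..n. real d * (x ^ k) ^ d)"
      by (simp add: sum.cartesian_product power_mult)
    \<comment> \<open>Since ln (x^k) = - 2 k / sqrt n, the term \<open>k\<close> is n / (4 k^2) and
      the sum is at most n / 2; the factor 2 in front gives exactly n. With a bound exp (K sqrt n)
      the same count yields 16 n / K^2, which explains K = 4.\<close>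
    also have "\<dots> \<le> (\<Sum>k=1..n. 1 / (ln (x ^ k))\<^sup>2)"
      using x by (intro sum_mono sum_mult_power_le) (auto simp: power_less_one_iff)
    also have "\<dots> = (\<Sum>k=1..n. real n / 4 * (1 / (real k)\<^sup>2))"
      using x False by (intro sum.cong) (auto simp: ln_realpow power_mult_distrib power_divide x_def)
    also have "\<dots> \<le> real n / 4 * 2"
      unfolding sum_distrib_left[symmetric]
      using sum_inverse_squares_le[of n] False by (intro mult_left_mono) (auto intro: order.trans)
    finally have "real n * \<bar>c n\<bar> \<le> real n * exp (4 * sqrt (real n))"
      by (simp add: mult_ac)
    then show ?thesis using False by (simp add: c_def)
  qed
qed

section \<open>The Jacobi theta function in two variables\<close>

text \<open>\<open>E \<tau>\<close> is a square root of the nome: all series below are expanded in \<open>E \<tau>\<close>.\<close>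

definition E :: "complex \<Rightarrow> complex" where
  "E x = exp (of_real pi * \<i> * x)"

lemma E_0 [simp]: "E 0 = 1" by (simp add: E_def)
lemma E_nonzero [simp]: "E x \<noteq> 0" by (simp add: E_def)
lemma E_add: "E (x + y) = E x * E y" by (simp add: E_def exp_add algebra_simps)
lemma E_minus: "E (- x) = inverse (E x)" by (simp add: E_def exp_minus)
lemma E_diff: "E (x - y) = E x / E y" by (simp add: E_def exp_diff algebra_simps)
lemma norm_E: "norm (E x) = exp (- pi * Im x)" by (simp add: E_def)
lemma E_power: "E x ^ n = E (of_nat n * x)"
  by (simp add: E_def algebra_simps flip: exp_of_nat_mult)
lemma E_powi: "E x powi n = E (of_int n * x)"
  by (simp add: power_int_def E_power E_minus power_inverse)
lemma holomorphic_E [holomorphic_intros]: "f holomorphic_on A \<Longrightarrow> (\<lambda>x. E (f x)) holomorphic_on A"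
  unfolding E_def by (intro holomorphic_intros)
lemma continuous_E [continuous_intros]: "continuous_on A f \<Longrightarrow> continuous_on A (\<lambda>x. E (f x))"
  unfolding E_def by (intro continuous_intros)
lemma E_even_int: "even n \<Longrightarrow> E (of_int n) = 1"
  by (auto simp: E_def exp_eq_1 elim!: evenE)
lemma E_2_int [simp]: "E (2 * of_int n) = 1"
  using E_even_int[of "2 * n"] by simp
lemma E_1 [simp]: "E 1 = -1" by (simp add: E_def)
lemma E_odd_int: "odd n \<Longrightarrow> E (of_int n) = -1"
  using E_add[of "of_int (n - 1)" 1] E_even_int[of "n - 1"] by simp
lemma E_cong_even: "x - y = of_int n \<Longrightarrow> even n \<Longrightarrow> E x = E y"
  using E_add[of y "of_int n"] E_even_int[of n] by (simp add: algebra_simps)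
lemma E_eq_1_iff: "E (2 * x) = 1 \<longleftrightarrow> x \<in> \<int>"
proof
  assume "E (2 * x) = 1"
  then obtain n :: int where "Im (of_real pi * \<i> * (2 * x)) = of_int (2 * n) * pi" "Re (of_real pi * \<i> * (2 * x)) = 0"
    unfolding E_def exp_eq_1 by auto
  then have "x = of_int n" by (simp add: complex_eq_iff)
  then show "x \<in> \<int>" by simp
qed (auto elim!: Ints_cases)

definition th :: "complex \<Rightarrow> complex \<Rightarrow> complex" where
  "th \<tau> z = (\<Sum>\<^sub>\<infinity>n\<in>(UNIV :: int set). E (of_int n ^ 2 * \<tau> + 2 * of_int n * z))"

lemma summable_on_power_abs_int:
  fixes r :: real
  assumes "0 \<le> r" "r < 1"
  shows "(\<lambda>n :: int. r ^ nat \<bar>n\<bar>) summable_on UNIV"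
proof -
  have "summable (\<lambda>n. norm (r ^ n))" "summable (\<lambda>n. norm (r ^ Suc n))"
    using assms by (simp_all add: norm_power summable_mult summable_geometric)
  then have s: "(\<lambda>n. r ^ n) summable_on UNIV" "(\<lambda>n. r ^ Suc n) summable_on UNIV"
    by (blast intro: norm_summable_imp_summable_on)+
  have e: "((\<lambda>n :: int. r ^ nat \<bar>n\<bar>) \<circ> int) = (\<lambda>n. r ^ n)"
    "((\<lambda>n :: int. r ^ nat \<bar>n\<bar>) \<circ> (\<lambda>n. - int (Suc n))) = (\<lambda>n. r ^ Suc n)"
    unfolding o_def abs_minus_cancel abs_of_nat nat_int by (rule refl)+
  have "(\<lambda>n :: int. r ^ nat \<bar>n\<bar>) summable_on range int"
    unfolding summable_on_reindex[OF inj_of_nat] e by (rule s)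
  moreover have "(\<lambda>n :: int. r ^ nat \<bar>n\<bar>) summable_on range (\<lambda>n. - int (Suc n))"
    by (subst summable_on_reindex, simp add: inj_def, unfold e, rule s)
  ultimately have "(\<lambda>n :: int. r ^ nat \<bar>n\<bar>) summable_on (range int \<union> range (\<lambda>n. - int (Suc n)))"
    by (rule summable_on_Un_disjoint) auto
  also have "range int \<union> range (\<lambda>n. - int (Suc n)) = UNIV"
  proof -
    have "x \<in> range int \<union> range (\<lambda>n. - int (Suc n))" for x by (cases x) auto
    then show ?thesis by blast
  qed
  finally show ?thesis .
qed

text \<open>The constant comes from completing the square in - y m^2 + (2 V + 1) m with m = |n|.
  What is left is geometric and uniform for Im \<tau> \<ge> y, |Im z| \<le> V.\<close>

definition th_majorant :: "real \<Rightarrow> real \<Rightarrow> int \<Rightarrow> real" where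
  "th_majorant y V n = exp (pi * ((2 * V + 1)\<^sup>2 / (4 * y))) * exp (- pi) ^ nat \<bar>n\<bar>"

lemma th_majorant_summable: "th_majorant y V summable_on UNIV"
  unfolding th_majorant_def
  by (intro summable_on_cmult_right summable_on_power_abs_int) auto

lemma th_term_le:
  assumes "y > 0" "Im \<tau> \<ge> y" "\<bar>Im z\<bar> \<le> V"
  shows "norm (E (of_int n ^ 2 * \<tau> + 2 * of_int n * z)) \<le> th_majorant y V n"
proof -
  define m where "m = \<bar>real_of_int n\<bar>"
  have im: "Im (of_int n ^ 2 * \<tau> + 2 * of_int n * z) = m\<^sup>2 * Im \<tau> + 2 * of_int n * Im z"
    by (simp add: m_def power2_eq_square)
  have "- (2 * of_int n * Im z) \<le> 2 * m * \<bar>Im z\<bar>"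
    unfolding m_def by (metis abs_ge_minus_self abs_mult abs_numeral mult.assoc)
  also have "\<dots> \<le> 2 * m * V" using assms by (intro mult_left_mono) (auto simp: m_def)
  finally have 1: "- (2 * of_int n * Im z) \<le> 2 * m * V" .
  have 2: "m\<^sup>2 * y \<le> m\<^sup>2 * Im \<tau>" using assms by (intro mult_left_mono) auto
  have "0 \<le> (m * sqrt y - (2 * V + 1) / (2 * sqrt y))\<^sup>2" by simp
  also have "\<dots> = m\<^sup>2 * y - m * (2 * V + 1) + (2 * V + 1)\<^sup>2 / (4 * y)"
    using assms by (simp add: power2_diff power_mult_distrib power_divide)
  finally have "- Im (of_int n ^ 2 * \<tau> + 2 * of_int n * z) \<le> (2 * V + 1)\<^sup>2 / (4 * y) - m"
    unfolding im using 1 2 by (simp add: algebra_simps)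
  then have "norm (E (of_int n ^ 2 * \<tau> + 2 * of_int n * z)) \<le> exp (pi * ((2 * V + 1)\<^sup>2 / (4 * y) - m))"
    unfolding norm_E exp_le_cancel_iff mult_minus_left mult_minus_right[symmetric]
    by (rule mult_left_mono) simp
  also have "\<dots> = th_majorant y V n"
    unfolding th_majorant_def exp_of_nat_mult[symmetric] exp_add[symmetric]
    by (simp add: m_def algebra_simps)
  finally show ?thesis .
qed

lemma th_abs_summable:
  assumes "Im \<tau> > 0"
  shows "(\<lambda>n :: int. norm (E (of_int n ^ 2 * \<tau> + 2 * of_int n * z))) summable_on UNIV"
  by (rule summable_on_comparison_test[OF th_majorant_summable[of "Im \<tau>" "\<bar>Im z\<bar>"]])
     (use assms in \<open>auto intro!: th_term_le\<close>)

lemma th_has_sum: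
  assumes "Im \<tau> > 0"
  shows "((\<lambda>n :: int. E (of_int n ^ 2 * \<tau> + 2 * of_int n * z)) has_sum th \<tau> z) UNIV"
  unfolding th_def by (rule has_sum_infsum, rule abs_summable_summable, rule th_abs_summable[OF assms])

lemma th_uniform_limit:
  assumes "y > 0" "\<And>s. s \<in> S \<Longrightarrow> Im (f s) \<ge> y" "\<And>s. s \<in> S \<Longrightarrow> \<bar>Im (g s)\<bar> \<le> V"
  shows "uniform_limit S (\<lambda>A s. \<Sum>n\<in>A. E (of_int n ^ 2 * f s + 2 * of_int n * g s))
     (\<lambda>s. th (f s) (g s)) (finite_subsets_at_top UNIV)"
  unfolding th_def
  by (rule Weierstrass_m_test_general[OF th_term_le th_majorant_summable]) (use assms in auto)

text \<open>Composites from an arbitrary space are allowed because the final compactness argument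
  runs over \<tau> together with two real coordinates of z.\<close>

lemma continuous_on_th:
  fixes f g :: "'a :: heine_borel \<Rightarrow> complex"
  assumes "continuous_on S f" "continuous_on S g" "\<And>s. s \<in> S \<Longrightarrow> Im (f s) > 0"
  shows "continuous_on S (\<lambda>s. th (f s) (g s))"
proof -
  have "continuous_on {p. Im (fst p) > 0} (\<lambda>p. th (fst p) (snd p))"
  proof (rule continuous_at_imp_continuous_on, rule ballI)
    fix p :: "complex \<times> complex" assume p: "p \<in> {p. Im (fst p) > 0}"
    define y where "y = Im (fst p) / 2"
    define V where "V = \<bar>Im (snd p)\<bar> + 1"
    define U where "U = {q :: complex \<times> complex. Im (fst q) > y} \<inter> {q. \<bar>Im (snd q)\<bar> < V}"
    have "open U" unfolding U_def
      by (intro open_Int open_Collect_less continuous_intros)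
    moreover have "p \<in> U" using p by (auto simp: U_def y_def V_def)
    moreover have "continuous_on U (\<lambda>p. th (fst p) (snd p))"
    proof (rule uniform_limit_theorem)
      show "uniform_limit U (\<lambda>A s. \<Sum>n\<in>A. E (of_int n ^ 2 * fst s + 2 * of_int n * snd s))
         (\<lambda>s. th (fst s) (snd s)) (finite_subsets_at_top UNIV)"
        by (rule th_uniform_limit[of y _ _ _ V]) (use p in \<open>auto simp: U_def y_def\<close>)
    qed (auto intro!: always_eventually continuous_intros)
    ultimately show "isCont (\<lambda>p. th (fst p) (snd p)) p"
      using continuous_on_eq_continuous_at by blast
  qed
  then have "continuous_on S ((\<lambda>p. th (fst p) (snd p)) \<circ> (\<lambda>s. (f s, g s)))"
    by (intro continuous_on_compose continuous_intros assms)
       (use assms in \<open>auto elim!: continuous_on_subset\<close>)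
  then show ?thesis by (simp add: o_def)
qed

text \<open>Both arguments move holomorphically with one variable, the form in which the maximum
  principle is applied later. On a closed disc Im (f s) has a positive minimum and |Im (g s)| a
  maximum, so the series converges uniformly there.\<close>

lemma holomorphic_on_th [holomorphic_intros]:
  assumes "f holomorphic_on S" "g holomorphic_on S" "\<And>s. s \<in> S \<Longrightarrow> Im (f s) > 0" "open S"
  shows "(\<lambda>s. th (f s) (g s)) holomorphic_on S"
proof -
  have "\<exists>e>0. (\<lambda>s. th (f s) (g s)) holomorphic_on ball s e" if s: "s \<in> S" for s
  proof -
    obtain e where e: "e > 0" "cball s e \<subseteq> S" using assms(4) s by (meson open_contains_cball)
    have cf: "continuous_on (cball s e) f" "continuous_on (cball s e) g"
      using assms e by (meson continuous_on_subset holomorphic_on_imp_continuous_on)+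
    have "cball s e \<noteq> {}" using e by simp
    obtain s1 where s1: "s1 \<in> cball s e" "\<And>t. t \<in> cball s e \<Longrightarrow> Im (f s1) \<le> Im (f t)"
      using continuous_attains_inf[OF compact_cball \<open>cball s e \<noteq> {}\<close> continuous_on_Im[OF cf(1)]] by blast
    obtain s2 where s2: "s2 \<in> cball s e" "\<And>t. t \<in> cball s e \<Longrightarrow> \<bar>Im (g t)\<bar> \<le> \<bar>Im (g s2)\<bar>"
      using continuous_attains_sup[OF compact_cball \<open>cball s e \<noteq> {}\<close> continuous_on_rabs[OF continuous_on_Im[OF cf(2)]]]
      by blast
    have ul: "uniform_limit (cball s e) (\<lambda>A s. \<Sum>n\<in>A. E (of_int n ^ 2 * f s + 2 * of_int n * g s))
         (\<lambda>s. th (f s) (g s)) (finite_subsets_at_top UNIV)"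
      by (rule th_uniform_limit[of "Im (f s1)" _ _ _ "\<bar>Im (g s2)\<bar>"]) (use s1 s2 e assms(3) in auto)
    have "(\<lambda>s. th (f s) (g s)) holomorphic_on ball s e"
    proof (rule holomorphic_uniform_limit[OF _ ul])
      show "\<forall>\<^sub>F A in finite_subsets_at_top UNIV.
        continuous_on (cball s e) (\<lambda>s. \<Sum>n\<in>A. E (of_int n ^ 2 * f s + 2 * of_int n * g s)) \<and>
        (\<lambda>s. \<Sum>n\<in>A. E (of_int n ^ 2 * f s + 2 * of_int n * g s)) holomorphic_on ball s e"
      proof (intro always_eventually allI conjI)
        fix A
        have "(\<lambda>s. \<Sum>n\<in>A. E (of_int n ^ 2 * f s + 2 * of_int n * g s)) holomorphic_on S"
          by (intro holomorphic_intros assms)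
        then show "continuous_on (cball s e) (\<lambda>s. \<Sum>n\<in>A. E (of_int n ^ 2 * f s + 2 * of_int n * g s))"
          "(\<lambda>s. \<Sum>n\<in>A. E (of_int n ^ 2 * f s + 2 * of_int n * g s)) holomorphic_on ball s e"
          using e ball_subset_cball[of s e]
          by (meson continuous_on_subset holomorphic_on_imp_continuous_on holomorphic_on_subset subset_trans)+
      qed
    qed auto
    then show ?thesis using e by blast
  qed
  then have "(\<lambda>s. th (f s) (g s)) field_differentiable at s" if "s \<in> S" for s
    using that holomorphic_on_imp_differentiable_at[OF _ open_ball] centre_in_ball by blast
  then show ?thesis
    unfolding holomorphic_on_def using field_differentiable_at_within by blast
qed

lemma th_shift: "th \<tau> (z + of_int m * \<tau> + of_int k) = E (- (of_int m ^ 2 * \<tau>) - 2 * of_int m * z) * th \<tau> z"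
proof -
  have "th \<tau> (z + of_int m * \<tau> + of_int k) =
     (\<Sum>\<^sub>\<infinity>n\<in>(UNIV :: int set). E (- (of_int m ^ 2 * \<tau>) - 2 * of_int m * z) * E (of_int (n + m) ^ 2 * \<tau> + 2 * of_int (n + m) * z))"
    unfolding th_def E_add[symmetric]
  proof (rule infsum_cong)
    fix n :: int
    show "E (of_int n ^ 2 * \<tau> + 2 * of_int n * (z + of_int m * \<tau> + of_int k)) =
       E (- (of_int m ^ 2 * \<tau>) - 2 * of_int m * z + (of_int (n + m) ^ 2 * \<tau> + 2 * of_int (n + m) * z))"
      by (rule E_cong_even[of _ _ "2 * (n * k)"]) (simp_all add: power2_eq_square algebra_simps)
  qed
  also have "\<dots> = E (- (of_int m ^ 2 * \<tau>) - 2 * of_int m * z) * (\<Sum>\<^sub>\<infinity>n\<in>(UNIV :: int set). E (of_int (n + m) ^ 2 * \<tau> + 2 * of_int (n + m) * z))"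
    by (rule infsum_cmult_right')
  also have "(\<Sum>\<^sub>\<infinity>n\<in>(UNIV :: int set). E (of_int (n + m) ^ 2 * \<tau> + 2 * of_int (n + m) * z)) = th \<tau> z"
    unfolding th_def by (rule infsum_reindex_bij_witness[of _ "\<lambda>n. n - m" "\<lambda>n. n + m"]) auto
  finally show ?thesis .
qed

lemma th_minus: "th \<tau> (- z) = th \<tau> z"
  unfolding th_def by (rule infsum_reindex_bij_witness[of _ uminus uminus]) auto

lemma th_add_2: "th (\<tau> + 2) z = th \<tau> z"
  unfolding th_def
proof (rule infsum_cong)
  fix n :: int
  show "E (of_int n ^ 2 * (\<tau> + 2) + 2 * of_int n * z) = E (of_int n ^ 2 * \<tau> + 2 * of_int n * z)"
    by (rule E_cong_even[of _ _ "2 * n ^ 2"]) (auto simp: algebra_simps)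
qed

lemma th_add_1: "th \<tau> (z + 1) = th \<tau> z"
  using th_shift[of \<tau> z 0 1] by simp

lemma th_add_tau: "th \<tau> (z + \<tau>) = E (- \<tau> - 2 * z) * th \<tau> z"
  using th_shift[of \<tau> z 1 0] by simp

section \<open>Entire functions with the quasi-periods of theta\<close>

lemma contour_integral_linepath_primitive:
  assumes "\<And>z. (G has_field_derivative g z) (at z)"
  shows "contour_integral (linepath a b) g = G b - G a"
proof -
  have "(g has_contour_integral (G (pathfinish (linepath a b)) - G (pathstart (linepath a b)))) (linepath a b)"
    by (rule contour_integral_primitive[of UNIV]) (simp_all add: assms)
  then show ?thesis by (simp add: contour_integral_unique)
qed

lemma entire_primitive:
  assumes "g holomorphic_on UNIV"
  shows "\<exists>G. \<forall>z. (G has_field_derivative g z) (at z)"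
proof (rule holomorphic_convex_primitive'[OF convex_UNIV open_UNIV assms])
  fix G assume "\<And>x. x \<in> UNIV \<Longrightarrow> (G has_field_derivative g x) (at x)"
  then show ?thesis by blast
qed

text \<open>For a primitive \<open>G\<close> the function G (z + 1) - G z has derivative 0 by
  periodicity of \<open>g\<close>.\<close>

lemma contour_integral_period:
  assumes g: "g holomorphic_on UNIV" and per: "\<And>z. g (z + 1) = g z"
  shows "contour_integral (linepath s (s + 1)) g = contour_integral (linepath 0 1) g"
proof -
  obtain G where G: "\<And>z. (G has_field_derivative g z) (at z)" using entire_primitive[OF g] by blast
  have "((\<lambda>z. G (z + 1) - G z) has_field_derivative 0) (at z)" for z
    using DERIV_diff[OF G[of "z + 1", unfolded DERIV_shift] G[of z]] by (simp add: per)
  then have "\<exists>c. \<forall>z\<in>UNIV. G (z + 1) - G z = c"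
    by (intro has_field_derivative_zero_constant) auto
  then obtain c where "\<forall>z\<in>UNIV. G (z + 1) - G z = c" ..
  then have "G (s + 1) - G s = c" "G (0 + 1) - G 0 = c" by blast+
  then show ?thesis by (simp add: contour_integral_linepath_primitive[OF G])
qed

lemma contour_integral_linepath_shift:
  assumes g: "g holomorphic_on UNIV"
  shows "contour_integral (linepath (a + t) (b + t)) g = contour_integral (linepath a b) (\<lambda>s. g (s + t))"
proof -
  obtain G where G: "\<And>z. (G has_field_derivative g z) (at z)" using entire_primitive[OF g] by blast
  have "((\<lambda>s. G (s + t)) has_field_derivative g (z + t)) (at z)" for z
    using G[of "z + t", unfolded DERIV_shift] .
  then show ?thesis 
    by (simp add: contour_integral_linepath_primitive[OF G]
        contour_integral_linepath_primitive[of "\<lambda>s. G (s + t)" "\<lambda>s. g (s + t)"])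
qed

lemma E_linear_entire: "(\<lambda>s. E (2 * of_int m * (s - z))) holomorphic_on UNIV"
  by (intro holomorphic_intros)

text \<open>The denominator has simple zeros exactly at the integer translates of \<open>z\<close>,
  where \<open>f s - f z\<close> vanishes by periodicity, so every singularity is removable. The
  quotient serves to telescope Fourier coefficients.\<close>

lemma removable_quotient:
  assumes f: "f holomorphic_on UNIV" and per: "\<And>s. f (s + 1) = f s"
  shows "\<exists>k. k holomorphic_on UNIV \<and> (\<forall>s. k (s + 1) = k s) \<and>
    (\<forall>s. k s * (E (2 * (s - z)) - 1) = f s - f z)"
proof -
  define h where "h s = E (2 * (s - z)) - 1" for s
  \<comment> \<open>At a zero of \<open>h\<close> the value is the limit of the quotient, since
    \<open>h\<close> has derivative 2 pi i there.\<close>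
  define k where "k s = (if h s = 0 then deriv f s / (2 * pi * \<i>) else (f s - f z) / h s)" for s
  have h_hol: "h holomorphic_on UNIV" unfolding h_def by (intro holomorphic_intros)
  have h0: "h s = 0 \<longleftrightarrow> s - z \<in> \<int>" for s using E_eq_1_iff[of "s - z"] by (simp add: h_def)
  have per_int: "f (s + of_int n) = f s" for s n
  proof (induction n)
    case (nonneg n)
    show ?case
    proof (induction n)
      case (Suc n)
      then show ?case using per[of "s + of_nat n"] by (simp add: add_ac)
    qed simp
  next
    case (neg n)
    have "f (s + of_int (- int m)) = f s" for m
    proof (induction m)
      case (Suc m)
      then show ?case using per[of "s + of_int (- int (Suc m))"] by (simp add: add_ac)
    qed simp
    then show ?case by blast
  qed
  have fz: "f s = f z" if "h s = 0" for s
  proof -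
    have "s - z \<in> \<int>" using h0[of s] that by simp
    then obtain n where "s - z = of_int n" by (auto elim: Ints_cases)
    then show ?thesis using per_int[of z n] by (simp add: algebra_simps)
  qed
  have hper: "h (s + 1) = h s" for s
  proof -
    have "E (2 * (s + 1 - z)) = E (2 * (s - z))" by (rule E_cong_even[of _ _ 2]) (auto simp: algebra_simps)
    then show ?thesis by (simp add: h_def)
  qed
  have h_deriv: "(h has_field_derivative 2 * pi * \<i>) (at s)" if "h s = 0" for s
    using that unfolding h_def E_def by (auto intro!: derivative_eq_intros)
  have "deriv f (s + 1) = deriv f s" for s
  proof (rule DERIV_imp_deriv)
    have "((\<lambda>s. f (s + 1)) has_field_derivative deriv f s) (at s)"
      unfolding per by (rule holomorphic_derivI[OF f]) auto
    then show "(f has_field_derivative deriv f s) (at (s + 1))" by (simp add: DERIV_shift)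
  qed
  then have kper: "k (s + 1) = k s" for s by (simp add: k_def hper per)
  have "k field_differentiable at s0" for s0
  proof -
    have hnz: "h s \<noteq> 0" if "h s0 = 0" "s \<in> ball s0 1 - {s0}" for s
    proof
      assume "h s = 0"
      then have "s - z \<in> \<int>" "s0 - z \<in> \<int>" using h0 \<open>h s0 = 0\<close> by auto
      then have "(s - z) - (s0 - z) \<in> \<int>" by (rule Ints_diff)
      then obtain n where n: "s - s0 = of_int n" by (auto elim: Ints_cases)
      then have "norm (s - s0) = \<bar>of_int n\<bar>" by simp
      moreover have "norm (s - s0) < 1" using that(2) by (simp add: dist_norm norm_minus_commute)
      moreover have "n \<noteq> 0" using that(2) n by auto
      ultimately show False by simp
    qed
    have hol: "k holomorphic_on ball s0 1 - {s0}" if "h s0 = 0"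
    proof -
      have "h s \<noteq> 0" if "s \<in> ball s0 1 - {s0}" for s using hnz \<open>h s0 = 0\<close> that by blast
      moreover have "(\<lambda>s. (f s - f z) / h s) holomorphic_on ball s0 1 - {s0}"
        by (intro holomorphic_intros holomorphic_on_subset[OF f] holomorphic_on_subset[OF h_hol]) (use calculation in auto)
      ultimately show ?thesis by (elim holomorphic_transform) (auto simp: k_def)
    qed
    show ?thesis
    proof (cases "h s0 = 0")
      case True
      have "((\<lambda>s. ((f s - f s0) / (s - s0)) / ((h s - h s0) / (s - s0))) \<longlongrightarrow> deriv f s0 / (2 * pi * \<i>)) (at s0)"
        using holomorphic_derivI[OF f, of s0] h_deriv[OF True]
        by (intro tendsto_divide) (auto simp: has_field_derivative_iff)
      moreover have "\<forall>\<^sub>F s in at s0. ((f s - f s0) / (s - s0)) / ((h s - h s0) / (s - s0)) = k s"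
      proof -
        have "\<forall>\<^sub>F s in at s0. s \<noteq> s0 \<and> s \<in> ball s0 1"
          by (intro eventually_conj eventually_at_in_open' eventually_neq_at_within) auto
        then show ?thesis
        proof (eventually_elim)
          case (elim s)
          then have "h s \<noteq> 0" using hnz[OF True] by blast
          then show ?case using elim True fz[OF True] by (simp add: k_def)
        qed
      qed
      ultimately have "(k \<longlongrightarrow> deriv f s0 / (2 * pi * \<i>)) (at s0)"
        by (rule Lim_transform_eventually)
      then have "(k \<longlongrightarrow> k s0) (at s0)" using True by (simp add: k_def)
      then have "(k \<longlongrightarrow> k s0) (at s0 within ball s0 1)"
        by (rule tendsto_within_subset) simp
      then have "k holomorphic_on ball s0 1"
        using no_isolated_singularity'[of "{s0}" k "ball s0 1"] hol[OF True] by simp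
      then show ?thesis by (rule holomorphic_on_imp_differentiable_at) auto
    next
      case False
      have op: "open {s. h s \<noteq> 0}"
        using open_Collect_neq[of h "\<lambda>_. 0"] holomorphic_on_imp_continuous_on[OF h_hol] by simp
      have "(\<lambda>s. (f s - f z) / h s) holomorphic_on {s. h s \<noteq> 0}"
        by (intro holomorphic_intros holomorphic_on_subset[OF f] holomorphic_on_subset[OF h_hol]) auto
      then have "k holomorphic_on {s. h s \<noteq> 0}" by (rule holomorphic_transform) (simp add: k_def)
      then show ?thesis by (rule holomorphic_on_imp_differentiable_at) (use op False in auto)
    qed
  qed
  then have "k holomorphic_on UNIV" unfolding holomorphic_on_def by simp
  moreover have "k s * (E (2 * (s - z)) - 1) = f s - f z" for s
    using fz[of s] unfolding h_def[symmetric] by (simp add: k_def)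
  ultimately show ?thesis using kper by blast
qed

text \<open>Multiplication by E (2 (s - z)) - 1 shifts the Fourier index of the quotient
  \<open>k\<close>. Hence the coefficients \<open>a m\<close> are constant for m \<ge> 1 and for m
  \<le> 0, with jump - f z in between. They tend to 0 in both directions, so both constants vanish,
  and with them the jump.\<close>

lemma entire_fourier_coeffs_eq_0:
  assumes f: "f holomorphic_on UNIV" and per: "\<And>s. f (s + 1) = f s"
    and zero: "\<And>m :: int. contour_integral (linepath 0 1) (\<lambda>s. f s * E (2 * of_int m * s)) = 0"
  shows "f z = 0"
proof -
  obtain k where k: "k holomorphic_on UNIV" "\<And>s. k (s + 1) = k s"
    "\<And>s. k s * (E (2 * (s - z)) - 1) = f s - f z"
    using removable_quotient[OF f per, of z] by blast
  define e where "e m s = E (2 * of_int m * (s - z))" for m :: int and s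
  have e_hol: "e m holomorphic_on UNIV" for m unfolding e_def by (rule E_linear_entire)
  have e_per: "e m (s + 1) = e m s" for m s
    unfolding e_def by (rule E_cong_even[of _ _ "2 * m"]) (auto simp: algebra_simps)
  define a where "a m = contour_integral (linepath 0 1) (\<lambda>s. k s * e m s)" for m
  have int: "g contour_integrable_on linepath 0 1" if "g holomorphic_on UNIV" for g
    by (rule contour_integrable_holomorphic_simple[OF that]) auto
  have e_int: "contour_integral (linepath 0 1) (e m) = (if m = 0 then 1 else 0)" for m
  proof (cases "m = 0")
    case True
    have "e 0 = (\<lambda>_. 1)" by (simp add: e_def fun_eq_iff)
    then show ?thesis using True by simp
  next
    case False
    define G where "G s = e m s / (2 * pi * \<i> * of_int m)" for s
    have "(G has_field_derivative e m s) (at s)" for s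
      unfolding G_def e_def E_def using False by (auto intro!: derivative_eq_intros)
    then have "contour_integral (linepath 0 1) (e m) = G 1 - G 0"
      by (rule contour_integral_linepath_primitive)
    also have "\<dots> = 0" using e_per[of m 0] by (simp add: G_def)
    finally show ?thesis using False by (simp only: if_False)
  qed
  have f_int: "contour_integral (linepath 0 1) (\<lambda>s. f s * e m s) = 0" for m
  proof -
    have "(\<lambda>s. f s * e m s) = (\<lambda>s. E (- 2 * of_int m * z) * (f s * E (2 * of_int m * s)))"
      unfolding e_def by (auto simp: fun_eq_iff algebra_simps simp flip: E_add)
    then show ?thesis using zero[of m]
      by (simp add: contour_integral_lmul int holomorphic_intros f)
  qed
  have step: "a (m + 1) - a m = (if m = 0 then - f z else 0)" for m
  proof -
    have "a (m + 1) - a m = contour_integral (linepath 0 1) (\<lambda>s. k s * e (m + 1) s - k s * e m s)"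
      unfolding a_def by (rule contour_integral_diff[symmetric]) (intro int holomorphic_intros k e_hol)+
    also have "(\<lambda>s. k s * e (m + 1) s - k s * e m s) = (\<lambda>s. f s * e m s - f z * e m s)"
    proof
      fix s
      have "e (m + 1) s = e m s * E (2 * (s - z))"
        unfolding e_def E_add[symmetric] by (simp add: algebra_simps)
      then have "k s * e (m + 1) s - k s * e m s = e m s * (k s * (E (2 * (s - z)) - 1))"
        by (simp add: right_diff_distrib mult.left_commute)
      then show "k s * e (m + 1) s - k s * e m s = f s * e m s - f z * e m s"
        unfolding k(3) by (simp add: right_diff_distrib mult.commute)
    qed
    also have "contour_integral (linepath 0 1) \<dots> = 0 - f z * (if m = 0 then 1 else 0)"
      by (subst contour_integral_diff)
         (auto simp: f_int contour_integral_lmul int e_int f e_hol intro!: holomorphic_intros int)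
    finally show ?thesis by simp
  qed
  have lim: "(\<lambda>m. a (\<sigma> * int m)) \<longlonglongrightarrow> 0" if \<sigma>: "\<sigma> = 1 \<or> \<sigma> = -1" for \<sigma> :: int
  proof -
    \<comment> \<open>At height Im z + \<sigma> the exponential with index \<sigma> m has modulus
      exp (- 2 pi)^m, while \<open>k\<close> is bounded on the segment independently of m.\<close>
    define p where "p = z + of_int \<sigma> * \<i>"
    have "compact (k ` closed_segment p (p + 1))"
      by (intro compact_continuous_image holomorphic_on_imp_continuous_on holomorphic_on_subset[OF k(1)]) auto
    then obtain C where C: "\<And>s. s \<in> closed_segment p (p + 1) \<Longrightarrow> norm (k s) \<le> C"
      by (meson bounded_iff compact_imp_bounded imageI)
    have C0: "C \<ge> 0" by (rule order_trans[OF norm_ge_zero C[of p]]) simp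
    have "norm (a (\<sigma> * int m)) \<le> C * exp (- 2 * pi) ^ m" for m
    proof -
      have "a (\<sigma> * int m) = contour_integral (linepath p (p + 1)) (\<lambda>s. k s * e (\<sigma> * int m) s)"
        unfolding a_def by (rule contour_integral_period[symmetric])
          (auto intro!: holomorphic_intros k e_hol simp: k e_per)
      also have "norm \<dots> \<le> C * exp (- 2 * pi) ^ m * norm (p + 1 - p)"
      proof (rule contour_integral_bound_linepath)
        show "(\<lambda>s. k s * e (\<sigma> * int m) s) contour_integrable_on linepath p (p + 1)"
          by (rule contour_integrable_holomorphic_simple[of _ UNIV]) (auto intro!: holomorphic_intros k e_hol)
        fix s assume s: "s \<in> closed_segment p (p + 1)"
        have "Im s = Im z + of_int \<sigma>"
          using s by (auto simp: closed_segment_def p_def algebra_simps)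
        then have "norm (e (\<sigma> * int m) s) = exp (- 2 * pi) ^ m"
          unfolding e_def norm_E exp_of_nat_mult[symmetric] using \<sigma> by (auto simp: algebra_simps)
        then show "norm (k s * e (\<sigma> * int m) s) \<le> C * exp (- 2 * pi) ^ m"
          using C[OF s] by (simp add: norm_mult mult_right_mono)
      qed (use C0 in auto)
      finally show ?thesis by simp
    qed
    moreover have "(\<lambda>m. C * exp (- 2 * pi) ^ m) \<longlonglongrightarrow> 0"
      by (rule tendsto_mult_right_zero, rule LIMSEQ_realpow_zero) auto
    ultimately show ?thesis by (rule Lim_null_comparison[OF always_eventually, OF allI])
  qed
  have "a (1 + int m) = a 1" for m
  proof (induction m)
    case (Suc m)
    then show ?case using step[of "1 + int m"] by (simp add: add_ac)
  qed simp
  then have "a (1 * int (Suc m)) = a 1" for m by simp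
  then have a1: "a 1 = 0"
    using LIMSEQ_Suc[OF lim[of 1]] by (simp add: LIMSEQ_const_iff)
  have "a (- int m) = a 0" for m
  proof (induction m)
    case (Suc m)
    then show ?case using step[of "- int (Suc m)"] by simp
  qed simp
  then have a0: "a 0 = 0"
    using lim[of "-1"] by (simp add: LIMSEQ_const_iff)
  show ?thesis using step[of 0] a0 a1 by simp
qed

text \<open>The quasi-periods determine the Fourier coefficients up to a common factor.\<close>

lemma quasi_periodic_eq_0:
  assumes g: "g holomorphic_on UNIV" "\<And>z. g (z + 1) = g z" "\<And>z. g (z + \<tau>) = E (- \<tau> - 2 * z) * g z"
    and 0: "contour_integral (linepath 0 1) g = 0"
  shows "g z = 0"
proof -
  have int: "h contour_integrable_on linepath 0 1" if "h holomorphic_on UNIV" for h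
    by (rule contour_integrable_holomorphic_simple[OF that]) auto
  define a where "a n = contour_integral (linepath 0 1) (\<lambda>s. g s * E (2 * of_int n * s))" for n :: int
  have step: "a (n + 1) = E ((2 * of_int n + 1) * \<tau>) * a n" for n
  proof -
    define h where "h s = g s * E (2 * of_int (n + 1) * s)" for s
    have h: "h holomorphic_on UNIV" "h (s + 1) = h s" for s
    proof -
      show "h holomorphic_on UNIV" unfolding h_def by (intro holomorphic_intros g)
      have "E (2 * of_int (n + 1) * (s + 1)) = E (2 * of_int (n + 1) * s)"
        by (rule E_cong_even[of _ _ "2 * (n + 1)"]) (auto simp: algebra_simps)
      then show "h (s + 1) = h s" by (simp add: h_def g)
    qed
    \<comment> \<open>Moving the path by \<tau> and using the quasi-period trades index n + 1 for n
      up to a nonzero factor, so one vanishing coefficient forces all to vanish.\<close>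
    have "a (n + 1) = contour_integral (linepath \<tau> (\<tau> + 1)) h"
      unfolding a_def h_def[symmetric] using contour_integral_period[OF h] by simp
    also have "\<dots> = contour_integral (linepath 0 1) (\<lambda>s. h (s + \<tau>))"
      using contour_integral_linepath_shift[OF h(1), of 0 \<tau> 1] by (simp add: add.commute)
    also have "(\<lambda>s. h (s + \<tau>)) = (\<lambda>s. E ((2 * of_int n + 1) * \<tau>) * (g s * E (2 * of_int n * s)))"
    proof
      fix s
      have "E (- \<tau> - 2 * s) * E (2 * of_int (n + 1) * (s + \<tau>)) = E ((2 * of_int n + 1) * \<tau>) * E (2 * of_int n * s)"
        unfolding E_add[symmetric] by (simp add: algebra_simps)
      then show "h (s + \<tau>) = E ((2 * of_int n + 1) * \<tau>) * (g s * E (2 * of_int n * s))"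
        by (simp add: h_def g mult.left_commute mult.assoc)
    qed
    also have "contour_integral (linepath 0 1) \<dots> = E ((2 * of_int n + 1) * \<tau>) * a n"
      unfolding a_def by (rule contour_integral_lmul) (intro int holomorphic_intros g)
    finally show ?thesis .
  qed
  have "a n = 0" for n
  proof (induction n rule: int_induct[of _ 0])
    case base
    then show ?case using 0 by (simp add: a_def)
  next
    case (step1 n)
    then show ?case by (simp add: step)
  next
    case (step2 n)
    then show ?case using step[of "n - 1"] by simp
  qed
  then show ?thesis
    using entire_fourier_coeffs_eq_0[OF g(1,2)] by (simp add: a_def)
qed

lemma th_entire: "Im \<tau> > 0 \<Longrightarrow> th \<tau> holomorphic_on UNIV"
  using holomorphic_on_th[of "\<lambda>_. \<tau>" UNIV "\<lambda>s. s"] by (auto intro: holomorphic_intros)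

text \<open>The combination of \<open>f\<close> and \<open>th \<tau>\<close> with mean 0 vanishes,
  so the space of solutions is at most one-dimensional. In cross-multiplied form the statement can
  also be used to prove that theta values are nonzero.\<close>

lemma theta_unique:
  assumes f: "f holomorphic_on UNIV" "\<And>z. f (z + 1) = f z" "\<And>z. f (z + \<tau>) = E (- \<tau> - 2 * z) * f z"
    and \<tau>: "Im \<tau> > 0"
  shows "f z * th \<tau> 0 = f 0 * th \<tau> z"
proof -
  define P where "P g = contour_integral (linepath 0 1) g" for g :: "complex \<Rightarrow> complex"
  define g where "g s = P (th \<tau>) * f s - P f * th \<tau> s" for s
  have int: "h contour_integrable_on linepath 0 1" if "h holomorphic_on UNIV" for h
    by (rule contour_integrable_holomorphic_simple[OF that]) auto
  note th_hol = th_entire[OF \<tau>]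
  have g: "g holomorphic_on UNIV" "\<And>z. g (z + 1) = g z" "\<And>z. g (z + \<tau>) = E (- \<tau> - 2 * z) * g z"
    unfolding g_def by (auto intro!: holomorphic_intros f th_hol simp: f th_add_1 th_add_tau algebra_simps)
  have "P g = P (\<lambda>s. P (th \<tau>) * f s) - P (\<lambda>s. P f * th \<tau> s)"
    unfolding g_def P_def by (rule contour_integral_diff) (intro int holomorphic_intros f th_hol)+
  also have "\<dots> = 0"
    unfolding P_def by (simp add: contour_integral_lmul int f th_hol)
  finally have g0: "g s = 0" for s
    using quasi_periodic_eq_0[OF g] by (simp add: P_def)
  show ?thesis
  proof (cases "P (th \<tau>) = 0")
    case False
    have "P (th \<tau>) * (f z * th \<tau> 0 - f 0 * th \<tau> z) = g z * th \<tau> 0 - g 0 * th \<tau> z"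
      by (simp add: g_def algebra_simps)
    then show ?thesis using False g0 by simp
  next
    case True
    \<comment> \<open>If the mean of \<open>th \<tau>\<close> were 0, the same argument would make
      \<open>th \<tau>\<close> identically 0 and both sides would vanish.\<close>
    then have "th \<tau> s = 0" for s
      using quasi_periodic_eq_0[OF th_hol th_add_1 th_add_tau] by (simp add: P_def)
    then show ?thesis by simp
  qed
qed

section \<open>Theta and its reciprocal as convergent power series\<close>

text \<open>With l = ln R this is the square of sqrt (l n) - K / (2 sqrt l) being nonnegative.
  Through it every bound of type exp (K sqrt n) turns into convergence in the whole unit
  disc.\<close>

lemma exp_sqrt_le_power:
  fixes K R :: real
  assumes "R > 1"
  shows "\<exists>C>0. \<forall>n::nat. exp (K * sqrt (real n)) \<le> C * R ^ n"
proof (intro exI conjI allI)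
  fix n :: nat
  define l where "l = ln R"
  have l: "l > 0" using assms by (simp add: l_def)
  have "0 \<le> (sqrt l * sqrt (real n) - K / (2 * sqrt l))\<^sup>2" by simp
  also have "\<dots> = l * real n - K * sqrt (real n) + K\<^sup>2 / (4 * l)"
    using l by (simp add: power2_diff power_mult_distrib power_divide)
  finally have "K * sqrt (real n) \<le> K\<^sup>2 / (4 * l) + real n * l" by (simp add: algebra_simps)
  then have "exp (K * sqrt (real n)) \<le> exp (K\<^sup>2 / (4 * l) + real n * l)" by simp
  also have "\<dots> = exp (K\<^sup>2 / (4 * ln R)) * R ^ n"
    using assms by (simp add: exp_add l_def exp_of_nat_mult)
  finally show "exp (K * sqrt (real n)) \<le> exp (K\<^sup>2 / (4 * ln R)) * R ^ n" .
qed simp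

lemma fps_conv_radius_ge_1:
  fixes F :: "complex fps"
  assumes "\<And>R. R > 1 \<Longrightarrow> \<exists>C. \<forall>n. norm (fps_nth F n) \<le> C * R ^ n"
  shows "fps_conv_radius F \<ge> 1"
  unfolding fps_conv_radius_def
proof (rule conv_radius_geI_ex)
  fix r :: real assume r: "r > 0" "ereal r < 1"
  then have r1: "r < 1" by simp
  define R where "R = 1 / sqrt r"
  have "R > 1" using r r1 by (simp add: R_def)
  then obtain C where C: "\<And>n. norm (fps_nth F n) \<le> C * R ^ n" using assms by blast
  have Rr: "R * r = sqrt r" using r by (simp add: R_def real_div_sqrt)
  have "summable (\<lambda>n. fps_nth F n * of_real r ^ n)"
  proof (rule summable_comparison_test')
    show "summable (\<lambda>n. C * sqrt r ^ n)" using r r1 by (intro summable_mult summable_geometric) auto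
    fix n :: nat
    have "norm (fps_nth F n * of_real r ^ n) = norm (fps_nth F n) * r ^ n"
      using r by (simp add: norm_mult norm_power)
    also have "\<dots> \<le> C * R ^ n * r ^ n" using r C[of n] by (intro mult_right_mono) auto
    also have "\<dots> = C * sqrt r ^ n" by (simp flip: Rr add: power_mult_distrib)
    finally show "norm (fps_nth F n * of_real r ^ n) \<le> C * sqrt r ^ n" .
  qed
  then show "\<exists>z. norm z = r \<and> summable (\<lambda>n. fps_nth F n * z ^ n)"
    using r by (intro exI[of _ "of_real r"]) auto
qed

definition theta_C :: "complex fps" where
  "theta_C = Abs_fps (\<lambda>n. of_real (fps_nth theta_fps n))"

definition inv_theta_C :: "complex fps" where
  "inv_theta_C = Abs_fps (\<lambda>n. of_real (fps_nth (inverse theta_fps) n))"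

lemma theta_C_mult_inv: "theta_C * inv_theta_C = 1"
proof (rule fps_ext)
  fix n
  have "theta_fps * inverse theta_fps = 1"
    by (rule inverse_mult_eq_1') (simp add: fps_nth_theta_fps_0)
  then have "(of_real (fps_nth (theta_fps * inverse theta_fps) n) :: complex) = of_real (fps_nth 1 n)" by simp
  then show "fps_nth (theta_C * inv_theta_C) n = fps_nth 1 n"
    by (simp add: fps_mult_nth theta_C_def inv_theta_C_def)
qed

lemma inv_theta_C_bound: "norm (fps_nth inv_theta_C n) \<le> exp (4 * sqrt (real n))"
  using norm_inverse_theta_fps_le by (simp add: inv_theta_C_def)

lemma theta_C_bound: "norm (fps_nth theta_C n) \<le> 2"
proof -
  have "card {k :: int. k\<^sup>2 = int n} \<le> 2"
  proof (cases "{k :: int. k\<^sup>2 = int n} = {}")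
    case False
    then obtain j :: int where j: "j\<^sup>2 = int n" by blast
    have "{k :: int. k\<^sup>2 = int n} \<subseteq> {j, - j}" unfolding j[symmetric] power2_eq_iff by auto
    then have "card {k :: int. k\<^sup>2 = int n} \<le> card {j, - j}" by (intro card_mono) auto
    also have "\<dots> \<le> 2" by (simp add: card_insert_if)
    finally show ?thesis .
  qed simp
  then show ?thesis by (simp add: theta_C_def theta_fps_def)
qed

lemma fps_conv_radius_inv_theta_C: "fps_conv_radius inv_theta_C \<ge> 1"
proof (rule fps_conv_radius_ge_1)
  fix R :: real assume "R > 1"
  then show "\<exists>C. \<forall>n. norm (fps_nth inv_theta_C n) \<le> C * R ^ n"
    using exp_sqrt_le_power[of R 4] order_trans[OF inv_theta_C_bound] by blast
qed

lemma fps_conv_radius_theta_C: "fps_conv_radius theta_C \<ge> 1"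
proof (rule fps_conv_radius_ge_1)
  fix R :: real assume "R > 1"
  then have "2 \<le> 2 * R ^ n" for n by (simp add: one_le_power)
  then show "\<exists>C. \<forall>n. norm (fps_nth theta_C n) \<le> C * R ^ n"
    using order_trans[OF theta_C_bound] by blast
qed

lemma norm_E_less_1: "Im \<tau> > 0 \<Longrightarrow> norm (E \<tau>) < 1"
  by (simp add: norm_E)

lemma eval_theta_C: "Im \<tau> > 0 \<Longrightarrow> eval_fps theta_C (E \<tau>) = th \<tau> 0"
  using theta_fps_sums[OF norm_E_less_1, of \<tau>]
  by (simp add: eval_fps_def sums_iff theta_C_def th_def E_powi)

lemma eval_theta_C_inv:
  assumes "norm q < 1"
  shows "eval_fps theta_C q * eval_fps inv_theta_C q = 1"
proof -
  have q: "ereal (norm q) < fps_conv_radius theta_C" "ereal (norm q) < fps_conv_radius inv_theta_C"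
    using assms fps_conv_radius_theta_C fps_conv_radius_inv_theta_C less_le_trans[of "ereal (norm q)" 1] by auto
  show ?thesis using eval_fps_mult[OF q] by (simp add: theta_C_mult_inv)
qed

text \<open>By the coefficient bound the reciprocal series converges at every point of the unit
  disc, and the product identity there excludes zeros.\<close>

lemma th_0_nonzero: "Im \<tau> > 0 \<Longrightarrow> th \<tau> 0 \<noteq> 0"
  by (metis eval_theta_C eval_theta_C_inv mult_zero_left norm_E_less_1 zero_neq_one)

text \<open>The reciprocal is continuous, hence bounded, on the closed disc of radius exp (- pi /
  2). The height 1/2 is the one that \<open>reduction_to_strip\<close> attains.\<close>

lemma th_0_lower_bound: "\<exists>c>0. \<forall>\<tau>. Im \<tau> \<ge> 1 / 2 \<longrightarrow> norm (th \<tau> 0) \<ge> c"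
proof -
  define r where "r = exp (- pi / 2)"
  have r: "0 < r" "r < 1" by (auto simp: r_def)
  have "continuous_on (cball 0 r) (eval_fps inv_theta_C)"
  proof (rule continuous_on_subset[OF continuous_on_eval_fps], rule subsetI)
    fix x :: complex assume "x \<in> cball 0 r"
    then have "ereal (norm x) < 1" using r by auto
    then show "x \<in> eball 0 (fps_conv_radius inv_theta_C)"
      using less_le_trans[OF _ fps_conv_radius_inv_theta_C] by simp
  qed
  then have "compact (eval_fps inv_theta_C ` cball 0 r)"
    by (rule compact_continuous_image) simp
  then have "bounded (eval_fps inv_theta_C ` cball 0 r)" by (rule compact_imp_bounded)
  then have "\<exists>B>0. \<forall>x\<in>eval_fps inv_theta_C ` cball 0 r. norm x \<le> B" unfolding bounded_pos .
  then obtain B where B0: "B > 0" "\<forall>x\<in>eval_fps inv_theta_C ` cball 0 r. norm x \<le> B" by (elim exE conjE)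
  have B: "norm (eval_fps inv_theta_C q) \<le> B" if "q \<in> cball 0 r" for q
    using B0(2) imageI[OF that] by (rule bspec)
  have "norm (th \<tau> 0) \<ge> 1 / B" if \<tau>: "Im \<tau> \<ge> 1 / 2" for \<tau>
  proof -
    have \<tau>0: "Im \<tau> > 0" using \<tau> by linarith
    have "pi * (1 / 2) \<le> pi * Im \<tau>" using \<tau> by (intro mult_left_mono) auto
    then have "norm (E \<tau>) \<le> r" unfolding norm_E r_def exp_le_cancel_iff by linarith
    then have "E \<tau> \<in> cball 0 r" by simp
    then have b: "norm (eval_fps inv_theta_C (E \<tau>)) \<le> B" by (rule B)
    have "norm (th \<tau> 0) * norm (eval_fps inv_theta_C (E \<tau>)) = 1"
      using eval_theta_C_inv[OF norm_E_less_1[OF \<tau>0]] unfolding eval_theta_C[OF \<tau>0]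
      by (metis norm_mult norm_one)
    then have "1 \<le> norm (th \<tau> 0) * B" using mult_left_mono[OF b, of "norm (th \<tau> 0)"] by simp
    then show ?thesis using B0(1) by (simp add: divide_le_eq)
  qed
  moreover have "1 / B > 0" using B0(1) by simp
  ultimately show ?thesis by blast
qed

section \<open>Transformation laws of the normalized theta function\<close>

text \<open>Dividing by the value at z = 0 removes the weight 1/2 factor and its roots of unity. The
  normalized function is determined by its quasi-periods and its value 1 at z = 0.\<close>

definition ph :: "complex \<Rightarrow> complex \<Rightarrow> complex" where
  "ph \<tau> z = th \<tau> z / th \<tau> 0"

lemma Im_moebius:
  fixes a b c d :: int
  shows "Im ((of_int a * \<tau> + of_int b) / (of_int c * \<tau> + of_int d)) =
    of_int (a * d - b * c) * Im \<tau> / (norm (of_int c * \<tau> + of_int d))\<^sup>2"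
  by (simp add: Im_divide cmod_power2 algebra_simps)

lemma moebius_denom_nonzero:
  fixes c d :: int
  assumes "Im \<tau> > 0" "c \<noteq> 0 \<or> d \<noteq> 0"
  shows "of_int c * \<tau> + of_int d \<noteq> 0"
  using assms by (auto simp: complex_eq_iff)

text \<open>Scaling by j carries the lattice of t to that of \<tau>: 1 / j = a - c t and \<tau> / j
  = d t - b. By \<open>th_shift\<close> only the signs E (- a c) and E (- b d) distinguish
  \<open>f\<close> from a multiple of \<open>th \<tau>\<close>.\<close>

lemma th_moebius_quasi_periods:
  fixes a b c d :: int
  assumes det: "a * d - b * c = 1" and \<tau>: "Im \<tau> > 0"
  defines "j \<equiv> of_int c * \<tau> + of_int d"
  defines "f \<equiv> (\<lambda>z. th ((of_int a * \<tau> + of_int b) / j) (z / j) * E (- (of_int c * z\<^sup>2 / j)))"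
  shows "f holomorphic_on UNIV" "f (z + 1) = E (- of_int (a * c)) * f z"
    "f (z + \<tau>) = E (- of_int (b * d)) * E (- \<tau> - 2 * z) * f z"
proof -
  define t where "t = (of_int a * \<tau> + of_int b) / j"
  have j0: "j \<noteq> 0" unfolding j_def by (rule moebius_denom_nonzero[OF \<tau>]) (use det in auto)
  have t: "Im t > 0" using j0 det \<tau> unfolding t_def j_def Im_moebius by simp
  have f: "f z = th t (z / j) * E (- (of_int c * z\<^sup>2 / j))" for z by (simp add: f_def t_def)
  show "f holomorphic_on UNIV"
    unfolding f_def t_def[symmetric] using t j0 by (intro holomorphic_intros) auto
  have detC: "(of_int a :: complex) * of_int d - of_int b * of_int c = 1"
    by (metis det of_int_1 of_int_diff of_int_mult)
  have tj: "t * j = of_int a * \<tau> + of_int b" using j0 by (simp add: t_def)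
  have j1: "1 / j = of_int (- c) * t + of_int a"
  proof -
    have "(of_int (- c) * t + of_int a) * j = of_int a * j - of_int c * (t * j)" by (simp add: algebra_simps)
    also have "\<dots> = 1" unfolding tj unfolding j_def using detC by (simp add: algebra_simps)
    finally show ?thesis using j0 by (simp add: field_simps)
  qed
  have j2: "\<tau> / j = of_int d * t + of_int (- b)"
  proof -
    have "(of_int d * t + of_int (- b)) * j = of_int d * (t * j) - of_int b * j" by (simp add: algebra_simps)
    also have "\<dots> = \<tau> * (of_int a * of_int d - of_int b * of_int c)"
      unfolding tj unfolding j_def by (simp add: algebra_simps)
    finally show ?thesis using j0 detC by (simp add: field_simps)
  qed
  have "(z + 1) / j = z / j + of_int (- c) * t + of_int a"
    unfolding add_divide_distrib j1 by simp
  then have "f (z + 1) = E (- (of_int (- c) ^ 2 * t) - 2 * of_int (- c) * (z / j)) * th t (z / j) * E (- (of_int c * (z + 1)\<^sup>2 / j))"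
    unfolding f by (simp only: th_shift)
  also have "\<dots> = E (- (of_int (- c) ^ 2 * t) - 2 * of_int (- c) * (z / j) - of_int c * (z + 1)\<^sup>2 / j) * th t (z / j)"
    by (simp add: E_diff E_add E_minus field_simps)
  also have "- (of_int (- c) ^ 2 * t) - 2 * of_int (- c) * (z / j) - of_int c * (z + 1)\<^sup>2 / j =
      - (of_int c * z\<^sup>2 / j) - of_int c * (of_int c * t + 1 / j)"
    using j0 by (simp add: field_simps power2_eq_square)
  also have "of_int c * t + 1 / j = of_int a" by (simp add: j1)
  finally show "f (z + 1) = E (- of_int (a * c)) * f z"
    unfolding f by (simp add: E_diff E_minus field_simps)
  have "(z + \<tau>) / j = z / j + of_int d * t + of_int (- b)"
    unfolding add_divide_distrib j2 by simp
  then have "f (z + \<tau>) = E (- (of_int d ^ 2 * t) - 2 * of_int d * (z / j)) * th t (z / j) * E (- (of_int c * (z + \<tau>)\<^sup>2 / j))"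
    unfolding f by (simp only: th_shift)
  also have "\<dots> = E (- (of_int d ^ 2 * t) - 2 * of_int d * (z / j) - of_int c * (z + \<tau>)\<^sup>2 / j) * th t (z / j)"
    by (simp add: E_diff E_add E_minus field_simps)
  also have "- (of_int d ^ 2 * t) - 2 * of_int d * (z / j) - of_int c * (z + \<tau>)\<^sup>2 / j =
      - (of_int c * z\<^sup>2 / j) - of_int d ^ 2 * t - \<tau> * (of_int c * (\<tau> / j)) - 2 * z * ((of_int c * \<tau> + of_int d) / j)"
    using j0 by (simp add: field_simps power2_eq_square)
  also have "(of_int c * \<tau> + of_int d) / j = 1" using j0 by (simp add: j_def)
  also have "of_int c * (\<tau> / j) = 1 - of_int d * (1 / j)"
    using j0 by (simp add: field_simps j_def)
  also have "- (of_int c * z\<^sup>2 / j) - of_int d ^ 2 * t - \<tau> * (1 - of_int d * (1 / j)) - 2 * z * 1 =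
     - (of_int c * z\<^sup>2 / j) + (- \<tau> - 2 * z) + of_int d * (\<tau> / j - of_int d * t)"
    by (simp add: algebra_simps power2_eq_square)
  also have "\<tau> / j - of_int d * t = - of_int b" by (simp add: j2)
  finally show "f (z + \<tau>) = E (- of_int (b * d)) * E (- \<tau> - 2 * z) * f z"
    unfolding f by (simp add: E_diff E_add E_minus field_simps)
qed

text \<open>Even a c and b d remove both signs, so \<open>theta_unique\<close> applies; comparing at
  z = 0 cancels the unknown constant.\<close>

lemma ph_moebius:
  fixes a b c d :: int
  assumes det: "a * d - b * c = 1" and ev: "even (a * c)" "even (b * d)" and \<tau>: "Im \<tau> > 0"
  defines "j \<equiv> of_int c * \<tau> + of_int d"
  shows "ph ((of_int a * \<tau> + of_int b) / j) (z / j) = E (of_int c * z\<^sup>2 / j) * ph \<tau> z"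
proof -
  define t where "t = (of_int a * \<tau> + of_int b) / j"
  define f where "f z = th t (z / j) * E (- (of_int c * z\<^sup>2 / j))" for z
  have j0: "j \<noteq> 0" unfolding j_def by (rule moebius_denom_nonzero[OF \<tau>]) (use det in auto)
  have t: "Im t > 0" using j0 det \<tau> unfolding t_def j_def Im_moebius by simp
  have "E (- of_int (a * c)) = 1" "E (- of_int (b * d)) = 1"
    using E_even_int[OF ev(1)] E_even_int[OF ev(2)] by (simp_all add: E_minus)
  then have "f holomorphic_on UNIV" "f (z + 1) = f z" "f (z + \<tau>) = E (- \<tau> - 2 * z) * f z" for z
    using th_moebius_quasi_periods[OF det \<tau>, folded j_def, folded t_def, folded f_def]
    by (simp_all flip: f_def)
  then have "f z * th \<tau> 0 = f 0 * th \<tau> z" by (rule theta_unique[OF _ _ _ \<tau>])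
  then have "th t (z / j) * th \<tau> 0 = E (of_int c * z\<^sup>2 / j) * (th t 0 * th \<tau> z)"
    by (simp add: f_def E_minus field_simps)
  then show ?thesis
    unfolding ph_def t_def[symmetric]
    using th_0_nonzero[OF \<tau>] th_0_nonzero[OF t] by (simp add: field_simps)
qed

text \<open>Outside the theta group the transformed function changes sign under z + 1. A shift by
  the half period \<tau> / 2 and the factor E z restore the quasi-periods of
  \<open>th \<tau>\<close>, which is how \<open>th \<tau> (\<tau> / 2)\<close> takes the place of
  \<open>th \<tau> 0\<close>.\<close>

lemma ph_cusp:
  assumes \<tau>: "Im \<tau> > 0"
  shows "ph (1 - 1 / \<tau>) (z / \<tau>) * th \<tau> (\<tau> / 2) = E (z\<^sup>2 / \<tau> - z) * th \<tau> (z - \<tau> / 2)"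
    and "th \<tau> (\<tau> / 2) \<noteq> 0"
proof -
  have \<tau>0: "\<tau> \<noteq> 0" using \<tau> by auto
  define t where "t = 1 - 1 / \<tau>"
  have t': "(of_int 1 * \<tau> + of_int (- 1)) / \<tau> = t" using \<tau>0 by (simp add: t_def field_simps)
  have t: "Im t > 0" using \<tau> \<tau>0 Im_moebius[of 1 \<tau> "-1" 1 0] by (simp add: t'[symmetric])
  define f where "f z = th t (z / \<tau>) * E (- (z\<^sup>2 / \<tau>))" for z
  have f: "f holomorphic_on UNIV" "f (z + 1) = - f z" "f (z + \<tau>) = E (- \<tau> - 2 * z) * f z" for z
    using th_moebius_quasi_periods[of 1 0 "-1" 1 \<tau>] \<tau> t'
    by (simp_all add: f_def[abs_def] E_minus)
  define g where "g z = f (z + \<tau> / 2) * E z" for z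
  have g: "g holomorphic_on UNIV" 
    unfolding g_def by (intro holomorphic_intros holomorphic_on_compose_gen[OF _ f(1), unfolded o_def]) auto
  have g1: "g (z + 1) = g z" for z
    using f(2)[of "z + \<tau> / 2"] by (simp add: g_def E_add add_ac)
  have g2: "g (z + \<tau>) = E (- \<tau> - 2 * z) * g z" for z
    using f(3)[of "z + \<tau> / 2"] by (simp add: g_def add_ac) (simp flip: E_add add: mult.left_commute algebra_simps)
  have gz: "g z * th \<tau> 0 = g 0 * th \<tau> z" for z by (rule theta_unique[OF g g1 g2 \<tau>])
  have fz: "f z = g (z - \<tau> / 2) * E (\<tau> / 2 - z)" for z
    by (simp add: g_def mult.assoc flip: E_add)
  have f0: "f 0 = th t 0" by (simp add: f_def)
  have th_half: "th \<tau> (- (\<tau> / 2)) = th \<tau> (\<tau> / 2)" by (rule th_minus)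
  have a: "f 0 * th \<tau> 0 = g 0 * E (\<tau> / 2) * th \<tau> (\<tau> / 2)"
    using gz[of "- (\<tau> / 2)"] th_half by (simp add: fz[of 0] algebra_simps)
  then have nz: "g 0 \<noteq> 0" "th \<tau> (\<tau> / 2) \<noteq> 0" using th_0_nonzero[OF \<tau>] th_0_nonzero[OF t] f0 by auto
  then show "th \<tau> (\<tau> / 2) \<noteq> 0" by simp
  have b: "f z * th \<tau> 0 = g 0 * th \<tau> (z - \<tau> / 2) * E (\<tau> / 2 - z)"
    using gz[of "z - \<tau> / 2"] by (simp add: fz[of z] algebra_simps)
  have "f z * th \<tau> (\<tau> / 2) * (g 0 * E (\<tau> / 2)) = f z * (f 0 * th \<tau> 0)" using a by (simp add: mult_ac)
  also have "\<dots> = f 0 * (g 0 * th \<tau> (z - \<tau> / 2) * E (\<tau> / 2 - z))" using b by (simp add: mult_ac)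
  also have "\<dots> = (f 0 * th \<tau> (z - \<tau> / 2) * E (- z)) * (g 0 * E (\<tau> / 2))"
    unfolding E_diff E_minus by (simp add: field_simps)
  finally have "f z * th \<tau> (\<tau> / 2) = f 0 * th \<tau> (z - \<tau> / 2) * E (- z)" using nz by simp
  then have "th t (z / \<tau>) * th \<tau> (\<tau> / 2) = th t 0 * (E (z\<^sup>2 / \<tau> - z) * th \<tau> (z - \<tau> / 2))"
    unfolding f0 by (simp add: f_def E_diff E_minus field_simps)
  then show "ph (1 - 1 / \<tau>) (z / \<tau>) * th \<tau> (\<tau> / 2) = E (z\<^sup>2 / \<tau> - z) * th \<tau> (z - \<tau> / 2)"
    unfolding ph_def t_def[symmetric] using th_0_nonzero[OF t] by (simp add: field_simps)
qed

section \<open>Growth under the modular group\<close>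

text \<open>Under the Jacobi group \<open>gauss\<close> compensates the automorphy factor of the absolute value of a form of weight 0 and index 1/2.\<close>

definition gauss :: "complex \<Rightarrow> complex \<Rightarrow> real" where
  "gauss \<tau> z = exp (- (pi * (Im z)\<^sup>2 / Im \<tau>))"

lemma gauss_pos [simp]: "gauss \<tau> z > 0" by (simp add: gauss_def)

text \<open>With w = z / j it comes down to Im (w^2 j) Im j + (Im w)^2 |j|^2 = (Im (w j))^2, an
  identity for arbitrary complex w and j.\<close>

lemma gauss_moebius:
  fixes a b c d :: int
  assumes det: "a * d - b * c = 1" and \<tau>: "Im \<tau> > 0"
  defines "j \<equiv> of_int c * \<tau> + of_int d"
  shows "norm (E (of_int c * z\<^sup>2 / j)) * gauss ((of_int a * \<tau> + of_int b) / j) (z / j) = gauss \<tau> z"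
proof -
  define w where "w = z / j"
  have j0: "j \<noteq> 0" unfolding j_def by (rule moebius_denom_nonzero[OF \<tau>]) (use det in auto)
  have z: "z = w * j" using j0 by (simp add: w_def)
  have e: "of_int c * z\<^sup>2 / j = of_int c * (w\<^sup>2 * j)" using j0 by (simp add: z power2_eq_square)
  have imj: "Im j = of_int c * Im \<tau>" by (simp add: j_def)
  have imt: "Im ((of_int a * \<tau> + of_int b) / j) = Im \<tau> / (norm j)\<^sup>2"
    unfolding j_def Im_moebius det by simp
  have "Im (of_int c * (w\<^sup>2 * j)) * Im \<tau> + (Im w)\<^sup>2 * (norm j)\<^sup>2 =
     Im (w\<^sup>2 * j) * Im j + (Im w)\<^sup>2 * ((Re j)\<^sup>2 + (Im j)\<^sup>2)"
    unfolding imj cmod_power2 by simp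
  also have "\<dots> = (Im (w * j))\<^sup>2"
    by (simp add: power2_eq_square algebra_simps)
  finally have id: "Im (of_int c * (w\<^sup>2 * j)) * Im \<tau> + (Im w)\<^sup>2 * (norm j)\<^sup>2 = (Im z)\<^sup>2" by (simp add: z)
  have "Im (of_int c * (w\<^sup>2 * j)) + (Im w)\<^sup>2 / (Im \<tau> / (norm j)\<^sup>2) = (Im z)\<^sup>2 / Im \<tau>"
    unfolding id[symmetric] using \<tau> by (simp add: add_divide_distrib)
  then have "pi * Im (of_int c * (w\<^sup>2 * j)) + pi * (Im w)\<^sup>2 / (Im \<tau> / (norm j)\<^sup>2) = pi * (Im z)\<^sup>2 / Im \<tau>"
    by (metis distrib_left times_divide_eq_right)
  then show ?thesis
    unfolding gauss_def norm_E imt e w_def[symmetric] exp_add[symmetric] by simp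
qed

lemma gauss_inversion:
  assumes "Im \<tau> > 0"
  shows "norm (E (z\<^sup>2 / \<tau>)) * gauss (- 1 / \<tau>) (z / \<tau>) = gauss \<tau> z"
  using gauss_moebius[of 0 0 "-1" 1 \<tau> z] assms by simp

text \<open>Uniformity in the shift \<open>s\<close> is the point. Rounding \<open>s\<close> to an
  integer reindexes the sum, and (n + s)^2 \<ge> |n + round s| - 3/4 leaves a geometric
  majorant.\<close>

lemma sum_gauss_bound:
  "\<exists>C>0. \<forall>s t :: real. t \<ge> 1 / 2 \<longrightarrow>
     (\<lambda>n :: int. exp (- (pi * t * (of_int n + s)\<^sup>2))) summable_on UNIV \<and>
     (\<Sum>\<^sub>\<infinity>n :: int. exp (- (pi * t * (of_int n + s)\<^sup>2))) \<le> C"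
proof -
  define M :: "int \<Rightarrow> real" where "M n = exp (pi / 2 * (3 / 4)) * exp (- pi / 2) ^ nat \<bar>n\<bar>" for n
  have Ms: "M summable_on UNIV"
    unfolding M_def by (intro summable_on_cmult_right summable_on_power_abs_int) auto
  show ?thesis
  proof (intro exI[of _ "infsum M UNIV + 1"] conjI allI impI)
    show "infsum M UNIV + 1 > 0"
      by (intro add_nonneg_pos infsum_nonneg) (auto simp: M_def)
    fix s t :: real assume t: "t \<ge> 1 / 2"
    define m where "m = round s"
    have Ms': "(\<lambda>n. M (n + m)) summable_on UNIV"
      using Ms summable_on_reindex_bij_witness[of UNIV "\<lambda>n. n - m" "\<lambda>n. n + m" UNIV M "\<lambda>n. M (n + m)"] by auto
    have le: "exp (- (pi * t * (of_int n + s)\<^sup>2)) \<le> M (n + m)" for n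
    proof -
      define u where "u = \<bar>real_of_int (n + m)\<bar>"
      have "\<bar>s - of_int m\<bar> \<le> 1 / 2" unfolding m_def using of_int_round_abs_le[of s] by (simp add: abs_minus_commute)
      then have *: "\<bar>of_int n + s\<bar> \<ge> u - 1 / 2" unfolding u_def by (simp add: abs_if split: if_splits)
      have "(of_int n + s)\<^sup>2 \<ge> u - 3 / 4"
      proof (cases "u - 1 / 2 \<ge> 0")
        case True
        have "u - 3 / 4 \<le> (u - 1 / 2)\<^sup>2"
          using zero_le_power2[of "u - 1"] by (simp add: power2_eq_square algebra_simps)
        also have "\<dots> \<le> \<bar>of_int n + s\<bar>\<^sup>2" using True * by (intro power_mono) auto
        finally show ?thesis by simp
      next
        case False
        then have "u - 3 / 4 \<le> 0" by simp
        also have "\<dots> \<le> (of_int n + s)\<^sup>2" by simp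
        finally show ?thesis .
      qed
      moreover have "1 / 2 * (of_int n + s)\<^sup>2 \<le> t * (of_int n + s)\<^sup>2"
        using t by (intro mult_right_mono) auto
      ultimately have "1 / 2 * (u - 3 / 4) \<le> t * (of_int n + s)\<^sup>2"
        using mult_left_mono[of "u - 3 / 4" "(of_int n + s)\<^sup>2" "1 / 2"] by (meson divide_nonneg_nonneg order_trans zero_le_numeral zero_le_one)
      then have "pi * (1 / 2 * (u - 3 / 4)) \<le> pi * (t * (of_int n + s)\<^sup>2)" by (intro mult_left_mono) auto
      then have "exp (- (pi * t * (of_int n + s)\<^sup>2)) \<le> exp (pi / 2 * (3 / 4) + u * (- pi / 2))"
        by (simp add: algebra_simps)
      also have "\<dots> = M (n + m)"
        unfolding M_def exp_of_nat_mult[symmetric] exp_add[symmetric] by (simp add: u_def)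
      finally show ?thesis .
    qed
    show s: "(\<lambda>n :: int. exp (- (pi * t * (of_int n + s)\<^sup>2))) summable_on UNIV"
      by (rule summable_on_comparison_test[OF Ms' le]) auto
    have "(\<Sum>\<^sub>\<infinity>n :: int. exp (- (pi * t * (of_int n + s)\<^sup>2))) \<le> (\<Sum>\<^sub>\<infinity>n. M (n + m))"
      by (rule infsum_mono[OF s Ms' le])
    also have "(\<Sum>\<^sub>\<infinity>n. M (n + m)) = infsum M UNIV"
      by (rule infsum_reindex_bij_witness[of _ "\<lambda>n. n - m" "\<lambda>n. n + m"]) auto
    finally show "(\<Sum>\<^sub>\<infinity>n :: int. exp (- (pi * t * (of_int n + s)\<^sup>2))) \<le> infsum M UNIV + 1" by simp
  qed
qed

text \<open>With s = Im z / Im \<tau> the weight completes the square: the term n becomes exp (- pi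
  Im \<tau> (n + s)^2) in modulus.\<close>

lemma th_gauss_bound: "\<exists>C>0. \<forall>\<tau> z. Im \<tau> \<ge> 1 / 2 \<longrightarrow> norm (th \<tau> z) * gauss \<tau> z \<le> C"
proof -
  obtain C where C: "C > 0" "\<And>s t :: real. t \<ge> 1 / 2 \<Longrightarrow>
     (\<lambda>n :: int. exp (- (pi * t * (of_int n + s)\<^sup>2))) summable_on UNIV"
     "\<And>s t :: real. t \<ge> 1 / 2 \<Longrightarrow> (\<Sum>\<^sub>\<infinity>n :: int. exp (- (pi * t * (of_int n + s)\<^sup>2))) \<le> C"
    using sum_gauss_bound by blast
  have "norm (th \<tau> z) * gauss \<tau> z \<le> C" if \<tau>: "Im \<tau> \<ge> 1 / 2" for \<tau> z
  proof -
    have \<tau>0: "Im \<tau> > 0" using \<tau> by linarith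
    define y where "y = Im \<tau>"
    define s where "s = Im z / y"
    have y: "y > 0" using \<tau>0 by (simp add: y_def)
    have summand: "norm (E (of_int n ^ 2 * \<tau> + 2 * of_int n * z)) * gauss \<tau> z = exp (- (pi * y * (of_int n + s)\<^sup>2))" for n :: int
    proof -
      have imz: "Im z = s * y" using y by (simp add: s_def)
      have "Im (of_int n ^ 2 * \<tau> + 2 * of_int n * z) = (of_int n)\<^sup>2 * y + 2 * of_int n * (s * y)"
        unfolding imz[symmetric] by (simp add: y_def power2_eq_square)
      then show ?thesis
        unfolding norm_E gauss_def exp_add[symmetric] y_def[symmetric] imz using y
        by (simp add: power2_eq_square algebra_simps)
    qed
    have sum: "(\<lambda>n :: int. norm (E (of_int n ^ 2 * \<tau> + 2 * of_int n * z))) summable_on UNIV"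
      by (rule th_abs_summable[OF \<tau>0])
    have "norm (th \<tau> z) \<le> (\<Sum>\<^sub>\<infinity>n :: int. norm (E (of_int n ^ 2 * \<tau> + 2 * of_int n * z)))"
      unfolding th_def using sum by (rule norm_infsum_bound)
    then have "norm (th \<tau> z) * gauss \<tau> z \<le> (\<Sum>\<^sub>\<infinity>n :: int. norm (E (of_int n ^ 2 * \<tau> + 2 * of_int n * z))) * gauss \<tau> z"
      by (intro mult_right_mono) (auto simp: less_imp_le)
    also have "\<dots> = (\<Sum>\<^sub>\<infinity>n :: int. exp (- (pi * y * (of_int n + s)\<^sup>2)))"
      unfolding infsum_cmult_left'[symmetric] summand ..
    also have "\<dots> \<le> C" using C(3)[of y s] \<tau> by (simp add: y_def)
    finally show ?thesis .
  qed
  then show ?thesis using C(1) by blast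
qed

text \<open>The exponents n^2 + n are invariant under n to - n - 1, so the value is 2 (1 + X^2 + X^6
  + ...) with X = E \<tau> and |X| < 1/3.\<close>

lemma th_half_lower_bound:
  assumes \<tau>: "Im \<tau> \<ge> 1 / 2"
  shows "norm (th \<tau> (\<tau> / 2)) \<ge> 1"
proof -
  have \<tau>0: "Im \<tau> > 0" using \<tau> by linarith
  define f :: "int \<Rightarrow> complex" where "f n = E (of_int n ^ 2 * \<tau> + 2 * of_int n * (\<tau> / 2))" for n
  define g :: "nat \<Rightarrow> complex" where "g n = E (of_nat (n ^ 2 + n) * \<tau>)" for n
  define r where "r = exp (- pi / 2)"
  have r: "0 < r" "r < 1 / 3"
  proof -
    have "1 + pi / 2 + (pi / 2)\<^sup>2 / 2 \<le> exp (pi / 2)" by (rule exp_lower_Taylor_quadratic) simp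
    moreover have "pi / 2 \<ge> 3 / 2" using pi_gt3 by simp
    moreover have "(pi / 2)\<^sup>2 \<ge> (3 / 2)\<^sup>2" using pi_gt3 by (intro power_mono) auto
    ultimately have "exp (pi / 2) > 3" by (simp add: power2_eq_square)
    then show "r < 1 / 3" by (simp add: r_def exp_minus field_simps)
  qed (simp add: r_def)
  have g_le: "norm (g n) \<le> r ^ (2 * n)" for n
  proof -
    have "pi * (1 / 2) \<le> pi * Im \<tau>" using \<tau> by (intro mult_left_mono) auto
    then have "norm (E \<tau>) \<le> r" unfolding norm_E r_def exp_le_cancel_iff by linarith
    then have "norm (E \<tau>) ^ (n ^ 2 + n) \<le> r ^ (n ^ 2 + n)" by (intro power_mono) auto
    also have "\<dots> \<le> r ^ (2 * n)" using r by (intro power_decreasing) (auto simp: power2_eq_square)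
    finally show ?thesis unfolding norm_power[symmetric] E_power g_def[symmetric] .
  qed
  have gs: "summable (\<lambda>n. norm (g n))"
    by (rule summable_comparison_test'[of "\<lambda>n. (r ^ 2) ^ n" 0])
       (use g_le r in \<open>auto simp: power_mult abs_square_less_1 intro!: summable_geometric\<close>)
  have fs: "f summable_on UNIV" "(f has_sum th \<tau> (\<tau> / 2)) UNIV"
    using th_has_sum[OF \<tau>0, of "\<tau> / 2"] unfolding f_def by (auto simp: summable_on_def)
  have g_sum: "(g has_sum suminf g) UNIV"
    using gs by (rule norm_summable_imp_has_sum) (use gs summable_norm_cancel summable_sums in blast)
  have "(f has_sum suminf g) (range int)"
    unfolding has_sum_reindex[OF inj_of_nat]
    by (rule has_sum_cong[THEN iffD1, OF _ g_sum]) (auto simp: f_def g_def algebra_simps power2_eq_square)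
  moreover have "(f has_sum suminf g) (range (\<lambda>n. - int (Suc n)))"
    by (subst has_sum_reindex, simp add: inj_def, rule has_sum_cong[THEN iffD1, OF _ g_sum])
       (auto simp: f_def g_def algebra_simps power2_eq_square)
  ultimately have "(f has_sum (suminf g + suminf g)) (range int \<union> range (\<lambda>n. - int (Suc n)))"
    by (rule has_sum_Un_disjoint) auto
  moreover have "range int \<union> range (\<lambda>n. - int (Suc n)) = UNIV"
  proof -
    have "x \<in> range int \<union> range (\<lambda>n. - int (Suc n))" for x by (cases x) auto
    then show ?thesis by blast
  qed
  ultimately have th: "th \<tau> (\<tau> / 2) = 2 * suminf g"
    using fs(2) has_sum_unique by fastforce
  have "suminf g = g 0 + (\<Sum>n. g (Suc n))"
    using suminf_split_head[of g] gs summable_norm_cancel by fastforce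
  then have sg: "suminf g = 1 + (\<Sum>n. g (Suc n))" by (simp add: g_def)
  have geo: "(\<lambda>n. r\<^sup>2 * (r\<^sup>2) ^ n) sums (r\<^sup>2 * (1 / (1 - r\<^sup>2)))"
    using r by (intro sums_mult geometric_sums) (auto simp: abs_square_less_1)
  have "norm (\<Sum>n. g (Suc n)) \<le> (\<Sum>n. norm (g (Suc n)))"
    using gs summable_Suc_iff[of "\<lambda>n. norm (g n)"] by (intro summable_norm) simp
  also have "\<dots> \<le> (\<Sum>n. r\<^sup>2 * (r\<^sup>2) ^ n)"
  proof (rule suminf_le)
    show "norm (g (Suc n)) \<le> r\<^sup>2 * (r\<^sup>2) ^ n" for n
      using g_le[of "Suc n"] by (simp only: power_mult power_Suc)
  qed (use gs geo summable_Suc_iff[of "\<lambda>n. norm (g n)"] in \<open>auto simp: sums_iff\<close>)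
  also have "\<dots> = r\<^sup>2 / (1 - r\<^sup>2)" using geo by (simp add: sums_iff)
  also have "\<dots> \<le> 1 / 2"
  proof -
    have "r\<^sup>2 \<le> (1 / 3)\<^sup>2" using r by (intro power_mono) auto
    then have "r\<^sup>2 \<le> 1 / 9" by (simp add: power2_eq_square)
    then show ?thesis by (simp add: divide_le_eq)
  qed
  finally have "norm (suminf g) \<ge> 1 / 2"
    unfolding sg using norm_diff_ineq[of 1 "\<Sum>n. g (Suc n)"] by simp
  then show ?thesis by (simp add: th norm_mult)
qed

text \<open>By \<open>gauss_moebius\<close> the weight turns the modulus of \<open>ph\<close> into
  an invariant of the theta group acting on (\<tau>, z).\<close>

definition kg :: "complex \<Rightarrow> complex \<Rightarrow> real" where
  "kg \<tau> z = norm (ph \<tau> z) * gauss \<tau> z"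

lemma kg_nonneg [simp]: "kg \<tau> z \<ge> 0" by (simp add: kg_def less_imp_le)

lemma kg_inversion: "Im \<tau> > 0 \<Longrightarrow> kg (- 1 / \<tau>) (z / \<tau>) = kg \<tau> z"
  using ph_moebius[of 0 0 "-1" 1 \<tau> z] gauss_inversion[of \<tau> z]
  by (simp add: kg_def norm_mult mult.assoc mult.left_commute mult.commute)

lemma kg_add_2: "kg (\<tau> + 2) z = kg \<tau> z"
  by (simp add: kg_def ph_def th_add_2 gauss_def)

lemma kg_minus: "kg \<tau> (- z) = kg \<tau> z"
  by (simp add: kg_def ph_def th_minus gauss_def)

text \<open>The growth in the second bound is the cost of the half-period shift in
  \<open>ph_cusp\<close>: the numerator is \<open>th\<close> at z - \<tau> / 2, and passing from the
  Gaussian at z to the one at z - \<tau> / 2 leaves the factor exp (pi Im \<tau> / 4).\<close>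

lemma kg_bounds: "\<exists>C>0. \<forall>\<tau> z. Im \<tau> \<ge> 1 / 2 \<longrightarrow> kg \<tau> z \<le> C \<and> kg (1 - 1 / \<tau>) (z / \<tau>) \<le> C * exp (pi * Im \<tau> / 4)"
proof -
  obtain C where C: "C > 0" "\<And>\<tau> z. Im \<tau> \<ge> 1 / 2 \<Longrightarrow> norm (th \<tau> z) * gauss \<tau> z \<le> C"
    using th_gauss_bound by blast
  obtain c where c: "c > 0" "\<And>\<tau>. Im \<tau> \<ge> 1 / 2 \<Longrightarrow> norm (th \<tau> 0) \<ge> c"
    using th_0_lower_bound by blast
  have 1: "kg \<tau> z \<le> C / c" if "Im \<tau> \<ge> 1 / 2" for \<tau> z
  proof -
    have "kg \<tau> z = norm (th \<tau> z) * gauss \<tau> z / norm (th \<tau> 0)" by (simp add: kg_def ph_def norm_divide)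
    also have "\<dots> \<le> C / c" using C c that by (intro frac_le) auto
    finally show ?thesis .
  qed
  have 2: "kg (1 - 1 / \<tau>) (z / \<tau>) \<le> C * exp (pi * Im \<tau> / 4)" if \<tau>: "Im \<tau> \<ge> 1 / 2" for \<tau> z
  proof -
    have \<tau>0: "Im \<tau> > 0" using \<tau> by linarith
    have g: "gauss (1 - 1 / \<tau>) (z / \<tau>) = gauss (- 1 / \<tau>) (z / \<tau>)" by (simp add: gauss_def)
    have "kg (1 - 1 / \<tau>) (z / \<tau>) \<le> kg (1 - 1 / \<tau>) (z / \<tau>) * norm (th \<tau> (\<tau> / 2))"
      using th_half_lower_bound[OF \<tau>] mult_left_mono[of 1 "norm (th \<tau> (\<tau> / 2))" "kg (1 - 1 / \<tau>) (z / \<tau>)"] by simp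
    also have "\<dots> = norm (E (z\<^sup>2 / \<tau> - z) * th \<tau> (z - \<tau> / 2)) * gauss (- 1 / \<tau>) (z / \<tau>)"
      unfolding ph_cusp(1)[OF \<tau>0, symmetric] kg_def norm_mult g by (simp add: mult_ac)
    also have "\<dots> = (norm (E (z\<^sup>2 / \<tau>)) * gauss (- 1 / \<tau>) (z / \<tau>)) * norm (E (- z)) * norm (th \<tau> (z - \<tau> / 2))"
      by (simp add: norm_mult E_diff E_minus norm_divide field_simps)
    also have "\<dots> = gauss \<tau> z * norm (E (- z)) * norm (th \<tau> (z - \<tau> / 2))"
      by (simp only: gauss_inversion[OF \<tau>0])
    also have "gauss \<tau> z * norm (E (- z)) = gauss \<tau> (z - \<tau> / 2) * exp (pi * Im \<tau> / 4)"
      unfolding gauss_def norm_E exp_add[symmetric] using \<tau>0 by (simp add: field_simps power2_eq_square)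
    also have "gauss \<tau> (z - \<tau> / 2) * exp (pi * Im \<tau> / 4) * norm (th \<tau> (z - \<tau> / 2)) =
        (norm (th \<tau> (z - \<tau> / 2)) * gauss \<tau> (z - \<tau> / 2)) * exp (pi * Im \<tau> / 4)" by simp
    also have "\<dots> \<le> C * exp (pi * Im \<tau> / 4)" by (intro mult_right_mono C \<tau>) auto
    finally show ?thesis .
  qed
  show ?thesis
  proof (intro exI[of _ "C / c + C"] conjI allI impI)
    show "C / c + C > 0" using C(1) c(1) by (simp add: add_pos_pos)
    fix \<tau> z assume \<tau>: "Im \<tau> \<ge> 1 / 2"
    show "kg \<tau> z \<le> C / c + C" using 1[OF \<tau>, of z] C(1) by simp
    have "C * exp (pi * Im \<tau> / 4) \<le> (C / c + C) * exp (pi * Im \<tau> / 4)"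
      using C(1) c(1) by (intro mult_right_mono) auto
    then show "kg (1 - 1 / \<tau>) (z / \<tau>) \<le> (C / c + C) * exp (pi * Im \<tau> / 4)" using 2[OF \<tau>, of z] by linarith
  qed
qed

text \<open>A function on the cosets of the theta group, which has index 3 with representatives
  \<open>1\<close>, \<open>T\<close>, \<open>T S\<close>; its symmetrizations are invariant under \<open>T\<close> and \<open>S\<close>.\<close>

lemma theta_group_cosets:
  fixes f :: "complex \<Rightarrow> complex \<Rightarrow> 'a"
  assumes f: "\<And>\<tau> z. Im \<tau> > 0 \<Longrightarrow> f (\<tau> + 2) z = f \<tau> z"
    "\<And>\<tau> z. Im \<tau> > 0 \<Longrightarrow> f (- 1 / \<tau>) (z / \<tau>) = f \<tau> z" "\<And>\<tau> z. Im \<tau> > 0 \<Longrightarrow> f \<tau> (- z) = f \<tau> z"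
    and \<tau>: "Im \<tau> > 0"
  shows "f (1 - 1 / (\<tau> + 1)) (z / (\<tau> + 1)) = f (1 - 1 / \<tau>) (z / \<tau>)"
    and "f (1 - 1 / (- 1 / \<tau>)) (z / \<tau> / (- 1 / \<tau>)) = f (\<tau> + 1) z"
proof -
  have nz: "\<tau> \<noteq> 0" "\<tau> + 1 \<noteq> 0" using \<tau> by (auto simp: complex_eq_iff)
  define t where "t = 1 - 1 / (\<tau> + 1)"
  have t: "t = \<tau> / (\<tau> + 1)" using nz by (simp add: t_def field_simps)
  have imt: "Im t > 0"
    using Im_moebius[of 1 \<tau> 0 1 1] \<tau> nz by (simp add: t)
  have "t \<noteq> 0" using imt by auto
  then have imt': "Im (- 1 / t) > 0" using imt Im_moebius[of 0 t "-1" 1 0] by simp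
  \<comment> \<open>T S T and T S lie in the same coset: inverting t and adding 2, both in the theta
    group, leads from T S T \<tau> to T S \<tau>.\<close>
  have "f t (z / (\<tau> + 1)) = f (- 1 / t) (z / (\<tau> + 1) / t)" by (rule f(2)[OF imt, symmetric])
  also have "\<dots> = f (- 1 / t + 2) (z / (\<tau> + 1) / t)" by (rule f(1)[OF imt', symmetric])
  also have "- 1 / t + 2 = 1 - 1 / \<tau>" using nz by (simp add: t field_simps)
  also have "z / (\<tau> + 1) / t = z / \<tau>" using nz by (simp add: t)
  finally show "f (1 - 1 / (\<tau> + 1)) (z / (\<tau> + 1)) = f (1 - 1 / \<tau>) (z / \<tau>)" by (simp add: t_def)
  have "1 - 1 / (- 1 / \<tau>) = \<tau> + 1" "z / \<tau> / (- 1 / \<tau>) = - z" using nz by (auto simp: field_simps)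
  then show "f (1 - 1 / (- 1 / \<tau>)) (z / \<tau> / (- 1 / \<tau>)) = f (\<tau> + 1) z"
    using f(3)[of "\<tau> + 1"] \<tau> by (simp only:) simp
qed

text \<open>A point with |Re t| \<le> 1/2 and Im t < 1/2 has |t|^2 \<le> 1/2, so inversion at least
  doubles its height; the induction counts doublings. The predicate \<open>P\<close> can carry data
  about the orbit besides a function value.\<close>

lemma reduction_to_strip:
  fixes P :: "complex \<Rightarrow> complex \<Rightarrow> bool"
  assumes P: "P \<tau> z" "Im \<tau> > 0"
    and T: "\<And>\<tau> z. Im \<tau> > 0 \<Longrightarrow> P \<tau> z \<Longrightarrow> P (\<tau> + 1) z" "\<And>\<tau> z. Im \<tau> > 0 \<Longrightarrow> P \<tau> z \<Longrightarrow> P (\<tau> - 1) z"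
    and S: "\<And>\<tau> z. Im \<tau> > 0 \<Longrightarrow> P \<tau> z \<Longrightarrow> P (- 1 / \<tau>) (z / \<tau>)"
  shows "\<exists>\<tau>' z'. P \<tau>' z' \<and> Im \<tau>' \<ge> 1 / 2 \<and> \<bar>Re \<tau>'\<bar> \<le> 1 / 2"
proof -
  have Tn: "P (\<tau> + of_int n) z" if "P \<tau> z" "Im \<tau> > 0" for \<tau> z n
  proof (induction n rule: int_induct[of _ 0])
    case (step1 i)
    then show ?case using T(1)[of "\<tau> + of_int i" z] that by (simp add: add_ac)
  next
    case (step2 i)
    then show ?case using T(2)[of "\<tau> + of_int i" z] that by (simp add: algebra_simps)
  qed (use that in simp)
  have "P \<tau> z \<Longrightarrow> Im \<tau> > 0 \<Longrightarrow> Im \<tau> \<ge> (1 / 2) / 2 ^ n \<Longrightarrow> ?thesis" for n \<tau> z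
  proof (induction n arbitrary: \<tau> z)
    case (0 \<tau> z)
    define t where "t = \<tau> + of_int (- round (Re \<tau>))"
    have "\<bar>Re t\<bar> \<le> 1 / 2" using of_int_round_abs_le[of "Re \<tau>"] by (simp add: t_def abs_minus_commute)
    moreover have "P t z" unfolding t_def by (rule Tn[OF 0(1,2)])
    moreover have "Im t \<ge> 1 / 2" using 0 by (simp add: t_def)
    ultimately show ?case by blast
  next
    case (Suc n \<tau> z)
    define t where "t = \<tau> + of_int (- round (Re \<tau>))"
    have t: "\<bar>Re t\<bar> \<le> 1 / 2" "P t z" "Im t = Im \<tau>"
      using of_int_round_abs_le[of "Re \<tau>"] Tn[OF Suc(2,3), of "- round (Re \<tau>)"]
      by (simp_all add: t_def abs_minus_commute)
    show ?case
    proof (cases "Im t \<ge> 1 / 2")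
      case True
      then show ?thesis using t by blast
    next
      case False
      have t0: "Im t > 0" using t Suc by simp
      then have tnz: "norm t > 0" by (auto simp: complex_eq_iff)
      have "\<bar>Re t\<bar>\<^sup>2 \<le> (1 / 2)\<^sup>2" "(Im t)\<^sup>2 \<le> (1 / 2)\<^sup>2" using t t0 False by (intro power_mono; simp)+
      then have n: "(norm t)\<^sup>2 \<le> 1 / 2" unfolding cmod_power2 by (simp add: power2_eq_square)
      have im: "Im (- 1 / t) = Im t / (norm t)\<^sup>2" using Im_moebius[of 0 t "-1" 1 0] by simp
      have "2 * Im t \<le> Im t / (norm t)\<^sup>2" using n t0 tnz by (simp add: field_simps)
      moreover have "Im t \<ge> (1 / 2) / 2 ^ Suc n" using Suc t by simp
      ultimately have i: "Im (- 1 / t) \<ge> (1 / 2) / 2 ^ n" unfolding im by simp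
      moreover have "(1 / 2 :: real) / 2 ^ n > 0" by simp
      ultimately have "Im (- 1 / t) > 0" by linarith
      then show ?thesis using Suc.IH[OF S[OF t0 t(2)]] i by blast
    qed
  qed
  moreover obtain n where "(1 / 2) ^ n < Im \<tau>" using real_arch_pow_inv[of "Im \<tau>" "1 / 2"] P(2) by auto
  then have "Im \<tau> \<ge> (1 / 2) / 2 ^ n" by (simp add: power_divide field_simps)
  ultimately show ?thesis using P by blast
qed

text \<open>The sum \<open>kk\<close> over the three cosets is invariant under the full modular
  group, so the image point may be moved into the strip. It remains an image of \<tau> under a
  matrix of the same determinant m, hence has height at most m Im \<tau>. This is how a Hecke
  operator of degree m multiplies the growth exponent by m.\<close>

lemma kg_orbit_bound:
  "\<exists>C>0. \<forall>\<tau> w. \<forall>a b c d :: int. Im \<tau> \<ge> 1 \<longrightarrow> a * d - b * c > 0 \<longrightarrow>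
     kg ((of_int a * \<tau> + of_int b) / (of_int c * \<tau> + of_int d)) w \<le> C * exp (pi * of_int (a * d - b * c) * Im \<tau> / 4)"
proof -
  obtain C where C: "C > 0" "\<And>\<tau> z. Im \<tau> \<ge> 1 / 2 \<Longrightarrow> kg \<tau> z \<le> C"
     "\<And>\<tau> z. Im \<tau> \<ge> 1 / 2 \<Longrightarrow> kg (1 - 1 / \<tau>) (z / \<tau>) \<le> C * exp (pi * Im \<tau> / 4)"
    using kg_bounds by blast
  define kk where "kk \<tau> z = kg \<tau> z + kg (\<tau> + 1) z + kg (1 - 1 / \<tau>) (z / \<tau>)" for \<tau> z
  have cosets: "kg (1 - 1 / (\<tau> + 1)) (z / (\<tau> + 1)) = kg (1 - 1 / \<tau>) (z / \<tau>)"
    "kg (1 - 1 / (- 1 / \<tau>)) (z / \<tau> / (- 1 / \<tau>)) = kg (\<tau> + 1) z" if "Im \<tau> > 0" for \<tau> z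
    by (rule theta_group_cosets[of kg, OF _ _ _ that]; simp only: kg_add_2 kg_inversion kg_minus)+
  have kkT: "kk (\<tau> + 1) z = kk \<tau> z" if "Im \<tau> > 0" for \<tau> z
    using cosets(1)[OF that, of z] kg_add_2[of \<tau> z] by (simp add: kk_def add.assoc)
  have kkS: "kk (- 1 / \<tau>) (z / \<tau>) = kk \<tau> z" if "Im \<tau> > 0" for \<tau> z
    using cosets(2)[OF that, of z] kg_inversion[OF that, of z] by (simp add: kk_def)
  have kk_le: "kk \<tau> z \<le> 3 * C * exp (pi * Im \<tau> / 4)" if "Im \<tau> \<ge> 1 / 2" for \<tau> z
  proof -
    have "C \<le> C * exp (pi * Im \<tau> / 4)" using C(1) that by simp
    then show ?thesis
      unfolding kk_def using C(2)[OF that, of z] C(2)[of "\<tau> + 1" z] C(3)[OF that, of z] that by simp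
  qed
  have "kg ((of_int a * \<tau> + of_int b) / (of_int c * \<tau> + of_int d)) w \<le> 3 * C * exp (pi * of_int m * Im \<tau> / 4)"
    if \<tau>: "Im \<tau> \<ge> 1" and m: "m = a * d - b * c" "m > 0" for \<tau> w and a b c d m :: int
  proof -
    have \<tau>0: "Im \<tau> > 0" using \<tau> by linarith
    define s0 where "s0 = (of_int a * \<tau> + of_int b) / (of_int c * \<tau> + of_int d)"
    define P where "P s z \<longleftrightarrow> kk s z = kk s0 w \<and> (\<exists>a b c d :: int. a * d - b * c = m \<and>
       s = (of_int a * \<tau> + of_int b) / (of_int c * \<tau> + of_int d))" for s z
    have im_s0: "Im s0 > 0"
    proof -
      have "of_int c * \<tau> + of_int d \<noteq> 0" by (rule moebius_denom_nonzero[OF \<tau>0]) (use m in auto)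
      then show ?thesis unfolding s0_def Im_moebius m(1)[symmetric] using m(2) \<tau>0 by simp
    qed
    have "\<exists>\<tau>' z'. P \<tau>' z' \<and> Im \<tau>' \<ge> 1 / 2 \<and> \<bar>Re \<tau>'\<bar> \<le> 1 / 2"
    proof (rule reduction_to_strip)
      show "P s0 w" unfolding P_def s0_def using m by blast
      show "Im s0 > 0" by (rule im_s0)
    next
      fix s z assume s: "Im s > 0" and Ps: "P s z"
      from Ps obtain a b c d :: int where abcd: "a * d - b * c = m"
         "s = (of_int a * \<tau> + of_int b) / (of_int c * \<tau> + of_int d)" and kk: "kk s z = kk s0 w"
        unfolding P_def by blast
      have nz: "of_int c * \<tau> + of_int d \<noteq> 0" by (rule moebius_denom_nonzero[OF \<tau>0]) (use abcd m in auto)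
      have nz': "of_int a * \<tau> + of_int b \<noteq> 0" by (rule moebius_denom_nonzero[OF \<tau>0]) (use abcd m in auto)
      have "s + 1 = (of_int (a + c) * \<tau> + of_int (b + d)) / (of_int c * \<tau> + of_int d)"
        unfolding abcd(2) using nz by (simp add: field_simps)
      moreover have "(a + c) * d - (b + d) * c = m" using abcd by (simp add: algebra_simps)
      ultimately show "P (s + 1) z" unfolding P_def using kkT[OF s] kk by metis
      have "s - 1 = (of_int (a - c) * \<tau> + of_int (b - d)) / (of_int c * \<tau> + of_int d)"
        unfolding abcd(2) using nz by (simp add: field_simps)
      moreover have "(a - c) * d - (b - d) * c = m" using abcd by (simp add: algebra_simps)
      moreover have "kk (s - 1) z = kk s0 w" using kkT[of "s - 1" z] s kk by simp
      ultimately show "P (s - 1) z" unfolding P_def by metis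
      have "- 1 / s = (of_int (- c) * \<tau> + of_int (- d)) / (of_int a * \<tau> + of_int b)"
        unfolding abcd(2) using nz nz' by (simp add: field_simps)
      moreover have "(- c) * b - (- d) * a = m" using abcd by (simp add: algebra_simps)
      ultimately show "P (- 1 / s) (z / s)" unfolding P_def using kkS[OF s] kk by metis
    qed
    then obtain s z a' b' c' d' where s: "Im s \<ge> 1 / 2" "kk s z = kk s0 w" "a' * d' - b' * c' = m"
       "s = (of_int a' * \<tau> + of_int b') / (of_int c' * \<tau> + of_int d')"
      unfolding P_def by blast
    have n1: "(norm (of_int c' * \<tau> + of_int d'))\<^sup>2 \<ge> 1"
    proof (cases "c' = 0")
      case True
      then have "d' \<noteq> 0" using s(3) m(2) by auto
      then have "\<bar>d'\<bar> \<ge> 1" by simp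
      then have "\<bar>d'\<bar>\<^sup>2 \<ge> 1\<^sup>2" by (intro power_mono) auto
      then have "(real_of_int d')\<^sup>2 \<ge> 1" by (simp flip: of_int_power)
      then show ?thesis using True by simp
    next
      case False
      then have "\<bar>real_of_int c'\<bar> \<ge> 1" by (simp flip: of_int_abs)
      then have "\<bar>real_of_int c'\<bar> * Im \<tau> \<ge> 1 * 1" using \<tau> by (intro mult_mono) auto
      then have "\<bar>of_int c' * Im \<tau>\<bar> \<ge> 1" using \<tau>0 by (simp add: abs_mult)
      then have "\<bar>of_int c' * Im \<tau>\<bar>\<^sup>2 \<ge> 1\<^sup>2" by (intro power_mono) auto
      then have "(of_int c' * Im \<tau>)\<^sup>2 \<ge> 1" by simp
      then show ?thesis unfolding cmod_power2 by simp (smt (verit) zero_le_power2)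
    qed
    have "Im s = of_int m * Im \<tau> / (norm (of_int c' * \<tau> + of_int d'))\<^sup>2"
      unfolding s(4) Im_moebius s(3) by simp
    also have "\<dots> \<le> of_int m * Im \<tau> / 1" 
      by (rule divide_left_mono[OF n1]) (use m(2) \<tau>0 n1 in auto)
    finally have ims: "Im s \<le> of_int m * Im \<tau>" by simp
    have "kg s0 w \<le> kk s0 w" by (simp add: kk_def)
    also have "\<dots> = kk s z" using s by simp
    also have "\<dots> \<le> 3 * C * exp (pi * Im s / 4)" by (rule kk_le[OF s(1)])
    also have "\<dots> \<le> 3 * C * exp (pi * of_int m * Im \<tau> / 4)"
      using C(1) ims by (intro mult_left_mono) (auto simp: mult.assoc intro: mult_left_mono)
    finally show ?thesis by (simp add: s0_def)
  qed
  then show ?thesis using C(1) by (intro exI[of _ "3 * C"]) auto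
qed

section \<open>Hecke operators for the theta group\<close>

text \<open>A complex version of \<open>gauss\<close>: with it \<open>ph\<close> becomes invariant under the theta group, at the price of holomorphy.\<close>

definition gauss_C :: "complex \<Rightarrow> complex \<Rightarrow> complex" where
  "gauss_C \<tau> z = exp (of_real pi * z\<^sup>2 / (2 * of_real (Im \<tau>)))"

definition Kc :: "complex \<Rightarrow> complex \<Rightarrow> complex" where
  "Kc \<tau> z = ph \<tau> z * gauss_C \<tau> z"

lemma gauss_C_moebius:
  fixes a b c d :: int
  assumes det: "a * d - b * c = 1" and \<tau>: "Im \<tau> > 0"
  defines "j \<equiv> of_int c * \<tau> + of_int d"
  shows "E (of_int c * z\<^sup>2 / j) * gauss_C ((of_int a * \<tau> + of_int b) / j) (z / j) = gauss_C \<tau> z"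
proof -
  have j0: "j \<noteq> 0" unfolding j_def by (rule moebius_denom_nonzero[OF \<tau>]) (use det in auto)
  have imt: "Im ((of_int a * \<tau> + of_int b) / j) = Im \<tau> / (norm j)\<^sup>2"
    unfolding j_def Im_moebius det by simp
  define y :: complex where "y = of_real (Im \<tau>)"
  have y0: "y \<noteq> 0" using \<tau> by (simp add: y_def)
  have nj: "of_real ((norm j)\<^sup>2) = j * (j - 2 * \<i> * of_int c * y)"
  proof -
    have "cnj j = j - 2 * \<i> * of_int c * y"
      by (simp add: complex_eq_iff j_def y_def)
    then show ?thesis by (metis complex_norm_square of_real_power)
  qed
  have "of_real pi * (z / j)\<^sup>2 / (2 * of_real (Im \<tau> / (norm j)\<^sup>2)) =
     of_real pi * (z / j)\<^sup>2 * of_real ((norm j)\<^sup>2) / (2 * y)"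
    by (simp add: y_def)
  also have "\<dots> = of_real pi * z\<^sup>2 / (2 * y) - of_real pi * \<i> * (of_int c * z\<^sup>2 / j)"
    unfolding nj using j0 y0 by (simp add: field_simps power2_eq_square)
  finally show ?thesis
    unfolding gauss_C_def imt E_def y_def by (simp flip: exp_add)
qed

lemma Kc_moebius:
  fixes a b c d :: int
  assumes det: "a * d - b * c = 1" and ev: "even (a * c)" "even (b * d)" and \<tau>: "Im \<tau> > 0"
  shows "Kc ((of_int a * \<tau> + of_int b) / (of_int c * \<tau> + of_int d)) (z / (of_int c * \<tau> + of_int d)) = Kc \<tau> z"
  unfolding Kc_def ph_moebius[OF assms] gauss_C_moebius[OF det \<tau>, of z, symmetric] by (simp add: mult_ac)

text \<open>The determinant in front of \<open>z\<close> makes an upper triangular (a, b, 0, d) send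
  z to a z, and multiplies the index by the determinant.\<close>

fun KM :: "int \<times> int \<times> int \<times> int \<Rightarrow> complex \<Rightarrow> complex \<Rightarrow> complex" where
  "KM (a, b, c, d) \<tau> z = Kc ((of_int a * \<tau> + of_int b) / (of_int c * \<tau> + of_int d))
     (of_int (a * d - b * c) * z / (of_int c * \<tau> + of_int d))"

text \<open>Left equivalence of integer matrices under the theta group.\<close>

fun th_rel :: "int \<times> int \<times> int \<times> int \<Rightarrow> int \<times> int \<times> int \<times> int \<Rightarrow> bool" where
  "th_rel (a, b, c, d) (a', b', c', d') \<longleftrightarrow> (\<exists>p q r s. p * s - q * r = 1 \<and> even (p * r) \<and> even (q * s) \<and>
     a' = p * a + q * c \<and> b' = p * b + q * d \<and> c' = r * a + s * c \<and> d' = r * b + s * d)"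

fun mult_S :: "int \<times> int \<times> int \<times> int \<Rightarrow> int \<times> int \<times> int \<times> int" where
  "mult_S (a, b, c, d) = (b, - a, d, - c)"

lemma th_rel_mult_S: "th_rel (mult_S M) (mult_S M') \<longleftrightarrow> th_rel M M'"
  by (cases M; cases M') (auto simp: algebra_simps; blast)

text \<open>Modulo 2 the theta group consists of the identity and the swap of the two
  coordinates.\<close>

lemma theta_group_parity:
  fixes p q r s :: int
  assumes "p * s - q * r = 1" "even (p * r)" "even (q * s)"
  shows "(odd p \<and> odd s \<and> even q \<and> even r) \<or> (even p \<and> even s \<and> odd q \<and> odd r)"
proof -
  have "odd (p * s - q * r)" unfolding assms(1) by simp
  then show ?thesis using assms(2,3) unfolding even_diff even_add even_mult_iff by blast
qed

lemma th_rel_sym: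
  assumes "th_rel M M'"
  shows "th_rel M' M"
proof -
  obtain a b c d where M: "M = (a, b, c, d)" by (metis prod_cases4)
  obtain a' b' c' d' where M': "M' = (a', b', c', d')" by (metis prod_cases4)
  obtain p q r s where g: "p * s - q * r = 1" "even (p * r)" "even (q * s)"
    and eq: "a' = p * a + q * c" "b' = p * b + q * d" "c' = r * a + s * c" "d' = r * b + s * d"
    using assms unfolding M M' by auto
  have par: "even (s * (- r))" "even ((- q) * p)" using theta_group_parity[OF g] by auto
  have "s * a' + (- q) * c' = (p * s - q * r) * a" "s * b' + (- q) * d' = (p * s - q * r) * b"
    "(- r) * a' + p * c' = (p * s - q * r) * c" "(- r) * b' + p * d' = (p * s - q * r) * d"
    "s * p - (- q) * (- r) = p * s - q * r"
    unfolding eq by (simp_all add: algebra_simps)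
  then show ?thesis unfolding M M' th_rel.simps using par g(1) by (metis mult_1)
qed

lemma th_rel_trans:
  assumes "th_rel M M'" "th_rel M' M''"
  shows "th_rel M M''"
proof -
  obtain a b c d where M: "M = (a, b, c, d)" by (metis prod_cases4)
  obtain a' b' c' d' where M': "M' = (a', b', c', d')" by (metis prod_cases4)
  obtain a'' b'' c'' d'' where M'': "M'' = (a'', b'', c'', d'')" by (metis prod_cases4)
  obtain p q r s where g: "p * s - q * r = 1" "even (p * r)" "even (q * s)"
    and eq: "a' = p * a + q * c" "b' = p * b + q * d" "c' = r * a + s * c" "d' = r * b + s * d"
    using assms unfolding M M' by auto
  obtain p' q' r' s' where g': "p' * s' - q' * r' = 1" "even (p' * r')" "even (q' * s')"
    and eq': "a'' = p' * a' + q' * c'" "b'' = p' * b' + q' * d'" "c'' = r' * a' + s' * c'" "d'' = r' * b' + s' * d'"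
    using assms unfolding M' M'' by auto
  define P Q R S where PQRS: "P = p' * p + q' * r" "Q = p' * q + q' * s" "R = r' * p + s' * r" "S = r' * q + s' * s"
  have "P * S - Q * R = (p * s - q * r) * (p' * s' - q' * r')" by (simp add: PQRS algebra_simps)
  then have 1: "P * S - Q * R = 1" using g(1) g'(1) by simp
  have 2: "even (P * R)" "even (Q * S)"
    using theta_group_parity[OF g] theta_group_parity[OF g'] by (auto simp: PQRS)
  have 3: "a'' = P * a + Q * c" "b'' = P * b + Q * d" "c'' = R * a + S * c" "d'' = R * b + S * d"
    unfolding eq eq' PQRS by (simp_all add: algebra_simps)
  show ?thesis unfolding M M'' th_rel.simps using 1 2 3 by blast
qed

text \<open>Left multiplication multiplies the denominators c \<tau> + d as a cocycle, and
  \<open>Kc\<close> absorbs the theta group factor.\<close>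

lemma th_rel_KM:
  assumes "th_rel M M'" and M: "M = (a, b, c, d)" and det: "a * d - b * c > 0" and \<tau>: "Im \<tau> > 0"
  shows "KM M' \<tau> z = KM M \<tau> z"
proof -
  obtain a' b' c' d' where M': "M' = (a', b', c', d')" by (metis prod_cases4)
  obtain p q r s where g: "p * s - q * r = 1" "even (p * r)" "even (q * s)"
    and eq: "a' = p * a + q * c" "b' = p * b + q * d" "c' = r * a + s * c" "d' = r * b + s * d"
    using assms(1) unfolding M M' by auto
  have "a' * d' - b' * c' = (p * s - q * r) * (a * d - b * c)"
    unfolding eq by (simp add: algebra_simps)
  then have det': "a' * d' - b' * c' = a * d - b * c" using g by simp
  define j where "j = of_int c * \<tau> + of_int d"
  define t where "t = (of_int a * \<tau> + of_int b) / j"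
  define w where "w = of_int (a * d - b * c) * z / j"
  have j0: "j \<noteq> 0" unfolding j_def by (rule moebius_denom_nonzero[OF \<tau>]) (use det in auto)
  have "real_of_int (a * d - b * c) > 0" using det by (simp only: of_int_0_less_iff)
  then have t: "Im t > 0"
    unfolding t_def j_def Im_moebius using \<tau> j0[unfolded j_def] by (simp del: of_int_diff of_int_mult)
  have k0: "of_int r * t + of_int s \<noteq> 0" by (rule moebius_denom_nonzero[OF t]) (use g in auto)
  have tj: "t * j = of_int a * \<tau> + of_int b" using j0 by (simp add: t_def)
  have n: "of_int a' * \<tau> + of_int b' = (of_int p * t + of_int q) * j"
    by (simp only: distrib_right mult.assoc tj) (simp add: eq j_def algebra_simps)
  have m: "of_int c' * \<tau> + of_int d' = (of_int r * t + of_int s) * j"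
    by (simp only: distrib_right mult.assoc tj) (simp add: eq j_def algebra_simps)
  have "KM M' \<tau> z = Kc ((of_int p * t + of_int q) / (of_int r * t + of_int s)) (w / (of_int r * t + of_int s))"
    unfolding M' KM.simps det' n m w_def using j0 k0 by (simp add: mult.commute)
  also have "\<dots> = Kc t w" by (rule Kc_moebius[OF g t])
  also have "\<dots> = KM M \<tau> z" unfolding M KM.simps t_def w_def j_def ..
  finally show ?thesis .
qed

lemma KM_mult_S:
  assumes \<tau>: "Im \<tau> > 0" and M: "M = (a, b, c, d)" "a * d - b * c \<noteq> 0"
  shows "KM M (- 1 / \<tau>) (z / \<tau>) = KM (mult_S M) \<tau> z"
proof -
  have \<tau>0: "\<tau> \<noteq> 0" using \<tau> by auto
  have nz: "of_int d * \<tau> + of_int (- c) \<noteq> 0" by (rule moebius_denom_nonzero[OF \<tau>]) (use M(2) in auto)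
  have 1: "of_int a * (- 1 / \<tau>) + of_int b = (of_int b * \<tau> + of_int (- a)) / \<tau>"
    "of_int c * (- 1 / \<tau>) + of_int d = (of_int d * \<tau> + of_int (- c)) / \<tau>"
    using \<tau>0 by (simp_all add: field_simps)
  have 2: "a * d - b * c = b * - c - - a * d" by simp
  show ?thesis unfolding M(1) mult_S.simps KM.simps 1 2 using \<tau>0 nz by simp
qed

text \<open>Representatives of the matrices of determinant \<open>N\<close> with odd column sums, modulo the theta group.\<close>

definition hecke_reps :: "int \<Rightarrow> (int \<times> int \<times> int \<times> int) set" where
  "hecke_reps N = {(a, b, c, d). c = 0 \<and> a > 0 \<and> d > 0 \<and> a * d = N \<and> odd a \<and> 0 \<le> b \<and> b < 2 * d \<and> odd (b + d)}"

lemma hecke_repsE: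
  assumes "M \<in> hecke_reps N"
  obtains a b d where "M = (a, b, 0, d)" "a > 0" "d > 0" "a * d = N" "odd a" "0 \<le> b" "b < 2 * d" "odd (b + d)"
  using assms unfolding hecke_reps_def by blast

lemma finite_hecke_reps: "finite (hecke_reps N)"
proof (rule finite_subset)
  show "hecke_reps N \<subseteq> {0..N} \<times> {0..2 * N} \<times> {0} \<times> {0..N}"
  proof
    fix M assume "M \<in> hecke_reps N"
    then obtain a b d where M: "M = (a, b, 0, d)" "a > 0" "d > 0" "a * d = N" "0 \<le> b" "b < 2 * d"
      by (elim hecke_repsE)
    have "a * 1 \<le> a * d" "1 * d \<le> a * d" using M by (intro mult_left_mono mult_right_mono; simp)+
    then show "M \<in> {0..N} \<times> {0..2 * N} \<times> {0} \<times> {0..N}" using M by auto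
  qed
qed auto

lemma hecke_reps_unique:
  assumes "M \<in> hecke_reps N" "M' \<in> hecke_reps N" "th_rel M M'"
  shows "M = M'"
proof -
  obtain a b d where M: "M = (a, b, 0, d)" "a > 0" "d > 0" "0 \<le> b" "b < 2 * d"
    using assms(1) by (elim hecke_repsE)
  obtain a' b' d' where M': "M' = (a', b', 0, d')" "a' > 0" "d' > 0" "0 \<le> b'" "b' < 2 * d'"
    using assms(2) by (elim hecke_repsE)
  obtain p q r s where g: "p * s - q * r = 1" "even (p * r)" "even (q * s)"
    and eq: "a' = p * a" "b' = p * b + q * d" "0 = r * a" "d' = r * b + s * d"
    using assms(3) unfolding M(1) M'(1) by auto
  have r: "r = 0" using eq(3) M by simp
  then have "p * s = 1" using g by simp
  moreover have "p > 0" using eq(1) M M' by (metis zero_less_mult_pos2)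
  ultimately have ps: "p = 1" "s = 1" by (auto simp: zmult_eq_1_iff)
  then obtain k where k: "q = 2 * k" using g by auto
  have d: "d' = d" using eq r ps by simp
  have "b' = b + (2 * d) * k" using eq ps k by simp
  then have "b' mod (2 * d) = b mod (2 * d)" by simp
  then have "b' = b" using M M' d by simp
  then show ?thesis using eq M M' ps d by simp
qed

text \<open>Bezout coefficients u, v of the first column clear the lower left entry. If their
  parities do not fit the theta group, (u - c1, v + a1) does, because a1 + c1 is odd. An even
  translation then reduces b. Odd column sums persist under left multiplication by the theta group,
  which modulo 2 only permutes rows, and under \<open>mult_S\<close>, which permutes columns up to
  sign.\<close>

lemma hecke_reps_exists:
  assumes N: "a * d - b * c = N" "N > 0" and odd: "odd (a + c)" "odd (b + d)"
  shows "\<exists>M\<in>hecke_reps N. th_rel (a, b, c, d) M"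
proof -
  define g where "g = gcd a c"
  have g: "g > 0" using odd(1) by (auto simp: g_def)
  define a1 c1 where "a1 = a div g" "c1 = c div g"
  have ac: "a = g * a1" "c = g * c1" by (auto simp: g_def a1_c1_def)
  have "coprime a1 c1" unfolding a1_c1_def g_def by (rule div_gcd_coprime) (use odd(1) in auto)
  then obtain u0 v0 where uv0: "u0 * a1 + v0 * c1 = 1" by (metis bezout_int coprime_iff_gcd_eq_1)
  have odd': "odd g" "odd (a1 + c1)" using odd(1) unfolding ac by (auto simp flip: distrib_left)
  have "\<exists>u v. u * a1 + v * c1 = 1 \<and> even (u * c1) \<and> even (v * a1)"
  proof (cases "even (u0 * c1) \<and> even (v0 * a1)")
    case True
    then show ?thesis using uv0 by blast
  next
    case False
    have "odd (u0 * a1 + v0 * c1)" using uv0 by simp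
    then have "even ((u0 - c1) * c1)" "even ((v0 + a1) * a1)" using False odd' by auto
    moreover have "(u0 - c1) * a1 + (v0 + a1) * c1 = 1" using uv0 by (simp add: algebra_simps)
    ultimately show ?thesis by blast
  qed
  then obtain u v where uv: "u * a1 + v * c1 = 1" "even (u * c1)" "even (v * a1)" by blast
  define b0 d0 where "b0 = u * b + v * d" "d0 = (- c1) * b + a1 * d"
  define k where "k = b0 div (2 * d0)"
  have gd: "g * d0 = N" using N(1) unfolding ac by (simp add: b0_d0_def algebra_simps)
  have d0: "d0 > 0" using gd g N(2) by (metis zero_less_mult_pos)
  have M1: "th_rel (a, b, c, d) (g, b0, 0, d0)"
    unfolding th_rel.simps
  proof (intro exI conjI)
    show "u * a1 - v * (- c1) = 1" "even (u * (- c1))" "even (v * a1)" using uv by auto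
    have "u * a + v * c = g * (u * a1 + v * c1)" unfolding ac by (simp add: algebra_simps)
    then show "g = u * a + v * c" using uv by simp
    show "0 = - c1 * a + a1 * c" unfolding ac by simp
  qed (simp_all add: b0_d0_def)
  have M2: "th_rel (g, b0, 0, d0) (g, b0 mod (2 * d0), 0, d0)"
    unfolding th_rel.simps
    by (rule exI[of _ 1], rule exI[of _ "- 2 * k"], rule exI[of _ 0], rule exI[of _ 1])
       (use div_mult_mod_eq[of b0 "2 * d0"] in \<open>auto simp: k_def algebra_simps\<close>)
  have par: "odd (b0 + d0)"
  proof -
    have "odd (u - c1)" "odd (v + a1)" using theta_group_parity[of u a1 v "- c1"] uv by auto
    moreover have "b0 + d0 = (u - c1) * b + (v + a1) * d" by (simp add: b0_d0_def algebra_simps)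
    ultimately show ?thesis using odd(2) by auto
  qed
  have "b0 = 2 * (d0 * k) + b0 mod (2 * d0)" unfolding k_def by (metis mult.assoc mult_div_mod_eq)
  then have "even (b0 - b0 mod (2 * d0))" by (metis add_diff_cancel_right' dvd_triv_left)
  then have "odd (b0 mod (2 * d0) + d0)" using par by auto
  then have "(g, b0 mod (2 * d0), 0, d0) \<in> hecke_reps N"
    using g gd d0 odd' by (auto simp: hecke_reps_def)
  then show ?thesis using th_rel_trans[OF M1 M2] by blast
qed

text \<open>Right multiplication by S permutes the cosets: uniqueness of representatives makes the
  induced self-map of a finite set injective, hence bijective.\<close>

lemma sum_KM_inversion:
  assumes N: "N > 0" and \<tau>: "Im \<tau> > 0"
  shows "(\<Sum>M\<in>hecke_reps N. KM M (- 1 / \<tau>) (z / \<tau>)) = (\<Sum>M\<in>hecke_reps N. KM M \<tau> z)"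
proof -
  have "\<exists>M'\<in>hecke_reps N. th_rel (mult_S M) M'" if M0: "M \<in> hecke_reps N" for M
  proof -
    obtain a b d where M: "M = (a, b, 0, d)" "a * d = N" "odd a" "odd (b + d)"
      using M0 by (elim hecke_repsE)
    show ?thesis unfolding M(1) mult_S.simps by (rule hecke_reps_exists) (use M N in auto)
  qed
  then obtain f where f: "\<And>M. M \<in> hecke_reps N \<Longrightarrow> f M \<in> hecke_reps N"
    "\<And>M. M \<in> hecke_reps N \<Longrightarrow> th_rel (mult_S M) (f M)" by metis
  have inj: "inj_on f (hecke_reps N)"
  proof
    fix M M' assume M: "M \<in> hecke_reps N" "M' \<in> hecke_reps N" "f M = f M'"
    then have "th_rel (mult_S M) (mult_S M')" using f(2) th_rel_sym th_rel_trans by metis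
    then show "M = M'" using hecke_reps_unique M unfolding th_rel_mult_S by blast
  qed
  have img: "f ` hecke_reps N = hecke_reps N"
    by (rule endo_inj_surj[OF finite_hecke_reps _ inj]) (use f in blast)
  have "(\<Sum>M\<in>hecke_reps N. KM M (- 1 / \<tau>) (z / \<tau>)) = (\<Sum>M\<in>hecke_reps N. KM (f M) \<tau> z)"
  proof (rule sum.cong)
    fix M assume M: "M \<in> hecke_reps N"
    then obtain a b d where M': "M = (a, b, 0, d)" "a * d = N" by (elim hecke_repsE)
    have "KM M (- 1 / \<tau>) (z / \<tau>) = KM (mult_S M) \<tau> z" by (rule KM_mult_S[OF \<tau> M'(1)]) (use M' N in auto)
    also have "\<dots> = KM (f M) \<tau> z"
      by (rule th_rel_KM[OF f(2)[OF M], symmetric, of b "- a" d "- 0"]) (use M' N \<tau> in auto)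
    finally show "KM M (- 1 / \<tau>) (z / \<tau>) = KM (f M) \<tau> z" .
  qed simp
  also have "\<dots> = (\<Sum>M\<in>f ` hecke_reps N. KM M \<tau> z)" by (simp add: sum.reindex[OF inj])
  finally show ?thesis by (simp only: img)
qed

text \<open>The image of \<open>ph\<close> under the Hecke operator of degree N, which multiplies
  the index by N. All representatives have c = 0, so no automorphy factor appears.\<close>

definition psi :: "nat \<Rightarrow> complex \<Rightarrow> complex \<Rightarrow> complex" where
  "psi N \<tau> z = (\<Sum>(a, b, c, d)\<in>hecke_reps (int N). ph ((of_int a * \<tau> + of_int b) / of_int d) (of_int a * z))"

lemma Im_hecke: "a > 0 \<Longrightarrow> d > 0 \<Longrightarrow> Im ((of_int a * \<tau> + of_int b) / of_int d) = of_int a * Im \<tau> / of_int d"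
  using Im_moebius[of a \<tau> b 0 d] by (simp add: power2_eq_square)

text \<open>(a z)^2 divided by a Im \<tau> / d equals N z^2 / Im \<tau>, so each representative
  yields the same power of \<open>gauss_C\<close>. It splits off, and the holomorphic
  \<open>psi\<close> inherits the transformation law.\<close>

lemma psi_gauss_C:
  assumes "Im \<tau> > 0"
  shows "(\<Sum>M\<in>hecke_reps (int N). KM M \<tau> z) = psi N \<tau> z * gauss_C \<tau> z ^ N"
  unfolding psi_def sum_distrib_right
proof (rule sum.cong)
  fix M assume "M \<in> hecke_reps (int N)"
  then obtain a b d where M: "M = (a, b, 0, d)" "a > 0" "d > 0" "a * d = int N"
    by (elim hecke_repsE)
  have N: "(of_nat N :: complex) = of_int a * of_int d" by (metis M(4) of_int_mult of_int_of_nat_eq)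
  have d0: "(of_int d :: complex) \<noteq> 0" "(of_int a :: complex) \<noteq> 0" using M by auto
  have "gauss_C ((of_int a * \<tau> + of_int b) / of_int d) (of_int a * z) = gauss_C \<tau> z ^ N"
    unfolding gauss_C_def Im_hecke[OF M(2,3)] exp_of_nat_mult[symmetric] N
    using d0 assms by (simp add: field_simps power2_eq_square)
  then show "KM M \<tau> z = (case M of (a, b, c, d) \<Rightarrow> ph ((of_int a * \<tau> + of_int b) / of_int d) (of_int a * z)) * gauss_C \<tau> z ^ N"
    using d0 by (simp add: M(1) Kc_def)
qed simp

lemma psi_inversion:
  assumes N: "N > 0" and \<tau>: "Im \<tau> > 0"
  shows "psi N (- 1 / \<tau>) (z / \<tau>) = E (z\<^sup>2 / \<tau>) ^ N * psi N \<tau> z"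
proof -
  have "\<tau> \<noteq> 0" using \<tau> by auto
  then have \<tau>': "Im (- 1 / \<tau>) > 0" using Im_moebius[of 0 \<tau> "-1" 1 0] \<tau> by simp
  have "psi N (- 1 / \<tau>) (z / \<tau>) * gauss_C (- 1 / \<tau>) (z / \<tau>) ^ N = psi N \<tau> z * gauss_C \<tau> z ^ N"
    using sum_KM_inversion[of "int N" \<tau> z] N \<tau> unfolding psi_gauss_C[OF \<tau>] psi_gauss_C[OF \<tau>'] by simp
  also have "gauss_C \<tau> z = E (z\<^sup>2 / \<tau>) * gauss_C (- 1 / \<tau>) (z / \<tau>)"
    using gauss_C_moebius[of 0 0 "-1" 1 \<tau> z] \<tau> by simp
  finally have "psi N (- 1 / \<tau>) (z / \<tau>) * gauss_C (- 1 / \<tau>) (z / \<tau>) ^ N =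
     (E (z\<^sup>2 / \<tau>) ^ N * psi N \<tau> z) * gauss_C (- 1 / \<tau>) (z / \<tau>) ^ N"
    by (simp add: power_mult_distrib mult_ac)
  moreover have "gauss_C (- 1 / \<tau>) (z / \<tau>) \<noteq> 0" by (simp add: gauss_C_def)
  ultimately show ?thesis by simp
qed

lemma ph_shift: "ph \<tau> (z + of_int m * \<tau> + of_int k) = E (- (of_int m ^ 2 * \<tau>) - 2 * of_int m * z) * ph \<tau> z"
  by (simp add: ph_def th_shift)

lemma psi_shift_1: "psi N \<tau> (z + 1) = psi N \<tau> z"
  unfolding psi_def
proof (intro sum.cong refl)
  fix M assume "M \<in> hecke_reps (int N)"
  obtain a b c d where M: "M = (a, b, c, d)" by (metis prod_cases4)
  show "(case M of (a, b, c, d) \<Rightarrow> ph ((of_int a * \<tau> + of_int b) / of_int d) (of_int a * (z + 1))) =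
     (case M of (a, b, c, d) \<Rightarrow> ph ((of_int a * \<tau> + of_int b) / of_int d) (of_int a * z))"
    using ph_shift[of "(of_int a * \<tau> + of_int b) / of_int d" "of_int a * z" 0 a]
    by (simp add: M distrib_left)
qed

text \<open>Since b + d is odd, b d is even, so the quasi-period carries no sign.\<close>

lemma psi_shift_tau: "psi N \<tau> (z + \<tau>) = E (- \<tau> - 2 * z) ^ N * psi N \<tau> z"
  unfolding psi_def sum_distrib_left
proof (intro sum.cong refl)
  fix M assume "M \<in> hecke_reps (int N)"
  then obtain a b d where M: "M = (a, b, 0, d)" "a > 0" "d > 0" "a * d = int N" "odd a" "odd (b + d)"
    by (elim hecke_repsE)
  define t where "t = (of_int a * \<tau> + of_int b) / of_int d"
  have td: "of_int d * t = of_int a * \<tau> + of_int b" using M by (simp add: t_def)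
  have N: "(of_nat N :: complex) = of_int d * of_int a" by (metis M(4) mult.commute of_int_mult of_int_of_nat_eq)
  have "of_int a * (z + \<tau>) = of_int a * z + of_int d * t + of_int (- b)"
    unfolding td by (simp add: algebra_simps)
  then have "ph t (of_int a * (z + \<tau>)) = E (- (of_int d ^ 2 * t) - 2 * of_int d * (of_int a * z)) * ph t (of_int a * z)"
    by (simp only: ph_shift)
  also have "of_int d ^ 2 * t = of_int d * (of_int a * \<tau> + of_int b)"
    unfolding td[symmetric] by (simp add: power2_eq_square)
  also have "E (- (of_int d * (of_int a * \<tau> + of_int b)) - 2 * of_int d * (of_int a * z)) = E (- \<tau> - 2 * z) ^ N"
    unfolding E_power N by (rule E_cong_even[of _ _ "- (d * b)"]) (use M in \<open>auto simp: algebra_simps\<close>)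
  finally show "(case M of (a, b, c, d) \<Rightarrow> ph ((of_int a * \<tau> + of_int b) / of_int d) (of_int a * (z + \<tau>))) =
     E (- \<tau> - 2 * z) ^ N * (case M of (a, b, c, d) \<Rightarrow> ph ((of_int a * \<tau> + of_int b) / of_int d) (of_int a * z))"
    by (simp add: M(1) t_def)
qed

lemma psi_minus: "psi N \<tau> (- z) = psi N \<tau> z"
  by (simp add: psi_def ph_def th_minus)

section \<open>The formal product and its symmetry\<close>

definition theta_z_fps :: "complex \<Rightarrow> complex fps" where
  "theta_z_fps z = Abs_fps (\<lambda>n. \<Sum>m | m\<^sup>2 = int n. E (2 * of_int m * z))"

definition ph_fps :: "complex \<Rightarrow> complex fps" where
  "ph_fps z = inv_theta_C * theta_z_fps z"

text \<open>The coefficient of \<open>X\<^sup>i Y\<^sup>N\<close> in the logarithm of the product; the symmetry in \<open>i\<close> and \<open>N\<close> is what drives the proof.\<close>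

definition log_coeff :: "nat \<Rightarrow> nat \<Rightarrow> complex \<Rightarrow> complex" where
  "log_coeff i N z = (\<Sum>k | k dvd i \<and> k dvd N \<and> odd k.
     2 / of_nat k * (-1) ^ ((i div k + 1) * (N div k + 1)) * fps_nth (ph_fps (of_nat k * z)) (i div k * (N div k)))"

definition log_fps :: "complex \<Rightarrow> nat \<Rightarrow> complex fps" where
  "log_fps z N = Abs_fps (\<lambda>i. log_coeff i N z)"

lemma log_coeff_commute: "log_coeff i N z = log_coeff N i z"
  unfolding log_coeff_def by (intro sum.cong) (auto simp: mult.commute)

text \<open>Coefficient of Y^N in the exponential of the sum of \<open>log_fps z M\<close> Y^M over
  M > 0, computed by the recursion that Y d/dY gives. The row M = 0 is left aside; it accounts for
  the factor theta.\<close>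

function exp_fps :: "complex \<Rightarrow> nat \<Rightarrow> complex fps" where
  "exp_fps z N = (if N = 0 then 1 else
     fps_const (1 / of_nat N) * (\<Sum>M\<in>{1..N}. of_nat M * log_fps z M * exp_fps z (N - M)))"
  by auto
termination by (relation "Wellfounded.measure snd") auto

declare exp_fps.simps [simp del]

text \<open>Coefficient of Y^N in the sum of ph (n z) Y^(n^2) over all integers n.\<close>

definition square_fps :: "complex \<Rightarrow> nat \<Rightarrow> complex fps" where
  "square_fps z N = (\<Sum>n | n\<^sup>2 = int N. ph_fps (of_int n * z))"

lemma exp_fps_0 [simp]: "exp_fps z 0 = 1" by (simp add: exp_fps.simps)

lemma exp_fps_rec: "of_nat N * exp_fps z N = (\<Sum>M\<in>{1..N}. of_nat M * log_fps z M * exp_fps z (N - M))"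
proof (cases "N = 0")
  case False
  have "(of_nat N :: complex fps) * (fps_const (1 / of_nat N) * F) = F" for F :: "complex fps"
    using False by (simp add: fps_eq_iff fps_mult_of_nat_nth)
  then show ?thesis using False by (subst exp_fps.simps) simp
qed simp

lemma theta_C_ph_fps: "theta_C * ph_fps z = theta_z_fps z"
  by (simp add: ph_fps_def theta_C_mult_inv flip: mult.assoc)

lemma ph_fps_nth_0: "fps_nth (ph_fps z) 0 = 1"
  by (simp add: ph_fps_def inv_theta_C_def theta_z_fps_def fps_nth_theta_fps_0)

text \<open>The row N = 0 is log theta itself, so \<open>theta_C\<close> times
  \<open>exp_fps\<close> is the exponential of the full double series, whose coefficients are
  symmetric.\<close>

lemma log_coeff_0: "log_coeff i 0 z = of_real (log_theta_coeff i)"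
proof -
  have "(-1 :: complex) ^ (i div k + 1) = (-1) ^ (i + 1)" if "k dvd i" "odd k" for k
  proof -
    have "even (i div k) = even i" using that by (metis dvd_mult_div_cancel even_mult_iff)
    then show ?thesis by (simp add: uminus_power_if)
  qed
  then show ?thesis
    unfolding log_coeff_def log_theta_coeff_def of_real_sum
    by (intro sum.cong) (auto simp: ph_fps_nth_0)
qed

section \<open>Two commuting Euler derivations\<close>

text \<open>Elements of \<open>complex fps fps\<close> are series in Y whose coefficients are series
  in X: this is X d/dX, while \<open>theta_op\<close> acts as Y d/dY.\<close>

definition inner_theta_op :: "complex fps fps \<Rightarrow> complex fps fps" where
  "inner_theta_op F = Abs_fps (\<lambda>N. theta_op (fps_nth F N))"

lemma theta_op_diff: "theta_op (F - G) = theta_op F - theta_op G"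
  by (rule fps_ext) (simp add: algebra_simps)
lemma theta_op_sum: "theta_op (sum F A) = (\<Sum>x\<in>A. theta_op (F x))"
  by (rule fps_ext) (simp add: fps_sum_nth sum_distrib_left)

lemma inner_theta_op_mult: "inner_theta_op (F * G) = inner_theta_op F * G + F * inner_theta_op G"
  by (rule fps_ext) (simp add: inner_theta_op_def fps_mult_nth theta_op_sum theta_op_mult sum.distrib)

lemma inner_theta_op_commute: "inner_theta_op (theta_op F) = theta_op (inner_theta_op F)"
proof (rule fps_ext)
  fix N
  have "theta_op (of_nat N * f) = of_nat N * theta_op f" for f :: "complex fps"
    by (rule fps_ext) (simp add: fps_mult_of_nat_nth)
  then show "fps_nth (inner_theta_op (theta_op F)) N = fps_nth (theta_op (inner_theta_op F)) N"
    by (simp add: inner_theta_op_def)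
qed

text \<open>As \<open>M\<close> has no constant term, the equation determines each coefficient from
  lower ones, and these start with 0.\<close>

lemma theta_op_eq_mult_imp_0:
  fixes R M :: "complex fps fps"
  assumes "theta_op R = R * M" "fps_nth M 0 = 0" "fps_nth R 0 = 0"
  shows "R = 0"
proof -
  have "fps_nth R n = 0" for n
  proof (induction n rule: less_induct)
    case (less n)
    show ?case
    proof (cases "n = 0")
      case False
      have "of_nat n * fps_nth R n = (\<Sum>i=0..n. fps_nth R i * fps_nth M (n - i))"
        using arg_cong[OF assms(1), of "\<lambda>F. fps_nth F n"] by (simp add: fps_mult_nth)
      also have "\<dots> = 0"
      proof (rule sum.neutral, rule ballI)
        fix i assume "i \<in> {0..n}"
        then show "fps_nth R i * fps_nth M (n - i) = 0" using less assms(2) by (cases "i = n") auto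
      qed
      finally show ?thesis using False by (simp add: fps_eq_iff fps_mult_of_nat_nth)
    qed (use assms in simp)
  qed
  then show ?thesis by (intro fps_ext) simp
qed

definition prod_fps2 :: "complex \<Rightarrow> complex fps fps" where
  "prod_fps2 z = Abs_fps (\<lambda>N. theta_C * exp_fps z N)"

definition log_fps2 :: "complex \<Rightarrow> complex fps fps" where
  "log_fps2 z = Abs_fps (log_fps z)"

lemma theta_op_prod_fps2: "theta_op (prod_fps2 z) = prod_fps2 z * theta_op (log_fps2 z)"
proof (rule fps_ext)
  fix N
  have "fps_nth (theta_op (prod_fps2 z)) N = theta_C * (of_nat N * exp_fps z N)"
    by (simp add: prod_fps2_def mult.left_commute)
  also have "\<dots> = (\<Sum>M\<in>{1..N}. theta_C * exp_fps z (N - M) * (of_nat M * log_fps z M))"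
    unfolding exp_fps_rec by (simp add: sum_distrib_left mult_ac)
  also have "\<dots> = (\<Sum>M\<in>{0..N}. theta_C * exp_fps z (N - M) * (of_nat M * log_fps z M))"
    by (rule sum.mono_neutral_left) auto
  also have "\<dots> = (\<Sum>i\<in>{0..N}. theta_C * exp_fps z i * (of_nat (N - i) * log_fps z (N - i)))"
    by (rule sum.reindex_bij_witness[of _ "\<lambda>i. N - i" "\<lambda>i. N - i"]) auto
  also have "\<dots> = fps_nth (prod_fps2 z * theta_op (log_fps2 z)) N"
    by (simp add: fps_mult_nth prod_fps2_def log_fps2_def)
  finally show "fps_nth (theta_op (prod_fps2 z)) N = fps_nth (prod_fps2 z * theta_op (log_fps2 z)) N" .
qed

lemma theta_op_theta_C: "theta_op theta_C = theta_C * theta_op (log_fps z 0)"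
proof (rule fps_ext)
  fix n
  have "(of_real (fps_nth (theta_op theta_fps) n) :: complex) =
    of_real (fps_nth (theta_fps * Abs_fps (\<lambda>i. real i * log_theta_coeff i)) n)"
    by (simp only: theta_op_theta_fps)
  then show "fps_nth (theta_op theta_C) n = fps_nth (theta_C * theta_op (log_fps z 0)) n"
    by (simp add: fps_mult_nth theta_C_def log_fps_def log_coeff_0)
qed

text \<open>Both derivations annihilate the same equation since they commute.\<close>

lemma inner_theta_op_prod_fps2: "inner_theta_op (prod_fps2 z) = prod_fps2 z * inner_theta_op (log_fps2 z)"
proof -
  define P L where "P = prod_fps2 z" "L = log_fps2 z"
  define R where "R = inner_theta_op P - P * inner_theta_op L"
  have P: "theta_op P = P * theta_op L" unfolding P_L_def by (rule theta_op_prod_fps2)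
  have "theta_op R = inner_theta_op (theta_op P) - (theta_op P * inner_theta_op L + P * theta_op (inner_theta_op L))"
    by (simp add: R_def theta_op_diff theta_op_mult inner_theta_op_commute)
  also have "\<dots> = R * theta_op L"
    unfolding P inner_theta_op_mult by (simp add: R_def inner_theta_op_commute algebra_simps)
  finally have "theta_op R = R * theta_op L" .
  moreover have "fps_nth (theta_op L) 0 = 0" by simp
  \<comment> \<open>At Y = 0 the claim is the logarithmic derivative of theta, which supplies the
    initial value.\<close>
  moreover have "fps_nth R 0 = 0"
    using theta_op_theta_C[of z]
    by (simp add: R_def inner_theta_op_def P_L_def prod_fps2_def log_fps2_def fps_mult_nth_0)
  ultimately have "R = 0" by (rule theta_op_eq_mult_imp_0)
  then show ?thesis by (simp add: R_def P_L_def)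
qed

text \<open>Exchanging i and N turns the recursion \<open>r1\<close>, from Y d/dY, into
  \<open>r2\<close>, from X d/dX, because \<open>log_coeff\<close> is symmetric. The induction is on
  i + N.\<close>

lemma prod_coeff_symmetric: "fps_nth (theta_C * exp_fps z N) i = fps_nth (theta_C * exp_fps z i) N"
proof -
  define p where "p i N = fps_nth (theta_C * exp_fps z N) i" for i N
  have r1: "of_nat N * p i N = (\<Sum>m=0..N. \<Sum>j=0..i. p j m * (of_nat (N - m) * log_coeff (i - j) (N - m) z))" for i N
  proof -
    have "of_nat N * p i N = fps_nth (fps_nth (theta_op (prod_fps2 z)) N) i"
      by (simp add: prod_fps2_def p_def fps_mult_of_nat_nth)
    also have "\<dots> = (\<Sum>m=0..N. \<Sum>j=0..i. p j m * (of_nat (N - m) * log_coeff (i - j) (N - m) z))"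
      unfolding theta_op_prod_fps2
      by (simp add: fps_mult_nth[of "prod_fps2 z"] fps_sum_nth del: of_nat_diff)
         (simp add: fps_mult_nth[of "theta_C * exp_fps z _"] prod_fps2_def log_fps2_def p_def log_fps_def fps_mult_of_nat_nth del: of_nat_diff)
    finally show ?thesis .
  qed
  have r2: "of_nat i * p i N = (\<Sum>m=0..N. \<Sum>j=0..i. p j m * (of_nat (i - j) * log_coeff (i - j) (N - m) z))" for i N
  proof -
    have "of_nat i * p i N = fps_nth (fps_nth (inner_theta_op (prod_fps2 z)) N) i"
      by (simp add: prod_fps2_def p_def inner_theta_op_def)
    also have "\<dots> = (\<Sum>m=0..N. \<Sum>j=0..i. p j m * (of_nat (i - j) * log_coeff (i - j) (N - m) z))"
      unfolding inner_theta_op_prod_fps2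
      by (simp add: fps_mult_nth[of "prod_fps2 z"] fps_sum_nth del: of_nat_diff)
         (simp add: fps_mult_nth[of "theta_C * exp_fps z _"] prod_fps2_def log_fps2_def p_def log_fps_def inner_theta_op_def del: of_nat_diff)
    finally show ?thesis .
  qed
  have "p i N = p N i" for i N
  proof (induction "i + N" arbitrary: i N rule: less_induct)
    case less
    have *: "p i N = p N i" if N: "N > 0" and IH: "\<And>j m. j + m < i + N \<Longrightarrow> p j m = p m j" for i N
    proof -
      have "of_nat N * p i N = (\<Sum>m=0..N. \<Sum>j=0..i. p j m * (of_nat (N - m) * log_coeff (i - j) (N - m) z))"
        by (rule r1)
      also have "\<dots> = (\<Sum>m=0..N. \<Sum>j=0..i. p m j * (of_nat (N - m) * log_coeff (N - m) (i - j) z))"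
      proof (intro sum.cong refl)
        fix m j assume mj: "m \<in> {0..N}" "j \<in> {0..i}"
        show "p j m * (of_nat (N - m) * log_coeff (i - j) (N - m) z) = p m j * (of_nat (N - m) * log_coeff (N - m) (i - j) z)"
        \<comment> \<open>Any term of full degree has m = N and is killed by the factor N - m; all
          others fall under the induction hypothesis.\<close>
        proof (cases "m = N")
          case False
          then have "p j m = p m j" using mj by (intro IH) auto
          then show ?thesis by (simp add: log_coeff_commute)
        qed simp
      qed
      also have "\<dots> = (\<Sum>j=0..i. \<Sum>m=0..N. p m j * (of_nat (N - m) * log_coeff (N - m) (i - j) z))"
        by (rule sum.swap)
      also have "\<dots> = of_nat N * p N i" by (rule r2[symmetric])
      finally show ?thesis using N by simp
    qed
    show ?case
    proof (cases "N > 0")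
      case True
      then show ?thesis using * less by blast
    next
      case False
      show ?thesis
      proof (cases "i > 0")
        case True
        then show ?thesis using *[of i N] less by (metis add.commute)
      qed (use False in simp)
    qed
  qed
  then show ?thesis by (simp add: p_def)
qed

lemma finite_int_squares [simp]: "finite {n :: int. n\<^sup>2 = k}"
  by (rule finite_square_eq)

text \<open>Multiplication by theta cancels the denominator of every \<open>ph_fps\<close>, leaving
  the double series of X^(m^2) Y^(n^2) E (2 m n z).\<close>

lemma square_coeff_symmetric: "fps_nth (theta_C * square_fps z N) i = fps_nth (theta_C * square_fps z i) N"
proof -
  have "fps_nth (theta_C * square_fps z N) i = (\<Sum>n | n\<^sup>2 = int N. \<Sum>m | m\<^sup>2 = int i. E (2 * of_int m * (of_int n * z)))" for N i
    by (simp add: square_fps_def sum_distrib_left theta_C_ph_fps fps_sum_nth theta_z_fps_def)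
  then show ?thesis
    using sum.swap[of "\<lambda>n m. E (2 * of_int m * (of_int n * z))" "{m. m\<^sup>2 = int i}" "{n. n\<^sup>2 = int N}"]
    by (simp add: mult_ac)
qed

definition diff_fps :: "complex \<Rightarrow> nat \<Rightarrow> complex fps" where
  "diff_fps z N = exp_fps z N - square_fps z N"

text \<open>After multiplication by theta the coefficient at X^j Y^N equals the one at X^N Y^j,
  which is 0 by hypothesis for j < N. Dividing by the unit \<open>theta_C\<close> preserves the
  order of vanishing.\<close>

lemma diff_fps_low_coeffs:
  assumes "\<And>M. M < N \<Longrightarrow> diff_fps z M = 0" "i < N"
  shows "fps_nth (diff_fps z N) i = 0"
proof -
  have sym: "fps_nth (theta_C * diff_fps z N) j = fps_nth (theta_C * diff_fps z j) N" for j
    unfolding diff_fps_def right_diff_distrib fps_sub_nth prod_coeff_symmetric[of z N j]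
      square_coeff_symmetric[of z N j] by simp
  have low: "fps_nth (theta_C * diff_fps z N) j = 0" if "j < N" for j
    unfolding sym assms(1)[OF that] by simp
  have "inv_theta_C * (theta_C * diff_fps z N) = (theta_C * inv_theta_C) * diff_fps z N"
    by (simp only: mult_ac)
  then have eq: "inv_theta_C * (theta_C * diff_fps z N) = diff_fps z N" by (simp add: theta_C_mult_inv)
  have "fps_nth (inv_theta_C * (theta_C * diff_fps z N)) i = 0"
    unfolding fps_mult_nth[of inv_theta_C]
    by (rule sum.neutral) (use low assms(2) in \<open>auto simp del: fps_mult_nth\<close>)
  then show ?thesis by (simp only: eq)
qed

section \<open>Convergence of the formal series\<close>

lemma card_int_squares_le: "card {m :: int. m\<^sup>2 = int n} \<le> 2"
  using theta_C_bound[of n] by (simp add: theta_C_def theta_fps_def)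

lemma norm_E_square_le:
  assumes "m\<^sup>2 = int n"
  shows "norm (E (2 * of_int m * z)) \<le> exp (2 * pi * \<bar>Im z\<bar> * sqrt (real n))"
proof -
  have "real_of_int (m\<^sup>2) = real_of_int (int n)" using assms by simp
  then have "real_of_int m ^ 2 = real n" by simp
  then have "sqrt (real n) = \<bar>real_of_int m\<bar>" by (metis real_sqrt_abs)
  moreover have "- (real_of_int m * Im z) \<le> \<bar>Im z\<bar> * \<bar>real_of_int m\<bar>"
    by (metis abs_ge_minus_self abs_mult mult.commute)
  ultimately have "2 * pi * (- (real_of_int m * Im z)) \<le> 2 * pi * (\<bar>Im z\<bar> * sqrt (real n))"
    by (intro mult_left_mono) auto
  then show ?thesis unfolding norm_E by (simp add: algebra_simps)
qed

lemma theta_z_fps_bound: "norm (fps_nth (theta_z_fps z) n) \<le> 2 * exp (2 * pi * \<bar>Im z\<bar> * sqrt (real n))"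
proof -
  have "norm (fps_nth (theta_z_fps z) n) \<le> (\<Sum>m | m\<^sup>2 = int n. exp (2 * pi * \<bar>Im z\<bar> * sqrt (real n)))"
    unfolding theta_z_fps_def fps_nth_Abs_fps by (rule sum_norm_le) (auto intro: norm_E_square_le)
  also have "\<dots> \<le> 2 * exp (2 * pi * \<bar>Im z\<bar> * sqrt (real n))"
    using card_int_squares_le[of n] by simp
  finally show ?thesis .
qed

lemma ph_fps_bound:
  "norm (fps_nth (ph_fps z) n) \<le> 2 * (real n + 1) * exp (4 * sqrt (real n) + 2 * pi * \<bar>Im z\<bar> * sqrt (real n))"
proof -
  have "norm (fps_nth (ph_fps z) n) \<le> (\<Sum>i=0..n. exp (4 * sqrt (real n)) * (2 * exp (2 * pi * \<bar>Im z\<bar> * sqrt (real n))))"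
    unfolding ph_fps_def fps_mult_nth
  proof (rule sum_norm_le)
    fix i assume i: "i \<in> {0..n}"
    have "norm (fps_nth inv_theta_C i) \<le> exp (4 * sqrt (real i))" by (rule inv_theta_C_bound)
    also have "\<dots> \<le> exp (4 * sqrt (real n))" using i by simp
    finally have 1: "norm (fps_nth inv_theta_C i) \<le> exp (4 * sqrt (real n))" .
    have "norm (fps_nth (theta_z_fps z) (n - i)) \<le> 2 * exp (2 * pi * \<bar>Im z\<bar> * sqrt (real (n - i)))"
      by (rule theta_z_fps_bound)
    also have "\<dots> \<le> 2 * exp (2 * pi * \<bar>Im z\<bar> * sqrt (real n))"
      using i by (auto intro!: mult_left_mono)
    finally show "norm (fps_nth inv_theta_C i * fps_nth (theta_z_fps z) (n - i)) \<le>
        exp (4 * sqrt (real n)) * (2 * exp (2 * pi * \<bar>Im z\<bar> * sqrt (real n)))"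
      unfolding norm_mult using 1 by (intro mult_mono) auto
  qed
  also have "\<dots> = 2 * (real n + 1) * exp (4 * sqrt (real n) + 2 * pi * \<bar>Im z\<bar> * sqrt (real n))"
    by (simp add: exp_add algebra_simps)
  finally show ?thesis .
qed

lemma square_plus_one_le_exp: "real n + 1 \<le> 2 * exp (sqrt (real n))"
proof -
  have "1 + sqrt (real n) + (sqrt (real n))\<^sup>2 / 2 \<le> exp (sqrt (real n))"
    by (rule exp_lower_Taylor_quadratic) simp
  moreover have "0 \<le> sqrt (real n)" "(sqrt (real n))\<^sup>2 = real n" by simp_all
  ultimately show ?thesis by linarith
qed

lemma ph_fps_bound':
  "norm (fps_nth (ph_fps z) n) \<le> 4 * exp (5 * sqrt (real n)) * exp (2 * pi * \<bar>Im z\<bar> * sqrt (real n))"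
proof -
  have "2 * (real n + 1) * exp (4 * sqrt (real n) + 2 * pi * \<bar>Im z\<bar> * sqrt (real n)) \<le>
     2 * (2 * exp (sqrt (real n))) * exp (4 * sqrt (real n) + 2 * pi * \<bar>Im z\<bar> * sqrt (real n))"
    by (intro mult_right_mono mult_left_mono square_plus_one_le_exp) auto
  also have "\<dots> = 4 * exp (5 * sqrt (real n)) * exp (2 * pi * \<bar>Im z\<bar> * sqrt (real n))"
    by (simp flip: exp_add)
  finally show ?thesis using ph_fps_bound[of z n] by linarith
qed

text \<open>In the term \<open>k\<close> the argument z is multiplied by k while the index i N is
  divided by k^2, so the factor exp (2 pi |Im z| sqrt (i N)) is common to all terms.\<close>

lemma log_coeff_bound:
  assumes N: "N > 0"
  shows "norm (log_coeff i N z) \<le> 8 * real N * exp (5 * sqrt (real (i * N))) * exp (2 * pi * \<bar>Im z\<bar> * sqrt (real (i * N)))"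
proof -
  define S where "S = {k. k dvd i \<and> k dvd N \<and> odd k}"
  define B where "B = 8 * exp (5 * sqrt (real (i * N))) * exp (2 * pi * \<bar>Im z\<bar> * sqrt (real (i * N)))"
  have fin: "finite S" using N by (intro finite_subset[of S "{..N}"]) (auto simp: S_def dest: dvd_imp_le)
  have cS: "card S \<le> N"
  proof -
    have "S \<subseteq> {1..N}" using N by (auto simp: S_def Suc_le_eq dest: dvd_imp_le intro: Nat.gr0I)
    then show ?thesis by (metis card_atLeastAtMost card_mono diff_Suc_1 finite_atLeastAtMost)
  qed
  have "norm (log_coeff i N z) \<le> (\<Sum>k\<in>S. B)"
    unfolding log_coeff_def S_def[symmetric]
  proof (rule sum_norm_le)
    fix k assume k: "k \<in> S"
    define n where "n = i div k * (N div k)"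
    have k0: "k > 0" using k N by (auto simp: S_def intro: Nat.gr0I)
    have nk: "real (i * N) = (real k)\<^sup>2 * real n"
    proof -
      have "k * (i div k) = i" "k * (N div k) = N" using k by (auto simp: S_def)
      moreover have "(k * (i div k)) * (k * (N div k)) = k * k * n" by (simp add: n_def)
      ultimately have "i * N = k * k * n" by simp
      then show ?thesis by (simp add: power2_eq_square)
    qed
    have sq: "sqrt (real (i * N)) = real k * sqrt (real n)" unfolding nk by (simp add: real_sqrt_mult)
    have sqn: "sqrt (real n) \<le> sqrt (real (i * N))"
      unfolding sq using k0 mult_right_mono[of 1 "real k" "sqrt (real n)"] by simp
    have "norm (fps_nth (ph_fps (of_nat k * z)) n) \<le> 4 * exp (5 * sqrt (real n)) * exp (2 * pi * \<bar>Im (of_nat k * z)\<bar> * sqrt (real n))"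
      by (rule ph_fps_bound')
    also have "2 * pi * \<bar>Im (of_nat k * z)\<bar> * sqrt (real n) = 2 * pi * \<bar>Im z\<bar> * sqrt (real (i * N))"
      unfolding sq by (simp add: abs_mult)
    also have "4 * exp (5 * sqrt (real n)) * exp (2 * pi * \<bar>Im z\<bar> * sqrt (real (i * N))) \<le> B / 2"
      unfolding B_def using sqn by (auto intro!: mult_right_mono)
    finally have 1: "norm (fps_nth (ph_fps (of_nat k * z)) n) \<le> B / 2" .
    have "norm (2 / of_nat k * (-1) ^ ((i div k + 1) * (N div k + 1)) :: complex) \<le> 2"
      using k0 by (simp add: norm_mult norm_divide norm_power divide_le_eq)
    then have "norm (2 / of_nat k * (-1) ^ ((i div k + 1) * (N div k + 1)) * fps_nth (ph_fps (of_nat k * z)) n) \<le> 2 * (B / 2)"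
      unfolding norm_mult[of "2 / of_nat k * (-1) ^ ((i div k + 1) * (N div k + 1)) :: complex"] using 1 by (intro mult_mono) auto
    then show "norm (2 / of_nat k * (-1) ^ ((i div k + 1) * (N div k + 1)) * fps_nth (ph_fps (of_nat k * z)) (i div k * (N div k))) \<le> B"
      by (simp add: n_def)
  qed
  also have "\<dots> \<le> real N * B" using cS by (simp add: B_def mult_right_mono)
  finally show ?thesis by (simp add: B_def mult_ac)
qed

text \<open>Growth condition on the coefficients of a Jacobi form of index \<open>N / 2\<close>, holomorphic at
  infinity: the exponents \<open>(i, b)\<close> satisfy \<open>b\<^sup>2 \<le> i N\<close>.\<close>

definition jacobi_growth :: "nat \<Rightarrow> (complex \<Rightarrow> complex fps) \<Rightarrow> bool" where
  "jacobi_growth N F \<longleftrightarrow> (\<forall>R>1. \<exists>C. \<forall>z i. norm (fps_nth (F z) i) \<le> C * R ^ i * exp (2 * pi * \<bar>Im z\<bar> * sqrt (real (i * N))))"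

lemma jacobi_growthI:
  assumes "\<And>z i. norm (fps_nth (F z) i) \<le> A * exp (K * sqrt (real i)) * exp (2 * pi * \<bar>Im z\<bar> * sqrt (real (i * N)))"
    and "A \<ge> 0"
  shows "jacobi_growth N F"
  unfolding jacobi_growth_def
proof (intro allI impI)
  fix R :: real assume "R > 1"
  then obtain C where C: "\<And>n. exp (K * sqrt (real n)) \<le> C * R ^ n" using exp_sqrt_le_power[of R K] by blast
  show "\<exists>C. \<forall>z i. norm (fps_nth (F z) i) \<le> C * R ^ i * exp (2 * pi * \<bar>Im z\<bar> * sqrt (real (i * N)))"
  proof (intro exI allI)
    fix z i
    have "A * exp (K * sqrt (real i)) * exp (2 * pi * \<bar>Im z\<bar> * sqrt (real (i * N))) \<le>
       A * (C * R ^ i) * exp (2 * pi * \<bar>Im z\<bar> * sqrt (real (i * N)))"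
      using C[of i] assms(2) by (intro mult_right_mono mult_left_mono) auto
    then show "norm (fps_nth (F z) i) \<le> (A * C) * R ^ i * exp (2 * pi * \<bar>Im z\<bar> * sqrt (real (i * N)))"
      using assms(1)[of z i] by (simp add: mult.assoc)
  qed
qed

lemma jacobi_growth_add:
  assumes "jacobi_growth N F" "jacobi_growth N G"
  shows "jacobi_growth N (\<lambda>z. F z + G z)"
  unfolding jacobi_growth_def
proof (intro allI impI)
  fix R :: real assume R: "R > 1"
  obtain C1 where C1: "\<And>z i. norm (fps_nth (F z) i) \<le> C1 * R ^ i * exp (2 * pi * \<bar>Im z\<bar> * sqrt (real (i * N)))"
    using assms(1) R unfolding jacobi_growth_def by blast
  obtain C2 where C2: "\<And>z i. norm (fps_nth (G z) i) \<le> C2 * R ^ i * exp (2 * pi * \<bar>Im z\<bar> * sqrt (real (i * N)))"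
    using assms(2) R unfolding jacobi_growth_def by blast
  show "\<exists>C. \<forall>z i. norm (fps_nth (F z + G z) i) \<le> C * R ^ i * exp (2 * pi * \<bar>Im z\<bar> * sqrt (real (i * N)))"
  proof (intro exI allI)
    fix z i
    show "norm (fps_nth (F z + G z) i) \<le> (C1 + C2) * R ^ i * exp (2 * pi * \<bar>Im z\<bar> * sqrt (real (i * N)))"
      using norm_triangle_mono[OF C1[of z i] C2[of z i]] by (simp add: distrib_right)
  qed
qed

text \<open>Cauchy-Schwarz for (sqrt i, sqrt j) and (sqrt M, sqrt N). It makes the growth condition
  multiplicative, with indices adding.\<close>

lemma sqrt_mult_add_le:
  fixes i j M N :: nat
  shows "sqrt (real (i * M)) + sqrt (real (j * N)) \<le> sqrt (real ((i + j) * (M + N)))"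
proof (rule real_le_rsqrt)
  define a b c d where "a = sqrt (real i)" "b = sqrt (real j)" "c = sqrt (real M)" "d = sqrt (real N)"
  have sq: "real i = a\<^sup>2" "real j = b\<^sup>2" "real M = c\<^sup>2" "real N = d\<^sup>2" by (simp_all add: a_b_c_d_def)
  have "(a * c + b * d)\<^sup>2 \<le> (a\<^sup>2 + b\<^sup>2) * (c\<^sup>2 + d\<^sup>2)"
    using zero_le_power2[of "a * d - b * c"] by (simp add: power2_eq_square algebra_simps)
  then show "(sqrt (real (i * M)) + sqrt (real (j * N)))\<^sup>2 \<le> real ((i + j) * (M + N))"
    unfolding of_nat_mult of_nat_add real_sqrt_mult sq[symmetric] by (simp add: a_b_c_d_def)
qed

lemma jacobi_growth_mult:
  assumes "jacobi_growth M F" "jacobi_growth N G"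
  shows "jacobi_growth (M + N) (\<lambda>z. F z * G z)"
  unfolding jacobi_growth_def
proof (intro allI impI)
  fix R :: real assume R: "R > 1"
  \<comment> \<open>One factor r^n serves the two series, the other absorbs the n + 1 terms of the
    convolution.\<close>
  define r where "r = sqrt R"
  have r: "r > 1" "r * r = R" using R by (auto simp: r_def)
  obtain C1 where C1: "\<And>z i. norm (fps_nth (F z) i) \<le> C1 * r ^ i * exp (2 * pi * \<bar>Im z\<bar> * sqrt (real (i * M)))"
    using assms(1) r unfolding jacobi_growth_def by blast
  obtain C2 where C2: "\<And>z i. norm (fps_nth (G z) i) \<le> C2 * r ^ i * exp (2 * pi * \<bar>Im z\<bar> * sqrt (real (i * N)))"
    using assms(2) r unfolding jacobi_growth_def by blast
  have C0: "0 \<le> C1" using order_trans[OF norm_ge_zero C1[of 0 0]] by simp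
  obtain C3 where C3: "\<And>n. exp (1 * sqrt (real n)) \<le> C3 * r ^ n" using exp_sqrt_le_power[of r 1] r by blast
  show "\<exists>C. \<forall>z i. norm (fps_nth (F z * G z) i) \<le> C * R ^ i * exp (2 * pi * \<bar>Im z\<bar> * sqrt (real (i * (M + N))))"
  proof (intro exI allI)
    fix z n
    define e where "e = exp (2 * pi * \<bar>Im z\<bar> * sqrt (real (n * (M + N))))"
    have C02: "0 \<le> C2" using order_trans[OF norm_ge_zero C2[of 0 0]] by simp
    have "norm (fps_nth (F z * G z) n) \<le> (\<Sum>i=0..n. C1 * C2 * r ^ n * e)"
      unfolding fps_mult_nth
    proof (rule sum_norm_le)
      fix i assume i: "i \<in> {0..n}"
      have "norm (fps_nth (F z) i * fps_nth (G z) (n - i)) \<le>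
         (C1 * r ^ i * exp (2 * pi * \<bar>Im z\<bar> * sqrt (real (i * M)))) * (C2 * r ^ (n - i) * exp (2 * pi * \<bar>Im z\<bar> * sqrt (real ((n - i) * N))))"
        unfolding norm_mult using C0 r by (intro mult_mono C1 C2) auto
      also have "\<dots> = C1 * C2 * (r ^ i * r ^ (n - i)) * exp (2 * pi * \<bar>Im z\<bar> * (sqrt (real (i * M)) + sqrt (real ((n - i) * N))))"
        by (simp add: distrib_left exp_add mult_ac)
      also have "r ^ i * r ^ (n - i) = r ^ n" using i by (simp flip: power_add)
      also have "C1 * C2 * r ^ n * exp (2 * pi * \<bar>Im z\<bar> * (sqrt (real (i * M)) + sqrt (real ((n - i) * N)))) \<le> C1 * C2 * r ^ n * e"
        unfolding e_def using sqrt_mult_add_le[of i M "n - i" N] i C0 C02 r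
        by (intro mult_left_mono) (auto intro!: mult_left_mono)
      finally show "norm (fps_nth (F z) i * fps_nth (G z) (n - i)) \<le> C1 * C2 * r ^ n * e" .
    qed
    also have "\<dots> = C1 * C2 * r ^ n * e * (real n + 1)" by (simp add: algebra_simps)
    also have "real n + 1 \<le> 2 * (C3 * r ^ n)" using square_plus_one_le_exp[of n] C3[of n] by simp
    then have "C1 * C2 * r ^ n * e * (real n + 1) \<le> C1 * C2 * r ^ n * e * (2 * (C3 * r ^ n))"
      using C0 C02 r by (intro mult_left_mono) (auto simp: e_def)
    also have "\<dots> = 2 * C1 * C2 * C3 * R ^ n * e"
      unfolding r(2)[symmetric] power_mult_distrib by simp
    finally show "norm (fps_nth (F z * G z) n) \<le> (2 * C1 * C2 * C3) * R ^ n * exp (2 * pi * \<bar>Im z\<bar> * sqrt (real (n * (M + N))))"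
      by (simp add: e_def)
  qed
qed

lemma jacobi_growth_const: "jacobi_growth 0 (\<lambda>_. fps_const c)"
  by (rule jacobi_growthI[of _ "norm c" 0]) auto

lemma jacobi_growth_cmult: "jacobi_growth N F \<Longrightarrow> jacobi_growth N (\<lambda>z. fps_const c * F z)"
  using jacobi_growth_mult[OF jacobi_growth_const, of N F c] by simp

lemma jacobi_growth_zero: "jacobi_growth N (\<lambda>_. 0)"
  by (rule jacobi_growthI[of _ 0 0]) auto

lemma jacobi_growth_sum:
  assumes "finite A" "\<And>x. x \<in> A \<Longrightarrow> jacobi_growth N (F x)"
  shows "jacobi_growth N (\<lambda>z. \<Sum>x\<in>A. F x z)"
  using assms by (induction A rule: finite_induct) (auto intro: jacobi_growth_zero jacobi_growth_add)

lemma jacobi_growth_log_fps: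
  assumes "N > 0"
  shows "jacobi_growth N (\<lambda>z. log_fps z N)"
  by (rule jacobi_growthI[of _ "8 * real N" "5 * sqrt (real N)"])
     (use log_coeff_bound[OF assms] in \<open>auto simp: log_fps_def real_sqrt_mult mult_ac\<close>)

lemma jacobi_growth_exp_fps: "jacobi_growth N (\<lambda>z. exp_fps z N)"
proof (induction N rule: less_induct)
  case (less N)
  show ?case
  proof (cases "N = 0")
    case True
    then show ?thesis using jacobi_growth_const[of 1] by simp
  next
    case False
    have "jacobi_growth N (\<lambda>z. of_nat M * log_fps z M * exp_fps z (N - M))" if M: "M \<in> {1..N}" for M
    proof -
      have "jacobi_growth (M + (N - M)) (\<lambda>z. (fps_const (of_nat M) * log_fps z M) * exp_fps z (N - M))"
        using M by (intro jacobi_growth_mult jacobi_growth_cmult jacobi_growth_log_fps less) auto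
      then show ?thesis using M by (simp add: fps_of_nat)
    qed
    then have "jacobi_growth N (\<lambda>z. fps_const (1 / of_nat N) * (\<Sum>M\<in>{1..N}. of_nat M * log_fps z M * exp_fps z (N - M)))"
      by (intro jacobi_growth_cmult jacobi_growth_sum) auto
    then show ?thesis using False by (simp add: exp_fps.simps[of _ N])
  qed
qed

lemma jacobi_growth_square_fps: "jacobi_growth N (\<lambda>z. square_fps z N)"
  unfolding square_fps_def
proof (rule jacobi_growth_sum)
  fix n assume n: "n \<in> {n. n\<^sup>2 = int N}"
  then have "real_of_int (n\<^sup>2) = real_of_int (int N)" by simp
  then have "real N = (real_of_int n)\<^sup>2" by simp
  then have sN: "sqrt (real (i * N)) = \<bar>real_of_int n\<bar> * sqrt (real i)" for i by (simp add: real_sqrt_mult mult.commute)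
  show "jacobi_growth N (\<lambda>z. ph_fps (of_int n * z))"
  proof (rule jacobi_growthI[of _ 4 5])
    fix z i
    have "2 * pi * \<bar>Im (of_int n * z)\<bar> * sqrt (real i) = 2 * pi * \<bar>Im z\<bar> * sqrt (real (i * N))"
      unfolding sN by (simp add: abs_mult)
    then show "norm (fps_nth (ph_fps (of_int n * z)) i) \<le> 4 * exp (5 * sqrt (real i)) * exp (2 * pi * \<bar>Im z\<bar> * sqrt (real (i * N)))"
      using ph_fps_bound'[of "of_int n * z" i] by (simp only:)
  qed simp
qed simp

lemma jacobi_growth_diff_fps: "jacobi_growth N (\<lambda>z. diff_fps z N)"
  using jacobi_growth_add[OF jacobi_growth_exp_fps[of N] jacobi_growth_cmult[OF jacobi_growth_square_fps[of N], of "-1"]]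
  by (simp add: diff_fps_def fps_const_neg[symmetric] del: fps_const_neg)

lemma jacobi_growth_radius:
  assumes "jacobi_growth N F"
  shows "fps_conv_radius (F z) \<ge> 1"
proof (rule fps_conv_radius_ge_1)
  fix R :: real assume R: "R > 1"
  define r where "r = sqrt R"
  have r: "r > 1" "r * r = R" using R by (auto simp: r_def)
  obtain C where C: "\<And>z i. norm (fps_nth (F z) i) \<le> C * r ^ i * exp (2 * pi * \<bar>Im z\<bar> * sqrt (real (i * N)))"
    using assms(1) r unfolding jacobi_growth_def by blast
  have C0: "0 \<le> C" using order_trans[OF norm_ge_zero C[of 0 0]] by simp
  obtain C3 where C3: "\<And>n. exp ((2 * pi * \<bar>Im z\<bar> * sqrt (real N)) * sqrt (real n)) \<le> C3 * r ^ n"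
    using exp_sqrt_le_power[of r] r by blast
  show "\<exists>C. \<forall>n. norm (fps_nth (F z) n) \<le> C * R ^ n"
  proof (intro exI allI)
    fix n
    have "norm (fps_nth (F z) n) \<le> C * r ^ n * exp (2 * pi * \<bar>Im z\<bar> * sqrt (real (n * N)))" by (rule C)
    also have "2 * pi * \<bar>Im z\<bar> * sqrt (real (n * N)) = (2 * pi * \<bar>Im z\<bar> * sqrt (real N)) * sqrt (real n)"
      by (simp add: real_sqrt_mult)
    also have "C * r ^ n * exp \<dots> \<le> C * r ^ n * (C3 * r ^ n)" using C0 r C3 by (intro mult_left_mono) auto
    also have "\<dots> = (C * C3) * R ^ n" unfolding r(2)[symmetric] power_mult_distrib by simp
    finally show "norm (fps_nth (F z) n) \<le> (C * C3) * R ^ n" .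
  qed
qed

lemma radius_E:
  assumes "fps_conv_radius F \<ge> 1" "Im \<tau> > 0"
  shows "ereal (norm (E \<tau>)) < fps_conv_radius F"
  using less_le_trans[of "ereal (norm (E \<tau>))" 1] assms norm_E_less_1 by auto

lemma jacobi_growth_ph_fps: "jacobi_growth 1 ph_fps"
  by (rule jacobi_growthI[of _ 4 5]) (use ph_fps_bound' in auto)

lemma theta_z_fps_eval:
  assumes \<tau>: "Im \<tau> > 0"
  shows "eval_fps (theta_z_fps z) (E \<tau>) = th \<tau> z"
proof -
  define B where "B = (\<lambda>k. {n :: int. n\<^sup>2 = int k})"
  define f where "f n = E (of_int n ^ 2 * \<tau> + 2 * of_int n * z)" for n :: int
  have "(f has_sum th \<tau> z) UNIV" unfolding f_def by (rule th_has_sum[OF \<tau>])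
  also have "(UNIV :: int set) = snd ` Sigma UNIV B"
  proof -
    have "n \<in> snd ` Sigma UNIV B" for n
      by (rule image_eqI[of _ _ "(nat (n\<^sup>2), n)"]) (auto simp: B_def)
    then show ?thesis by blast
  qed
  finally have "((\<lambda>p. f (snd p)) has_sum th \<tau> z) (Sigma UNIV B)"
    by (subst (asm) has_sum_reindex) (auto simp: inj_on_def B_def o_def)
  then have "((\<lambda>k. \<Sum>n\<in>B k. f n) has_sum th \<tau> z) UNIV"
    by (rule has_sum_SigmaD) (auto intro!: has_sum_finiteI simp: B_def)
  moreover have "(\<Sum>n\<in>B k. f n) = fps_nth (theta_z_fps z) k * E \<tau> ^ k" for k
    unfolding theta_z_fps_def fps_nth_Abs_fps sum_distrib_right B_def
  proof (rule sum.cong)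
    fix n assume "n \<in> {n. n\<^sup>2 = int k}"
    then have "(of_int (n\<^sup>2) :: complex) = of_int (int k)" by simp
    then have "(of_int n ^ 2 :: complex) = of_nat k" by simp
    then show "f n = E (2 * of_int n * z) * E \<tau> ^ k" by (simp add: f_def E_power E_add)
  qed simp
  ultimately have "(\<lambda>k. fps_nth (theta_z_fps z) k * E \<tau> ^ k) sums th \<tau> z"
    by (simp add: has_sum_imp_sums)
  then show ?thesis by (simp add: eval_fps_def sums_iff)
qed

lemma ph_fps_eval:
  assumes \<tau>: "Im \<tau> > 0"
  shows "eval_fps (ph_fps z) (E \<tau>) = ph \<tau> z"
proof -
  have "eval_fps theta_C (E \<tau>) * eval_fps (ph_fps z) (E \<tau>) = eval_fps (theta_C * ph_fps z) (E \<tau>)"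
    by (rule eval_fps_mult[symmetric]; rule radius_E)
       (use \<tau> fps_conv_radius_theta_C jacobi_growth_radius[OF jacobi_growth_ph_fps] in auto)
  then have "th \<tau> 0 * eval_fps (ph_fps z) (E \<tau>) = th \<tau> z"
    by (simp add: theta_C_ph_fps theta_z_fps_eval[OF \<tau>] eval_theta_C[OF \<tau>])
  then show ?thesis using th_0_nonzero[OF \<tau>] by (simp add: ph_def field_simps)
qed

section \<open>Fourier expansion of the Hecke images\<close>

definition hecke_shifts :: "nat \<Rightarrow> int set" where
  "hecke_shifts d = {b. 0 \<le> b \<and> b < 2 * int d \<and> odd (b + int d)}"

lemma hecke_shifts_eq: "hecke_shifts d = (\<lambda>j. int ((d + 1) mod 2) + 2 * int j) ` {..<d}"
proof (intro equalityI subsetI)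
  fix b assume b: "b \<in> hecke_shifts d"
  define j where "j = nat ((b - int ((d + 1) mod 2)) div 2)"
  have par: "even (b - int ((d + 1) mod 2))" using b by (auto simp: hecke_shifts_def mod2_eq_if)
  have "b \<ge> int ((d + 1) mod 2)" using b by (cases "b = 0") (auto simp: hecke_shifts_def mod2_eq_if)
  then have bj: "b = int ((d + 1) mod 2) + 2 * int j" using par by (auto simp: j_def elim: evenE)
  then have "j < d" using b by (auto simp: hecke_shifts_def)
  then show "b \<in> (\<lambda>j. int ((d + 1) mod 2) + 2 * int j) ` {..<d}" using bj by blast
next
  fix b assume "b \<in> (\<lambda>j. int ((d + 1) mod 2) + 2 * int j) ` {..<d}"
  then obtain j where j: "j < d" "b = int ((d + 1) mod 2) + 2 * int j" by blast
  then show "b \<in> hecke_shifts d" by (auto simp: hecke_shifts_def mod2_eq_if)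
qed

lemma finite_hecke_shifts: "finite (hecke_shifts d)" by (simp add: hecke_shifts_eq)

text \<open>The shifts are e + 2 j for j < d with e the parity of d + 1, so this is a geometric sum
  over powers of a d-th root of unity; the first shift e leaves the sign.\<close>

lemma sum_hecke_shifts:
  assumes d: "d > 0"
  shows "(\<Sum>b\<in>hecke_shifts d. E (of_nat n * of_int b / of_nat d)) =
     (if d dvd n then of_nat d * (-1) ^ ((n div d) * (d + 1)) else 0)"
proof -
  define e where "e = (d + 1) mod 2"
  define w where "w = E (2 * (of_nat n / of_nat d))"
  have "inj_on (\<lambda>j. int e + 2 * int j) {..<d}" by (auto simp: inj_on_def)
  then have "(\<Sum>b\<in>hecke_shifts d. E (of_nat n * of_int b / of_nat d)) = (\<Sum>j<d. E (of_nat n * of_int (int e + 2 * int j) / of_nat d))"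
    unfolding hecke_shifts_eq e_def[symmetric] by (simp add: sum.reindex)
  also have "\<dots> = (\<Sum>j<d. E (of_nat n * of_nat e / of_nat d) * w ^ j)"
    unfolding w_def E_power E_add[symmetric] using d
    by (intro sum.cong refl arg_cong[of _ _ E]) (simp add: field_simps)
  also have "\<dots> = E (of_nat n * of_nat e / of_nat d) * (\<Sum>j<d. w ^ j)" by (simp add: sum_distrib_left)
  finally have *: "(\<Sum>b\<in>hecke_shifts d. E (of_nat n * of_int b / of_nat d)) = E (of_nat n * of_nat e / of_nat d) * (\<Sum>j<d. w ^ j)" .
  have w1: "w = 1 \<longleftrightarrow> d dvd n"
  proof
    assume "w = 1"
    then have "of_nat n / of_nat d \<in> (\<int> :: complex set)" unfolding w_def E_eq_1_iff .
    then obtain k where "of_nat n / of_nat d = (of_int k :: complex)" by (auto elim: Ints_cases)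
    then have "(of_nat n :: complex) = of_int k * of_nat d" using d by (simp add: field_simps)
    then have "of_int (int n) = (of_int (k * int d) :: complex)" by simp
    then have "int n = k * int d" by (simp only: of_int_eq_iff)
    then show "d dvd n" by (metis dvd_triv_right int_dvd_int_iff)
  next
    assume "d dvd n"
    then obtain m where "n = d * m" by blast
    then show "w = 1" using d E_2_int[of "int m"] by (simp add: w_def)
  qed
  show ?thesis
  proof (cases "d dvd n")
    case True
    then obtain m where m: "n = d * m" by blast
    have "E (of_nat n * of_nat e / of_nat d) = E (of_int (int (m * e)))" using d by (simp add: m)
    also have "\<dots> = (-1) ^ (m * (d + 1))"
    proof (cases "even (m * e)")
      case True
      then have "even (m * (d + 1))" by (auto simp: e_def mod2_eq_if split: if_splits)
      then show ?thesis using True E_even_int[of "int (m * e)"] by simp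
    next
      case False
      then have "odd (m * (d + 1))" by (auto simp: e_def mod2_eq_if split: if_splits)
      then show ?thesis using False E_odd_int[of "int (m * e)"] by simp
    qed
    finally show ?thesis using * w1 True d by (simp add: m mult.commute)
  next
    case False
    have "w ^ d = 1" using d E_2_int[of "int n"] by (simp add: w_def E_power)
    then have "(\<Sum>j<d. w ^ j) = 0" using False w1 by (simp add: sum_gp_strict)
    then show ?thesis using * False by simp
  qed
qed

lemma psi_eq_divisor_sum:
  assumes N: "N > 0"
  shows "psi N \<tau> z = (\<Sum>k | k dvd N \<and> odd k. \<Sum>b\<in>hecke_shifts (N div k).
     ph ((of_nat k * \<tau> + of_int b) / of_nat (N div k)) (of_nat k * z))"
proof -
  define S where "S = {k. k dvd N \<and> odd k}"
  have fin: "finite S" unfolding S_def by (rule finite_subset[of _ "{..N}"]) (use N in \<open>auto dest: dvd_imp_le\<close>)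
  define h where "h = (\<lambda>(k, b :: int). (int k, b, 0 :: int, int (N div k)))"
  have img: "hecke_reps (int N) = h ` Sigma S (\<lambda>k. hecke_shifts (N div k))"
  proof (intro equalityI subsetI)
    fix M assume "M \<in> hecke_reps (int N)"
    then obtain a b d where M: "M = (a, b, 0, d)" "a > 0" "d > 0" "a * d = int N" "odd a" "0 \<le> b" "b < 2 * d" "odd (b + d)"
      by (elim hecke_repsE)
    define k where "k = nat a"
    have k: "a = int k" using M by (simp add: k_def)
    define e where "e = nat d"
    have e: "d = int e" using M by (simp add: e_def)
    have "k * e = N" using M(4) unfolding k e by (simp flip: of_nat_mult)
    then have "N div k = e" "k \<in> S" using M k by (auto simp: S_def)
    then have "M = h (k, b)" "(k, b) \<in> Sigma S (\<lambda>k. hecke_shifts (N div k))"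
      using M by (auto simp: h_def k e hecke_shifts_def)
    then show "M \<in> h ` Sigma S (\<lambda>k. hecke_shifts (N div k))" by blast
  next
    fix M assume "M \<in> h ` Sigma S (\<lambda>k. hecke_shifts (N div k))"
    then obtain k b where kb: "M = h (k, b)" "k dvd N" "odd k" "b \<in> hecke_shifts (N div k)" by (auto simp: S_def)
    obtain e where e: "N = k * e" using kb by blast
    have "k > 0" "e > 0" "N div k = e" using e N by auto
    then show "M \<in> hecke_reps (int N)" using kb e by (simp add: h_def hecke_reps_def hecke_shifts_def)
  qed
  have "inj_on h (Sigma S (\<lambda>k. hecke_shifts (N div k)))" by (auto simp: inj_on_def h_def)
  then have "psi N \<tau> z = (\<Sum>(k, b)\<in>Sigma S (\<lambda>k. hecke_shifts (N div k)).
     ph ((of_nat k * \<tau> + of_int b) / of_nat (N div k)) (of_nat k * z))"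
    unfolding psi_def img by (simp add: sum.reindex h_def case_prod_unfold)
  also have "\<dots> = (\<Sum>k\<in>S. \<Sum>b\<in>hecke_shifts (N div k).
     ph ((of_nat k * \<tau> + of_int b) / of_nat (N div k)) (of_nat k * z))"
    by (rule sum.Sigma[symmetric]) (use fin finite_hecke_shifts in auto)
  finally show ?thesis by (simp add: S_def)
qed

lemma ph_sums:
  assumes "Im \<tau> > 0"
  shows "(\<lambda>n. fps_nth (ph_fps z) n * E \<tau> ^ n) sums ph \<tau> z"
  using sums_eval_fps[OF radius_E[OF jacobi_growth_radius[OF jacobi_growth_ph_fps] assms], of z]
  by (simp add: ph_fps_eval[OF assms])

text \<open>Summing over b retains only exponents n = d m, and the point (k \<tau> + b) / d turns
  these into X^(k m). This is the origin of the index (i div k) * d at X^i.\<close>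

lemma hecke_inner_sums:
  assumes \<tau>: "Im \<tau> > 0" and kd: "k > 0" "d > 0"
  shows "(\<lambda>i. if k dvd i then of_nat d * (-1) ^ ((i div k) * (d + 1)) * fps_nth (ph_fps z) (i div k * d) * E \<tau> ^ i else 0)
     sums (\<Sum>b\<in>hecke_shifts d. ph ((of_nat k * \<tau> + of_int b) / of_nat d) z)" (is "?G sums ?S")
proof -
  define F where "F n = fps_nth (ph_fps z) n * E (of_nat n * of_nat k * \<tau> / of_nat d) *
     (if d dvd n then of_nat d * (-1) ^ ((n div d) * (d + 1)) else 0)" for n
  have "(\<lambda>n. \<Sum>b\<in>hecke_shifts d. fps_nth (ph_fps z) n * E ((of_nat k * \<tau> + of_int b) / of_nat d) ^ n) sums ?S"
  proof (rule sums_sum, rule ph_sums)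
    fix b
    show "Im ((of_nat k * \<tau> + of_int b) / of_nat d) > 0"
      using Im_hecke[of "int k" "int d" \<tau> b] kd \<tau> by simp
  qed
  moreover have "(\<Sum>b\<in>hecke_shifts d. fps_nth (ph_fps z) n * E ((of_nat k * \<tau> + of_int b) / of_nat d) ^ n) = F n" for n
  proof -
    have "E ((of_nat k * \<tau> + of_int b) / of_nat d) ^ n = E (of_nat n * of_nat k * \<tau> / of_nat d) * E (of_nat n * of_int b / of_nat d)" for b
      unfolding E_power E_add[symmetric] using kd by (simp add: field_simps)
    then show ?thesis
      unfolding F_def sum_hecke_shifts[OF kd(2), symmetric] by (simp add: sum_distrib_left mult_ac)
  qed
  ultimately have "F sums ?S" by simp
  moreover have "strict_mono (\<lambda>m. d * m)" using kd by (auto simp: strict_mono_def)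
  then have "(\<lambda>m. F (d * m)) sums ?S \<longleftrightarrow> F sums ?S"
    by (rule sums_mono_reindex) (auto simp: F_def)
  ultimately have "(\<lambda>m. F (d * m)) sums ?S" by simp
  also have "(\<lambda>m. F (d * m)) = (\<lambda>m. ?G (k * m))"
  proof
    fix m
    have "E (of_nat (d * m) * of_nat k * \<tau> / of_nat d) = E \<tau> ^ (k * m)"
      unfolding E_power using kd by (simp add: field_simps)
    then show "F (d * m) = ?G (k * m)" using kd by (simp add: F_def mult_ac)
  qed
  finally have "(\<lambda>m. ?G (k * m)) sums ?S" .
  moreover have "strict_mono (\<lambda>m. k * m)" using kd by (auto simp: strict_mono_def)
  then have "(\<lambda>m. ?G (k * m)) sums ?S \<longleftrightarrow> ?G sums ?S"
    by (rule sums_mono_reindex) auto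
  ultimately show ?thesis by simp
qed

text \<open>For N = k d one has 2 / k = (2 / N) d, and since k is odd N and d have equal parity,
  which separates the sign (-1)^(N + 1). So the symmetric \<open>log_coeff\<close> is indeed the
  expansion of a Hecke image.\<close>

lemma log_fps_eval:
  assumes \<tau>: "Im \<tau> > 0" and N: "N > 0"
  shows "eval_fps (log_fps z N) (E \<tau>) = 2 / of_nat N * (-1) ^ (N + 1) * psi N \<tau> z"
proof -
  define S where "S = {k. k dvd N \<and> odd k}"
  have fin: "finite S" unfolding S_def by (rule finite_subset[of _ "{..N}"]) (use N in \<open>auto dest: dvd_imp_le\<close>)
  define G where "G k i = (if k dvd i then of_nat (N div k) * (-1) ^ ((i div k) * (N div k + 1)) *
     fps_nth (ph_fps (of_nat k * z)) (i div k * (N div k)) * E \<tau> ^ i else 0)" for k i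
  have kN: "k > 0" "N div k > 0" if "k \<in> S" for k
    using that N by (auto simp: S_def div_greater_zero_iff dest: dvd_imp_le intro: dvd_pos_nat)
  have "(\<lambda>i. \<Sum>k\<in>S. G k i) sums psi N \<tau> z"
    unfolding psi_eq_divisor_sum[OF N] S_def[symmetric] G_def
    by (rule sums_sum, rule hecke_inner_sums[OF \<tau>]) (use kN in auto)
  then have "(\<lambda>i. 2 / of_nat N * (-1) ^ (N + 1) * (\<Sum>k\<in>S. G k i)) sums (2 / of_nat N * (-1) ^ (N + 1) * psi N \<tau> z)"
    by (rule sums_mult)
  moreover have "2 / of_nat N * (-1) ^ (N + 1) * (\<Sum>k\<in>S. G k i) = fps_nth (log_fps z N) i * E \<tau> ^ i" for i
  proof -
    have "fps_nth (log_fps z N) i * E \<tau> ^ i = (\<Sum>k\<in>{k\<in>S. k dvd i}. 2 / of_nat k * (-1) ^ ((i div k + 1) * (N div k + 1)) *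
        fps_nth (ph_fps (of_nat k * z)) (i div k * (N div k)) * E \<tau> ^ i)"
      unfolding log_fps_def fps_nth_Abs_fps log_coeff_def sum_distrib_right
      by (rule sum.cong) (auto simp: S_def)
    also have "\<dots> = (\<Sum>k\<in>S. 2 / of_nat N * (-1) ^ (N + 1) * G k i)"
      unfolding sum.inter_filter[OF fin]
    proof (rule sum.cong)
      fix k assume k: "k \<in> S"
      define d where "d = N div k"
      have d: "N = k * d" using k by (simp add: S_def d_def)
      have kd: "k > 0" "d > 0" using kN[OF k] by (auto simp: d_def)
      have "even N = even d" using k d by (auto simp: S_def)
      then have "(-1 :: complex) ^ (N + 1) = (-1) ^ (d + 1)" by (simp add: uminus_power_if)
      then have "(-1 :: complex) ^ ((i div k + 1) * (d + 1)) = (-1) ^ (N + 1) * (-1) ^ ((i div k) * (d + 1))"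
        by (simp add: distrib_right power_add mult.commute)
      moreover have "2 / of_nat k = 2 / of_nat N * (of_nat d :: complex)" using kd by (simp add: d)
      ultimately show "(if k dvd i then 2 / of_nat k * (-1) ^ ((i div k + 1) * (N div k + 1)) *
          fps_nth (ph_fps (of_nat k * z)) (i div k * (N div k)) * E \<tau> ^ i else 0) = 2 / of_nat N * (-1) ^ (N + 1) * G k i"
        unfolding G_def d_def[symmetric] by simp
    qed simp
    finally show ?thesis by (simp add: sum_distrib_left)
  qed
  ultimately have "(\<lambda>i. fps_nth (log_fps z N) i * E \<tau> ^ i) sums (2 / of_nat N * (-1) ^ (N + 1) * psi N \<tau> z)"
    by simp
  then show ?thesis by (simp add: eval_fps_def sums_iff)
qed

definition ell :: "nat \<Rightarrow> complex \<Rightarrow> complex \<Rightarrow> complex" where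
  "ell N \<tau> z = 2 / of_nat N * (-1) ^ (N + 1) * psi N \<tau> z"

definition exp_val :: "nat \<Rightarrow> complex \<Rightarrow> complex \<Rightarrow> complex" where
  "exp_val N \<tau> z = eval_fps (exp_fps z N) (E \<tau>)"

definition square_val :: "nat \<Rightarrow> complex \<Rightarrow> complex \<Rightarrow> complex" where
  "square_val N \<tau> z = (\<Sum>n | n\<^sup>2 = int N. ph \<tau> (of_int n * z))"

definition diff_val :: "nat \<Rightarrow> complex \<Rightarrow> complex \<Rightarrow> complex" where
  "diff_val N \<tau> z = exp_val N \<tau> z - square_val N \<tau> z"

lemma eval_fps_sum:
  fixes F :: "'b \<Rightarrow> complex fps"
  assumes "finite A" "\<And>x. x \<in> A \<Longrightarrow> ereal (norm q) < fps_conv_radius (F x)"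
  shows "eval_fps (sum F A) q = (\<Sum>x\<in>A. eval_fps (F x) q) \<and> ereal (norm q) < fps_conv_radius (sum F A)"
  using assms
proof (induction A rule: finite_induct)
  case (insert x A)
  then have "ereal (norm q) < min (fps_conv_radius (F x)) (fps_conv_radius (sum F A))" by auto
  then have "ereal (norm q) < fps_conv_radius (F x + sum F A)"
    using less_le_trans[OF _ fps_conv_radius_add] by blast
  then show ?case using insert by (auto simp: eval_fps_add)
qed auto

lemma exp_val_0 [simp]: "exp_val 0 \<tau> z = 1" by (simp add: exp_val_def)

lemma exp_val_rec:
  assumes \<tau>: "Im \<tau> > 0"
  shows "of_nat N * exp_val N \<tau> z = (\<Sum>M\<in>{1..N}. of_nat M * ell M \<tau> z * exp_val (N - M) \<tau> z)"
proof -
  have rE: "ereal (norm (E \<tau>)) < fps_conv_radius (exp_fps z N)" for N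
    by (rule radius_E[OF jacobi_growth_radius[OF jacobi_growth_exp_fps] \<tau>])
  have rL: "ereal (norm (E \<tau>)) < fps_conv_radius (log_fps z M)" if "M > 0" for M
    by (rule radius_E[OF jacobi_growth_radius[OF jacobi_growth_log_fps[OF that]] \<tau>])
  have nat: "ereal (norm (E \<tau>)) < fps_conv_radius (of_nat M :: complex fps)" "eval_fps (of_nat M) (E \<tau>) = of_nat M" for M
    by (simp_all flip: fps_of_nat)
  have m: "ereal (norm (E \<tau>)) < fps_conv_radius (F * G)" if "ereal (norm (E \<tau>)) < fps_conv_radius F" "ereal (norm (E \<tau>)) < fps_conv_radius G" for F G :: "complex fps"
    using less_le_trans[OF _ fps_conv_radius_mult[of F G]] that by simp
  have "of_nat N * exp_val N \<tau> z = eval_fps (of_nat N * exp_fps z N) (E \<tau>)"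
    by (simp add: eval_fps_mult nat rE exp_val_def)
  also have "\<dots> = (\<Sum>M\<in>{1..N}. eval_fps (of_nat M * log_fps z M * exp_fps z (N - M)) (E \<tau>))"
    unfolding exp_fps_rec by (rule conjunct1[OF eval_fps_sum]) (auto intro!: m nat rL rE)
  also have "\<dots> = (\<Sum>M\<in>{1..N}. of_nat M * ell M \<tau> z * exp_val (N - M) \<tau> z)"
  proof (rule sum.cong)
    fix M assume "M \<in> {1..N}"
    then have M: "M > 0" by simp
    show "eval_fps (of_nat M * log_fps z M * exp_fps z (N - M)) (E \<tau>) = of_nat M * ell M \<tau> z * exp_val (N - M) \<tau> z"
      by (simp add: eval_fps_mult m nat rL[OF M] rE exp_val_def ell_def log_fps_eval[OF \<tau> M])
  qed simp
  finally show ?thesis .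
qed

lemma square_fps_eval:
  assumes \<tau>: "Im \<tau> > 0"
  shows "eval_fps (square_fps z N) (E \<tau>) = square_val N \<tau> z"
  unfolding square_fps_def square_val_def
  by (subst conjunct1[OF eval_fps_sum])
     (auto intro!: radius_E jacobi_growth_radius[OF jacobi_growth_ph_fps] \<tau> simp: ph_fps_eval[OF \<tau>])

lemma diff_fps_eval:
  assumes \<tau>: "Im \<tau> > 0"
  shows "eval_fps (diff_fps z N) (E \<tau>) = diff_val N \<tau> z"
  unfolding diff_fps_def diff_val_def exp_val_def square_fps_eval[OF \<tau>, symmetric]
  by (rule eval_fps_diff; rule radius_E[OF _ \<tau>])
     (rule jacobi_growth_radius[OF jacobi_growth_exp_fps] jacobi_growth_radius[OF jacobi_growth_square_fps])+

text \<open>\<open>E\<close> maps the upper half-plane onto the punctured unit disc, and continuity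
  fills in the centre.\<close>

lemma diff_fps_eq_0I:
  assumes "\<And>\<tau>. Im \<tau> > 0 \<Longrightarrow> diff_val N \<tau> z = 0"
  shows "diff_fps z N = 0"
proof (rule eval_fps_eqD)
  have r: "fps_conv_radius (diff_fps z N) \<ge> 1"
    by (rule jacobi_growth_radius[OF jacobi_growth_diff_fps])
  then show r0: "fps_conv_radius (diff_fps z N) > 0" by (rule less_le_trans[rotated]) simp
  show "fps_conv_radius (0 :: complex fps) > 0" by simp
  have nz: "eval_fps (diff_fps z N) q = 0" if q: "q \<noteq> 0" "norm q < 1" for q
  proof -
    define \<tau> where "\<tau> = Ln q / (of_real pi * \<i>)"
    have E: "E \<tau> = q" using q by (simp add: \<tau>_def E_def)
    have "exp (- pi * Im \<tau>) < 1" using q E norm_E[of \<tau>] by simp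
    then have "Im \<tau> > 0" by (simp add: zero_less_mult_iff)
    then show ?thesis using assms diff_fps_eval[of \<tau> z N] by (simp add: E)
  qed
  have "isCont (eval_fps (diff_fps z N)) 0"
    using continuous_on_eval_fps[of "diff_fps z N"] r0 open_eball
    by (simp add: continuous_on_eq_continuous_at zero_ereal_def)
  moreover have "(eval_fps (diff_fps z N) \<longlongrightarrow> 0) (at 0)"
  proof (rule tendsto_eventually)
    have "\<forall>\<^sub>F q in at (0 :: complex). q \<noteq> 0 \<and> q \<in> ball 0 1"
      by (intro eventually_conj eventually_at_in_open' eventually_neq_at_within) auto
    then show "\<forall>\<^sub>F q in at 0. eval_fps (diff_fps z N) q = 0"
      by eventually_elim (auto intro: nz)
  qed
  ultimately have "eval_fps (diff_fps z N) 0 = 0"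
    using LIM_unique isCont_def by blast
  then have "eval_fps (diff_fps z N) q = 0" if "norm q < 1" for q using nz that by (cases "q = 0") auto
  then show "\<forall>\<^sub>F q in nhds 0. eval_fps (diff_fps z N) q = eval_fps 0 q"
    using eventually_nhds_in_open[of "ball 0 1" "0 :: complex"] by (auto elim: eventually_mono)
qed

section \<open>Transformation laws and the maximum principle\<close>

text \<open>The recursion is homogeneous if place M has weight M. In this way transformation factors
  u^M pass from \<open>psi\<close> to the exponential.\<close>

lemma exp_rec_scale:
  fixes q q' l l' :: "nat \<Rightarrow> complex"
  assumes "q 0 = 1" "\<And>N. of_nat N * q N = (\<Sum>M\<in>{1..N}. of_nat M * l M * q (N - M))"
    and "q' 0 = 1" "\<And>N. of_nat N * q' N = (\<Sum>M\<in>{1..N}. of_nat M * l' M * q' (N - M))"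
    and "\<And>M. M > 0 \<Longrightarrow> l' M = u ^ M * l M"
  shows "q' N = u ^ N * q N"
proof (induction N rule: less_induct)
  case (less N)
  show ?case
  proof (cases "N = 0")
    case False
    have "of_nat N * q' N = (\<Sum>M\<in>{1..N}. of_nat M * l' M * q' (N - M))" by (rule assms)
    also have "\<dots> = (\<Sum>M\<in>{1..N}. u ^ N * (of_nat M * l M * q (N - M)))"
    proof (rule sum.cong)
      fix M assume M: "M \<in> {1..N}"
      have "u ^ N = u ^ M * u ^ (N - M)" using M by (simp flip: power_add)
      then show "of_nat M * l' M * q' (N - M) = u ^ N * (of_nat M * l M * q (N - M))"
        using M less[of "N - M"] assms(5)[of M] by simp
    qed simp
    also have "\<dots> = u ^ N * (of_nat N * q N)" unfolding assms(2) by (simp add: sum_distrib_left)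
    finally show ?thesis using False by simp
  qed (use assms in simp)
qed

text \<open>The constant depends on \<open>b\<close> and \<open>N\<close> alone. With
  \<open>q\<close>, \<open>l\<close> and \<open>t\<close> quantified inside, the resulting estimate
  is uniform in \<tau> and z.\<close>

lemma exp_rec_bound:
  fixes b :: "nat \<Rightarrow> real"
  shows "\<exists>C\<ge>0. \<forall>(q :: nat \<Rightarrow> complex) l t. t \<ge> 0 \<longrightarrow> q 0 = 1 \<longrightarrow>
    (\<forall>N. of_nat N * q N = (\<Sum>M\<in>{1..N}. of_nat M * l M * q (N - M))) \<longrightarrow>
    (\<forall>M>0. norm (l M) \<le> b M * t ^ M) \<longrightarrow> norm (q N) \<le> C * t ^ N"
proof (induction N rule: less_induct)
  case (less N)
  define P where "P C M \<longleftrightarrow> C \<ge> 0 \<and> (\<forall>(q :: nat \<Rightarrow> complex) l t. t \<ge> 0 \<longrightarrow> q 0 = 1 \<longrightarrow>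
    (\<forall>N. of_nat N * q N = (\<Sum>M\<in>{1..N}. of_nat M * l M * q (N - M))) \<longrightarrow>
    (\<forall>M>0. norm (l M) \<le> b M * t ^ M) \<longrightarrow> norm (q M) \<le> C * t ^ M)" for C :: real and M
  have "\<forall>M. \<exists>C. M < N \<longrightarrow> P C M" using less unfolding P_def by blast
  then obtain C where C: "\<And>M. M < N \<Longrightarrow> P (C M) M" by metis
  show ?case
  proof (cases "N = 0")
    case True
    then show ?thesis by (intro exI[of _ 1]) auto
  next
    case False
    define D where "D = (\<Sum>M\<in>{1..N}. real M * \<bar>b M\<bar> * C (N - M)) / real N"
    show ?thesis
    proof (intro exI[of _ D] conjI allI impI)
      show "D \<ge> 0" unfolding D_def using C P_def
        by (intro divide_nonneg_nonneg sum_nonneg mult_nonneg_nonneg) auto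
      fix q l :: "nat \<Rightarrow> complex" and t :: real
      assume t: "t \<ge> 0" and q0: "q 0 = 1" and q: "\<forall>N. of_nat N * q N = (\<Sum>M\<in>{1..N}. of_nat M * l M * q (N - M))"
        and l: "\<forall>M>0. norm (l M) \<le> b M * t ^ M"
      have "real N * norm (q N) = norm (\<Sum>M\<in>{1..N}. of_nat M * l M * q (N - M))"
        using q[rule_format, of N] by (metis norm_mult norm_of_nat)
      also have "\<dots> \<le> (\<Sum>M\<in>{1..N}. real M * \<bar>b M\<bar> * C (N - M) * t ^ N)"
      proof (rule sum_norm_le)
        fix M assume M: "M \<in> {1..N}"
        then have "P (C (N - M)) (N - M)" by (intro C) auto
        then have 1: "C (N - M) \<ge> 0" "norm (q (N - M)) \<le> C (N - M) * t ^ (N - M)"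
          using t q0 q l unfolding P_def by blast+
        have "norm (l M) \<le> b M * t ^ M" using l M by simp
        also have "\<dots> \<le> \<bar>b M\<bar> * t ^ M" using t by (intro mult_right_mono) auto
        finally have 2: "norm (l M) \<le> \<bar>b M\<bar> * t ^ M" .
        have "norm (of_nat M * l M * q (N - M)) = real M * (norm (l M) * norm (q (N - M)))"
          by (simp add: norm_mult)
        also have "\<dots> \<le> real M * ((\<bar>b M\<bar> * t ^ M) * (C (N - M) * t ^ (N - M)))"
          using 1 2 t by (intro mult_left_mono mult_mono) auto
        also have "\<dots> = real M * \<bar>b M\<bar> * C (N - M) * (t ^ M * t ^ (N - M))" by simp
        also have "t ^ M * t ^ (N - M) = t ^ N" using M by (simp flip: power_add)
        finally show "norm (of_nat M * l M * q (N - M)) \<le> real M * \<bar>b M\<bar> * C (N - M) * t ^ N" .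
      qed
      also have "\<dots> = real N * (D * t ^ N)" using False by (simp add: D_def sum_distrib_right)
      finally show "norm (q N) \<le> D * t ^ N" using False by simp
    qed
  qed
qed

lemma gauss_shift_1: "gauss \<tau> (z + 1) = gauss \<tau> z" by (simp add: gauss_def)

lemma gauss_shift_tau:
  assumes "Im \<tau> > 0"
  shows "norm (E (- \<tau> - 2 * z)) * gauss \<tau> (z + \<tau>) = gauss \<tau> z"
  unfolding gauss_def norm_E exp_add[symmetric] using assms
  by (simp add: power2_eq_square field_simps)

lemma gauss_power_of_int: "n\<^sup>2 = int N \<Longrightarrow> gauss \<tau> z ^ N = gauss \<tau> (of_int n * z)"
proof -
  assume "n\<^sup>2 = int N"
  then have "real_of_int (n\<^sup>2) = real_of_int (int N)" by (simp only:)
  then have "real N = (real_of_int n)\<^sup>2" by simp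
  then show ?thesis unfolding gauss_def exp_of_nat_mult[symmetric] by (simp add: power_mult_distrib)
qed

lemma square_val_scale:
  assumes "\<And>n :: int. n\<^sup>2 = int N \<Longrightarrow> ph \<tau>' (of_int n * z') = u ^ N * ph \<tau> (of_int n * z)"
  shows "square_val N \<tau>' z' = u ^ N * square_val N \<tau> z"
  unfolding square_val_def sum_distrib_left by (rule sum.cong) (use assms in auto)

lemma exp_val_scale:
  assumes "Im \<tau> > 0" "Im \<tau>' > 0" "\<And>M. M > 0 \<Longrightarrow> psi M \<tau>' z' = u ^ M * psi M \<tau> z"
  shows "exp_val N \<tau>' z' = u ^ N * exp_val N \<tau> z"
  by (rule exp_rec_scale[OF _ exp_val_rec _ exp_val_rec]) (use assms in \<open>auto simp: ell_def\<close>)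

lemma E_power_square: "n\<^sup>2 = int N \<Longrightarrow> E x ^ N = E (of_int n ^ 2 * x)"
proof -
  assume "n\<^sup>2 = int N"
  then have "complex_of_int (n\<^sup>2) = complex_of_int (int N)" by (simp only:)
  then show ?thesis by (simp add: E_power)
qed

lemma diff_val_inversion:
  assumes \<tau>: "Im \<tau> > 0"
  shows "diff_val N (- 1 / \<tau>) (z / \<tau>) = E (z\<^sup>2 / \<tau>) ^ N * diff_val N \<tau> z"
proof -
  have "\<tau> \<noteq> 0" using \<tau> by auto
  then have \<tau>': "Im (- 1 / \<tau>) > 0" using Im_moebius[of 0 \<tau> "-1" 1 0] \<tau> by simp
  have "exp_val N (- 1 / \<tau>) (z / \<tau>) = E (z\<^sup>2 / \<tau>) ^ N * exp_val N \<tau> z"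
    by (rule exp_val_scale[OF \<tau> \<tau>']) (rule psi_inversion[OF _ \<tau>])
  moreover have "square_val N (- 1 / \<tau>) (z / \<tau>) = E (z\<^sup>2 / \<tau>) ^ N * square_val N \<tau> z"
  proof (rule square_val_scale)
    fix n :: int assume n: "n\<^sup>2 = int N"
    show "ph (- 1 / \<tau>) (of_int n * (z / \<tau>)) = E (z\<^sup>2 / \<tau>) ^ N * ph \<tau> (of_int n * z)"
      using ph_moebius[of 0 0 "-1" 1 \<tau> "of_int n * z"] \<tau> by (simp add: E_power_square[OF n] power_mult_distrib)
  qed
  ultimately show ?thesis by (simp add: diff_val_def algebra_simps)
qed

lemma diff_val_shift_1:
  assumes \<tau>: "Im \<tau> > 0"
  shows "diff_val N \<tau> (z + 1) = diff_val N \<tau> z"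
proof -
  have "exp_val N \<tau> (z + 1) = 1 ^ N * exp_val N \<tau> z"
    by (rule exp_val_scale[OF \<tau> \<tau>]) (simp add: psi_shift_1)
  moreover have "square_val N \<tau> (z + 1) = 1 ^ N * square_val N \<tau> z"
    by (rule square_val_scale) (use ph_shift[of \<tau> _ 0] in \<open>simp add: distrib_left\<close>)
  ultimately show ?thesis by (simp add: diff_val_def)
qed

lemma diff_val_shift_tau:
  assumes \<tau>: "Im \<tau> > 0"
  shows "diff_val N \<tau> (z + \<tau>) = E (- \<tau> - 2 * z) ^ N * diff_val N \<tau> z"
proof -
  have "exp_val N \<tau> (z + \<tau>) = E (- \<tau> - 2 * z) ^ N * exp_val N \<tau> z"
    by (rule exp_val_scale[OF \<tau> \<tau>]) (simp add: psi_shift_tau)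
  moreover have "square_val N \<tau> (z + \<tau>) = E (- \<tau> - 2 * z) ^ N * square_val N \<tau> z"
  proof (rule square_val_scale)
    fix n :: int assume n: "n\<^sup>2 = int N"
    show "ph \<tau> (of_int n * (z + \<tau>)) = E (- \<tau> - 2 * z) ^ N * ph \<tau> (of_int n * z)"
      using ph_shift[of \<tau> "of_int n * z" n 0] by (simp add: E_power_square[OF n] algebra_simps power2_eq_square)
  qed
  ultimately show ?thesis by (simp add: diff_val_def algebra_simps)
qed

lemma diff_val_minus:
  assumes \<tau>: "Im \<tau> > 0"
  shows "diff_val N \<tau> (- z) = diff_val N \<tau> z"
proof -
  have "exp_val N \<tau> (- z) = 1 ^ N * exp_val N \<tau> z"
    by (rule exp_val_scale[OF \<tau> \<tau>]) (simp add: psi_minus)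
  moreover have "square_val N \<tau> (- z) = 1 ^ N * square_val N \<tau> z"
    by (rule square_val_scale) (simp add: ph_def th_minus)
  ultimately show ?thesis by (simp add: diff_val_def)
qed

lemma diff_val_add_2:
  shows "diff_val N (\<tau> + 2) z = diff_val N \<tau> z"
  using E_cong_even[of "\<tau> + 2" \<tau> 2] by (simp add: diff_val_def exp_val_def square_val_def ph_def th_add_2)

definition diff_norm :: "nat \<Rightarrow> complex \<Rightarrow> complex \<Rightarrow> real" where
  "diff_norm N \<tau> z = norm (diff_val N \<tau> z) * gauss \<tau> z ^ N"

lemma diff_norm_nonneg [simp]: "diff_norm N \<tau> z \<ge> 0" by (simp add: diff_norm_def less_imp_le)

lemma diff_norm_inversion: "Im \<tau> > 0 \<Longrightarrow> diff_norm N (- 1 / \<tau>) (z / \<tau>) = diff_norm N \<tau> z"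
  unfolding diff_norm_def gauss_inversion[of \<tau> z, symmetric] diff_val_inversion
  by (simp only: norm_mult norm_power power_mult_distrib mult_ac)

lemma diff_norm_shift_1: "Im \<tau> > 0 \<Longrightarrow> diff_norm N \<tau> (z + 1) = diff_norm N \<tau> z"
  by (simp add: diff_norm_def diff_val_shift_1 gauss_shift_1)

lemma diff_norm_shift_tau: "Im \<tau> > 0 \<Longrightarrow> diff_norm N \<tau> (z + \<tau>) = diff_norm N \<tau> z"
  unfolding diff_norm_def gauss_shift_tau[of \<tau> z, symmetric]
  by (simp add: diff_val_shift_tau norm_mult norm_power power_mult_distrib mult_ac)

lemma diff_norm_minus: "Im \<tau> > 0 \<Longrightarrow> diff_norm N \<tau> (- z) = diff_norm N \<tau> z"
  by (simp add: diff_norm_def diff_val_minus gauss_def)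

lemma diff_norm_add_2: "diff_norm N (\<tau> + 2) z = diff_norm N \<tau> z"
  by (simp add: diff_norm_def diff_val_add_2 gauss_def)

text \<open>With T = exp (pi Im \<tau> / 4), the weighted Hecke image of degree M is O(T^M) by
  \<open>kg_orbit_bound\<close>, and homogeneity of the recursion gives O(T^N) for the exponential.
  The terms of \<open>square_val\<close> are only O(T).\<close>

lemma diff_norm_cusp_bound:
  assumes N: "N > 0"
  shows "\<exists>C\<ge>0. \<forall>\<tau> z. Im \<tau> \<ge> 1 \<longrightarrow> diff_norm N (1 - 1 / \<tau>) (z / \<tau>) \<le> C * exp (pi * real N * Im \<tau> / 4)"
proof -
  obtain C where C: "C > 0" "\<And>\<tau> w a b c d. Im \<tau> \<ge> 1 \<Longrightarrow> a * d - b * c > 0 \<Longrightarrow>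
     kg ((of_int a * \<tau> + of_int b) / (of_int c * \<tau> + of_int d)) w \<le> C * exp (pi * of_int (a * d - b * c) * Im \<tau> / 4)"
    using kg_orbit_bound by blast
  define b where "b M = 2 / real M * (real (card (hecke_reps (int M))) * C)" for M
  obtain C' where C': "C' \<ge> 0" "\<And>q l t. t \<ge> 0 \<Longrightarrow> q 0 = (1 :: complex) \<Longrightarrow>
    (\<And>N. of_nat N * q N = (\<Sum>M\<in>{1..N}. of_nat M * l M * q (N - M))) \<Longrightarrow>
    (\<And>M. M > 0 \<Longrightarrow> norm (l M) \<le> b M * t ^ M) \<Longrightarrow> norm (q N) \<le> C' * t ^ N"
    using exp_rec_bound[of b N] by blast
  define C2 where "C2 = real (card {n :: int. n\<^sup>2 = int N}) * C"
  have "diff_norm N (1 - 1 / \<tau>) (z / \<tau>) \<le> (C' + C2) * exp (pi * real N * Im \<tau> / 4)" if \<tau>: "Im \<tau> \<ge> 1" for \<tau> z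
  proof -
    define t where "t = 1 - 1 / \<tau>"
    define w where "w = z / \<tau>"
    define T where "T = exp (pi * Im \<tau> / 4)"
    have \<tau>0: "Im \<tau> > 0" "\<tau> \<noteq> 0" using \<tau> by auto
    have t: "Im t > 0" using Im_moebius[of 1 \<tau> "-1" 1 0] \<tau>0 by (simp add: t_def diff_divide_distrib)
    have T: "exp (pi * real M * Im \<tau> / 4) = T ^ M" for M
      unfolding T_def exp_of_nat_mult[symmetric] by (simp add: mult_ac)
    have psi_le: "norm (psi M t w) * gauss t w ^ M \<le> real (card (hecke_reps (int M))) * C * T ^ M" if M: "M > 0" for M
    proof -
      have "norm (psi M t w) * gauss t w ^ M \<le> (\<Sum>(a, b, c, d)\<in>hecke_reps (int M). norm (ph ((of_int a * t + of_int b) / of_int d) (of_int a * w))) * gauss t w ^ M"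
        unfolding psi_def by (intro mult_right_mono order.trans[OF norm_sum] sum_mono) (auto simp: less_imp_le)
      also have "\<dots> = (\<Sum>(a, b, c, d)\<in>hecke_reps (int M). norm (ph ((of_int a * t + of_int b) / of_int d) (of_int a * w)) * gauss t w ^ M)"
        by (simp add: sum_distrib_right case_prod_unfold)
      also have "\<dots> \<le> (\<Sum>M'\<in>hecke_reps (int M). C * T ^ M)"
      proof (rule sum_mono)
        fix M' assume "M' \<in> hecke_reps (int M)"
        then obtain a b d where M': "M' = (a, b, 0, d)" "a > 0" "d > 0" "a * d = int M" by (elim hecke_repsE)
        have rM: "real M = of_int a * of_int d" by (metis M'(4) of_int_mult of_int_of_nat_eq)
        have "gauss t w ^ M = gauss ((of_int a * t + of_int b) / of_int d) (of_int a * w)"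
          unfolding gauss_def Im_hecke[OF M'(2,3)] exp_of_nat_mult[symmetric] rM using M'(2,3) t
          by (simp add: power2_eq_square)
        then have k: "norm (ph ((of_int a * t + of_int b) / of_int d) (of_int a * w)) * gauss t w ^ M =
          kg ((of_int a * t + of_int b) / of_int d) (of_int a * w)" by (simp add: kg_def)
        \<comment> \<open>The representative (a, b, 0, d) times the coset matrix (1, -1, 1, 0),
          again of determinant M.\<close>
        have h: "(of_int a * t + of_int b) / of_int d = (of_int (a + b) * \<tau> + of_int (- a)) / (of_int d * \<tau> + of_int 0)"
          using \<tau>0 M' by (simp add: t_def field_simps)
        have m: "(a + b) * 0 - (- a) * d = int M" using M' by simp
        have "kg ((of_int a * t + of_int b) / of_int d) (of_int a * w) \<le> C * exp (pi * of_int (int M) * Im \<tau> / 4)"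
          unfolding h m[symmetric] by (rule C(2)[OF \<tau>]) (use M' M in auto)
        then show "(case M' of (a, b, c, d) \<Rightarrow> norm (ph ((of_int a * t + of_int b) / of_int d) (of_int a * w)) * gauss t w ^ M) \<le> C * T ^ M"
          unfolding M'(1) case_prod_conv k by (simp flip: T)
      qed
      finally show ?thesis by simp
    qed
    \<comment> \<open>Weighting both sequences by powers of the Gaussian preserves the recursion, so
      the uniform bound applies to the weighted ones.\<close>
    have "norm (exp_val N t w * of_real (gauss t w ^ N)) \<le> C' * T ^ N"
    proof (rule C'(2)[where q = "\<lambda>N. exp_val N t w * of_real (gauss t w ^ N)" and l = "\<lambda>M. ell M t w * of_real (gauss t w ^ M)"])
      fix N
      have "of_nat N * (exp_val N t w * of_real (gauss t w ^ N)) =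
        (\<Sum>M\<in>{1..N}. of_nat M * ell M t w * exp_val (N - M) t w * of_real (gauss t w ^ N))"
        using exp_val_rec[OF t, of N w] by (simp add: sum_distrib_right flip: mult.assoc)
      also have "\<dots> = (\<Sum>M\<in>{1..N}. of_nat M * (ell M t w * of_real (gauss t w ^ M)) * (exp_val (N - M) t w * of_real (gauss t w ^ (N - M))))"
      proof (rule sum.cong)
        fix M assume "M \<in> {1..N}"
        then have "gauss t w ^ N = gauss t w ^ M * gauss t w ^ (N - M)" by (simp flip: power_add)
        then show "of_nat M * ell M t w * exp_val (N - M) t w * of_real (gauss t w ^ N) =
          of_nat M * (ell M t w * of_real (gauss t w ^ M)) * (exp_val (N - M) t w * of_real (gauss t w ^ (N - M)))"
          by (simp only: of_real_mult mult_ac)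
      qed simp
      finally show "of_nat N * (exp_val N t w * of_real (gauss t w ^ N)) =
        (\<Sum>M\<in>{1..N}. of_nat M * (ell M t w * of_real (gauss t w ^ M)) * (exp_val (N - M) t w * of_real (gauss t w ^ (N - M))))" .
    next
      fix M :: nat assume M: "M > 0"
      have "norm (ell M t w * of_real (gauss t w ^ M)) = 2 / real M * (norm (psi M t w) * gauss t w ^ M)"
        by (simp add: ell_def norm_mult norm_divide norm_power less_imp_le)
      also have "\<dots> \<le> 2 / real M * (real (card (hecke_reps (int M))) * C * T ^ M)"
        by (intro mult_left_mono psi_le M) auto
      finally show "norm (ell M t w * of_real (gauss t w ^ M)) \<le> b M * T ^ M" by (simp add: b_def)
    qed (auto simp: T_def)
    then have 1: "norm (exp_val N t w) * gauss t w ^ N \<le> C' * T ^ N" by (simp add: norm_mult norm_power less_imp_le)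
    have "norm (square_val N t w) * gauss t w ^ N \<le> (\<Sum>n | n\<^sup>2 = int N. norm (ph t (of_int n * w))) * gauss t w ^ N"
      unfolding square_val_def by (intro mult_right_mono norm_sum) (auto simp: less_imp_le)
    also have "\<dots> = (\<Sum>n | n\<^sup>2 = int N. kg t (of_int n * w))"
      unfolding sum_distrib_right kg_def by (rule sum.cong) (auto simp: gauss_power_of_int)
    also have "\<dots> \<le> (\<Sum>n | n\<^sup>2 = int N. C * T ^ N)"
    proof (rule sum_mono)
      fix n
      have "t = (of_int 1 * \<tau> + of_int (- 1)) / (of_int 1 * \<tau> + of_int 0)" using \<tau>0 by (simp add: t_def field_simps)
      then have "kg t (of_int n * w) \<le> C * exp (pi * of_int (1 * 0 - (- 1) * 1) * Im \<tau> / 4)"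
        using C(2)[OF \<tau>, of 1 0 "-1" 1 "of_int n * w"] by simp
      also have "\<dots> = C * T" by (simp add: T_def)
      also have "\<dots> \<le> C * T ^ N" using C(1) N \<tau>0 by (intro mult_left_mono self_le_power) (auto simp: T_def)
      finally show "kg t (of_int n * w) \<le> C * T ^ N" .
    qed
    finally have 2: "norm (square_val N t w) * gauss t w ^ N \<le> C2 * T ^ N" by (simp add: C2_def)
    have "diff_norm N t w \<le> (norm (exp_val N t w) + norm (square_val N t w)) * gauss t w ^ N"
      unfolding diff_norm_def diff_val_def by (intro mult_right_mono norm_triangle_ineq4) (auto simp: less_imp_le)
    also have "\<dots> \<le> (C' + C2) * T ^ N" using 1 2 by (simp add: distrib_right)
    finally show ?thesis by (simp add: t_def w_def T)
  qed
  moreover have "C' + C2 \<ge> 0" using C'(1) C(1) by (simp add: C2_def)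
  ultimately show ?thesis by blast
qed

text \<open>Write y = Im \<tau> and |Im z| = l y with l \<le> 1/2. Coefficient growth, X^i and the
  Gaussian combine to exp (- pi y (sqrt i - l sqrt N)^2), which is at most exp (- pi i y / 4) for i
  \<ge> N, and only such i occur.\<close>

lemma diff_norm_infinity_bound:
  assumes low: "\<And>z i. i < N \<Longrightarrow> fps_nth (diff_fps z N) i = 0"
  shows "\<exists>C\<ge>0. \<forall>\<tau> z. Im \<tau> \<ge> 1 \<longrightarrow> \<bar>Im z\<bar> \<le> Im \<tau> / 2 \<longrightarrow> diff_norm N \<tau> z \<le> C * exp (- (pi * real N * Im \<tau> / 4))"
proof -
  \<comment> \<open>With i = j + N, half of the decay pi j y / 4 pays for the loss pi j / 8 because
    y \<ge> 1; the rest is a geometric series in j, and R^N goes into the constant.\<close>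
  define R where "R = exp (pi / 8)"
  have "R > 1" by (simp add: R_def)
  then obtain C where C: "\<And>z i. norm (fps_nth (diff_fps z N) i) \<le> C * R ^ i * exp (2 * pi * \<bar>Im z\<bar> * sqrt (real (i * N)))"
    using jacobi_growth_diff_fps[of N] unfolding jacobi_growth_def by blast
  have C0: "C \<ge> 0" using order_trans[OF norm_ge_zero C[of 0 0]] by simp
  define r where "r = exp (- (pi / 8))"
  have r: "0 < r" "r < 1" by (auto simp: r_def)
  define C' where "C' = C * exp (pi * real N / 8) / (1 - r)"
  have "diff_norm N \<tau> z \<le> C' * exp (- (pi * real N * Im \<tau> / 4))" if \<tau>: "Im \<tau> \<ge> 1" and z: "\<bar>Im z\<bar> \<le> Im \<tau> / 2" for \<tau> z
  proof -
    define y where "y = Im \<tau>"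
    have y: "y \<ge> 1" "Im \<tau> > 0" using \<tau> by (auto simp: y_def)
    define e where "e = exp (- (pi * real N * y / 4))"
    define F where "F i = fps_nth (diff_fps z N) i * E \<tau> ^ i" for i
    have F_le: "norm (F (j + N)) * gauss \<tau> z ^ N \<le> C * exp (pi * real N / 8) * e * r ^ j" for j
    proof -
      define i where "i = j + N"
      define l where "l = \<bar>Im z\<bar> / y"
      have l: "0 \<le> l" "l \<le> 1 / 2" "\<bar>Im z\<bar> = l * y" using z y by (auto simp: l_def y_def field_simps)
      define s n where "s = sqrt (real i)" "n = sqrt (real N)"
      have sn: "0 \<le> n" "n \<le> s" "real i = s\<^sup>2" "real N = n\<^sup>2" by (auto simp: s_n_def i_def)
      have "l * n \<le> (1 / 2) * s" using l sn by (intro mult_mono) auto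
      then have "(s / 2)\<^sup>2 \<le> (s - l * n)\<^sup>2" using sn by (intro power_mono) auto
      then have "y * (s / 2)\<^sup>2 \<le> y * (s - l * n)\<^sup>2" using y by (intro mult_left_mono) auto
      then have ex: "2 * l * y * (s * n) - real i * y - real N * l\<^sup>2 * y \<le> - (real i * y / 4)"
        unfolding sn by (simp add: power2_eq_square algebra_simps)
      have "norm (F i) * gauss \<tau> z ^ N \<le> (C * R ^ i * exp (2 * pi * \<bar>Im z\<bar> * sqrt (real (i * N)))) * norm (E \<tau> ^ i) * gauss \<tau> z ^ N"
        unfolding F_def norm_mult by (intro mult_right_mono C) (auto simp: less_imp_le)
      also have "\<dots> = C * (exp (real i * (pi / 8)) * exp (2 * pi * (l * y) * (s * n)) * exp (real i * (- pi * y)) * exp (real N * - (pi * (l * y)\<^sup>2 / y)))"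
        unfolding norm_power norm_E R_def gauss_def exp_of_nat_mult[symmetric] l(3)[symmetric] y_def[symmetric]
        by (simp add: real_sqrt_mult s_n_def)
      also have "\<dots> = C * exp (pi * (real i / 8 + (2 * l * y * (s * n) - real i * y - real N * l\<^sup>2 * y)))"
        unfolding exp_add[symmetric] using y by (simp add: power2_eq_square algebra_simps)
      also have "\<dots> \<le> C * exp (pi * (real i / 8 + - (real i * y / 4)))"
        using C0 ex by (intro mult_left_mono) auto
      also have "\<dots> \<le> C * exp (pi * (real N / 8 - real N * y / 4 - real j / 8))"
      proof -
        have "real j * 1 \<le> real j * y" using y by (intro mult_left_mono) auto
        moreover have "real i / 8 + - (real i * y / 4) = real N / 8 - real N * y / 4 + (real j / 8 - real j * y / 4)"
          by (simp add: i_def add_divide_distrib distrib_right)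
        ultimately have "real i / 8 + - (real i * y / 4) \<le> real N / 8 - real N * y / 4 - real j / 8"
          by linarith
        then show ?thesis using C0 by (intro mult_left_mono) auto
      qed
      also have "\<dots> = C * exp (pi * real N / 8) * e * r ^ j"
      proof -
        have "pi * (real N / 8 - real N * y / 4 - real j / 8) = pi * real N / 8 + (- (pi * real N * y / 4) + real j * - (pi / 8))"
          by (simp add: right_diff_distrib mult_ac)
        then show ?thesis unfolding e_def r_def exp_of_nat_mult[symmetric] mult.assoc exp_add[symmetric] by (simp only: mult.assoc add.assoc)
      qed
      finally show ?thesis by (simp add: i_def)
    qed
    have rad: "ereal (norm (E \<tau>)) < fps_conv_radius (diff_fps z N)"
      by (rule radius_E[OF jacobi_growth_radius[OF jacobi_growth_diff_fps] y(2)])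
    have sF: "F sums diff_val N \<tau> z"
      using sums_eval_fps[OF rad] by (simp add: F_def[abs_def] diff_fps_eval[OF y(2)])
    have sum0: "(\<Sum>i<N. F i) = 0" by (rule sum.neutral) (use low in \<open>auto simp: F_def\<close>)
    have "(\<lambda>j. F (j + N)) sums diff_val N \<tau> z"
      using sF sums_iff_shift[of F N "diff_val N \<tau> z"] sum0 by simp
    then have "(\<lambda>j. F (j + N) * of_real (gauss \<tau> z ^ N)) sums (diff_val N \<tau> z * of_real (gauss \<tau> z ^ N))"
      by (rule sums_mult2)
    moreover have "(\<lambda>j. C * exp (pi * real N / 8) * e * r ^ j) sums (C * exp (pi * real N / 8) * e * (1 / (1 - r)))"
      using r by (intro sums_mult geometric_sums) auto
    moreover have "norm (F (j + N) * of_real (gauss \<tau> z ^ N)) \<le> C * exp (pi * real N / 8) * e * r ^ j" for j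
    proof -
      have "norm (F (j + N) * of_real (gauss \<tau> z ^ N)) = norm (F (j + N)) * gauss \<tau> z ^ N"
        unfolding norm_mult norm_of_real power_abs abs_of_pos[OF gauss_pos] ..
      then show ?thesis using F_le[of j] by (simp only:)
    qed
    ultimately have "norm (diff_val N \<tau> z * of_real (gauss \<tau> z ^ N)) \<le> C * exp (pi * real N / 8) * e * (1 / (1 - r))"
      by (rule norm_sums_le)
    moreover have "norm (diff_val N \<tau> z * of_real (gauss \<tau> z ^ N)) = diff_norm N \<tau> z"
      unfolding diff_norm_def norm_mult norm_of_real power_abs abs_of_pos[OF gauss_pos] ..
    ultimately show ?thesis by (simp add: C'_def e_def y_def)
  qed
  moreover have "C' \<ge> 0" using C0 r by (simp add: C'_def)
  ultimately show ?thesis by blast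
qed

section \<open>Holomorphy and continuity of the difference\<close>

lemma holomorphic_on_ph:
  assumes "f holomorphic_on S" "g holomorphic_on S" "\<And>s. s \<in> S \<Longrightarrow> Im (f s) > 0" "open S"
  shows "(\<lambda>s. ph (f s) (g s)) holomorphic_on S"
  unfolding ph_def
  by (intro holomorphic_intros assms) (use assms(3) th_0_nonzero in auto)

lemma holomorphic_on_psi:
  assumes "f holomorphic_on S" "g holomorphic_on S" "\<And>s. s \<in> S \<Longrightarrow> Im (f s) > 0" "open S"
  shows "(\<lambda>s. psi N (f s) (g s)) holomorphic_on S"
  unfolding psi_def case_prod_unfold
proof (intro holomorphic_on_sum)
  fix M assume "M \<in> hecke_reps (int N)"
  then obtain a b d where M: "M = (a, b, 0, d)" "a > 0" "d > 0" by (elim hecke_repsE)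
  have "(\<lambda>s. ph ((of_int a * f s + of_int b) / of_int d) (of_int a * g s)) holomorphic_on S"
  proof (rule holomorphic_on_ph)
    show "(\<lambda>s. (of_int a * f s + of_int b) / of_int d) holomorphic_on S"
      using M by (intro holomorphic_intros assms) auto
    show "Im ((of_int a * f s + of_int b) / of_int d) > 0" if "s \<in> S" for s
      unfolding Im_hecke[OF M(2,3)] using M assms(3)[OF that] by simp
  qed (intro holomorphic_intros assms)+
  then show "(\<lambda>s. ph ((of_int (fst M) * f s + of_int (fst (snd M))) / of_int (snd (snd (snd M)))) (of_int (fst M) * g s)) holomorphic_on S"
    by (simp add: M)
qed

lemma exp_val_eq:
  assumes "Im \<tau> > 0" "N > 0"
  shows "exp_val N \<tau> z = (\<Sum>M\<in>{1..N}. of_nat M * ell M \<tau> z * exp_val (N - M) \<tau> z) / of_nat N"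
  using exp_val_rec[OF assms(1), of N z] assms(2) by (simp add: field_simps)

lemma holomorphic_on_diff_val:
  assumes "f holomorphic_on S" "g holomorphic_on S" "\<And>s. s \<in> S \<Longrightarrow> Im (f s) > 0" "open S"
  shows "(\<lambda>s. diff_val N (f s) (g s)) holomorphic_on S"
proof -
  have "(\<lambda>s. exp_val N (f s) (g s)) holomorphic_on S"
  proof (induction N rule: less_induct)
    case (less N)
    show ?case
    proof (cases "N = 0")
      case False
      have "(\<lambda>s. (\<Sum>M\<in>{1..N}. of_nat M * ell M (f s) (g s) * exp_val (N - M) (f s) (g s)) / of_nat N) holomorphic_on S"
        unfolding ell_def using False
        by (intro holomorphic_intros holomorphic_on_psi assms less) auto
      then show ?thesis
        by (rule holomorphic_transform) (use exp_val_eq assms(3) False in auto)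
    qed simp
  qed
  moreover have "(\<lambda>s. square_val N (f s) (g s)) holomorphic_on S"
    unfolding square_val_def by (intro holomorphic_on_sum holomorphic_on_ph holomorphic_intros assms)
  ultimately show ?thesis unfolding diff_val_def by (intro holomorphic_intros)
qed

lemma continuous_on_ph:
  fixes f g :: "'a :: heine_borel \<Rightarrow> complex"
  assumes "continuous_on S f" "continuous_on S g" "\<And>s. s \<in> S \<Longrightarrow> Im (f s) > 0"
  shows "continuous_on S (\<lambda>s. ph (f s) (g s))"
  unfolding ph_def
  by (intro continuous_on_divide continuous_on_th assms continuous_on_const) (use assms(3) th_0_nonzero in auto)

lemma continuous_on_psi:
  fixes f g :: "'a :: heine_borel \<Rightarrow> complex"
  assumes "continuous_on S f" "continuous_on S g" "\<And>s. s \<in> S \<Longrightarrow> Im (f s) > 0"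
  shows "continuous_on S (\<lambda>s. psi N (f s) (g s))"
  unfolding psi_def case_prod_unfold
proof (intro continuous_on_sum)
  fix M assume "M \<in> hecke_reps (int N)"
  then obtain a b d where M: "M = (a, b, 0, d)" "a > 0" "d > 0" by (elim hecke_repsE)
  have "continuous_on S (\<lambda>s. ph ((of_int a * f s + of_int b) / of_int d) (of_int a * g s))"
  proof (rule continuous_on_ph)
    show "continuous_on S (\<lambda>s. (of_int a * f s + of_int b) / of_int d)"
      using M by (intro continuous_intros assms) auto
    show "Im ((of_int a * f s + of_int b) / of_int d) > 0" if "s \<in> S" for s
      unfolding Im_hecke[OF M(2,3)] using M assms(3)[OF that] by simp
  qed (intro continuous_intros assms)
  then show "continuous_on S (\<lambda>s. ph ((of_int (fst M) * f s + of_int (fst (snd M))) / of_int (snd (snd (snd M)))) (of_int (fst M) * g s))"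
    by (simp add: M)
qed

lemma continuous_on_diff_norm:
  fixes f g :: "'a :: heine_borel \<Rightarrow> complex"
  assumes "continuous_on S f" "continuous_on S g" "\<And>s. s \<in> S \<Longrightarrow> Im (f s) > 0"
  shows "continuous_on S (\<lambda>s. diff_norm N (f s) (g s))"
proof -
  have "continuous_on S (\<lambda>s. exp_val N (f s) (g s))"
  proof (induction N rule: less_induct)
    case (less N)
    show ?case
    proof (cases "N = 0")
      case False
      have "continuous_on S (\<lambda>s. (\<Sum>M\<in>{1..N}. of_nat M * ell M (f s) (g s) * exp_val (N - M) (f s) (g s)) / of_nat N)"
        unfolding ell_def using False
        by (intro continuous_intros continuous_on_psi assms less) auto
      then show ?thesis
        by (rule continuous_on_eq) (use exp_val_eq assms(3) False in auto)
    qed simp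
  qed
  moreover have "continuous_on S (\<lambda>s. square_val N (f s) (g s))"
    unfolding square_val_def by (intro continuous_on_sum continuous_on_ph continuous_intros assms)
  moreover have "continuous_on S (\<lambda>s. gauss (f s) (g s))"
    unfolding gauss_def by (intro continuous_intros assms) (use assms(3) in force)
  ultimately show ?thesis unfolding diff_norm_def diff_val_def by (intro continuous_intros)
qed

section \<open>The modular invariant built from the three cosets\<close>

definition diff_norm3 :: "nat \<Rightarrow> complex \<Rightarrow> complex \<Rightarrow> real" where
  "diff_norm3 N \<tau> z = diff_norm N \<tau> z * diff_norm N (\<tau> + 1) z * diff_norm N (1 - 1 / \<tau>) (z / \<tau>)"

lemma Im_cusp: "Im \<tau> > 0 \<Longrightarrow> Im (1 - 1 / \<tau>) > 0"
  using Im_moebius[of 1 \<tau> "-1" 1 0] by (cases "\<tau> = 0") (auto simp: diff_divide_distrib)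

lemma diff_norm3_T:
  assumes "Im \<tau> > 0"
  shows "diff_norm3 N (\<tau> + 1) z = diff_norm3 N \<tau> z"
proof -
  have "diff_norm N (1 - 1 / (\<tau> + 1)) (z / (\<tau> + 1)) = diff_norm N (1 - 1 / \<tau>) (z / \<tau>)"
    by (rule theta_group_cosets(1)[of "diff_norm N", OF _ _ _ assms];
        simp only: diff_norm_add_2 diff_norm_inversion diff_norm_minus)
  then show ?thesis using diff_norm_add_2[of N \<tau> z] by (simp add: diff_norm3_def add.assoc)
qed

lemma diff_norm3_S:
  assumes "Im \<tau> > 0"
  shows "diff_norm3 N (- 1 / \<tau>) (z / \<tau>) = diff_norm3 N \<tau> z"
proof -
  have 1: "diff_norm N (1 - 1 / (- 1 / \<tau>)) (z / \<tau> / (- 1 / \<tau>)) = diff_norm N (\<tau> + 1) z"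
    by (rule theta_group_cosets(2)[of "diff_norm N", OF _ _ _ assms];
        simp only: diff_norm_add_2 diff_norm_inversion diff_norm_minus)
  have 2: "- 1 / \<tau> + 1 = 1 - 1 / \<tau>" by simp
  show ?thesis unfolding diff_norm3_def 1 2 diff_norm_inversion[OF assms] by simp
qed

lemma diff_norm3_shift:
  assumes \<tau>: "Im \<tau> > 0"
  shows "diff_norm3 N \<tau> (z + of_int m * \<tau> + of_int k) = diff_norm3 N \<tau> z"
proof -
  have nz: "\<tau> \<noteq> 0" using \<tau> by auto
  have 1: "diff_norm3 N \<tau> (z + 1) = diff_norm3 N \<tau> z" for z
  proof -
    define t where "t = 1 - 1 / \<tau>"
    have t: "Im t > 0" unfolding t_def by (rule Im_cusp[OF \<tau>])
    \<comment> \<open>Adding the period t = 1 - 1 / \<tau> turns the translation by 1 / \<tau> into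
      a translation by 1.\<close>
    have "diff_norm N t ((z + 1) / \<tau>) = diff_norm N t ((z + 1) / \<tau> + t)" by (rule diff_norm_shift_tau[OF t, symmetric])
    also have "(z + 1) / \<tau> + t = z / \<tau> + 1" using nz by (simp add: t_def field_simps)
    also have "diff_norm N t (z / \<tau> + 1) = diff_norm N t (z / \<tau>)" by (rule diff_norm_shift_1[OF t])
    finally show ?thesis using \<tau> by (simp add: diff_norm3_def diff_norm_shift_1 t_def)
  qed
  have 2: "diff_norm3 N \<tau> (z + \<tau>) = diff_norm3 N \<tau> z" for z
  proof -
    have "diff_norm N (1 - 1 / \<tau>) ((z + \<tau>) / \<tau>) = diff_norm N (1 - 1 / \<tau>) (z / \<tau>)"
      using diff_norm_shift_1[OF Im_cusp[OF \<tau>], of N "z / \<tau>"] nz by (simp add: add_divide_distrib)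
    moreover have "diff_norm N (\<tau> + 1) (z + \<tau>) = diff_norm N (\<tau> + 1) z"
      using diff_norm_shift_1[of "\<tau> + 1" N "z + \<tau>"] diff_norm_shift_tau[of "\<tau> + 1" N z] \<tau> by (simp add: add.assoc)
    ultimately show ?thesis using \<tau> by (simp add: diff_norm3_def diff_norm_shift_tau)
  qed
  have "diff_norm3 N \<tau> (z + of_int k) = diff_norm3 N \<tau> z" for z k
  proof (induction k rule: int_induct[of _ 0])
    case (step1 i)
    then show ?case using 1[of "z + of_int i"] by (simp add: add_ac)
  next
    case (step2 i)
    then show ?case using 1[of "z + of_int (i - 1)"] by (simp add: add_ac)
  qed simp
  moreover have "diff_norm3 N \<tau> (z + of_int m * \<tau>) = diff_norm3 N \<tau> z" for m
  proof (induction m rule: int_induct[of _ 0])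
    case (step1 i)
    then show ?case using 2[of "z + of_int i * \<tau>"] by (simp add: algebra_simps)
  next
    case (step2 i)
    then show ?case using 2[of "z + of_int (i - 1) * \<tau>"] by (simp add: algebra_simps)
  qed simp
  ultimately show ?thesis by simp
qed

text \<open>The two cosets over infinity contribute exponent -1/4 each and the third +1/4, in units
  of pi N Im \<tau>.\<close>

lemma diff_norm3_bound:
  assumes N: "N > 0" and low: "\<And>z i. i < N \<Longrightarrow> fps_nth (diff_fps z N) i = 0"
  shows "\<exists>C\<ge>0. \<forall>\<tau> z. Im \<tau> \<ge> 1 \<longrightarrow> \<bar>Im z\<bar> \<le> Im \<tau> / 2 \<longrightarrow> diff_norm3 N \<tau> z \<le> C * exp (- (pi * real N * Im \<tau> / 4))"
proof -
  obtain C1 where C1: "C1 \<ge> 0" "\<And>\<tau> z. Im \<tau> \<ge> 1 \<Longrightarrow> \<bar>Im z\<bar> \<le> Im \<tau> / 2 \<Longrightarrow> diff_norm N \<tau> z \<le> C1 * exp (- (pi * real N * Im \<tau> / 4))"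
    using diff_norm_infinity_bound[OF low] by blast
  obtain C2 where C2: "C2 \<ge> 0" "\<And>\<tau> z. Im \<tau> \<ge> 1 \<Longrightarrow> diff_norm N (1 - 1 / \<tau>) (z / \<tau>) \<le> C2 * exp (pi * real N * Im \<tau> / 4)"
    using diff_norm_cusp_bound[OF N] by blast
  have "diff_norm3 N \<tau> z \<le> (C1 * C1 * C2) * exp (- (pi * real N * Im \<tau> / 4))"
    if \<tau>: "Im \<tau> \<ge> 1" and z: "\<bar>Im z\<bar> \<le> Im \<tau> / 2" for \<tau> z
  proof -
    define e where "e = exp (- (pi * real N * Im \<tau> / 4))"
    have "diff_norm3 N \<tau> z \<le> (C1 * e) * (C1 * e) * (C2 * exp (pi * real N * Im \<tau> / 4))"
      unfolding diff_norm3_def e_def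
      using C1(2)[OF \<tau> z] C1(2)[of "\<tau> + 1" z] C2(2)[OF \<tau>, of z] \<tau> z C1(1) C2(1)
      by (intro mult_mono) auto
    also have "\<dots> = (C1 * C1 * C2) * e * (e * exp (pi * real N * Im \<tau> / 4))" by simp
    also have "e * exp (pi * real N * Im \<tau> / 4) = 1" by (simp add: e_def flip: exp_add)
    finally show ?thesis by (simp add: e_def)
  qed
  moreover have "C1 * C1 * C2 \<ge> 0" using C1 C2 by simp
  ultimately show ?thesis by blast
qed

text \<open>On z = l \<tau> + m with l and m real, the Gaussian at \<tau> equals |E (l^2 \<tau>)|,
  the modulus of a holomorphic function. Three Gaussians give 3 l^2 \<tau>, and the inversion inside
  the third contributes - z^2 / \<tau>.\<close>

lemma diff_norm3_eq_norm_holomorphic: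
  fixes l m :: real and N :: nat
  defines "G \<equiv> (\<lambda>\<tau>. diff_val N \<tau> (of_real l * \<tau> + of_real m) * diff_val N (\<tau> + 1) (of_real l * \<tau> + of_real m) *
      diff_val N (1 - 1 / \<tau>) ((of_real l * \<tau> + of_real m) / \<tau>) *
      E (3 * of_real l ^ 2 * \<tau> - (of_real l * \<tau> + of_real m)\<^sup>2 / \<tau>) ^ N)"
  shows "G holomorphic_on {\<tau>. Im \<tau> > 0}"
    and "Im \<tau> > 0 \<Longrightarrow> norm (G \<tau>) = diff_norm3 N \<tau> (of_real l * \<tau> + of_real m)"
proof -
  have op: "open {\<tau>. Im \<tau> > 0}" by (intro open_Collect_less continuous_intros)
  show "G holomorphic_on {\<tau>. Im \<tau> > 0}"
    unfolding G_def
    by (intro holomorphic_intros holomorphic_on_diff_val op) (use Im_cusp in auto)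
  assume \<tau>: "Im \<tau> > 0"
  define z where "z = of_real l * \<tau> + of_real m"
  have imz: "Im z = l * Im \<tau>" by (simp add: z_def)
  have g1: "gauss \<tau> z = norm (E (of_real l ^ 2 * \<tau>))"
    unfolding gauss_def norm_E imz using \<tau> by (simp add: power2_eq_square)
  have g2: "gauss (\<tau> + 1) z = gauss \<tau> z" by (simp add: gauss_def)
  have "gauss (1 - 1 / \<tau>) (z / \<tau>) = gauss (- 1 / \<tau>) (z / \<tau>)" by (simp add: gauss_def)
  then have g3: "gauss (1 - 1 / \<tau>) (z / \<tau>) = gauss \<tau> z / norm (E (z\<^sup>2 / \<tau>))"
    using gauss_inversion[OF \<tau>, of z] by (simp add: field_simps)
  have "norm (E (3 * of_real l ^ 2 * \<tau> - z\<^sup>2 / \<tau>)) = gauss \<tau> z * gauss (\<tau> + 1) z * gauss (1 - 1 / \<tau>) (z / \<tau>)"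
  proof -
    have "3 * of_real l ^ 2 * \<tau> = of_real l ^ 2 * \<tau> + of_real l ^ 2 * \<tau> + of_real l ^ 2 * \<tau>" by simp
    then show ?thesis unfolding g3 g2 g1 by (simp only: E_diff E_add norm_mult norm_divide times_divide_eq_right)
  qed
  then show "norm (G \<tau>) = diff_norm3 N \<tau> (of_real l * \<tau> + of_real m)"
    unfolding G_def z_def[symmetric] diff_norm3_def diff_norm_def norm_mult norm_power
    by (simp add: power_mult_distrib)
qed

lemma countable_zeros_or_zero:
  assumes "f holomorphic_on S" "open S" "connected S" "fsigma S" "z0 \<in> S" "f z0 \<noteq> 0"
  shows "countable {z\<in>S. f z = 0}"
proof (cases "f constant_on S")
  case True
  then have "{z\<in>S. f z = 0} = {}" using assms(5,6) by (auto simp: constant_on_def)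
  then show ?thesis by (metis countable_empty)
qed (use assms holomorphic_countable_zeros in blast)

text \<open>Holomorphic functions that are not identically 0 have countably many zeros. First \<tau>
  is chosen so that \<open>diff_val\<close> at \<open>z1\<close> is nonzero at all three coset
  points, then z off the zeros of three entire functions.\<close>

lemma diff_norm3_nonzero:
  assumes nz: "diff_val N \<tau>1 z1 \<noteq> 0" "Im \<tau>1 > 0"
  shows "\<exists>\<tau> z. Im \<tau> > 0 \<and> diff_norm3 N \<tau> z > 0"
proof -
  define H where "H = {\<tau>. Im \<tau> > 0}"
  have H: "open H" "connected H" "\<tau>1 \<in> H"
    unfolding H_def using nz(2) by (auto intro!: open_Collect_less continuous_intros convex_connected convex_halfspace_Im_gt)
  have fsH: "fsigma H"
  proof -
    have "H = (\<Union>n. {\<tau>. Im \<tau> \<ge> 1 / real (Suc n)})"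
    proof (intro equalityI subsetI)
      fix \<tau> assume "\<tau> \<in> H"
      then have "Im \<tau> > 0" by (simp add: H_def)
      then obtain n where "inverse (real (Suc n)) < Im \<tau>" using reals_Archimedean by blast
      then show "\<tau> \<in> (\<Union>n. {\<tau>. Im \<tau> \<ge> 1 / real (Suc n)})" by (auto simp: inverse_eq_divide intro!: exI[of _ n])
    next
      fix \<tau> assume "\<tau> \<in> (\<Union>n. {\<tau>. Im \<tau> \<ge> 1 / real (Suc n)})"
      then obtain n where "Im \<tau> \<ge> 1 / real (Suc n)" by blast
      moreover have "1 / real (Suc n) > 0" by simp
      ultimately show "\<tau> \<in> H" unfolding H_def by (simp only: mem_Collect_eq)
    qed
    moreover have "closed {\<tau>. Im \<tau> \<ge> 1 / real (Suc n)}" for n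
      by (intro closed_Collect_le continuous_intros)
    ultimately show ?thesis by (metis fsigma.intros)
  qed
  define B where "B = {\<tau>\<in>H. diff_val N \<tau> z1 = 0}"
  have "(\<lambda>\<tau>. diff_val N \<tau> z1) holomorphic_on H"
    by (rule holomorphic_on_diff_val) (auto simp: H_def[symmetric] H intro!: holomorphic_intros, simp add: H_def)
  then have cB: "countable B"
    unfolding B_def by (rule countable_zeros_or_zero[where f = "\<lambda>\<tau>. diff_val N \<tau> z1", OF _ H(1,2) fsH H(3) nz(1)])
  \<comment> \<open>The preimages of \<open>B\<close> under the coset maps \<tau> + 1 and 1 - 1 /
    \<tau> are included.\<close>
  define B' where "B' = B \<union> (\<lambda>t. t - 1) ` B \<union> (\<lambda>t. 1 / (1 - t)) ` B"
  have "countable B'" unfolding B'_def using cB by auto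
  moreover have "uncountable H"
    using uncountable_ball[of "Im \<tau>1" \<tau>1] nz(2) 
    by (metis H(1) H(3) countable_subset open_contains_ball_eq uncountable_ball)
  ultimately obtain \<tau> where \<tau>: "\<tau> \<in> H" "\<tau> \<notin> B'" by (metis countable_subset subsetI)
  have \<tau>0: "Im \<tau> > 0" "\<tau> \<noteq> 0" using \<tau> by (auto simp: H_def)
  have n1: "diff_val N \<tau> z1 \<noteq> 0" using \<tau> by (auto simp: B'_def B_def)
  have n2: "diff_val N (\<tau> + 1) z1 \<noteq> 0"
  proof
    assume "diff_val N (\<tau> + 1) z1 = 0"
    then have "\<tau> + 1 \<in> B" using \<tau>0 by (simp add: B_def H_def)
    then have "\<tau> + 1 - 1 \<in> (\<lambda>t. t - 1) ` B" by (rule imageI)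
    then show False using \<tau>(2) by (simp add: B'_def)
  qed
  have n3: "diff_val N (1 - 1 / \<tau>) z1 \<noteq> 0"
  proof
    assume "diff_val N (1 - 1 / \<tau>) z1 = 0"
    then have "1 - 1 / \<tau> \<in> B" using Im_cusp[OF \<tau>0(1)] by (simp add: B_def H_def)
    then have "1 / (1 - (1 - 1 / \<tau>)) \<in> (\<lambda>t. 1 / (1 - t)) ` B" by (rule imageI)
    then show False using \<tau>(2) by (simp add: B'_def)
  qed
  have c: "countable {z. diff_val N t (z * s) = 0}" if t: "Im t > 0" "s \<noteq> 0" "diff_val N t z1 \<noteq> 0" for t s
  proof -
    have hol: "(\<lambda>z. diff_val N t (z * s)) holomorphic_on UNIV"
      by (rule holomorphic_on_diff_val) (use t in \<open>auto intro!: holomorphic_intros\<close>)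
    have "countable {z\<in>UNIV. diff_val N t (z * s) = 0}"
      by (rule countable_zeros_or_zero[OF hol open_UNIV connected_UNIV fsigma_UNIV UNIV_I, of "z1 / s"])
         (use t in simp)
    then show ?thesis by simp
  qed
  have "countable ({z. diff_val N \<tau> (z * 1) = 0} \<union> {z. diff_val N (\<tau> + 1) (z * 1) = 0} \<union> {z. diff_val N (1 - 1 / \<tau>) (z * (1 / \<tau>)) = 0})"
    using c[of \<tau> 1] c[of "\<tau> + 1" 1] c[of "1 - 1 / \<tau>" "1 / \<tau>"] n1 n2 n3 \<tau>0 Im_cusp[OF \<tau>0(1)] by auto
  then obtain z where "z \<notin> {z. diff_val N \<tau> (z * 1) = 0} \<union> {z. diff_val N (\<tau> + 1) (z * 1) = 0} \<union> {z. diff_val N (1 - 1 / \<tau>) (z * (1 / \<tau>)) = 0}"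
    using uncountable_UNIV_complex by (metis UNIV_eq_I)
  then have "diff_norm3 N \<tau> z > 0" by (simp add: diff_norm3_def diff_norm_def)
  then show ?thesis using \<tau>0 by blast
qed

text \<open>The maximum modulus principle applies in \<open>\<tau>\<close> after fixing the coordinates \<open>(l, m)\<close> of
  \<open>z = l \<tau> + m\<close>.\<close>

lemma diff_val_eq_0:
  assumes N: "N > 0" and low: "\<And>z i. i < N \<Longrightarrow> fps_nth (diff_fps z N) i = 0" and \<tau>2: "Im \<tau>2 > 0"
  shows "diff_val N \<tau>2 z2 = 0"
proof (rule ccontr)
  assume "diff_val N \<tau>2 z2 \<noteq> 0"
  then obtain \<tau>1 z1 where 1: "Im \<tau>1 > 0" "diff_norm3 N \<tau>1 z1 > 0" using diff_norm3_nonzero[OF _ \<tau>2] by blast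
  define \<epsilon> where "\<epsilon> = diff_norm3 N \<tau>1 z1"
  obtain C where C: "C \<ge> 0" "\<And>\<tau> z. Im \<tau> \<ge> 1 \<Longrightarrow> \<bar>Im z\<bar> \<le> Im \<tau> / 2 \<Longrightarrow> diff_norm3 N \<tau> z \<le> C * exp (- (pi * real N * Im \<tau> / 4))"
    using diff_norm3_bound[OF N low] by blast
  have small: "\<exists>Y\<ge>1. \<forall>y\<ge>Y. C * exp (- (pi * real N * y / 4)) < \<delta>" if \<delta>: "\<delta> > 0" for \<delta>
  proof -
    define k where "k = pi * real N / 4"
    have k: "k > 0" using N by (simp add: k_def)
    show ?thesis
    proof (intro exI[of _ "max 1 (C / \<delta> / k)"] conjI allI impI)
      fix y assume "max 1 (C / \<delta> / k) \<le> y"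
      then have "C / \<delta> / k \<le> y" by simp
      then have "C / \<delta> \<le> y * k" unfolding pos_divide_le_eq[OF k] .
      also have "\<dots> < 1 + k * y" by simp
      also have "\<dots> \<le> exp (k * y)" by (rule exp_ge_add_one_self)
      finally have "C < \<delta> * exp (k * y)" using \<delta> by (simp add: pos_divide_less_eq mult.commute)
      then show "C * exp (- (pi * real N * y / 4)) < \<delta>" by (simp add: k_def exp_minus field_simps)
    qed simp
  qed
  \<comment> \<open>Above height \<open>Y\<close> the invariant stays below the attained value
    \<epsilon>, so its supremum is a maximum over the compact set \<open>K\<close> of parameters
    (\<tau>, l, m).\<close>
  obtain Y where Y: "Y \<ge> 1" "\<And>y. y \<ge> Y \<Longrightarrow> C * exp (- (pi * real N * y / 4)) < \<epsilon>"
    using small[of \<epsilon>] 1 by (auto simp: \<epsilon>_def)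
  define b where "b p = diff_norm3 N (fst p) (of_real (fst (snd p)) * fst p + of_real (snd (snd p)))" for p :: "complex \<times> real \<times> real"
  define K where "K = cbox (Complex (-1/2) (1/2)) (Complex (1/2) Y) \<times> {-1/2..1/2 :: real} \<times> {-1/2..1/2 :: real}"
  have K_iff: "p \<in> K \<longleftrightarrow> \<bar>Re (fst p)\<bar> \<le> 1 / 2 \<and> 1 / 2 \<le> Im (fst p) \<and> Im (fst p) \<le> Y \<and> \<bar>fst (snd p)\<bar> \<le> 1 / 2 \<and> \<bar>snd (snd p)\<bar> \<le> 1 / 2" for p
    by (cases p) (auto simp: K_def in_cbox_complex_iff abs_le_iff)
  have reduce: "\<exists>p. b p = diff_norm3 N \<tau> z \<and> (p \<in> K \<or> b p < \<epsilon>)" if \<tau>: "Im \<tau> > 0" for \<tau> z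
  proof -
    define v where "v = diff_norm3 N \<tau> z"
    have "\<exists>\<tau>' z'. diff_norm3 N \<tau>' z' = v \<and> Im \<tau>' \<ge> 1 / 2 \<and> \<bar>Re \<tau>'\<bar> \<le> 1 / 2"
    proof (rule reduction_to_strip)
      show "diff_norm3 N \<tau> z = v" by (simp add: v_def)
      show "Im \<tau> > 0" by (rule \<tau>)
    next
      fix t w assume "Im t > 0" "diff_norm3 N t w = v"
      then show "diff_norm3 N (t + 1) w = v" "diff_norm3 N (t - 1) w = v" "diff_norm3 N (- 1 / t) (w / t) = v"
        using diff_norm3_T[of t N w] diff_norm3_T[of "t - 1" N w] diff_norm3_S[of t N w] by simp_all
    qed
    then obtain t w where t: "diff_norm3 N t w = v" "Im t \<ge> 1 / 2" "\<bar>Re t\<bar> \<le> 1 / 2" by blast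
    have t0: "Im t > 0" using t by linarith
    define l0 where "l0 = Im w / Im t"
    define m0 where "m0 = Re w - l0 * Re t"
    have w: "w = of_real l0 * t + of_real m0" using t0 by (simp add: complex_eq_iff l0_def m0_def)
    define l m where "l = l0 - of_int (round l0)" "m = m0 - of_int (round m0)"
    have lm: "\<bar>l\<bar> \<le> 1 / 2" "\<bar>m\<bar> \<le> 1 / 2"
      using of_int_round_abs_le[of l0] of_int_round_abs_le[of m0] by (simp_all add: l_m_def abs_minus_commute)
    have "of_real l * t + of_real m = w + of_int (- round l0) * t + of_int (- round m0)"
      unfolding w by (simp add: l_m_def algebra_simps)
    then have bv: "b (t, l, m) = v" 
      unfolding b_def fst_conv snd_conv by (simp only: diff_norm3_shift[OF t0] t(1))
    have "(t, l, m) \<in> K \<or> b (t, l, m) < \<epsilon>"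
    proof (cases "Im t \<le> Y")
      case True
      then show ?thesis using t lm by (simp add: K_iff)
    next
      case False
      have "\<bar>Im (of_real l * t + of_real m)\<bar> = \<bar>l\<bar> * Im t" using t0 by (simp add: abs_mult)
      also have "\<dots> \<le> 1 / 2 * Im t" using lm t0 by (intro mult_right_mono) auto
      finally have "b (t, l, m) \<le> C * exp (- (pi * real N * Im t / 4))"
        unfolding b_def fst_conv snd_conv using False Y(1) by (intro C) auto
      also have "\<dots> < \<epsilon>" using Y(2) False by simp
      finally show ?thesis by simp
    qed
    then show ?thesis using bv v_def by blast
  qed
  have "compact K" unfolding K_def by (intro compact_Times compact_cbox compact_Icc)
  moreover have "K \<noteq> {}"
  proof -
    have "(\<i>, 0, 0) \<in> K" using Y(1) by (simp add: K_iff)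
    then show ?thesis by blast
  qed
  moreover have "continuous_on K b"
    unfolding b_def diff_norm3_def
    by (intro continuous_on_mult continuous_on_diff_norm continuous_intros)
       (use Im_cusp in \<open>auto simp: K_iff complex_eq_iff\<close>)
  ultimately have "\<exists>p\<in>K. \<forall>q\<in>K. b q \<le> b p" by (rule continuous_attains_sup)
  then obtain p0 where p0: "p0 \<in> K" "\<And>p. p \<in> K \<Longrightarrow> b p \<le> b p0" by blast
  obtain q where q: "b q = \<epsilon>" "q \<in> K \<or> b q < \<epsilon>" using reduce[OF 1(1), of z1] by (auto simp: \<epsilon>_def)
  then have s: "\<epsilon> \<le> b p0" using p0(2)[of q] by auto
  have sup: "diff_norm3 N \<tau> z \<le> b p0" if \<tau>: "Im \<tau> > 0" for \<tau> z
  proof -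
    obtain p where "b p = diff_norm3 N \<tau> z" "p \<in> K \<or> b p < \<epsilon>" using reduce[OF \<tau>] by blast
    then show ?thesis using p0(2)[of p] s by auto
  qed
  obtain \<tau>0 l m where p0e: "p0 = (\<tau>0, l, m)" by (cases p0)
  have \<tau>0: "Im \<tau>0 > 0" "\<bar>l\<bar> \<le> 1 / 2" using p0(1) unfolding p0e K_iff by auto
  define H where "H = {\<tau>. Im \<tau> > 0}"
  have H: "open H" "connected H" "\<tau>0 \<in> H"
    unfolding H_def using \<tau>0(1) by (auto intro!: open_Collect_less continuous_intros convex_connected convex_halfspace_Im_gt)
  define G where "G = (\<lambda>\<tau>. diff_val N \<tau> (of_real l * \<tau> + of_real m) * diff_val N (\<tau> + 1) (of_real l * \<tau> + of_real m) *
      diff_val N (1 - 1 / \<tau>) ((of_real l * \<tau> + of_real m) / \<tau>) *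
      E (3 * of_real l ^ 2 * \<tau> - (of_real l * \<tau> + of_real m)\<^sup>2 / \<tau>) ^ N)"
  have G: "G holomorphic_on H" "\<And>\<tau>. Im \<tau> > 0 \<Longrightarrow> norm (G \<tau>) = diff_norm3 N \<tau> (of_real l * \<tau> + of_real m)"
    unfolding G_def H_def by (rule diff_norm3_eq_norm_holomorphic)+
  have Gb: "norm (G \<tau>0) = b p0" using G(2)[OF \<tau>0(1)] by (simp add: b_def p0e)
  have "G constant_on H"
  proof (rule maximum_modulus_principle[OF G(1) H(1,2,1) order_refl H(3)])
    fix t assume "t \<in> H"
    then show "norm (G t) \<le> norm (G \<tau>0)" unfolding Gb using G(2)[of t] sup[of t] by (simp add: H_def)
  qed
  then have Gc: "G t = G \<tau>0" if "t \<in> H" for t using that H(3) unfolding constant_on_def by metis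
  have bp: "b p0 > 0" using s 1(2) by (simp add: \<epsilon>_def)
  \<comment> \<open>The constant modulus of \<open>G\<close> is positive, yet with the same l and m
    it must fall below any bound high up on the imaginary axis.\<close>
  then obtain y where y: "y \<ge> 1" "C * exp (- (pi * real N * y / 4)) < b p0" using small by blast
  define t where "t = Complex 0 y"
  have t: "t \<in> H" "Im t = y" using y by (auto simp: t_def H_def)
  have "\<bar>l\<bar> * y \<le> 1 / 2 * y" using \<tau>0(2) y by (intro mult_right_mono) auto
  then have "diff_norm3 N t (of_real l * t + of_real m) \<le> C * exp (- (pi * real N * y / 4))"
    using C(2)[of t "of_real l * t + of_real m"] t y by (simp add: abs_mult)
  moreover have "norm (G t) = diff_norm3 N t (of_real l * t + of_real m)" using G(2) t y by simp
  ultimately show False using Gc[OF t(1)] Gb y by simp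
qed

text \<open>The quantifier over z stays inside the induction, since \<open>diff_val_eq_0\<close>
  uses the order of vanishing at all z at once.\<close>

lemma diff_fps_eq_0: "diff_fps z N = 0"
proof -
  have "\<forall>z. diff_fps z N = 0"
  proof (induction N rule: less_induct)
    case (less N)
    show ?case
    proof (cases "N = 0")
      case True
      have "{n :: int. n\<^sup>2 = 0} = {0}" by auto
      then have "square_fps z 0 = ph_fps 0" for z by (simp add: square_fps_def)
      moreover have "theta_z_fps 0 = theta_C"
        by (rule fps_ext) (simp add: theta_z_fps_def theta_C_def theta_fps_def)
      then have "ph_fps 0 = 1" by (metis mult.commute ph_fps_def theta_C_mult_inv)
      ultimately show ?thesis using True by (simp add: diff_fps_def)
    next
      case False
      have "fps_nth (diff_fps z N) i = 0" if "i < N" for z i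
        using diff_fps_low_coeffs[OF _ that, of z] less by blast
      then show ?thesis using diff_fps_eq_0I diff_val_eq_0 False by blast
    qed
  qed
  then show ?thesis by blast
qed

lemma exp_val_eq_square_val: "Im \<tau> > 0 \<Longrightarrow> exp_val N \<tau> z = square_val N \<tau> z"
  using diff_fps_eval[of \<tau> z N] diff_fps_eq_0[of z N] by (simp add: diff_val_def)

section \<open>The product for the theta series in three variables\<close>

lemma theta_op_eq_X_deriv: "theta_op F = fps_X * fps_deriv F"
proof (rule fps_ext)
  fix n show "fps_nth (theta_op F) n = fps_nth (fps_X * fps_deriv F) n" by (cases n) auto
qed

text \<open>On the closed disc of radius |w| the function Q exp (- L) has derivative 0, so the
  formal differential equation identifies the values of \<open>Q\<close> and of the exponential of
  \<open>L\<close>.\<close>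

lemma eval_fps_exp_ode:
  fixes Q L :: "complex fps"
  assumes "fps_nth Q 0 = 1" "fps_nth L 0 = 0" "theta_op Q = Q * theta_op L"
    and r: "ereal (norm w) < fps_conv_radius Q" "ereal (norm w) < fps_conv_radius L"
  shows "eval_fps Q w = exp (eval_fps L w)"
proof -
  have "fps_X * fps_deriv Q = fps_X * (Q * fps_deriv L)"
    using assms(3) by (simp add: theta_op_eq_X_deriv mult_ac)
  then have ode: "fps_deriv Q = Q * fps_deriv L" by simp
  define f where "f s = eval_fps Q s * exp (- eval_fps L s)" for s
  have "(f has_field_derivative 0) (at s within cball 0 (norm w))" if s: "s \<in> cball 0 (norm w)" for s
  proof -
    have rs: "ereal (norm s) < fps_conv_radius Q" "ereal (norm s) < fps_conv_radius L"
      using s r by (auto intro: le_less_trans[of _ "ereal (norm w)"])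
    have "ereal (norm s) < fps_conv_radius (fps_deriv L)"
      using rs(2) fps_conv_radius_deriv[of L] by (rule less_le_trans)
    then have "eval_fps (fps_deriv Q) s = eval_fps Q s * eval_fps (fps_deriv L) s"
      unfolding ode using rs(1) by (intro eval_fps_mult)
    then have "(f has_field_derivative 0) (at s)"
      unfolding f_def using rs
      by (auto intro!: derivative_eq_intros has_field_derivative_eval_fps)
    then show ?thesis by (rule has_field_derivative_at_within)
  qed
  then have "\<exists>c. \<forall>s\<in>cball 0 (norm w). f s = c"
    by (intro has_field_derivative_zero_constant) auto
  then obtain c where c: "\<And>s. s \<in> cball 0 (norm w) \<Longrightarrow> f s = c" by blast
  have "f w = f 0" using c[of w] c[of 0] by simp
  also have "f 0 = 1" using assms(1,2) by (simp add: f_def eval_fps_at_0)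
  finally show ?thesis by (simp add: f_def exp_minus field_simps)
qed

text \<open>At i = N = 0 every odd k divides both, so the index set is infinite and the sum is 0 by
  convention. That is the right constant term: log theta vanishes at X = 0.\<close>

lemma log_coeff_0_0: "log_coeff 0 0 z = 0"
proof -
  have "infinite {k :: nat. odd k}"
    unfolding infinite_nat_iff_unbounded
  proof
    fix m :: nat
    have "2 * m + 1 > m \<and> 2 * m + 1 \<in> {k :: nat. odd k}" by simp
    then show "\<exists>n>m. n \<in> {k :: nat. odd k}" by blast
  qed
  then show ?thesis by (simp add: log_coeff_def)
qed

lemma log_fps_0_radius: "fps_conv_radius (log_fps z 0) \<ge> 1"
proof (rule fps_conv_radius_ge_1)
  fix R :: real assume "R > 1"
  then obtain C where C: "\<And>n. exp (1 * sqrt (real n)) \<le> C * R ^ n" using exp_sqrt_le_power[of R 1] by blast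
  show "\<exists>C. \<forall>n. norm (fps_nth (log_fps z 0) n) \<le> C * R ^ n"
  proof (intro exI allI)
    fix n
    show "norm (fps_nth (log_fps z 0) n) \<le> (4 * C) * R ^ n"
    proof (cases "n = 0")
      case True
      then show ?thesis using C[of 0] by (simp add: log_fps_def log_coeff_0_0)
    next
      case False
      have "{k. k dvd n \<and> odd k} \<subseteq> {1..n}" using False by (auto dest: dvd_imp_le intro: Suc_leI Nat.gr0I)
      then have "card {k. k dvd n \<and> odd k} \<le> card {1..n}" by (intro card_mono) auto
      then have cd: "card {k. k dvd n \<and> odd k} \<le> n" by simp
      have "norm (fps_nth (log_fps z 0) n) = \<bar>log_theta_coeff n\<bar>" by (simp add: log_fps_def log_coeff_0)
      also have "\<dots> \<le> (\<Sum>k | k dvd n \<and> odd k. 2)"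
        unfolding log_theta_coeff_def real_norm_def[symmetric]
      proof (rule sum_norm_le)
        fix k assume "k \<in> {k. k dvd n \<and> odd k}"
        then have "k > 0" by (auto intro: Nat.gr0I)
        then have "2 / real k \<le> 2" by (simp add: divide_le_eq)
        then show "norm (2 / real k * (-1) ^ (n + 1)) \<le> 2" by (simp add: abs_mult power_abs)
      qed
      also have "\<dots> \<le> 2 * (real n + 1)" using cd by simp
      also have "\<dots> \<le> 2 * (2 * exp (sqrt (real n)))" by (intro mult_left_mono square_plus_one_le_exp) auto
      also have "\<dots> \<le> 4 * C * R ^ n" using C[of n] by simp
      finally show ?thesis .
    qed
  qed
qed

lemma exp_eval_log_fps_0:
  assumes \<tau>: "Im \<tau> > 0"
  shows "exp (eval_fps (log_fps z 0) (E \<tau>)) = th \<tau> 0"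
proof -
  have "eval_fps theta_C (E \<tau>) = exp (eval_fps (log_fps z 0) (E \<tau>))"
  proof (rule eval_fps_exp_ode)
    show "theta_op theta_C = theta_C * theta_op (log_fps z 0)" by (rule theta_op_theta_C)
  qed (use radius_E[OF fps_conv_radius_theta_C \<tau>] radius_E[OF log_fps_0_radius \<tau>]
    in \<open>auto simp: theta_C_def fps_nth_theta_fps_0 log_fps_def log_coeff_0_0\<close>)
  then show ?thesis using eval_theta_C[OF \<tau>] by simp
qed

lemma log_fps_radius: "fps_conv_radius (log_fps z N) \<ge> 1"
  using log_fps_0_radius jacobi_growth_radius[OF jacobi_growth_log_fps] by (cases "N = 0") auto

text \<open>\<open>E \<tau>\<close>, \<open>E (2 z)\<close> and \<open>E s\<close> are the three variables of the genus 2 theta constant; the condition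
  is a quantitative form of positive definiteness.\<close>

definition theta_cone :: "real \<Rightarrow> complex \<Rightarrow> complex \<Rightarrow> complex \<Rightarrow> bool" where
  "theta_cone \<eta> \<tau> z s \<longleftrightarrow> (\<forall>i N :: nat. \<forall>b :: int. b\<^sup>2 \<le> int (i * N) \<longrightarrow>
     \<eta> * (real i + real N) \<le> Im (of_nat i * \<tau> + 2 * of_int b * z + of_nat N * s))"

lemma theta_cone_Im: "theta_cone \<eta> \<tau> z s \<Longrightarrow> Im \<tau> \<ge> \<eta>"
proof -
  assume "theta_cone \<eta> \<tau> z s"
  then have "\<eta> * (real 1 + real 0) \<le> Im (of_nat 1 * \<tau> + 2 * of_int 0 * z + of_nat 0 * s)"
    unfolding theta_cone_def by (metis mult_0_right of_nat_0 order_refl power_zero_numeral)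
  then show ?thesis by simp
qed

text \<open>Lowering Im s increases |E s| at a small cost in \<eta>. Convergence at the shifted
  point then places E s strictly inside the disc of convergence.\<close>

lemma theta_cone_shift:
  assumes "theta_cone \<eta> \<tau> z s" "\<epsilon> \<ge> 0"
  shows "theta_cone (\<eta> - \<epsilon>) \<tau> z (s - of_real \<epsilon> * \<i>)"
  unfolding theta_cone_def
proof (intro allI impI)
  fix i N :: nat and b :: int assume "b\<^sup>2 \<le> int (i * N)"
  then have "\<eta> * (real i + real N) \<le> Im (of_nat i * \<tau> + 2 * of_int b * z + of_nat N * s)"
    using assms(1) unfolding theta_cone_def by blast
  moreover have "0 \<le> \<epsilon> * real i" using assms(2) by simp
  ultimately show "(\<eta> - \<epsilon>) * (real i + real N) \<le> Im (of_nat i * \<tau> + 2 * of_int b * z + of_nat N * (s - of_real \<epsilon> * \<i>))"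
    by (simp add: algebra_simps)
qed

lemma summable_on_mult_Times:
  fixes f :: "'a \<Rightarrow> real" and g :: "'b \<Rightarrow> real"
  assumes "f summable_on A" "g summable_on B" "\<And>x. f x \<ge> 0" "\<And>y. g y \<ge> 0"
  shows "(\<lambda>(x, y). f x * g y) summable_on A \<times> B"
proof (rule summable_on_SigmaI)
  fix x assume "x \<in> A"
  show "((\<lambda>y. case (x, y) of (x, y) \<Rightarrow> f x * g y) has_sum f x * infsum g B) B"
    using has_sum_cmult_right[OF has_sum_infsum[OF assms(2)]] by simp
qed (use assms in \<open>auto intro!: summable_on_cmult_left\<close>)

definition theta2 :: "complex \<Rightarrow> complex \<Rightarrow> complex \<Rightarrow> complex" where
  "theta2 \<tau> z s = (\<Sum>\<^sub>\<infinity>(n, m)\<in>(UNIV :: (int \<times> int) set). E (of_int m ^ 2 * \<tau> + 2 * of_int (m * n) * z + of_int n ^ 2 * s))"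

lemma theta2_has_sum:
  assumes P: "theta_cone \<eta> \<tau> z s" and \<eta>: "\<eta> > 0"
  shows "((\<lambda>(n, m). E (of_int m ^ 2 * \<tau> + 2 * of_int (m * n) * z + of_int n ^ 2 * s)) has_sum theta2 \<tau> z s) (UNIV :: (int \<times> int) set)"
proof -
  define r where "r = exp (- pi * \<eta>)"
  have r: "0 \<le> r" "r < 1" using \<eta> by (auto simp: r_def)
  have "(\<lambda>(n :: int, m :: int). r ^ nat \<bar>n\<bar> * r ^ nat \<bar>m\<bar>) summable_on UNIV \<times> UNIV"
    using r by (intro summable_on_mult_Times summable_on_power_abs_int) auto
  then have sum: "(\<lambda>(n :: int, m :: int). r ^ nat \<bar>n\<bar> * r ^ nat \<bar>m\<bar>) summable_on UNIV" by simp
  have "norm (E (of_int m ^ 2 * \<tau> + 2 * of_int (m * n) * z + of_int n ^ 2 * s)) \<le> r ^ nat \<bar>n\<bar> * r ^ nat \<bar>m\<bar>" for n m :: int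
  proof -
    have sq: "(of_int k :: complex) ^ 2 = of_nat (nat (k\<^sup>2))" for k :: int by simp
    have "(m * n)\<^sup>2 \<le> int (nat (m\<^sup>2) * nat (n\<^sup>2))" by (simp add: power_mult_distrib)
    then have "\<eta> * (real (nat (m\<^sup>2)) + real (nat (n\<^sup>2))) \<le> Im (of_int m ^ 2 * \<tau> + 2 * of_int (m * n) * z + of_int n ^ 2 * s)"
      using P unfolding theta_cone_def sq by blast
    moreover have ab: "real (nat \<bar>k\<bar>) \<le> real (nat (k\<^sup>2))" for k :: int
    proof -
      have "\<bar>k\<bar> \<le> k\<^sup>2" by (cases "k = 0") (use self_le_power[of "\<bar>k\<bar>" 2] in auto)
      then have "nat \<bar>k\<bar> \<le> nat (k\<^sup>2)" by (rule nat_mono)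
      then show ?thesis by (simp only: of_nat_le_iff)
    qed
    have "\<eta> * (real (nat \<bar>m\<bar>) + real (nat \<bar>n\<bar>)) \<le> \<eta> * (real (nat (m\<^sup>2)) + real (nat (n\<^sup>2)))"
      using \<eta> ab[of m] ab[of n] by (intro mult_left_mono) auto
    ultimately have "\<eta> * (real (nat \<bar>m\<bar>) + real (nat \<bar>n\<bar>)) \<le> Im (of_int m ^ 2 * \<tau> + 2 * of_int (m * n) * z + of_int n ^ 2 * s)"
      by linarith
    then have "pi * (\<eta> * (real (nat \<bar>m\<bar>) + real (nat \<bar>n\<bar>))) \<le> pi * Im (of_int m ^ 2 * \<tau> + 2 * of_int (m * n) * z + of_int n ^ 2 * s)"
      by (intro mult_left_mono) auto
    then have "norm (E (of_int m ^ 2 * \<tau> + 2 * of_int (m * n) * z + of_int n ^ 2 * s)) \<le> exp (- (pi * (\<eta> * (real (nat \<bar>m\<bar>) + real (nat \<bar>n\<bar>)))))"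
      unfolding norm_E by simp
    also have "\<dots> = r ^ nat \<bar>n\<bar> * r ^ nat \<bar>m\<bar>"
      unfolding r_def exp_of_nat_mult[symmetric] exp_add[symmetric] by (simp add: algebra_simps)
    finally show ?thesis .
  qed
  then have "(\<lambda>p. norm (case p of (n, m) \<Rightarrow> E (of_int m ^ 2 * \<tau> + 2 * of_int (m * n) * z + of_int n ^ 2 * s))) summable_on (UNIV :: (int \<times> int) set)"
    by (intro summable_on_comparison_test[OF sum]) auto
  then show ?thesis
    unfolding theta2_def by (rule has_sum_infsum[OF abs_summable_summable])
qed

text \<open>Summing over m first yields \<open>th \<tau> (n z)\<close>; division by
  \<open>th \<tau> 0\<close> and collecting equal n^2 produces \<open>square_val\<close>. The
  identity of \<open>exp_val\<close> and \<open>square_val\<close> enters here.\<close>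

lemma exp_val_sums:
  assumes P: "theta_cone \<eta> \<tau> z s" and \<eta>: "\<eta> > 0"
  shows "(\<lambda>N. exp_val N \<tau> z * E s ^ N) sums (theta2 \<tau> z s / th \<tau> 0)"
proof -
  have \<tau>: "Im \<tau> > 0" using theta_cone_Im[OF P] \<eta> by simp
  have "((\<lambda>n. E (of_int n ^ 2 * s) * th \<tau> (of_int n * z)) has_sum theta2 \<tau> z s) (UNIV :: int set)"
  proof (rule has_sum_SigmaD)
    show "((\<lambda>(n, m). E (of_int m ^ 2 * \<tau> + 2 * of_int (m * n) * z + of_int n ^ 2 * s)) has_sum theta2 \<tau> z s)
       (Sigma (UNIV :: int set) (\<lambda>_. UNIV :: int set))"
      using theta2_has_sum[OF P \<eta>] by simp
    fix n :: int
    have "((\<lambda>m :: int. E (of_int n ^ 2 * s) * E (of_int m ^ 2 * \<tau> + 2 * of_int m * (of_int n * z))) has_sum (E (of_int n ^ 2 * s) * th \<tau> (of_int n * z))) UNIV"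
      by (rule has_sum_cmult_right[OF th_has_sum[OF \<tau>]])
    then show "((\<lambda>m. case (n, m) of (n, m) \<Rightarrow> E (of_int m ^ 2 * \<tau> + 2 * of_int (m * n) * z + of_int n ^ 2 * s)) has_sum
      E (of_int n ^ 2 * s) * th \<tau> (of_int n * z)) UNIV"
      unfolding E_add[symmetric] by (simp add: algebra_simps)
  qed
  then have "((\<lambda>n. (E (of_int n ^ 2 * s) * th \<tau> (of_int n * z)) * (1 / th \<tau> 0)) has_sum theta2 \<tau> z s * (1 / th \<tau> 0)) (UNIV :: int set)"
    by (rule has_sum_cmult_left)
  then have hs: "((\<lambda>n. E (of_int n ^ 2 * s) * ph \<tau> (of_int n * z)) has_sum theta2 \<tau> z s / th \<tau> 0) (UNIV :: int set)"
    by (simp add: ph_def)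
  define B where "B = (\<lambda>k. {n :: int. n\<^sup>2 = int k})"
  define f where "f n = E (of_int n ^ 2 * s) * ph \<tau> (of_int n * z)" for n :: int
  note hs[folded f_def]
  also have "(UNIV :: int set) = snd ` Sigma UNIV B"
  proof -
    have "n \<in> snd ` Sigma UNIV B" for n
      by (rule image_eqI[of _ _ "(nat (n\<^sup>2), n)"]) (auto simp: B_def)
    then show ?thesis by blast
  qed
  finally have "((\<lambda>p. f (snd p)) has_sum theta2 \<tau> z s / th \<tau> 0) (Sigma UNIV B)"
    by (subst (asm) has_sum_reindex) (auto simp: inj_on_def B_def o_def)
  then have "((\<lambda>k. \<Sum>n\<in>B k. f n) has_sum theta2 \<tau> z s / th \<tau> 0) UNIV"
    by (rule has_sum_SigmaD) (auto intro!: has_sum_finiteI simp: B_def)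
  moreover have "(\<Sum>n\<in>B k. f n) = exp_val k \<tau> z * E s ^ k" for k
    unfolding exp_val_eq_square_val[OF \<tau>] square_val_def sum_distrib_right B_def
    by (rule sum.cong) (auto simp: f_def E_power_square)
  ultimately show ?thesis by (simp add: has_sum_imp_sums)
qed

text \<open>A point \<open>(i, N, b)\<close> stands for \<open>(\<alpha>, \<gamma>, \<beta>)\<close> in the definition of \<open>d_form\<close>.\<close>

definition cone_points :: "(nat \<times> nat \<times> int) set" where
  "cone_points = {(i, N, b). (i, N) \<noteq> (0, 0) \<and> b\<^sup>2 \<le> int (i * N)}"

fun cone_coeff :: "nat \<times> nat \<times> int \<Rightarrow> complex" where
  "cone_coeff (i, N, b) = (-1) ^ ((i + 1) * (N + 1)) * fps_nth inv_theta_C (nat (int (i * N) - b\<^sup>2))"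

text \<open>For odd k, the k-th term of \<open>cone_coeff\<close> times log ((1 + x) / (1 - x)) at
  the monomial x = E (i \<tau> + 2 b z + N s).\<close>

fun cone_term :: "complex \<Rightarrow> complex \<Rightarrow> complex \<Rightarrow> (nat \<times> nat \<times> int) \<times> nat \<Rightarrow> complex" where
  "cone_term \<tau> z s ((i, N, b), k) = cone_coeff (i, N, b) *
     (2 / of_nat k * E (of_nat i * \<tau> + 2 * of_int b * z + of_nat N * s) ^ k)"

lemma cone_point_bounds:
  assumes "b\<^sup>2 \<le> int (i * N)"
  shows "2 * sqrt (real (i * N)) \<le> real i + real N" "real (nat \<bar>b\<bar>) \<le> real i + real N"
proof -
  have "0 \<le> (sqrt (real i) - sqrt (real N))\<^sup>2" by simp
  then show 1: "2 * sqrt (real (i * N)) \<le> real i + real N" by (simp add: power2_diff real_sqrt_mult)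
  have "real_of_int (b\<^sup>2) \<le> real_of_int (int (i * N))" using assms by (simp only: of_int_le_iff)
  then have "sqrt ((real_of_int b)\<^sup>2) \<le> sqrt (real (i * N))" by (intro real_sqrt_le_mono) simp
  moreover have "0 \<le> sqrt (real (i * N))" by simp
  ultimately show "real (nat \<bar>b\<bar>) \<le> real i + real N" using 1 by simp
qed

text \<open>Put \<sigma> = i + N. The coefficient costs at most exp (2 \<sigma>), because 4 sqrt (i
  N) \<le> 2 \<sigma>, and summability over b costs another exp \<sigma>, because |b| \<le>
  \<sigma>. The monomial contributes exp (- pi \<eta> \<sigma>), whence the threshold 3.\<close>

lemma cone_term_abs_summable:
  assumes P: "theta_cone \<eta> \<tau> z s" and \<eta>: "pi * \<eta> > 3"
  shows "(\<lambda>p. norm (cone_term \<tau> z s p)) summable_on (cone_points \<times> {k. odd k})"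
proof -
  define \<kappa> where "\<kappa> = exp (3 - pi * \<eta>)"
  have \<kappa>: "0 \<le> \<kappa>" "\<kappa> < 1" using \<eta> by (auto simp: \<kappa>_def)
  define e where "e = exp (-1 :: real)"
  have e: "0 \<le> e" "e < 1" by (auto simp: e_def)
  have ns: "(\<lambda>n. \<kappa> ^ n) summable_on (UNIV :: nat set)"
    using \<kappa> by (intro norm_summable_imp_summable_on) (simp add: norm_power)
  have ks: "(\<lambda>n. 2 * \<kappa> ^ (n - 1)) summable_on (UNIV :: nat set)"
  proof (rule norm_summable_imp_summable_on)
    have "summable (\<lambda>n. 2 * \<kappa> ^ n)" using \<kappa> by (intro summable_mult summable_geometric) auto
    then have "summable (\<lambda>n. 2 * \<kappa> ^ (Suc n - 1))" by simp
    then have "summable (\<lambda>n. 2 * \<kappa> ^ (n - 1))" by (subst (asm) summable_Suc_iff[of "\<lambda>n. 2 * \<kappa> ^ (n - 1)"])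
    then show "summable (\<lambda>n. norm (2 * \<kappa> ^ (n - 1)))" using \<kappa> by (simp add: abs_mult power_abs)
  qed
  define M2 where "M2 = (\<lambda>(N :: nat, b :: int). \<kappa> ^ N * e ^ nat \<bar>b\<bar>)"
  have M2: "M2 summable_on UNIV"
    using summable_on_mult_Times[OF ns summable_on_power_abs_int[OF e]] \<kappa> e by (simp add: M2_def)
  define M1 where "M1 = (\<lambda>(i :: nat, p). \<kappa> ^ i * M2 p)"
  have M2n: "M2 p \<ge> 0" for p using \<kappa> e by (simp add: M2_def split: prod.split)
  have M1: "M1 summable_on UNIV"
    using summable_on_mult_Times[OF ns M2] \<kappa> M2n by (simp add: M1_def)
  have M1n: "M1 p \<ge> 0" for p using \<kappa> M2n by (simp add: M1_def split: prod.split)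
  have sum: "(\<lambda>(p, k). M1 p * (2 * \<kappa> ^ (k - 1))) summable_on (cone_points \<times> {k. odd k})"
    by (rule summable_on_mult_Times)
       (use M1 ks \<kappa> M1n in \<open>auto intro: summable_on_subset_banach\<close>)
  show ?thesis
  proof (rule summable_on_comparison_test[OF sum])
    fix p assume "p \<in> cone_points \<times> {k :: nat. odd k}"
    then obtain i N b k where p: "p = ((i, N, b), k)" "(i, N) \<noteq> (0, 0)" "b\<^sup>2 \<le> int (i * N)" "odd k"
      by (auto simp: cone_points_def)
    define \<sigma> where "\<sigma> = real i + real N"
    have k1: "real k \<ge> 1" using p(4) by (cases k) auto
    have \<sigma>1: "\<sigma> \<ge> 1" using p(2) by (cases i; cases N) (auto simp: \<sigma>_def)
    have im: "\<eta> * \<sigma> \<le> Im (of_nat i * \<tau> + 2 * of_int b * z + of_nat N * s)"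
      using P p(3) unfolding theta_cone_def \<sigma>_def by blast
    have "nat (int (i * N) - b\<^sup>2) \<le> i * N" by (simp add: nat_le_iff)
    then have "real (nat (int (i * N) - b\<^sup>2)) \<le> real (i * N)" by (simp only: of_nat_le_iff)
    then have "4 * sqrt (real (nat (int (i * N) - b\<^sup>2))) \<le> 4 * sqrt (real (i * N))" by (intro mult_left_mono real_sqrt_le_mono) auto
    also have "\<dots> \<le> 2 * \<sigma>" using cone_point_bounds(1)[OF p(3)] by (simp add: \<sigma>_def)
    finally have "exp (4 * sqrt (real (nat (int (i * N) - b\<^sup>2)))) \<le> exp (2 * \<sigma>)" by simp
    then have c: "norm (fps_nth inv_theta_C (nat (int (i * N) - b\<^sup>2))) \<le> exp (2 * \<sigma>)"
      using inv_theta_C_bound order_trans by blast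
    have "norm (cone_term \<tau> z s p) = norm (fps_nth inv_theta_C (nat (int (i * N) - b\<^sup>2))) * (2 / real k *
        exp (real k * (- pi * Im (of_nat i * \<tau> + 2 * of_int b * z + of_nat N * s))))"
      unfolding p(1) cone_term.simps cone_coeff.simps norm_mult norm_power norm_E exp_of_nat_mult
      by (simp add: norm_divide)
    also have "\<dots> \<le> exp (2 * \<sigma>) * (2 * exp (- (pi * \<eta>) * (real k * \<sigma>)))"
    proof (intro mult_mono c)
      show "2 / real k \<le> 2" using k1 by (simp add: divide_le_eq)
      have "real k * (pi * (\<eta> * \<sigma>)) \<le> real k * (pi * Im (of_nat i * \<tau> + 2 * of_int b * z + of_nat N * s))"
        using im by (intro mult_left_mono) auto
      then show "exp (real k * (- pi * Im (of_nat i * \<tau> + 2 * of_int b * z + of_nat N * s))) \<le> exp (- (pi * \<eta>) * (real k * \<sigma>))"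
        by (simp add: mult_ac)
    qed auto
    also have "\<dots> \<le> exp (2 * \<sigma>) * (2 * exp (- (pi * \<eta>) * (\<sigma> + (real k - 1))))"
    proof -
      \<comment> \<open>This splits the exponent k \<sigma> into separate decay in \<sigma> and in
        k, both being at least 1.\<close>
      have "0 \<le> (real k - 1) * (\<sigma> - 1)" using k1 \<sigma>1 by simp
      then have "\<sigma> + (real k - 1) \<le> real k * \<sigma>" by (simp add: algebra_simps)
      then have "(pi * \<eta>) * (\<sigma> + (real k - 1)) \<le> (pi * \<eta>) * (real k * \<sigma>)" using \<eta> by (intro mult_left_mono) auto
      then show ?thesis by simp
    qed
    also have "\<dots> = 2 * exp (2 * \<sigma> - pi * \<eta> * \<sigma> - pi * \<eta> * (real k - 1))"
      by (simp add: exp_add[symmetric] algebra_simps)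
    also have "\<dots> \<le> 2 * exp ((3 - pi * \<eta>) * \<sigma> - real (nat \<bar>b\<bar>) + (3 - pi * \<eta>) * (real k - 1))"
      using cone_point_bounds(2)[OF p(3)] k1 by (simp add: \<sigma>_def algebra_simps)
    also have "\<dots> = M1 (i, N, b) * (2 * \<kappa> ^ (k - 1))"
    proof -
      have "real (k - 1) = real k - 1" using k1 by simp
      then show ?thesis
        unfolding M1_def M2_def \<kappa>_def e_def \<sigma>_def prod.case exp_of_nat_mult[symmetric]
        by (simp add: exp_add[symmetric] algebra_simps)
    qed
    finally show "norm (cone_term \<tau> z s p) \<le> (case p of (p, k) \<Rightarrow> M1 p * (2 * \<kappa> ^ (k - 1)))" by (simp add: p(1))
  qed auto
qed

text \<open>Convolution of 1/theta with the squares. With n = \<alpha> \<gamma> this is the source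
  of the arguments \<alpha> \<gamma> - \<beta>^2 in \<open>d_form\<close>.\<close>

lemma ph_fps_nth: "fps_nth (ph_fps w) n = (\<Sum>b | b\<^sup>2 \<le> int n. fps_nth inv_theta_C (nat (int n - b\<^sup>2)) * E (2 * of_int b * w))"
proof -
  have "fps_nth (ph_fps w) n = (\<Sum>j=0..n. \<Sum>b | b\<^sup>2 = int (n - j). fps_nth inv_theta_C j * E (2 * of_int b * w))"
    by (simp add: ph_fps_def fps_mult_nth theta_z_fps_def sum_distrib_left)
  also have "\<dots> = (\<Sum>(j, b)\<in>Sigma {0..n} (\<lambda>j. {b :: int. b\<^sup>2 = int (n - j)}). fps_nth inv_theta_C j * E (2 * of_int b * w))"
    by (rule sum.Sigma) auto
  also have "\<dots> = (\<Sum>b | b\<^sup>2 \<le> int n. fps_nth inv_theta_C (nat (int n - b\<^sup>2)) * E (2 * of_int b * w))"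
    by (rule sum.reindex_bij_witness[of _ "\<lambda>b. (nat (int n - b\<^sup>2), b)" snd]) (auto simp: nat_diff_distrib)
  finally show ?thesis .
qed

lemma finite_squares_le: "finite {b :: int. b\<^sup>2 \<le> int n}"
proof (rule finite_subset)
  show "{b :: int. b\<^sup>2 \<le> int n} \<subseteq> {- int n..int n}"
  proof
    fix b :: int assume "b \<in> {b. b\<^sup>2 \<le> int n}"
    moreover have "\<bar>b\<bar> \<le> b\<^sup>2" by (cases "b = 0") (use self_le_power[of "\<bar>b\<bar>" 2] in auto)
    ultimately show "b \<in> {- int n..int n}" by auto
  qed
qed auto

definition log_theta2 :: "complex \<Rightarrow> complex \<Rightarrow> complex \<Rightarrow> complex" where
  "log_theta2 \<tau> z s = infsum (cone_term \<tau> z s) (cone_points \<times> {k. odd k})"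

lemma log_theta2_has_sum:
  assumes "theta_cone \<eta> \<tau> z s" "pi * \<eta> > 3"
  shows "(cone_term \<tau> z s has_sum log_theta2 \<tau> z s) (cone_points \<times> {k. odd k})"
  unfolding log_theta2_def
  by (rule has_sum_infsum[OF abs_summable_summable[OF cone_term_abs_summable[OF assms]]])

text \<open>The pairs (k, b) that contribute to the monomial X^i Y^N through the k-th power of a
  cone monomial. At (0, 0) every odd k would qualify; the empty set there agrees with
  \<open>log_coeff_0_0\<close>.\<close>

definition divisor_points :: "nat \<times> nat \<Rightarrow> (nat \<times> int) set" where
  "divisor_points = (\<lambda>(N, i). if (N, i) = (0, 0) then {} else
     Sigma {k. k dvd i \<and> k dvd N \<and> odd k} (\<lambda>k. {b. b\<^sup>2 \<le> int (i div k * (N div k))}))"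

lemma finite_common_divisors: "(N, i) \<noteq> (0, 0) \<Longrightarrow> finite {k :: nat. k dvd i \<and> k dvd N \<and> odd k}"
  by (rule finite_subset[of _ "{..i + N}"]) (auto dest: dvd_imp_le)

lemma finite_divisor_points: "finite (divisor_points p)"
proof (cases "p = (0, 0)")
  case False
  then show ?thesis
    by (cases p) (auto simp: divisor_points_def simp del: of_nat_mult intro!: finite_SigmaI finite_squares_le finite_common_divisors)
qed (simp add: divisor_points_def)

lemma log_coeff_term_eq_sum:
  "log_coeff i N z * E \<tau> ^ i * E s ^ N =
     (\<Sum>(k, b)\<in>divisor_points (N, i). cone_term \<tau> z s ((i div k, N div k, b), k))"
proof (cases "(N, i) = (0, 0)")
  case True
  then show ?thesis by (simp add: divisor_points_def log_coeff_0_0)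
next
  case False
  define K where "K = {k :: nat. k dvd i \<and> k dvd N \<and> odd k}"
  define c where "c k = 2 / of_nat k * (-1 :: complex) ^ ((i div k + 1) * (N div k + 1))" for k
  define B where "B k = {b :: int. b\<^sup>2 \<le> int (i div k * (N div k))}" for k
  define v where "v k b = fps_nth inv_theta_C (nat (int (i div k * (N div k)) - b\<^sup>2))" for k b
  have K: "finite K" unfolding K_def by (rule finite_common_divisors[OF False])
  have B: "finite (B k)" for k unfolding B_def by (rule finite_squares_le)
  have dp: "divisor_points (N, i) = Sigma K B" using False by (auto simp: divisor_points_def K_def B_def)
  have ct: "cone_term \<tau> z s ((i div k, N div k, b), k) = c k * (v k b * E (2 * of_int b * (of_nat k * z))) * (E \<tau> ^ i * E s ^ N)"
    if "k \<in> K" for k b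
  proof -
    have "k > 0" and k: "k * (i div k) = i" "k * (N div k) = N" using that by (auto simp: K_def intro!: Nat.gr0I)
    have "E (of_nat (i div k) * \<tau> + 2 * of_int b * z + of_nat (N div k) * s) ^ k =
       E (of_nat (k * (i div k)) * \<tau> + 2 * of_int b * (of_nat k * z) + of_nat (k * (N div k)) * s)"
      unfolding E_power of_nat_mult by (simp add: algebra_simps)
    also have "\<dots> = E (2 * of_int b * (of_nat k * z)) * (E \<tau> ^ i * E s ^ N)"
      unfolding k E_power E_add by (simp add: mult_ac)
    finally show ?thesis by (simp add: c_def v_def mult_ac)
  qed
  have "log_coeff i N z * E \<tau> ^ i * E s ^ N = (\<Sum>k\<in>K. c k * (\<Sum>b\<in>B k. v k b * E (2 * of_int b * (of_nat k * z)))) * (E \<tau> ^ i * E s ^ N)"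
    unfolding log_coeff_def ph_fps_nth K_def c_def v_def B_def by (simp only: mult.assoc)
  also have "\<dots> = (\<Sum>k\<in>K. \<Sum>b\<in>B k. cone_term \<tau> z s ((i div k, N div k, b), k))"
    unfolding sum_distrib_right sum_distrib_left by (intro sum.cong refl) (simp only: ct)
  also have "\<dots> = (\<Sum>(k, b)\<in>Sigma K B. cone_term \<tau> z s ((i div k, N div k, b), k))"
    by (rule sum.Sigma) (use K B in auto)
  finally show ?thesis unfolding dp .
qed

text \<open>A cone point with multiplier k is recorded by the exponents k N and k i of the monomial
  together with k and b, from which division recovers it.\<close>

lemma cone_points_reindex:
  "(f has_sum S) (cone_points \<times> {k. odd k}) \<longleftrightarrow>
   ((\<lambda>((N, i), (k, b)). f ((i div k, N div k, b), k)) has_sum S) (Sigma (UNIV \<times> UNIV) divisor_points)"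
proof (rule has_sum_reindex_bij_witness[of _ "\<lambda>((N, i), (k, b)). ((i div k, N div k, b), k)"
    "\<lambda>((i, N, b), k). ((k * N, k * i), (k, b))"])
  fix x :: "(nat \<times> nat \<times> int) \<times> nat" assume x: "x \<in> cone_points \<times> {k. odd k}"
  obtain i N b k where e: "x = ((i, N, b), k)" by (metis surj_pair)
  have k: "k > 0" using x e by (auto intro!: Nat.gr0I)
  show "(\<lambda>((N, i), (k, b)). ((i div k, N div k, b), k)) ((\<lambda>((i, N, b), k). ((k * N, k * i), (k, b))) x) = x"
    using k by (simp add: e)
  show "(\<lambda>((i, N, b), k). ((k * N, k * i), (k, b))) x \<in> Sigma (UNIV \<times> UNIV) divisor_points"
    using x k by (auto simp: e cone_points_def divisor_points_def)
  show "(\<lambda>((N, i), (k, b)). f ((i div k, N div k, b), k)) ((\<lambda>((i, N, b), k). ((k * N, k * i), (k, b))) x) = f x"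
    using k by (simp add: e)
next
  fix y :: "(nat \<times> nat) \<times> nat \<times> int" assume y: "y \<in> Sigma (UNIV \<times> UNIV) divisor_points"
  obtain N i k b where e: "y = ((N, i), (k, b))" by (metis surj_pair)
  have d: "(N, i) \<noteq> (0, 0)" "k dvd i" "k dvd N" "odd k" "b\<^sup>2 \<le> int (i div k * (N div k))"
    using y by (auto simp: e divisor_points_def split: if_splits)
  then have k: "k * (i div k) = i" "k * (N div k) = N" by auto
  show "(\<lambda>((i, N, b), k). ((k * N, k * i), (k, b))) ((\<lambda>((N, i), (k, b)). ((i div k, N div k, b), k)) y) = y"
    using k by (simp add: e)
  have "(i div k, N div k) \<noteq> (0, 0)" using d(1) k by (metis mult_0_right prod.inject)
  then show "(\<lambda>((N, i), (k, b)). ((i div k, N div k, b), k)) y \<in> cone_points \<times> {k. odd k}"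
    using d(4,5) by (simp add: e cone_points_def)
qed simp

lemma eval_log_fps_sums:
  assumes P: "theta_cone \<eta> \<tau> z s" and \<eta>: "pi * \<eta> > 3"
  shows "(\<lambda>N. eval_fps (log_fps z N) (E \<tau>) * E s ^ N) sums log_theta2 \<tau> z s"
proof -
  have "\<eta> > 0" using \<eta> by (metis less_trans pi_gt_zero zero_less_mult_pos zero_less_numeral)
  then have \<tau>: "Im \<tau> > 0" using theta_cone_Im[OF P] by simp
  have "((\<lambda>((N, i), (k, b)). cone_term \<tau> z s ((i div k, N div k, b), k)) has_sum log_theta2 \<tau> z s) (Sigma (UNIV \<times> UNIV) divisor_points)"
    using log_theta2_has_sum[OF P \<eta>] by (simp only: cone_points_reindex)
  then have "((\<lambda>(N, i). log_coeff i N z * E \<tau> ^ i * E s ^ N) has_sum log_theta2 \<tau> z s) (UNIV \<times> UNIV)"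
  proof (rule has_sum_SigmaD)
    fix p :: "nat \<times> nat"
    obtain N i where p: "p = (N, i)" by (cases p)
    show "((\<lambda>y. (\<lambda>((N, i), (k, b)). cone_term \<tau> z s ((i div k, N div k, b), k)) (p, y)) has_sum
       (case p of (N, i) \<Rightarrow> log_coeff i N z * E \<tau> ^ i * E s ^ N)) (divisor_points p)"
      using has_sum_finite[OF finite_divisor_points[of p], of "\<lambda>(k, b). cone_term \<tau> z s ((i div k, N div k, b), k)"]
      by (simp add: p log_coeff_term_eq_sum)
  qed
  then have "((\<lambda>N. eval_fps (log_fps z N) (E \<tau>) * E s ^ N) has_sum log_theta2 \<tau> z s) UNIV"
  proof (rule has_sum_SigmaD)
    fix N :: nat
    have r: "ereal (norm (E \<tau>)) < fps_conv_radius (log_fps z N)" by (rule radius_E[OF log_fps_radius \<tau>])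
    have "((\<lambda>i. fps_nth (log_fps z N) i * E \<tau> ^ i) has_sum eval_fps (log_fps z N) (E \<tau>)) UNIV"
      by (rule norm_summable_imp_has_sum[OF norm_summable_fps[OF r] sums_eval_fps[OF r]])
    then have "((\<lambda>i. fps_nth (log_fps z N) i * E \<tau> ^ i * E s ^ N) has_sum eval_fps (log_fps z N) (E \<tau>) * E s ^ N) UNIV"
      by (rule has_sum_cmult_left)
    then show "((\<lambda>i. case (N, i) of (N, i) \<Rightarrow> log_coeff i N z * E \<tau> ^ i * E s ^ N) has_sum
        eval_fps (log_fps z N) (E \<tau>) * E s ^ N) UNIV"
      by (simp add: log_fps_def)
  qed
  then show ?thesis by (rule has_sum_imp_sums)
qed

text \<open>The row N = 0 of the logarithm is a logarithm of \<open>th \<tau> 0\<close> and cancels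
  the division in \<open>exp_val_sums\<close>. On the remaining rows the recursion for
  \<open>exp_val\<close> is the differential equation of \<open>eval_fps_exp_ode\<close> in
  Y.\<close>

theorem theta2_eq_exp:
  assumes P: "theta_cone \<eta> \<tau> z s" and \<eta>: "pi * \<eta> > 3"
  shows "theta2 \<tau> z s = exp (log_theta2 \<tau> z s)"
proof -
  have \<eta>0: "\<eta> > 0" using \<eta> by (metis less_trans pi_gt_zero zero_less_mult_pos zero_less_numeral)
  then have \<tau>: "Im \<tau> > 0" using theta_cone_Im[OF P] by simp
  define l where "l N = eval_fps (log_fps z N) (E \<tau>)" for N
  define L where "L = Abs_fps (\<lambda>N. if N = 0 then 0 else ell N \<tau> z)"
  define Q where "Q = Abs_fps (\<lambda>N. exp_val N \<tau> z)"
  have L: "fps_nth L N = (if N = 0 then 0 else l N)" for N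
    by (simp add: L_def l_def ell_def log_fps_eval[OF \<tau>])
  \<comment> \<open>Half of the slack in pi \<eta> > 3 is spent on a point s' with |E s'| > |E s| at
    which both series still converge.\<close>
  define \<epsilon> where "\<epsilon> = (\<eta> - 3 / pi) / 2"
  have \<epsilon>: "\<epsilon> > 0" "pi * (\<eta> - \<epsilon>) > 3" using \<eta> by (auto simp: \<epsilon>_def field_simps)
  define s' where "s' = s - of_real \<epsilon> * \<i>"
  have P': "theta_cone (\<eta> - \<epsilon>) \<tau> z s'" unfolding s'_def using theta_cone_shift[OF P] \<epsilon> by simp
  have "\<eta> - \<epsilon> > 0" using \<epsilon>(2) by (metis less_trans pi_gt_zero zero_less_mult_pos zero_less_numeral)
  have lt: "ereal (norm (E s)) < ereal (norm (E s'))" using \<epsilon> by (simp add: norm_E s'_def)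
  have "summable (\<lambda>N. fps_nth Q N * E s' ^ N)"
    using exp_val_sums[OF P' \<open>\<eta> - \<epsilon> > 0\<close>] by (simp add: Q_def sums_iff)
  then have rQ: "ereal (norm (E s)) < fps_conv_radius Q"
    unfolding fps_conv_radius_def by (intro less_le_trans[OF lt] conv_radius_geI)
  have "eventually (\<lambda>N. fps_nth L N * E s' ^ N = l N * E s' ^ N) sequentially"
    using eventually_gt_at_top[of 0] by eventually_elim (simp add: L)
  then have "summable (\<lambda>N. fps_nth L N * E s' ^ N) = summable (\<lambda>N. l N * E s' ^ N)" by (rule summable_cong)
  also have "\<dots>" using eval_log_fps_sums[OF P' \<epsilon>(2)] by (simp add: l_def sums_iff)
  finally have rL: "ereal (norm (E s)) < fps_conv_radius L"
    unfolding fps_conv_radius_def by (intro less_le_trans[OF lt] conv_radius_geI)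
  have "theta_op Q = Q * theta_op L"
  proof (rule fps_ext)
    fix N
    have "of_nat N * exp_val N \<tau> z = (\<Sum>M\<in>{0..N}. of_nat M * fps_nth L M * exp_val (N - M) \<tau> z)"
      unfolding exp_val_rec[OF \<tau>] by (rule sum.mono_neutral_cong_left) (auto simp: L_def)
    also have "\<dots> = (\<Sum>i\<in>{0..N}. exp_val i \<tau> z * (of_nat (N - i) * fps_nth L (N - i)))"
      by (rule sum.reindex_bij_witness[of _ "\<lambda>i. N - i" "\<lambda>i. N - i"]) auto
    finally show "fps_nth (theta_op Q) N = fps_nth (Q * theta_op L) N"
      by (simp add: Q_def fps_mult_nth del: of_nat_diff)
  qed
  then have ex: "eval_fps Q (E s) = exp (eval_fps L (E s))"
    by (intro eval_fps_exp_ode rQ rL) (simp_all add: Q_def L)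
  have "eval_fps Q (E s) = theta2 \<tau> z s / th \<tau> 0"
    using exp_val_sums[OF P \<eta>0] by (simp add: eval_fps_def Q_def sums_iff)
  moreover have "eval_fps L (E s) = log_theta2 \<tau> z s - l 0"
  proof -
    have "(\<lambda>N. l N * E s ^ N - (if N = 0 then l N else 0)) sums (log_theta2 \<tau> z s - l 0)"
      using eval_log_fps_sums[OF P \<eta>] by (intro sums_diff sums_single) (simp add: l_def)
    moreover have "(\<lambda>N. l N * E s ^ N - (if N = 0 then l N else 0)) = (\<lambda>N. fps_nth L N * E s ^ N)"
      by (auto simp: L)
    ultimately show ?thesis by (simp add: eval_fps_def sums_iff)
  qed
  moreover have "exp (l 0) = th \<tau> 0" unfolding l_def by (rule exp_eval_log_fps_0[OF \<tau>])
  ultimately show ?thesis using ex th_0_nonzero[OF \<tau>] by (simp add: exp_diff)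
qed

section \<open>Binary quadratic forms\<close>

definition log_ratio :: "complex \<Rightarrow> complex" where
  "log_ratio x = ln (1 + x) - ln (1 - x)"

lemma exp_log_ratio:
  assumes "norm x < 1"
  shows "exp (log_ratio x) = (1 + x) / (1 - x)"
proof -
  have "1 + x \<noteq> 0" "1 - x \<noteq> 0" using assms by (auto simp: add_eq_0_iff)
  then show ?thesis by (simp add: log_ratio_def exp_diff)
qed

text \<open>Even powers cancel between the two logarithm series; absolute convergence permits the
  unordered sum.\<close>

lemma log_ratio_has_sum:
  assumes "norm x < 1"
  shows "((\<lambda>k. 2 / of_nat k * x ^ k) has_sum log_ratio x) {k. odd k}"
proof -
  define f where "f k = - ((- x) ^ k) / of_nat k - - (x ^ k) / of_nat k" for k
  have "f sums (ln (1 + x) - ln (1 + (- x)))"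
    unfolding f_def using Ln_series'[of x] Ln_series'[of "- x"] assms by (intro sums_diff) auto
  then have "f sums log_ratio x" by (simp add: log_ratio_def)
  moreover have "summable (\<lambda>k. norm (f k))"
  proof (rule summable_comparison_test')
    show "summable (\<lambda>k. 2 * norm x ^ k)" using assms by (intro summable_mult summable_geometric) auto
    fix k :: nat
    have "norm (f k) \<le> norm ((- x) ^ k) / real k + norm (x ^ k) / real k"
      unfolding f_def by (rule order_trans[OF norm_triangle_ineq4]) (simp add: norm_divide)
    also have "\<dots> \<le> norm ((- x) ^ k) + norm (x ^ k)"
      by (cases k) (auto intro!: add_mono simp: divide_le_eq mult_ge1_I mult_le_cancel_left1)
    finally show "norm (norm (f k)) \<le> 2 * norm x ^ k" by (simp add: norm_power)
  qed
  ultimately have "(f has_sum log_ratio x) UNIV" by (intro norm_summable_imp_has_sum)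
  then show ?thesis
    by (subst has_sum_cong_neutral[where T = UNIV and g = f]) (auto simp: f_def)
qed

definition form_val :: "int \<Rightarrow> int \<Rightarrow> int \<Rightarrow> nat \<times> nat \<times> int \<Rightarrow> int" where
  "form_val a b c = (\<lambda>(i, N, \<beta>). int i * a + \<beta> * b + int N * c)"

definition fiber :: "int \<Rightarrow> int \<Rightarrow> int \<Rightarrow> nat \<Rightarrow> (nat \<times> nat \<times> int) set" where
  "fiber a b c n = {\<omega> \<in> cone_points. form_val a b c \<omega> = int n}"

locale definite_form =
  fixes a b c :: int
  assumes a_pos: "a > 0" and c_pos: "c > 0" and disc_neg: "b\<^sup>2 < 4 * a * c"
begin

text \<open>Determinant over trace of the Gram matrix with diagonal a, c and off-diagonal b / 2, a
  lower bound for its smaller eigenvalue.\<close>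

definition gap :: real where
  "gap = (4 * of_int a * of_int c - (of_int b)\<^sup>2) / (4 * (of_int a + of_int c))"

lemma gap_pos: "gap > 0"
proof -
  have "real_of_int (b\<^sup>2) < real_of_int (4 * a * c)" using disc_neg by (simp only: of_int_less_iff)
  then show ?thesis using a_pos c_pos by (simp add: gap_def)
qed

text \<open>Subtracting \<open>gap\<close> from both diagonal entries leaves 4 (A - gap) (C - gap) =
  B^2 + 4 gap^2 \<ge> B^2, still a semidefinite form. Its pairing with the semidefinite matrix of
  entries x, \<beta>, y is nonnegative.\<close>

lemma gap_le:
  fixes x y \<beta> :: real
  assumes "x \<ge> 0" "y \<ge> 0" "\<beta>\<^sup>2 \<le> x * y"
  shows "gap * (x + y) \<le> of_int a * x + of_int b * \<beta> + of_int c * y"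
proof -
  define A B C where "A = real_of_int a" "B = real_of_int b" "C = real_of_int c"
  have AC: "A > 0" "C > 0" using a_pos c_pos by (auto simp: A_B_C_def)
  have gap: "gap * (4 * (A + C)) = 4 * A * C - B\<^sup>2" using AC by (simp add: gap_def A_B_C_def)
  have "gap * (4 * (A + C)) \<le> A * (4 * (A + C))" "gap * (4 * (A + C)) \<le> C * (4 * (A + C))"
    unfolding gap using AC by (auto simp: algebra_simps)
  then have g: "gap \<le> A" "gap \<le> C" using AC by simp_all
  have prod: "4 * ((A - gap) * (C - gap)) = B\<^sup>2 + 4 * gap\<^sup>2"
    using gap by (simp add: algebra_simps power2_eq_square)
  have "(B * \<beta>)\<^sup>2 \<le> B\<^sup>2 * (x * y)" using assms by (simp add: power_mult_distrib mult_left_mono)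
  also have "\<dots> \<le> (B\<^sup>2 + 4 * gap\<^sup>2) * (x * y)" using assms by (intro mult_right_mono) auto
  also have "\<dots> \<le> ((A - gap) * x + (C - gap) * y)\<^sup>2"
    unfolding prod[symmetric]
    using zero_le_power2[of "(A - gap) * x - (C - gap) * y"] by (simp add: power2_eq_square algebra_simps)
  finally have "\<bar>B * \<beta>\<bar> \<le> \<bar>(A - gap) * x + (C - gap) * y\<bar>" by (simp add: abs_le_square_iff)
  moreover have "0 \<le> (A - gap) * x + (C - gap) * y" using g assms by simp
  ultimately have "- (B * \<beta>) \<le> (A - gap) * x + (C - gap) * y" by linarith
  then show ?thesis by (simp add: A_B_C_def algebra_simps)
qed

lemma gap_le_form_val:
  assumes "\<beta>\<^sup>2 \<le> int (i * N)"
  shows "gap * (real i + real N) \<le> of_int (form_val a b c (i, N, \<beta>))"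
proof -
  have "real_of_int (\<beta>\<^sup>2) \<le> real_of_int (int (i * N))" using assms by (simp only: of_int_le_iff)
  then have "gap * (real i + real N) \<le> of_int a * real i + of_int b * of_int \<beta> + of_int c * real N"
    by (intro gap_le) simp_all
  then show ?thesis by (simp add: form_val_def mult.commute)
qed

lemma form_val_pos: "\<omega> \<in> cone_points \<Longrightarrow> form_val a b c \<omega> > 0"
proof -
  assume \<omega>: "\<omega> \<in> cone_points"
  obtain i N \<beta> where e: "\<omega> = (i, N, \<beta>)" by (cases \<omega>)
  have b: "\<beta>\<^sup>2 \<le> int (i * N)" "(i, N) \<noteq> (0, 0)" using \<omega> by (simp_all add: e cone_points_def)
  have "0 < gap * (real i + real N)" using gap_pos b(2) by (cases i; cases N) auto
  also have "\<dots> \<le> of_int (form_val a b c \<omega>)" unfolding e by (rule gap_le_form_val[OF b(1)])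
  finally show ?thesis by simp
qed

lemma finite_fiber: "finite (fiber a b c n)"
proof -
  obtain M :: nat where M: "real n / gap \<le> real M" using real_arch_simple by blast
  have "fiber a b c n \<subseteq> {..M} \<times> {..M} \<times> {- int M..int M}"
  proof
    fix \<omega> assume \<omega>: "\<omega> \<in> fiber a b c n"
    obtain i N \<beta> where e: "\<omega> = (i, N, \<beta>)" by (cases \<omega>)
    have b: "\<beta>\<^sup>2 \<le> int (i * N)" "form_val a b c (i, N, \<beta>) = int n"
      using \<omega> by (simp_all add: e fiber_def cone_points_def)
    have "gap * (real i + real N) \<le> real n" using gap_le_form_val[OF b(1)] b(2) by simp
    then have "real i + real N \<le> real n / gap" using gap_pos by (simp add: le_divide_eq mult.commute)
    then have "real i + real N \<le> real M" using M by linarith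
    then have "i + N \<le> M" by linarith
    moreover have "nat \<bar>\<beta>\<bar> \<le> i + N" using cone_point_bounds(2)[OF b(1)] by linarith
    ultimately show "\<omega> \<in> {..M} \<times> {..M} \<times> {- int M..int M}" by (auto simp: e)
  qed
  then show ?thesis by (rule finite_subset) auto
qed

text \<open>At (2 a t, b t, 2 c t) the monomial of (i, N, \<beta>) becomes \<open>nome t\<close> to
  the power a i + b \<beta> + c N; the factor 2 reflects that \<open>E\<close> is a square root of
  the nome. Definiteness enters through \<open>gap\<close>.\<close>

lemma theta_cone_form:
  assumes "Im t > 0"
  shows "theta_cone (2 * gap * Im t) (2 * of_int a * t) (of_int b * t) (2 * of_int c * t)"
  unfolding theta_cone_def
proof (intro allI impI)
  fix i N :: nat and \<beta> :: int assume "\<beta>\<^sup>2 \<le> int (i * N)"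
  then have "(2 * Im t) * (gap * (real i + real N)) \<le> (2 * Im t) * of_int (form_val a b c (i, N, \<beta>))"
    using assms by (intro mult_left_mono gap_le_form_val) auto
  then show "2 * gap * Im t * (real i + real N) \<le>
      Im (of_nat i * (2 * of_int a * t) + 2 * of_int \<beta> * (of_int b * t) + of_nat N * (2 * of_int c * t))"
    by (simp add: form_val_def algebra_simps)
qed

lemma E_form_val:
  "E (of_nat i * (2 * of_int a * t) + 2 * of_int \<beta> * (of_int b * t) + of_nat N * (2 * of_int c * t)) =
   E (2 * t) ^ nat (form_val a b c (i, N, \<beta>))" if "(i, N, \<beta>) \<in> cone_points"
proof -
  have "complex_of_nat (nat (form_val a b c (i, N, \<beta>))) = of_int (form_val a b c (i, N, \<beta>))"
    using form_val_pos[OF that] by simp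
  then show ?thesis unfolding E_power by (simp add: form_val_def algebra_simps)
qed

definition fiber_sum :: "nat \<Rightarrow> complex" where
  "fiber_sum n = (\<Sum>\<omega>\<in>fiber a b c n. cone_coeff \<omega>)"

text \<open>Summing over k assembles \<open>log_ratio\<close>; then cone points are collected by the
  value of the form, which is positive on the cone, so the exponents start at 1 and appear as
  \<open>Suc n\<close>.\<close>

lemma log_theta2_sums:
  assumes t: "Im t > 0" "2 * pi * gap * Im t > 3"
  shows "(\<lambda>n. fiber_sum (Suc n) * log_ratio (E (2 * t) ^ Suc n)) sums
    log_theta2 (2 * of_int a * t) (of_int b * t) (2 * of_int c * t)" (is "_ sums ?S")
proof -
  define q where "q = E (2 * t)"
  have q: "norm q < 1" unfolding q_def using t by (intro norm_E_less_1) simp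
  have "(cone_term (2 * of_int a * t) (of_int b * t) (2 * of_int c * t) has_sum ?S) (cone_points \<times> {k. odd k})"
    by (rule log_theta2_has_sum[OF theta_cone_form[OF t(1)]]) (use t(2) in \<open>simp add: mult_ac\<close>)
  then have "((\<lambda>\<omega>. cone_coeff \<omega> * log_ratio (q ^ nat (form_val a b c \<omega>))) has_sum ?S) cone_points"
  proof (rule has_sum_SigmaD)
    fix \<omega> assume \<omega>: "\<omega> \<in> cone_points"
    obtain i N \<beta> where e: "\<omega> = (i, N, \<beta>)" by (cases \<omega>)
    have "norm (q ^ nat (form_val a b c \<omega>)) < 1"
      using form_val_pos[OF \<omega>] q by (simp add: norm_power power_less_one_iff)
    then have "((\<lambda>k. cone_coeff \<omega> * (2 / of_nat k * (q ^ nat (form_val a b c \<omega>)) ^ k)) has_sum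
        cone_coeff \<omega> * log_ratio (q ^ nat (form_val a b c \<omega>))) {k. odd k}"
      by (intro has_sum_cmult_right log_ratio_has_sum)
    then show "((\<lambda>k. cone_term (2 * of_int a * t) (of_int b * t) (2 * of_int c * t) (\<omega>, k)) has_sum
        cone_coeff \<omega> * log_ratio (q ^ nat (form_val a b c \<omega>))) {k. odd k}"
      unfolding e cone_term.simps E_form_val[OF \<omega>[unfolded e]] q_def .
  qed
  also have "cone_points = snd ` Sigma UNIV (\<lambda>n. fiber a b c (Suc n))"
  proof -
    have "\<omega> \<in> snd ` Sigma UNIV (\<lambda>n. fiber a b c (Suc n))" if "\<omega> \<in> cone_points" for \<omega>
      by (rule image_eqI[of _ _ "(nat (form_val a b c \<omega>) - 1, \<omega>)"]) (use form_val_pos[OF that] that in \<open>auto simp: fiber_def\<close>)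
    then show ?thesis by (auto simp: fiber_def)
  qed
  finally have "((\<lambda>p. cone_coeff (snd p) * log_ratio (q ^ nat (form_val a b c (snd p)))) has_sum ?S)
      (Sigma UNIV (\<lambda>n. fiber a b c (Suc n)))"
    by (subst (asm) has_sum_reindex) (auto simp: inj_on_def fiber_def o_def)
  then have "((\<lambda>n. fiber_sum (Suc n) * log_ratio (q ^ Suc n)) has_sum ?S) UNIV"
  proof (rule has_sum_SigmaD)
    fix n :: nat
    have "fiber_sum (Suc n) * log_ratio (q ^ Suc n) = (\<Sum>\<omega>\<in>fiber a b c (Suc n). cone_coeff \<omega> * log_ratio (q ^ nat (form_val a b c \<omega>)))"
      unfolding fiber_sum_def sum_distrib_right by (rule sum.cong) (auto simp: fiber_def nat_add_distrib)
    then show "((\<lambda>\<omega>. cone_coeff (snd (n, \<omega>)) * log_ratio (q ^ nat (form_val a b c (snd (n, \<omega>))))) has_sum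
        fiber_sum (Suc n) * log_ratio (q ^ Suc n)) (fiber a b c (Suc n))"
      using has_sum_finite[OF finite_fiber] by simp
  qed
  then show ?thesis unfolding q_def by (rule has_sum_imp_sums)
qed

text \<open>A nonzero term has \<beta>^2 \<le> \<alpha> \<gamma>, so \<alpha> and \<gamma> have the
  same sign. On the negative cone and at the origin the linear form is at most 0, so for n > 0 only
  the fiber in the positive cone remains.\<close>

lemma fiber_sum_eq_d_form:
  assumes n: "n > 0"
  shows "fiber_sum n = of_real (d_form a b c n)"
proof -
  define g where "g = (\<lambda>(\<alpha>, \<beta>, \<gamma>). (-1) powi ((\<alpha> + 1) * (\<gamma> + 1)) * c_inv_theta (\<alpha> * \<gamma> - \<beta>\<^sup>2))"
  define h where "h = (\<lambda>(i :: nat, N :: nat, \<beta> :: int). (int i, \<beta>, int N))"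
  have "d_form a b c n = infsum g (h ` fiber a b c n)"
    unfolding d_form_def g_def[symmetric]
  proof (rule infsum_cong_neutral)
    fix x assume x: "x \<in> {(\<alpha>, \<beta>, \<gamma>). \<alpha> * a + \<beta> * b + \<gamma> * c = int n} - h ` fiber a b c n"
    obtain \<alpha> \<beta> \<gamma> where e: "x = (\<alpha>, \<beta>, \<gamma>)" by (cases x)
    have v: "\<alpha> * a + \<beta> * b + \<gamma> * c = int n" using x by (simp add: e)
    show "g x = 0"
    proof (rule ccontr)
      assume "g x \<noteq> 0"
      then have disc: "\<beta>\<^sup>2 \<le> \<alpha> * \<gamma>" by (auto simp: g_def e c_inv_theta_def split: if_splits)
      then have "0 \<le> \<alpha> * \<gamma>" using zero_le_power2[of \<beta>] by linarith
      then consider "\<alpha> \<ge> 0" "\<gamma> \<ge> 0" | "\<alpha> \<le> 0" "\<gamma> \<le> 0" by (auto simp: zero_le_mult_iff)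
      then show False
      proof cases
        case 1
        have "(nat \<alpha>, nat \<gamma>) \<noteq> (0, 0)"
        proof
          assume "(nat \<alpha>, nat \<gamma>) = (0, 0)"
          then have "\<alpha> = 0" "\<gamma> = 0" using 1 by auto
          then show False using v disc n by simp
        qed
        then have "(nat \<alpha>, nat \<gamma>, \<beta>) \<in> fiber a b c n"
          using 1 disc v by (auto simp: fiber_def cone_points_def form_val_def)
        then have "h (nat \<alpha>, nat \<gamma>, \<beta>) \<in> h ` fiber a b c n" by (rule imageI)
        then show False using x 1 by (simp add: h_def e)
      next
        case 2
        have "(- \<beta>)\<^sup>2 \<le> int (nat (- \<alpha>) * nat (- \<gamma>))" using 2 disc by simp
        then have "gap * (real (nat (- \<alpha>)) + real (nat (- \<gamma>))) \<le> of_int (form_val a b c (nat (- \<alpha>), nat (- \<gamma>), - \<beta>))"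
          by (rule gap_le_form_val)
        also have "form_val a b c (nat (- \<alpha>), nat (- \<gamma>), - \<beta>) = - int n"
          using 2 v by (simp add: form_val_def)
        finally have "gap * (real (nat (- \<alpha>)) + real (nat (- \<gamma>))) < 0" using n by simp
        moreover have "0 \<le> gap * (real (nat (- \<alpha>)) + real (nat (- \<gamma>)))" using gap_pos by simp
        ultimately show False by linarith
      qed
    qed
  qed (auto simp: h_def fiber_def form_val_def)
  also have "\<dots> = sum g (h ` fiber a b c n)" using finite_fiber by simp
  also have "\<dots> = (\<Sum>\<omega>\<in>fiber a b c n. g (h \<omega>))"
    by (subst sum.reindex) (auto simp: h_def inj_on_def)
  finally have "of_real (d_form a b c n) = (\<Sum>\<omega>\<in>fiber a b c n. complex_of_real (g (h \<omega>)))" by simp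
  also have "\<dots> = fiber_sum n"
    unfolding fiber_sum_def
  proof (rule sum.cong)
    fix \<omega> assume \<omega>: "\<omega> \<in> fiber a b c n"
    obtain i N \<beta> where e: "\<omega> = (i, N, \<beta>)" by (cases \<omega>)
    have "\<beta>\<^sup>2 \<le> int (i * N)" using \<omega> by (simp add: e fiber_def cone_points_def)
    moreover have "(-1 :: real) powi ((int i + 1) * (int N + 1)) = (-1) ^ ((i + 1) * (N + 1))"
      using power_int_of_nat[of "-1 :: real" "(i + 1) * (N + 1)"] by (simp only: of_nat_mult of_nat_add of_nat_1)
    ultimately show "complex_of_real (g (h \<omega>)) = cone_coeff \<omega>"
      by (simp add: g_def h_def e c_inv_theta_def inv_theta_C_def)
  qed simp
  finally show ?thesis by simp
qed

end

text \<open>Theta has integer coefficients and constant term 1, so the recursion for the reciprocal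
  stays within the integers.\<close>

lemma inverse_theta_fps_Ints: "fps_nth (inverse theta_fps) n \<in> \<int>"
proof (induction n rule: less_induct)
  case (less n)
  show ?case
  proof (cases "n = 0")
    case False
    have "theta_fps * inverse theta_fps = 1" by (rule inverse_mult_eq_1') (simp add: fps_nth_theta_fps_0)
    then have "(\<Sum>i=0..n. fps_nth theta_fps i * fps_nth (inverse theta_fps) (n - i)) = 0"
      using False by (metis fps_mult_nth fps_one_nth)
    then have "fps_nth (inverse theta_fps) n = - (\<Sum>i=Suc 0..n. fps_nth theta_fps i * fps_nth (inverse theta_fps) (n - i))"
      by (subst (asm) sum.atLeast_Suc_atMost) (simp_all add: fps_nth_theta_fps_0 eq_neg_iff_add_eq_0)
    also have "\<dots> \<in> \<int>"
      by (intro Ints_minus Ints_sum Ints_mult less) (use False in \<open>auto simp: theta_fps_def\<close>)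
    finally show ?thesis .
  qed (simp add: fps_nth_theta_fps_0)
qed

lemma d_form_Ints:
  assumes "pos_def_form a b c"
  shows "d_form a b c n \<in> \<int>"
proof -
  define g where "g = (\<lambda>(\<alpha>, \<beta>, \<gamma>). (-1) powi ((\<alpha> + 1) * (\<gamma> + 1)) * c_inv_theta (\<alpha> * \<gamma> - \<beta>\<^sup>2))"
  define S where "S = {(\<alpha>, \<beta>, \<gamma>). \<alpha> * a + \<beta> * b + \<gamma> * c = int n \<and> c_inv_theta (\<alpha> * \<gamma> - \<beta>\<^sup>2) \<noteq> 0}"
  have "d_form a b c n = infsum g S"
    unfolding d_form_def g_def[symmetric] by (rule infsum_cong_neutral) (auto simp: S_def g_def)
  also have "\<dots> = sum g S" using finite_d_form_support[OF assms, of n] by (simp add: S_def)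
  also have "\<dots> \<in> \<int>"
  proof (rule Ints_sum)
    fix x assume "x \<in> S"
    have "(-1 :: real) powi k \<in> \<int>" for k by (simp add: power_int_def)
    then show "g x \<in> \<int>"
      by (cases x) (auto simp: g_def c_inv_theta_def intro!: Ints_mult inverse_theta_fps_Ints)
  qed
  finally show ?thesis .
qed

lemma nome_eq_E: "nome t = E (2 * t)"
  by (simp add: nome_def E_def mult_ac)

lemma theta_form_eq_theta2: "theta_form a b c t = theta2 (2 * of_int a * t) (of_int b * t) (2 * of_int c * t)"
  unfolding theta_form_def theta2_def
  by (rule infsum_reindex_bij_witness[of _ prod.swap prod.swap])
     (auto simp: nome_eq_E E_powi bin_form_def algebra_simps)

theorem theorem1p1:
  fixes a b c :: int
  assumes "pos_def_form a b c"
    and "b\<^sup>2 - 4 * a * c < 0"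
  shows "(\<forall>n :: nat. d_form a b c n \<in> \<int>) \<and>
         (\<exists>Y>0. \<forall>\<tau>. Im \<tau> > Y \<longrightarrow>
            (\<lambda>n. ((1 + nome \<tau> ^ Suc n) / (1 - nome \<tau> ^ Suc n)) powi \<lfloor>d_form a b c (Suc n)\<rfloor>)
              has_prod theta_form a b c \<tau>)"
proof (intro conjI allI)
  show d_int: "d_form a b c n \<in> \<int>" for n by (rule d_form_Ints[OF assms(1)])
  have pos: "bin_form a b c x y > 0" if "(x, y) \<noteq> (0, 0)" for x y :: real
    using assms(1) that unfolding pos_def_form_def by blast
  interpret definite_form a b c
  proof
    show "a > 0" using pos[of 1 0] by (simp add: bin_form_def)
    show "c > 0" using pos[of 0 1] by (simp add: bin_form_def)
  qed (use assms(2) in simp)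
  \<comment> \<open>The condition pi \<eta> > 3 for \<eta> = 2 gap Im \<tau>, solved for Im
    \<tau>.\<close>
  define Y where "Y = 3 / (2 * pi * gap)"
  have Y: "Y > 0" using gap_pos by (simp add: Y_def)
  have "(\<lambda>n. ((1 + nome \<tau> ^ Suc n) / (1 - nome \<tau> ^ Suc n)) powi \<lfloor>d_form a b c (Suc n)\<rfloor>) has_prod theta_form a b c \<tau>"
    if \<tau>: "Im \<tau> > Y" for \<tau>
  proof -
    have Im: "Im \<tau> > 0" "2 * pi * gap * Im \<tau> > 3"
      using \<tau> Y gap_pos by (simp, simp add: Y_def field_simps)
    \<comment> \<open>The exponent is an integer, so the choice of branch in
      \<open>log_ratio\<close> disappears under the exponential.\<close>
    have "exp (fiber_sum (Suc n) * log_ratio (E (2 * \<tau>) ^ Suc n)) =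
        ((1 + nome \<tau> ^ Suc n) / (1 - nome \<tau> ^ Suc n)) powi \<lfloor>d_form a b c (Suc n)\<rfloor>" for n
    proof -
      have "norm (nome \<tau>) < 1" by (rule norm_nome_less_1[OF Im(1)])
      then have q: "norm (nome \<tau> ^ Suc n) < 1" unfolding norm_power by (simp add: power_less_one_iff del: power_Suc)
      obtain d where d: "d_form a b c (Suc n) = of_int d" using d_int by (auto elim: Ints_cases)
      have "fiber_sum (Suc n) = of_int d" using fiber_sum_eq_d_form[of "Suc n"] by (simp add: d)
      then show ?thesis
        unfolding exp_log_ratio[OF q, symmetric] exp_power_int by (simp add: d nome_eq_E)
    qed
    \<comment> \<open>Partial sums exponentiate to partial products, and the limit is nonzero, as
      convergence of a product demands, because it is an exponential.\<close>
    then have "raw_has_prod (\<lambda>n. ((1 + nome \<tau> ^ Suc n) / (1 - nome \<tau> ^ Suc n)) powi \<lfloor>d_form a b c (Suc n)\<rfloor>) 0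
        (exp (log_theta2 (2 * of_int a * \<tau>) (of_int b * \<tau>) (2 * of_int c * \<tau>)))"
      using sums_imp_has_prod_exp[OF log_theta2_sums[OF Im]] by simp
    moreover have "theta_form a b c \<tau> = exp (log_theta2 (2 * of_int a * \<tau>) (of_int b * \<tau>) (2 * of_int c * \<tau>))"
      unfolding theta_form_eq_theta2
      by (rule theta2_eq_exp[OF theta_cone_form[OF Im(1)]]) (use Im(2) in \<open>simp add: mult_ac\<close>)
    ultimately show ?thesis by (simp add: has_prod_def)
  qed
  then show "\<exists>Y>0. \<forall>\<tau>. Im \<tau> > Y \<longrightarrow>
            (\<lambda>n. ((1 + nome \<tau> ^ Suc n) / (1 - nome \<tau> ^ Suc n)) powi \<lfloor>d_form a b c (Suc n)\<rfloor>)
              has_prod theta_form a b c \<tau>"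
    using Y by blast
qed

end
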